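(* Let $p$ be a prime, $K$ an algebraically closed field of characteristic $p$, $m\ge 1$ and $0\le r\le m$. Let $R=m+1-r=\sum_{i=f}^kR_ip^i$ be the $p$-adic expansion of $R$ ($0\le R_i\le p-1$), with $R_f\ne 0$ and $R_k\neq 0$. The Weyl module $\Delta(\omega_r)$ for $\mathrm{Sp}(2m)$ is simple if and only if $r<2(p-R_f)p^f$.
   Context: $\mathrm{Sp}(2m)$ is the symplectic group of rank $m$ over $K$, and $\Delta(\omega_r)$ is its Weyl module with highest weight $\omega_r$, where $\omega_1,\dots,\omega_m$ are the fundamental weights in the usual numbering ($\omega_1$ is the highest weight of the natural module, $\omega_r$ that of its $r$-th exterior power) and $\omega_0=0$. *)

theory Defs
  imports
    "HOL-Computational_Algebra.Computational_Algebra"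
    "HOL-Library.Function_Algebras"
    "HOL-Algebra.Group"
    "Jordan_Normal_Form.Matrix"
begin

text \<open>
  Rows and columns are numbered from 0 to \<open>2m - 1\<close>. We use the alternating form with
  \<open>\<langle>e_i, e_(2m-1-i)\<rangle> = 1\<close> for \<open>i < m\<close>, for which the triangular matrices in the symplectic group
  are opposite Borel subgroups and the diagonal ones are a maximal torus, consisting of the
  \<open>diag(t_0, \<dots>, t_(m-1), t_(m-1)\<inverse>, \<dots>, t_0\<inverse>)\<close>.
\<close>

definition symp_form :: "nat \<Rightarrow> 'a::field mat" where
  "symp_form m = mat (2*m) (2*m)
     (\<lambda>(i, j). if i + j = 2*m - 1 then (if i < m then 1 else - 1) else 0)"

definition Sp :: "nat \<Rightarrow> 'a::field mat monoid" where
  "Sp m = \<lparr>carrier = {A \<in> carrier_mat (2*m) (2*m). A\<^sup>T * symp_form m * A = symp_form m},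
           mult = (*), one = 1\<^sub>m (2*m)\<rparr>"

text \<open>The negative Borel subgroup: the roots in the upper triangular one are taken as positive.\<close>

definition borel_neg :: "nat \<Rightarrow> 'a::field mat set" where
  "borel_neg m = {b \<in> carrier (Sp m). \<forall>i < 2*m. \<forall>j < 2*m. i < j \<longrightarrow> b $$ (i, j) = 0}"

text \<open>
  A weight \<open>a\<close> stands for \<open>\<Sum>i<m. a i * \<epsilon>_(i+1)\<close>, where \<open>\<epsilon>_(i+1)\<close> is the \<open>i\<close>-th diagonal entry;
  values of \<open>a\<close> at arguments \<open>\<ge> m\<close> are irrelevant. As a character it is extended from the torus
  to \<open>borel_neg\<close> by being trivial on the unipotent radical. The fundamental weight \<open>\<omega>_r\<close> is
  \<open>\<epsilon>_1 + \<dots> + \<epsilon>_r\<close>.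
\<close>

type_synonym weight = "nat \<Rightarrow> int"

definition weight_char :: "nat \<Rightarrow> weight \<Rightarrow> 'a::field mat \<Rightarrow> 'a" where
  "weight_char m a b = (\<Prod>i<m. (b $$ (i, i)) powi a i)"

definition fund_weight :: "nat \<Rightarrow> weight" where
  "fund_weight r = (\<lambda>i. if i < r then 1 else 0)"

text \<open>
  The coordinate ring \<open>K[Sp(2m)]\<close>. As \<open>K\<close> will be algebraically closed, a regular function is
  identified with the function it induces on the \<open>K\<close>-points; it is extended by 0 outside the group.
\<close>

inductive_set poly_funs :: "nat \<Rightarrow> ('a::field mat \<Rightarrow> 'a) set" for n where
  const: "(\<lambda>_. c) \<in> poly_funs n"
| coord: "i < n \<Longrightarrow> j < n \<Longrightarrow> (\<lambda>A. A $$ (i, j)) \<in> poly_funs n"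
| add: "P \<in> poly_funs n \<Longrightarrow> Q \<in> poly_funs n \<Longrightarrow> (\<lambda>A. P A + Q A) \<in> poly_funs n"
| mult: "P \<in> poly_funs n \<Longrightarrow> Q \<in> poly_funs n \<Longrightarrow> (\<lambda>A. P A * Q A) \<in> poly_funs n"

definition regular_funs :: "nat \<Rightarrow> ('a::field mat \<Rightarrow> 'a) set" where
  "regular_funs m = {\<lambda>g. if g \<in> carrier (Sp m) then P g else 0 | P. P \<in> poly_funs (2*m)}"

text \<open>
  The induced module \<open>H\<^sup>0(a) = ind_B^G a\<close>, with \<open>B\<close> the negative Borel subgroup, and the action of
  \<open>G\<close> on it by left translation.
\<close>

definition induced_module :: "nat \<Rightarrow> weight \<Rightarrow> ('a::field mat \<Rightarrow> 'a) set" where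
  "induced_module m a = {f \<in> regular_funs m.
     \<forall>g \<in> carrier (Sp m). \<forall>b \<in> borel_neg m. f (g * b) = inverse (weight_char m a b) * f g}"

definition left_translation ::
    "nat \<Rightarrow> 'a::field mat \<Rightarrow> ('a mat \<Rightarrow> 'a) \<Rightarrow> 'a mat \<Rightarrow> 'a" where
  "left_translation m g f = (\<lambda>x. if x \<in> carrier (Sp m) then f (inv\<^bsub>Sp m\<^esub> g * x) else 0)"

definition fun_scale :: "'a::field \<Rightarrow> ('b \<Rightarrow> 'a) \<Rightarrow> 'b \<Rightarrow> 'a" where
  "fun_scale c f = (\<lambda>x. c * f x)"

global_interpretation fun_space: vector_space "fun_scale :: 'a::field \<Rightarrow> ('b \<Rightarrow> 'a) \<Rightarrow> 'b \<Rightarrow> 'a"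
  by unfold_locales (auto simp: fun_scale_def plus_fun_def algebra_simps)

text \<open>Linear forms on a subspace, extended by 0 outside it, and the contragredient action.\<close>

definition dual_space :: "('b \<Rightarrow> 'a::field) set \<Rightarrow> (('b \<Rightarrow> 'a) \<Rightarrow> 'a) set" where
  "dual_space V = {\<phi>. (\<forall>f \<in> V. \<forall>g \<in> V. \<phi> (f + g) = \<phi> f + \<phi> g) \<and>
                      (\<forall>c. \<forall>f \<in> V. \<phi> (fun_scale c f) = c * \<phi> f) \<and>
                      (\<forall>f. f \<notin> V \<longrightarrow> \<phi> f = 0)}"

definition dual_action :: "('g, 'z) monoid_scheme \<Rightarrow> ('b \<Rightarrow> 'a::field) set \<Rightarrow>
    ('g \<Rightarrow> ('b \<Rightarrow> 'a) \<Rightarrow> ('b \<Rightarrow> 'a)) \<Rightarrow> 'g \<Rightarrow> (('b \<Rightarrow> 'a) \<Rightarrow> 'a) \<Rightarrow> (('b \<Rightarrow> 'a) \<Rightarrow> 'a)" where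
  "dual_action G V act g \<phi> = (\<lambda>f. if f \<in> V then \<phi> (act (inv\<^bsub>G\<^esub> g) f) else 0)"

definition simple_module :: "('g, 'z) monoid_scheme \<Rightarrow> ('b \<Rightarrow> 'a::field) set \<Rightarrow>
    ('g \<Rightarrow> ('b \<Rightarrow> 'a) \<Rightarrow> ('b \<Rightarrow> 'a)) \<Rightarrow> bool" where
  "simple_module G V act \<longleftrightarrow> V \<noteq> {0} \<and>
     (\<forall>W \<subseteq> V. fun_space.subspace W \<longrightarrow> (\<forall>g \<in> carrier G. \<forall>w \<in> W. act g w \<in> W) \<longrightarrow> W = {0} \<or> W = V)"

text \<open>
  The Weyl module \<open>\<Delta>(a) = H\<^sup>0(- w_0 a)\<^sup>*\<close> of highest weight \<open>a\<close>. The longest element \<open>w_0\<close> of the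
  Weyl group of \<open>Sp(2m)\<close> acts on weights as \<open>-1\<close>.
\<close>

definition longest_weyl :: "weight \<Rightarrow> weight" where
  "longest_weyl a = (\<lambda>i. - a i)"

definition weyl_module :: "nat \<Rightarrow> weight \<Rightarrow> (('a::field mat \<Rightarrow> 'a) \<Rightarrow> 'a) set" where
  "weyl_module m a = dual_space (induced_module m (- longest_weyl a))"

definition weyl_action ::
    "nat \<Rightarrow> weight \<Rightarrow> 'a::field mat \<Rightarrow> (('a mat \<Rightarrow> 'a) \<Rightarrow> 'a) \<Rightarrow> (('a mat \<Rightarrow> 'a) \<Rightarrow> 'a)" where
  "weyl_action m a =
     dual_action (Sp m) (induced_module m (- longest_weyl a)) (left_translation m)"

end

theory Submission
  imports Defs "Jordan_Normal_Form.Determinant"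
begin

text \<open>
  The dual of \<open>\<Delta>(\<omega>_r)\<close> is spanned by the \<open>r \<times> r\<close> minors in the last \<open>r\<close> columns, and the basis
  vectors come in \<open>m\<close> hyperbolic pairs. A weight with \<open>r - 2j\<close> nonzero entries, all of them \<open>\<plusminus>1\<close>, fixes
  \<open>r - 2j\<close> rows; the others are \<open>j\<close> of the remaining \<open>m - r + 2j\<close> pairs, so these minors \<open>x_J\<close>
  are indexed by the \<open>j\<close>-subsets \<open>J\<close> of a set of pairs. Since the columns of a symplectic matrix in question are
  isotropic, the sum of \<open>x_J\<close> over all \<open>J \<supseteq> I\<close> vanishes whenever \<open>|I| < j\<close>, and there are no other relations.

  A nonzero submodule contains a weight vector. Raising it one moves to a minor without complete pairs,
  and the Weyl group gives all such minors. Lowering these, all differences \<open>x_J - x_K\<close> are obtained by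
  induction on \<open>j\<close>, and the relation for a set \<open>I\<close> with \<open>j - i\<close> elements turns them into
  \<open>(m - r + j + i choose i) x_J\<close>. So the module is simple if for each \<open>1 \<le> j \<le> r/2\<close> one of these
  binomial coefficients, \<open>1 \<le> i \<le> j\<close>, is nonzero in \<open>K\<close>.

  If for some \<open>j\<close> they all vanish, then the constant function \<open>J \<mapsto> 1\<close> respects all relations and, by
  James' kernel intersection theorem, is a combination of polytabloids; hence there is a linear form taking
  the value \<open>1\<close> at all \<open>x_J\<close> and \<open>0\<close> at all other weights. It kills every translate of a minor without
  complete pairs, so that these translates span a proper submodule.
\<close>

section \<open>Symplectic matrices\<close>

text \<open>The induced module is a space of regular functions, so its weights, its dimension and
  the relations among minors must all be read off from functions. The handle is the dense big cell:
  it bounds the poles of a function along one-parameter subgroups, hence confines the entries of a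
  weight to -1, 0, 1 and their number to \<open>r\<close>. So raising soon leaves the possible
  weights, and a vector killed by enough raising operators vanishes. Raising \<open>j\<close> times
  along the arcs of a matching turns a vector into a multiple of an extremal minor, the factor for
  \<open>x_J\<close> being a polytabloid coefficient. Noncrossing matchings suffice to detect zero,
  and their factors can be prescribed; this gives both the spanning minors and the relations. The
  linear form kills translates because its value at the translate by \<open>g\<close> of the minor
  in the last \<open>r\<close> rows is the sum of all \<open>x_J\<close> at the transpose of
  \<open>g\<close>, the relation for empty \<open>I\<close>. The bound on \<open>r\<close> is twice
  the least positive \<open>j\<close> for which all the binomial coefficients vanish modulo
  \<open>p\<close>; for this \<open>j\<close>, \<open>m - r + 1 + j\<close> is divisible by
  \<open>p ^ (f + 1)\<close>.\<close>

definition sg :: "nat \<Rightarrow> nat \<Rightarrow> 'a::field" where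
  "sg m i = (if i < m then 1 else - 1)"

definition cj :: "nat \<Rightarrow> nat \<Rightarrow> nat" where
  "cj m i = 2 * m - 1 - i"

text \<open>The form of \<open>symp_form\<close> in coordinates. Vectors are functions of the index,
  so a row operation on all columns at once becomes a single linear map of functions.\<close>

definition bform :: "nat \<Rightarrow> (nat \<Rightarrow> 'a::field) \<Rightarrow> (nat \<Rightarrow> 'a) \<Rightarrow> 'a" where
  "bform m u v = (\<Sum>a<2*m. sg m a * u a * v (cj m a))"

lemma sg_mult_self [simp]: "sg m i * sg m i = 1" "sg m i * (sg m i * x) = x"
  by (auto simp: sg_def)

lemma cj_less [simp]: "i < 2*m \<Longrightarrow> cj m i < 2*m"
  by (auto simp: cj_def)

lemma cj_cj [simp]: "i < 2*m \<Longrightarrow> cj m (cj m i) = i"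
  by (auto simp: cj_def)

lemma cj_neq [simp]: "i < 2*m \<Longrightarrow> cj m i \<noteq> i" "i < 2*m \<Longrightarrow> i \<noteq> cj m i"
  unfolding cj_def by presburger+

lemma eq_cj_iff: "i < 2*m \<Longrightarrow> j < 2*m \<Longrightarrow> cj m i = j \<longleftrightarrow> i = cj m j"
  by (auto simp: cj_def)

lemma cj_eq_iff [simp]: "i < 2*m \<Longrightarrow> j < 2*m \<Longrightarrow> cj m i = cj m j \<longleftrightarrow> i = j"
  by (auto simp: cj_def)

lemma cj_less_iff: "i < 2*m \<Longrightarrow> j < 2*m \<Longrightarrow> cj m i < cj m j \<longleftrightarrow> j < i"
  by (auto simp: cj_def)

lemma sg_cj [simp]: "i < 2*m \<Longrightarrow> sg m (cj m i) = - sg m i"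
  by (auto simp: sg_def cj_def)

lemma sum_cj: "(\<Sum>a<2*m. f (cj m a)) = (\<Sum>a<2*m. f a)"
  by (rule sum.reindex_bij_witness[of _ "cj m" "cj m"]) auto

section \<open>The defining equation of the group, column by column\<close>

lemma symp_form_carrier [simp]: "symp_form m \<in> carrier_mat (2*m) (2*m)"
  by (simp add: symp_form_def)

lemma symp_form_dim [simp]: "dim_row (symp_form m) = 2*m" "dim_col (symp_form m) = 2*m"
  by (simp_all add: symp_form_def)

lemma symp_form_entry: "i < 2*m \<Longrightarrow> j < 2*m \<Longrightarrow> symp_form m $$ (i, j) = (if i = cj m j then sg m i else 0)"
  by (auto simp: symp_form_def cj_def sg_def)

lemma mult_entry:
  "A \<in> carrier_mat n n \<Longrightarrow> B \<in> carrier_mat n n \<Longrightarrow> k < n \<Longrightarrow> l < n \<Longrightarrow>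
    (A * B) $$ (k, l) = (\<Sum>a<n. A $$ (k, a) * B $$ (a, l))"
  by (simp add: scalar_prod_def atLeast0LessThan)

lemma Sp_carrier_mat: "g \<in> carrier (Sp m) \<Longrightarrow> g \<in> carrier_mat (2*m) (2*m)"
  by (simp add: Sp_def)

lemma mult_square_mat: "A \<in> carrier_mat n n \<Longrightarrow> B \<in> carrier_mat n n \<Longrightarrow> A * B \<in> carrier_mat n n"
  by (rule mult_carrier_mat)

lemmas assoc_square_mat = assoc_mult_mat[of _ n n _ n _ n for n]

lemma form_entry:
  assumes g: "g \<in> carrier_mat (2*m) (2*m)" and h: "h \<in> carrier_mat (2*m) (2*m)"
    and k: "k < 2*m" and l: "l < 2*m"
  shows "(g\<^sup>T * symp_form m * h) $$ (k, l) = bform m (\<lambda>a. g $$ (a, k)) (\<lambda>a. h $$ (a, l))"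
proof -
  let ?n = "2*m"
  have gt: "g\<^sup>T \<in> carrier_mat ?n ?n" using g by simp
  have J: "(g\<^sup>T * symp_form m) $$ (k, b) = sg m (cj m b) * g $$ (cj m b, k)" if b: "b < ?n" for b
  proof -
    have "(g\<^sup>T * symp_form m) $$ (k, b) = (\<Sum>a<?n. g\<^sup>T $$ (k, a) * symp_form m $$ (a, b))"
      by (rule mult_entry[OF gt symp_form_carrier k b])
    also have "\<dots> = (\<Sum>a<?n. if a = cj m b then sg m (cj m b) * g $$ (cj m b, k) else 0)"
      using b k g by (intro sum.cong) (auto simp: symp_form_entry)
    also have "\<dots> = sg m (cj m b) * g $$ (cj m b, k)"
      using b by simp
    finally show ?thesis .
  qed
  have "(g\<^sup>T * symp_form m * h) $$ (k, l) = (\<Sum>b<?n. (g\<^sup>T * symp_form m) $$ (k, b) * h $$ (b, l))"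
    using gt by (intro mult_entry h k l) auto
  also have "\<dots> = (\<Sum>b<?n. sg m (cj m b) * g $$ (cj m b, k) * h $$ (b, l))"
    by (intro sum.cong) (auto simp: J simp del: sg_cj)
  also have "\<dots> = (\<Sum>a<?n. sg m a * g $$ (a, k) * h $$ (cj m a, l))"
    by (subst (2) sum_cj[symmetric]) (auto intro!: sum.cong)
  finally show ?thesis
    by (simp add: bform_def)
qed

text \<open>Left multiplication acts on each column separately. This form of the equation therefore
  reduces closure under a row operation to the invariance of \<open>bform\<close>.\<close>

lemma Sp_iff:
  "g \<in> carrier (Sp m) \<longleftrightarrow> g \<in> carrier_mat (2*m) (2*m) \<and>
     (\<forall>k<2*m. \<forall>l<2*m. bform m (\<lambda>a. g $$ (a, k)) (\<lambda>a. g $$ (a, l)) = (if k = cj m l then sg m k else 0))"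
  (is "_ \<longleftrightarrow> ?G \<and> ?F")
proof -
  have "g\<^sup>T * symp_form m * g = symp_form m \<longleftrightarrow> ?F" if g: ?G
  proof -
    have "g\<^sup>T * symp_form m * g \<in> carrier_mat (2*m) (2*m)"
      using g by (metis mult_carrier_mat symp_form_carrier transpose_carrier_mat)
    then have "g\<^sup>T * symp_form m * g = symp_form m \<longleftrightarrow>
      (\<forall>k<2*m. \<forall>l<2*m. (g\<^sup>T * symp_form m * g) $$ (k, l) = symp_form m $$ (k, l))"
      unfolding mat_eq_iff using symp_form_carrier[of m] by (metis carrier_matD)
    also have "\<dots> \<longleftrightarrow> ?F"
      using form_entry[OF g g] by (simp add: symp_form_entry)
    finally show ?thesis .
  qed
  then show ?thesis unfolding Sp_def by fastforce
qed

section \<open>Inverses, transposes and the group axioms\<close>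

lemma symp_form_sq: "symp_form m * symp_form m = - (1\<^sub>m (2*m) :: 'a::field mat)"
proof (rule eq_matI)
  fix i j assume ij: "i < dim_row (- (1\<^sub>m (2*m) :: 'a mat))" "j < dim_col (- (1\<^sub>m (2*m) :: 'a mat))"
  have "(symp_form m * symp_form m :: 'a mat) $$ (i, j)
      = (\<Sum>a<2*m. symp_form m $$ (i, a) * symp_form m $$ (a, j))"
    using ij by (intro mult_entry) auto
  also have "\<dots> = (\<Sum>a<2*m. if a = cj m i then (if i = j then - 1 else 0) else 0)"
    using ij by (intro sum.cong) (auto simp: symp_form_entry)
  also have "\<dots> = (- 1\<^sub>m (2*m)) $$ (i, j)"
    using ij by auto
  finally show "(symp_form m * symp_form m :: 'a mat) $$ (i, j) = (- 1\<^sub>m (2*m)) $$ (i, j)" .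
qed (simp_all)

text \<open>With J the matrix of the form, J J = -1, so the defining equation multiplied by -J is a
  left inverse identity; for square matrices a left inverse is also a right inverse.\<close>

lemma Sp_right_inverse:
  fixes g :: "'a::field mat"
  assumes "g \<in> carrier (Sp m)"
  shows "- (symp_form m * g\<^sup>T * symp_form m) * g = 1\<^sub>m (2*m)"
    and "g * - (symp_form m * g\<^sup>T * symp_form m) = 1\<^sub>m (2*m)"
    and "- (symp_form m * g\<^sup>T * symp_form m) \<in> carrier_mat (2*m) (2*m)"
proof -
  let ?J = "symp_form m :: 'a mat"
  have g: "g \<in> carrier_mat (2*m) (2*m)" and f: "g\<^sup>T * ?J * g = ?J"
    using assms by (auto simp: Sp_def)
  have gt: "g\<^sup>T \<in> carrier_mat (2*m) (2*m)" using g by simp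
  have JgJ: "?J * g\<^sup>T * ?J \<in> carrier_mat (2*m) (2*m)"
    by (metis gt mult_carrier_mat symp_form_carrier)
  then show c: "- (?J * g\<^sup>T * ?J) \<in> carrier_mat (2*m) (2*m)" by simp
  have "- (?J * g\<^sup>T * ?J) * g = - (?J * g\<^sup>T * ?J * g)"
    by (rule uminus_mult_left_mat) (use g in auto)
  also have "?J * g\<^sup>T * ?J * g = ?J * (g\<^sup>T * ?J * g)"
    using g gt by (simp add: assoc_square_mat[where n = "2*m"] mult_square_mat)
  also have "- \<dots> = 1\<^sub>m (2*m)"
    by (simp add: f symp_form_sq)
  finally show 1: "- (?J * g\<^sup>T * ?J) * g = 1\<^sub>m (2*m)" .
  show "g * - (?J * g\<^sup>T * ?J) = 1\<^sub>m (2*m)"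
    by (rule mat_mult_left_right_inverse[OF c g 1])
qed

lemma Sp_mult: "g \<in> carrier (Sp m) \<Longrightarrow> h \<in> carrier (Sp m) \<Longrightarrow> g * h \<in> carrier (Sp m)"
  for g h :: "'a::field mat"
proof -
  assume "g \<in> carrier (Sp m)" "h \<in> carrier (Sp m)"
  then have g: "g \<in> carrier_mat (2*m) (2*m)" and f: "g\<^sup>T * symp_form m * g = symp_form m"
    and h: "h \<in> carrier_mat (2*m) (2*m)" and e: "h\<^sup>T * symp_form m * h = symp_form m"
    by (auto simp: Sp_def)
  have t: "h\<^sup>T \<in> carrier_mat (2*m) (2*m)" "g\<^sup>T \<in> carrier_mat (2*m) (2*m)" using g h by auto
  have "(g * h)\<^sup>T * symp_form m * (g * h) = h\<^sup>T * g\<^sup>T * symp_form m * (g * h)"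
    by (simp add: transpose_mult[OF g h])
  also have "\<dots> = h\<^sup>T * (g\<^sup>T * symp_form m * g) * h"
    using g h t by (simp add: assoc_square_mat[where n = "2*m"] mult_square_mat)
  finally show ?thesis using g h by (simp add: Sp_def f e)
qed

lemma Sp_one: "1\<^sub>m (2*m) \<in> carrier (Sp m)"
  by (simp add: Sp_def left_mult_one_mat[OF symp_form_carrier] right_mult_one_mat[OF symp_form_carrier])

lemma minus_symp_form:
  fixes A :: "'a::field mat"
  assumes "A \<in> carrier_mat (2*m) (2*m)"
  shows "- symp_form m * A = - (symp_form m * A)"
  by (rule uminus_mult_left_mat) (use assms in auto)

lemma symp_form_Sp: "symp_form m \<in> carrier (Sp m)" for m
proof -
  have t: "(symp_form m :: 'b::field mat)\<^sup>T = - symp_form m"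
    by (rule eq_matI) (auto simp: symp_form_entry eq_cj_iff)
  show ?thesis
    by (simp add: Sp_def t minus_symp_form symp_form_sq left_mult_one_mat[OF symp_form_carrier]
        uminus_mult_left_mat)
qed

text \<open>Multiplying the right inverse identity by J on the right and using J J = -1 gives the
  defining equation of the transpose. Transposition lets rows be eliminated like columns, and it
  exchanges the rows and columns of minors in the proof of non-simplicity.\<close>

lemma Sp_transpose:
  fixes g :: "'a::field mat"
  assumes gS: "g \<in> carrier (Sp m)"
  shows "g\<^sup>T \<in> carrier (Sp m)"
proof -
  let ?J = "symp_form m :: 'a mat"
  have g: "g \<in> carrier_mat (2*m) (2*m)" using gS by (rule Sp_carrier_mat)
  have gt: "g\<^sup>T \<in> carrier_mat (2*m) (2*m)" using g by simp
  have JgJ: "?J * g\<^sup>T * ?J \<in> carrier_mat (2*m) (2*m)"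
    by (metis gt mult_carrier_mat symp_form_carrier)
  have gJg: "g * ?J * g\<^sup>T \<in> carrier_mat (2*m) (2*m)"
    by (metis g gt mult_carrier_mat symp_form_carrier)
  have "?J = g * - (?J * g\<^sup>T * ?J) * ?J"
    using Sp_right_inverse(2)[OF gS] by (simp add: left_mult_one_mat[OF symp_form_carrier])
  also have "\<dots> = - (g * (?J * g\<^sup>T * ?J)) * ?J"
    using g JgJ by (subst uminus_mult_right_mat) auto
  also have "\<dots> = - (g * (?J * g\<^sup>T * ?J) * ?J)"
    using g JgJ by (subst uminus_mult_left_mat) auto
  also have "g * (?J * g\<^sup>T * ?J) * ?J = g * ?J * g\<^sup>T * (?J * ?J)"
    using g gt by (simp add: assoc_square_mat[where n = "2*m"] mult_square_mat)
  also have "\<dots> = - (g * ?J * g\<^sup>T)"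
    using right_mult_one_mat[OF gJg] g uminus_mult_right_mat[of "g * ?J * g\<^sup>T" "1\<^sub>m (2*m)"]
    by (simp add: symp_form_sq)
  finally have "g * ?J * g\<^sup>T = ?J" by simp
  then show ?thesis using g by (simp add: Sp_def)
qed

lemma Sp_group: "group (Sp m :: 'a::field mat monoid)"
proof (rule groupI)
  fix x :: "'a mat" assume x: "x \<in> carrier (Sp m)"
  let ?y = "symp_form m * x\<^sup>T * symp_form m"
  have c: "?y \<in> carrier (Sp m)"
    using x by (intro Sp_mult Sp_transpose symp_form_Sp) auto
  have y: "?y \<in> carrier_mat (2*m) (2*m)" using c by (rule Sp_carrier_mat)
  \<comment> \<open>Every factor of \<open>?y\<close> is in the group, and the sign drops out
    because the form is bilinear.\<close>
  have "bform m (\<lambda>a. (- ?y) $$ (a, k)) (\<lambda>a. (- ?y) $$ (a, l)) = bform m (\<lambda>a. ?y $$ (a, k)) (\<lambda>a. ?y $$ (a, l))"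
    if "k < 2*m" "l < 2*m" for k l
  proof -
    have "(- ?y) $$ (a, k) = - (?y $$ (a, k))" "(- ?y) $$ (a, l) = - (?y $$ (a, l))" if "a < 2*m" for a
      using y that \<open>k < 2*m\<close> \<open>l < 2*m\<close> by (metis carrier_matD index_uminus_mat(1))+
    then show ?thesis
      unfolding bform_def by (intro sum.cong) (simp_all del: index_mult_mat)
  qed
  then have "- ?y \<in> carrier (Sp m)"
    using c y unfolding Sp_iff by (metis uminus_carrier_iff_mat)
  then show "\<exists>y\<in>carrier (Sp m). y \<otimes>\<^bsub>Sp m\<^esub> x = \<one>\<^bsub>Sp m\<^esub>"
    using Sp_right_inverse(1)[OF x] by (intro bexI[of _ "- ?y"]) (simp_all add: Sp_def)
next
  fix x y z :: "'a mat" assume "x \<in> carrier (Sp m)" "y \<in> carrier (Sp m)" "z \<in> carrier (Sp m)"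
  then show "x \<otimes>\<^bsub>Sp m\<^esub> y \<otimes>\<^bsub>Sp m\<^esub> z = x \<otimes>\<^bsub>Sp m\<^esub> (y \<otimes>\<^bsub>Sp m\<^esub> z)"
    by (auto simp: Sp_def intro: assoc_mult_mat)
next
  fix x y :: "'a mat" assume "x \<in> carrier (Sp m)" "y \<in> carrier (Sp m)"
  then show "x \<otimes>\<^bsub>Sp m\<^esub> y \<in> carrier (Sp m)" using Sp_mult[of x m y] by (simp add: Sp_def)
next
  show "\<one>\<^bsub>Sp m\<^esub> \<in> carrier (Sp m :: 'a mat monoid)" using Sp_one[of m] by (simp add: Sp_def)
next
  fix x :: "'a mat" assume "x \<in> carrier (Sp m)"
  then show "\<one>\<^bsub>Sp m\<^esub> \<otimes>\<^bsub>Sp m\<^esub> x = x" by (auto simp: Sp_def)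
qed

lemma Sp_monoid_simps [simp]: "x \<otimes>\<^bsub>Sp m\<^esub> y = x * y" "\<one>\<^bsub>Sp m\<^esub> = 1\<^sub>m (2*m)"
  by (auto simp: Sp_def)

lemmas Sp_assoc = assoc_mult_mat[OF Sp_carrier_mat Sp_carrier_mat Sp_carrier_mat]

lemma Sp_inv:
  fixes g :: "'a::field mat"
  assumes "g \<in> carrier (Sp m)"
  shows "inv\<^bsub>Sp m\<^esub> g \<in> carrier (Sp m)" "g * inv\<^bsub>Sp m\<^esub> g = 1\<^sub>m (2*m)" "inv\<^bsub>Sp m\<^esub> g * g = 1\<^sub>m (2*m)"
  using group.inv_closed[OF Sp_group assms] group.r_inv[OF Sp_group assms] group.l_inv[OF Sp_group assms]
  by auto

lemma Sp_inv_cancel: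
  fixes g h :: "'a::field mat"
  assumes g: "g \<in> carrier (Sp m)" and h: "h \<in> carrier (Sp m)"
  shows "g * (inv\<^bsub>Sp m\<^esub> g * h) = h" "inv\<^bsub>Sp m\<^esub> g * (g * h) = h"
  using Sp_assoc[OF g Sp_inv(1)[OF g] h] Sp_assoc[OF Sp_inv(1)[OF g] g h] Sp_inv(2,3)[OF g]
    left_mult_one_mat[OF Sp_carrier_mat[OF h]]
  by auto

section \<open>Root elements and the torus\<close>

text \<open>
  Root elements; for \<open>j = cj m i\<close> the root is long and there is a single entry off the diagonal.
\<close>

definition rt :: "nat \<Rightarrow> nat \<Rightarrow> nat \<Rightarrow> 'a::field \<Rightarrow> 'a mat" where
  "rt m i j t = mat (2*m) (2*m) (\<lambda>(k, l). (if k = l then 1 else 0) + (if k = i \<and> l = j then t else 0) +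
     (if k = cj m j \<and> l = cj m i \<and> i \<noteq> cj m j then - (sg m i * sg m j * t) else 0))"

definition tor :: "nat \<Rightarrow> nat \<Rightarrow> 'a::field \<Rightarrow> 'a mat" where
  "tor m i s = mat (2*m) (2*m) (\<lambda>(k, l). if k = l then (if k = i then s else if k = cj m i then inverse s else 1) else 0)"

lemma rt_carrier_mat [simp]: "rt m i j t \<in> carrier_mat (2*m) (2*m)"
  by (simp add: rt_def)

lemma tor_carrier_mat [simp]: "tor m i s \<in> carrier_mat (2*m) (2*m)"
  by (simp add: tor_def)

lemma rt_dim: "dim_row (rt m i j t) = 2*m" "dim_col (rt m i j t) = 2*m"
  by (simp_all add: rt_def)

lemma tor_dim: "dim_row (tor m i t) = 2*m" "dim_col (tor m i t) = 2*m"
  by (simp_all add: tor_def)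

lemma rt_mult_entry:
  assumes g: "g \<in> carrier_mat (2*m) (2*m)" and i: "i < 2*m" and j: "j < 2*m" and k: "k < 2*m" and l: "l < 2*m"
  shows "(rt m i j t * g) $$ (k, l) = g $$ (k, l) + (if k = i then t * g $$ (j, l) else 0) +
     (if k = cj m j \<and> i \<noteq> cj m j then - (sg m i * sg m j * t) * g $$ (cj m i, l) else 0)"
proof -
  define c where "c = (if k = i then t else 0)"
  define d where "d = (if k = cj m j \<and> i \<noteq> cj m j then - (sg m i * sg m j * t) else 0)"
  have e: "rt m i j t $$ (k, a) = (if a = k then 1 else 0) + (if a = j then c else 0) + (if a = cj m i then d else 0)"
    if "a < 2*m" for a
    using that k by (simp add: rt_def c_def d_def eq_commute[of a k])
  have "(rt m i j t * g) $$ (k, l) = (\<Sum>a<2*m. rt m i j t $$ (k, a) * g $$ (a, l))"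
    by (intro mult_entry g k l) auto
  also have "\<dots> = (\<Sum>a<2*m. (if a = k then g $$ (k, l) else 0) + (if a = j then c * g $$ (j, l) else 0) +
     (if a = cj m i then d * g $$ (cj m i, l) else 0))"
    by (intro sum.cong refl) (simp add: e distrib_right)
  also have "\<dots> = g $$ (k, l) + c * g $$ (j, l) + d * g $$ (cj m i, l)"
    using i j k by (simp add: sum.distrib)
  finally show ?thesis by (simp add: c_def d_def if_distrib[of "\<lambda>x. x * _"] cong: if_cong)
qed

lemma tor_mult_entry:
  assumes g: "g \<in> carrier_mat (2*m) (2*m)" and "k < 2*m" "l < 2*m"
  shows "(tor m i s * g) $$ (k, l) = (if k = i then s else if k = cj m i then inverse s else 1) * g $$ (k, l)"
proof -
  have "(tor m i s * g) $$ (k, l) = (\<Sum>a<2*m. tor m i s $$ (k, a) * g $$ (a, l))"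
    using assms by (intro mult_entry) auto
  also have "\<dots> = (\<Sum>a<2*m. if a = k then (if k = i then s else if k = cj m i then inverse s else 1) * g $$ (k, l) else 0)"
    using assms by (intro sum.cong) (auto simp: tor_def)
  finally show ?thesis using assms by simp
qed

lemma bform_add_left: "bform m (\<lambda>a. u a + u' a) v = bform m u v + bform m u' v"
  by (simp add: bform_def algebra_simps sum.distrib)

lemma bform_add_right: "bform m u (\<lambda>a. v a + v' a) = bform m u v + bform m u v'"
  by (simp add: bform_def algebra_simps sum.distrib)

lemma bform_single_left: "i < 2*m \<Longrightarrow> bform m (\<lambda>a. if a = i then c else 0) v = sg m i * c * v (cj m i)"
proof -
  assume i: "i < 2*m"
  have "bform m (\<lambda>a. if a = i then c else 0) v = (\<Sum>a<2*m. if a = i then sg m i * c * v (cj m i) else 0)"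
    unfolding bform_def by (intro sum.cong) auto
  then show ?thesis using i by simp
qed

lemma bform_single_right: "i < 2*m \<Longrightarrow> bform m u (\<lambda>a. if a = i then c else 0) = - (sg m i * c * u (cj m i))"
proof -
  assume i: "i < 2*m"
  have "bform m u (\<lambda>a. if a = i then c else 0) = (\<Sum>a<2*m. if a = cj m i then sg m (cj m i) * c * u (cj m i) else 0)"
    unfolding bform_def using i by (intro sum.cong) auto
  then show ?thesis using i by (simp add: sg_cj)
qed

lemma bform_cong: "(\<And>a. a < 2*m \<Longrightarrow> u a = u' a) \<Longrightarrow> (\<And>a. a < 2*m \<Longrightarrow> v a = v' a) \<Longrightarrow> bform m u v = bform m u' v'"
  unfolding bform_def by (intro sum.cong) auto

text \<open>All columns undergo the same linear map \<open>u'\<close>, and the terms of first and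
  second order in \<open>t\<close> cancel in the form. Long and short roots are treated together:
  for a long root the companion coefficient \<open>c\<close> is 0.\<close>

lemma rt_mult_Sp:
  assumes g: "g \<in> carrier (Sp m)" and i: "i < 2*m" and j: "j < 2*m" and ij: "i \<noteq> j"
  shows "rt m i j t * g \<in> carrier (Sp m)"
proof -
  have gc: "g \<in> carrier_mat (2*m) (2*m)" using g by (rule Sp_carrier_mat)
  define c where "c = (if i = cj m j then 0 else - (sg m i * sg m j * t))"
  define u' where "u' u = (\<lambda>a::nat. u a + ((if a = i then t * u j else 0) + (if a = cj m j then c * u (cj m i) else 0)))"
    for u :: "nat \<Rightarrow> 'a"
  have inv: "bform m (u' u) (u' v) = bform m u v" for u v
    using i j ij unfolding u'_def c_def
    by (simp add: bform_add_left bform_add_right bform_single_left bform_single_right)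
      (auto simp: algebra_simps eq_cj_iff)
  have "bform m (\<lambda>a. (rt m i j t * g) $$ (a, k)) (\<lambda>a. (rt m i j t * g) $$ (a, l))
     = bform m (u' (\<lambda>a. g $$ (a, k))) (u' (\<lambda>a. g $$ (a, l)))" if "k < 2*m" "l < 2*m" for k l
    by (rule bform_cong) (use that i j gc in \<open>auto simp: rt_mult_entry u'_def c_def\<close>)
  moreover have "bform m (\<lambda>a. g $$ (a, k)) (\<lambda>a. g $$ (a, l)) = (if k = cj m l then sg m k else 0)"
    if "k < 2*m" "l < 2*m" for k l
    using g that unfolding Sp_iff by blast
  ultimately show ?thesis
    unfolding Sp_iff inv using mult_carrier_mat[OF rt_carrier_mat gc] by metis
qed

lemma rt_Sp: "i < 2*m \<Longrightarrow> j < 2*m \<Longrightarrow> i \<noteq> j \<Longrightarrow> rt m i j t \<in> carrier (Sp m)"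
  using rt_mult_Sp[OF Sp_one, of i m j t] by (simp add: right_mult_one_mat[OF rt_carrier_mat])

lemma tor_mult_Sp:
  fixes g :: "'a::field mat"
  assumes g: "g \<in> carrier (Sp m)" and i: "i < 2*m" and s: "s \<noteq> 0"
  shows "tor m i s * g \<in> carrier (Sp m)"
proof -
  have gc: "g \<in> carrier_mat (2*m) (2*m)" using g by (rule Sp_carrier_mat)
  define c where "c k = (if k = i then s else if k = cj m i then inverse s else 1)" for k
  have c: "c a * c (cj m a) = 1" if "a < 2*m" for a
  proof -
    have "cj m a = cj m i \<longleftrightarrow> a = i" "cj m a = i \<longleftrightarrow> a = cj m i"
      using that i by (auto simp: eq_cj_iff)
    then show ?thesis using s i by (simp add: c_def)
  qed
  have "bform m (\<lambda>a. (tor m i s * g) $$ (a, k)) (\<lambda>a. (tor m i s * g) $$ (a, l))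
     = bform m (\<lambda>a. g $$ (a, k)) (\<lambda>a. g $$ (a, l))" if kl: "k < 2*m" "l < 2*m" for k l
    unfolding bform_def
  proof (intro sum.cong refl)
    fix a assume "a \<in> {..<2*m}"
    then have a: "a < 2*m" by simp
    have "sg m a * (tor m i s * g) $$ (a, k) * (tor m i s * g) $$ (cj m a, l)
        = sg m a * (c a * g $$ (a, k)) * (c (cj m a) * g $$ (cj m a, l))"
      unfolding c_def tor_mult_entry[OF gc a kl(1)] tor_mult_entry[OF gc cj_less[OF a] kl(2)] ..
    also have "\<dots> = (c a * c (cj m a)) * (sg m a * g $$ (a, k) * g $$ (cj m a, l))"
      by (simp only: mult_ac)
    finally show "sg m a * (tor m i s * g) $$ (a, k) * (tor m i s * g) $$ (cj m a, l)
        = sg m a * g $$ (a, k) * g $$ (cj m a, l)"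
      using c[OF a] by simp
  qed
  moreover have "bform m (\<lambda>a. g $$ (a, k)) (\<lambda>a. g $$ (a, l)) = (if k = cj m l then sg m k else 0)"
    if "k < 2*m" "l < 2*m" for k l
    using g that unfolding Sp_iff by blast
  ultimately show ?thesis
    unfolding Sp_iff using mult_carrier_mat[OF tor_carrier_mat gc] by metis
qed

lemma tor_Sp: "i < 2*m \<Longrightarrow> s \<noteq> 0 \<Longrightarrow> tor m i s \<in> carrier (Sp m)"
  using tor_mult_Sp[OF Sp_one, of i m s] by (simp add: right_mult_one_mat[OF tor_carrier_mat])

section \<open>Polynomial functions along curves\<close>

text \<open>Over a finite field the product of all \<open>X - a\<close>, increased by 1, has
  positive degree but no root.\<close>

lemma infinite_alg_closed: "infinite (UNIV :: 'a::alg_closed_field set)"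
proof
  assume fin: "finite (UNIV :: 'a set)"
  define p :: "'a poly" where "p = (\<Prod>a\<in>UNIV. [:- a, 1:]) + 1"
  have "degree (\<Prod>a\<in>(UNIV :: 'a set). [:- a, 1:]) = card (UNIV :: 'a set)"
    by (subst degree_prod_eq_sum_degree) auto
  moreover have "card (UNIV :: 'a set) > 0" using fin by (simp add: card_gt_0_iff)
  ultimately have "degree p > 0" unfolding p_def by (subst degree_add_eq_left) auto
  then obtain x where x: "poly p x = 0" using alg_closed_imp_poly_has_root by blast
  have "poly (\<Prod>a\<in>UNIV. [:- a, 1:]) x = (\<Prod>a\<in>UNIV. x - a)"
    by (simp add: poly_prod)
  also have "\<dots> = 0" using fin by (intro prod_zero) auto
  finally show False using x by (simp add: p_def)
qed

lemma poly_eq_0_if_nonzero_roots: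
  fixes p :: "'a::alg_closed_field poly"
  assumes "\<And>s. s \<noteq> 0 \<Longrightarrow> poly p s = 0"
  shows "p = 0"
proof (rule ccontr)
  assume "p \<noteq> 0"
  then have "finite {s. poly p s = 0}" by (rule poly_roots_finite)
  then have "finite (insert 0 {s. poly p s = 0})" by simp
  moreover have "insert 0 {s. poly p s = 0} = UNIV" using assms by auto
  ultimately show False using infinite_alg_closed by metis
qed

lemma poly_eqI_nonzero:
  fixes p q :: "'a::alg_closed_field poly"
  assumes "\<And>s. s \<noteq> 0 \<Longrightarrow> poly p s = poly q s"
  shows "p = q"
  using poly_eq_0_if_nonzero_roots[of "p - q"] assms by simp

section \<open>Polynomial functions and their dependence on a parameter\<close>

lemma poly_funs_sum: "(\<And>x. x \<in> A \<Longrightarrow> F x \<in> poly_funs n) \<Longrightarrow> (\<lambda>g. \<Sum>x\<in>A. F x g) \<in> poly_funs n"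
  by (induction A rule: infinite_finite_induct) (auto intro: poly_funs.intros)

lemma poly_funs_prod: "(\<And>x. x \<in> A \<Longrightarrow> F x \<in> poly_funs n) \<Longrightarrow> (\<lambda>g. \<Prod>x\<in>A. F x g) \<in> poly_funs n"
  by (induction A rule: infinite_finite_induct) (auto intro: poly_funs.intros)

lemma poly_funs_cmult: "F \<in> poly_funs n \<Longrightarrow> (\<lambda>g. c * F g) \<in> poly_funs n"
  by (intro poly_funs.intros)

text \<open>The parameter set is kept variable since torus curves exist only for nonzero parameters.
  The coefficients are required to be polynomial functions of the matrix, so that they can be tested
  on the big cell one by one.\<close>

definition fam :: "'a::field set \<Rightarrow> nat \<Rightarrow> ('a \<Rightarrow> 'a mat \<Rightarrow> 'a) set" where
  "fam S n = {F. \<exists>M P. (\<forall>k. P k \<in> poly_funs n) \<and>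
     (\<forall>s\<in>S. \<forall>g\<in>carrier_mat n n. F s g = (\<Sum>k\<le>M::nat. s ^ k * P k g))}"

lemma famI:
  assumes "\<And>k. P k \<in> poly_funs n"
    and "\<And>s g. s \<in> S \<Longrightarrow> g \<in> carrier_mat n n \<Longrightarrow> F s g = (\<Sum>k\<le>M::nat. s ^ k * P k g)"
  shows "F \<in> fam S n"
  using assms unfolding fam_def by blast

lemma fam_single:
  assumes "Q \<in> poly_funs n"
  shows "(\<lambda>s g. s ^ k * Q g) \<in> fam S n"
proof (rule famI)
  show "(if i = k then Q else (\<lambda>_. 0)) \<in> poly_funs n" for i
    using assms by (cases "i = k") (auto intro: poly_funs.intros)
  fix s and g :: "'a mat"
  have "(\<Sum>i\<le>k. s ^ i * (if i = k then Q else (\<lambda>_. 0)) g) = (\<Sum>i\<le>k. if i = k then s ^ k * Q g else 0)"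
    by (intro sum.cong) auto
  then show "s ^ k * Q g = (\<Sum>i\<le>k. s ^ i * (if i = k then Q else (\<lambda>_. 0)) g)"
    by simp
qed

lemma fam_cong:
  assumes "F \<in> fam S n" and G: "\<And>s g. s \<in> S \<Longrightarrow> g \<in> carrier_mat n n \<Longrightarrow> G s g = F s g"
  shows "G \<in> fam S n"
proof -
  obtain M P where P: "\<And>k. P k \<in> poly_funs n"
    "\<And>s g. s \<in> S \<Longrightarrow> g \<in> carrier_mat n n \<Longrightarrow> F s g = (\<Sum>k\<le>M::nat. s ^ k * P k g)"
    using assms(1) unfolding fam_def by blast
  show ?thesis by (rule famI[OF P(1)]) (simp add: G P(2))
qed

lemma fam_add:
  assumes "F \<in> fam S n" "G \<in> fam S n"
  shows "(\<lambda>s g. F s g + G s g) \<in> fam S n"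
proof -
  obtain M P where P: "\<And>k. P k \<in> poly_funs n"
    "\<And>s g. s \<in> S \<Longrightarrow> g \<in> carrier_mat n n \<Longrightarrow> F s g = (\<Sum>k\<le>M::nat. s ^ k * P k g)"
    using assms(1) unfolding fam_def by blast
  obtain L Q where Q: "\<And>k. Q k \<in> poly_funs n"
    "\<And>s g. s \<in> S \<Longrightarrow> g \<in> carrier_mat n n \<Longrightarrow> G s g = (\<Sum>k\<le>L::nat. s ^ k * Q k g)"
    using assms(2) unfolding fam_def by blast
  have ext: "(\<Sum>k\<le>M. s ^ k * P k g) = (\<Sum>k\<le>max M L. s ^ k * (if k \<le> M then P k g else 0))"
    "(\<Sum>k\<le>L. s ^ k * Q k g) = (\<Sum>k\<le>max M L. s ^ k * (if k \<le> L then Q k g else 0))" for s g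
    by (rule sum.mono_neutral_cong_left; simp)+
  show ?thesis
  proof (rule famI[of "\<lambda>k g. (if k \<le> M then P k g else 0) + (if k \<le> L then Q k g else 0)" n S _ "max M L"])
    show "(\<lambda>g. (if k \<le> M then P k g else 0) + (if k \<le> L then Q k g else 0)) \<in> poly_funs n" for k
      using P(1)[of k] Q(1)[of k] by (cases "k \<le> M"; cases "k \<le> L") (auto intro: poly_funs.intros)
    show "F s g + G s g = (\<Sum>k\<le>max M L. s ^ k * ((if k \<le> M then P k g else 0) + (if k \<le> L then Q k g else 0)))"
      if "s \<in> S" "g \<in> carrier_mat n n" for s g
      unfolding P(2)[OF that] Q(2)[OF that] ext distrib_left sum.distrib ..
  qed
qed

lemma fam_sum: "finite A \<Longrightarrow> (\<And>x. x \<in> A \<Longrightarrow> F x \<in> fam S n) \<Longrightarrow> (\<lambda>s g. \<Sum>x\<in>A. F x s g) \<in> fam S n"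
proof (induction A rule: finite_induct)
  case empty
  then show ?case using fam_single[OF poly_funs.const[of 0 n], of 0 S] by simp
next
  case (insert x A)
  then show ?case using fam_add[of "F x" S n "\<lambda>s g. \<Sum>x\<in>A. F x s g"] by auto
qed

lemma fam_mult:
  assumes "F \<in> fam S n" "G \<in> fam S n"
  shows "(\<lambda>s g. F s g * G s g) \<in> fam S n"
proof -
  obtain M P where P: "\<And>k. P k \<in> poly_funs n"
    "\<And>s g. s \<in> S \<Longrightarrow> g \<in> carrier_mat n n \<Longrightarrow> F s g = (\<Sum>k\<le>M::nat. s ^ k * P k g)"
    using assms(1) unfolding fam_def by blast
  obtain L Q where Q: "\<And>k. Q k \<in> poly_funs n"
    "\<And>s g. s \<in> S \<Longrightarrow> g \<in> carrier_mat n n \<Longrightarrow> G s g = (\<Sum>k\<le>L::nat. s ^ k * Q k g)"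
    using assms(2) unfolding fam_def by blast
  have "(\<lambda>s g. \<Sum>i\<le>M. \<Sum>j\<le>L. s ^ (i + j) * (P i g * Q j g)) \<in> fam S n"
    by (intro fam_sum fam_single poly_funs.intros P(1) Q(1)) auto
  then show ?thesis
  proof (rule fam_cong)
    fix s and g :: "'a mat" assume sg: "s \<in> S" "g \<in> carrier_mat n n"
    show "F s g * G s g = (\<Sum>i\<le>M. \<Sum>j\<le>L. s ^ (i + j) * (P i g * Q j g))"
      unfolding P(2)[OF sg] Q(2)[OF sg] sum_product by (simp add: power_add mult_ac)
  qed
qed

lemma fam_const: "Q \<in> poly_funs n \<Longrightarrow> (\<lambda>s. Q) \<in> fam S n"
  using fam_single[of Q n 0 S] by simp

lemma fam_poly: "(\<lambda>s g. poly p s) \<in> fam S n"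
proof -
  have "(\<lambda>s g. \<Sum>k\<le>degree p. s ^ k * coeff p k) \<in> fam S n"
    by (intro fam_sum fam_single poly_funs.intros) auto
  then show ?thesis by (rule fam_cong) (simp add: poly_altdef mult.commute)
qed

lemma fam_pow: "F \<in> fam S n \<Longrightarrow> (\<lambda>s g. F s g ^ k) \<in> fam S n"
proof (induction k)
  case 0
  show ?case using fam_poly[of 1 S n] by simp
next
  case (Suc k)
  then show ?case using fam_mult[of F S n "\<lambda>s g. F s g ^ k"] by simp
qed

text \<open>\<open>q\<close> is a common denominator of the entries of the curve, for instance
  \<open>X\<close> for a torus curve. Under sums and products the exponents of the denominators add
  up.\<close>

lemma poly_funs_family:
  fixes A :: "'a::field \<Rightarrow> 'a mat"
  assumes P: "P \<in> poly_funs n" and A: "\<And>s. s \<in> S \<Longrightarrow> A s \<in> carrier_mat n n"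
    and ent: "\<And>i j. i < n \<Longrightarrow> j < n \<Longrightarrow> \<exists>p. \<forall>s\<in>S. poly q s * A s $$ (i, j) = poly p s"
  shows "\<exists>N. (\<lambda>s g. poly q s ^ N * P (A s * g)) \<in> fam S n"
  using P
proof induction
  case (const c)
  have "(\<lambda>s g. poly q s ^ 0 * c) \<in> fam S n" using fam_const[OF poly_funs.const, of c S n] by simp
  then show ?case by blast
next
  case (coord i j)
  obtain p where p: "\<And>l s. l < n \<Longrightarrow> s \<in> S \<Longrightarrow> poly q s * A s $$ (i, l) = poly (p l) s"
    using ent[OF coord(1)] by metis
  have "(\<lambda>s g. \<Sum>l<n. poly (p l) s * g $$ (l, j)) \<in> fam S n"
    by (intro fam_sum fam_mult fam_poly fam_const poly_funs.intros coord) auto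
  then have "(\<lambda>s g. poly q s ^ 1 * (A s * g) $$ (i, j)) \<in> fam S n"
  proof (rule fam_cong)
    fix s and g :: "'a mat" assume sg: "s \<in> S" "g \<in> carrier_mat n n"
    have "poly q s ^ 1 * (A s * g) $$ (i, j) = (\<Sum>l<n. (poly q s * A s $$ (i, l)) * g $$ (l, j))"
      unfolding mult_entry[OF A[OF sg(1)] sg(2) coord] by (simp add: sum_distrib_left mult.assoc)
    also have "\<dots> = (\<Sum>l<n. poly (p l) s * g $$ (l, j))"
      using p sg by (intro sum.cong) auto
    finally show "poly q s ^ 1 * (A s * g) $$ (i, j) = (\<Sum>l<n. poly (p l) s * g $$ (l, j))" .
  qed
  then show ?case by blast
next
  case (add P Q)
  then obtain N L where NL: "(\<lambda>s g. poly q s ^ N * P (A s * g)) \<in> fam S n" "(\<lambda>s g. poly q s ^ L * Q (A s * g)) \<in> fam S n"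
    by blast
  have "(\<lambda>s g. poly q s ^ L * (poly q s ^ N * P (A s * g)) + poly q s ^ N * (poly q s ^ L * Q (A s * g))) \<in> fam S n"
    by (rule fam_add[OF fam_mult[OF fam_pow[OF fam_poly] NL(1)] fam_mult[OF fam_pow[OF fam_poly] NL(2)]])
  then have "(\<lambda>s g. poly q s ^ (N + L) * (P (A s * g) + Q (A s * g))) \<in> fam S n"
    by (rule fam_cong) (simp add: power_add algebra_simps)
  then show ?case by blast
next
  case (mult P Q)
  then obtain N L where NL: "(\<lambda>s g. poly q s ^ N * P (A s * g)) \<in> fam S n" "(\<lambda>s g. poly q s ^ L * Q (A s * g)) \<in> fam S n"
    by blast
  have "(\<lambda>s g. (poly q s ^ N * P (A s * g)) * (poly q s ^ L * Q (A s * g))) \<in> fam S n"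
    by (rule fam_mult[OF NL])
  then have "(\<lambda>s g. poly q s ^ (N + L) * (P (A s * g) * Q (A s * g))) \<in> fam S n"
    by (rule fam_cong) (simp add: power_add algebra_simps)
  then show ?case by blast
qed

lemma poly_funs_poly_family:
  fixes A :: "'a::field \<Rightarrow> 'a mat"
  assumes P: "P \<in> poly_funs n" and A: "\<And>s. s \<in> S \<Longrightarrow> A s \<in> carrier_mat n n"
    and ent: "\<And>i j. i < n \<Longrightarrow> j < n \<Longrightarrow> \<exists>p. \<forall>s\<in>S. A s $$ (i, j) = poly p s"
  shows "(\<lambda>s g. P (A s * g)) \<in> fam S n"
proof -
  have "\<exists>N. (\<lambda>s g. poly 1 s ^ N * P (A s * g)) \<in> fam S n"
    by (rule poly_funs_family[OF P A]) (use ent in auto)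
  then show ?thesis by simp
qed

lemma fam_curve:
  assumes "F \<in> fam S n" "g \<in> carrier_mat n n"
  shows "\<exists>p. \<forall>s\<in>S. F s g = poly p s"
proof -
  obtain M P where P: "\<And>s. s \<in> S \<Longrightarrow> F s g = (\<Sum>k\<le>M::nat. s ^ k * P k g)"
    using assms unfolding fam_def by blast
  show ?thesis
    by (intro exI[of _ "\<Sum>k\<le>M. monom (P k g) k"] ballI)
      (simp add: P poly_sum poly_monom mult.commute)
qed

lemma poly_funs_curve:
  fixes A :: "'a::field \<Rightarrow> 'a mat"
  assumes P: "P \<in> poly_funs n" and A: "\<And>s. s \<in> S \<Longrightarrow> A s \<in> carrier_mat n n"
    and ent: "\<And>i j. i < n \<Longrightarrow> j < n \<Longrightarrow> \<exists>p. \<forall>s\<in>S. A s $$ (i, j) = poly p s"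
  shows "\<exists>p. \<forall>s\<in>S. P (A s) = poly p s"
  using fam_curve[OF poly_funs_poly_family[OF P A ent] one_carrier_mat] A by fastforce

lemma poly_funs_translate:
  assumes P: "P \<in> poly_funs n" and A: "A \<in> carrier_mat n n" and B: "B \<in> carrier_mat n n"
  shows "\<exists>Q\<in>poly_funs n. \<forall>g\<in>carrier_mat n n. P (A * g * B) = Q g"
  using P
proof induction
  case (const c)
  then show ?case by (intro bexI[of _ "\<lambda>_. c"]) (auto intro: poly_funs.intros)
next
  case (coord i j)
  show ?case
  proof (intro bexI ballI)
    show "(\<lambda>g. \<Sum>b<n. (\<Sum>a<n. A $$ (i, a) * g $$ (a, b)) * B $$ (b, j)) \<in> poly_funs n"
      by (intro poly_funs_sum poly_funs.intros) auto
    fix g :: "'a mat" assume g: "g \<in> carrier_mat n n"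
    show "(A * g * B) $$ (i, j) = (\<Sum>b<n. (\<Sum>a<n. A $$ (i, a) * g $$ (a, b)) * B $$ (b, j))"
      unfolding mult_entry[OF mult_square_mat[OF A g] B coord]
      by (intro sum.cong refl) (simp add: mult_entry[OF A g coord(1)] del: index_mult_mat)
  qed
next
  case (add P Q)
  then obtain P' Q' where "P' \<in> poly_funs n" "Q' \<in> poly_funs n"
    "\<forall>g\<in>carrier_mat n n. P (A * g * B) = P' g" "\<forall>g\<in>carrier_mat n n. Q (A * g * B) = Q' g" by blast
  then show ?case by (intro bexI[of _ "\<lambda>g. P' g + Q' g"]) (auto intro: poly_funs.intros)
next
  case (mult P Q)
  then obtain P' Q' where "P' \<in> poly_funs n" "Q' \<in> poly_funs n"
    "\<forall>g\<in>carrier_mat n n. P (A * g * B) = P' g" "\<forall>g\<in>carrier_mat n n. Q (A * g * B) = Q' g" by blast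
  then show ?case by (intro bexI[of _ "\<lambda>g. P' g * Q' g"]) (auto intro: poly_funs.intros)
qed

section \<open>Density of the big cell\<close>

lemma rt_rt:
  assumes g: "g \<in> carrier_mat (2*m) (2*m)" and i: "i < 2*m" and j: "j < 2*m" and ij: "i \<noteq> j"
  shows "rt m i j s * (rt m i j t * g) = rt m i j (s + t) * g"
proof (rule eq_matI)
  fix k l assume "k < dim_row (rt m i j (s + t) * g)" "l < dim_col (rt m i j (s + t) * g)"
  then have k: "k < 2*m" and l: "l < 2*m" using g by (auto simp: rt_dim)
  have c: "rt m i j t * g \<in> carrier_mat (2*m) (2*m)" using g by (intro mult_square_mat) auto
  show "(rt m i j s * (rt m i j t * g)) $$ (k, l) = (rt m i j (s + t) * g) $$ (k, l)"
    unfolding rt_mult_entry[OF c i j k l] rt_mult_entry[OF g i j k l] rt_mult_entry[OF g i j j l]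
      rt_mult_entry[OF g i j cj_less[OF i] l]
    using ij i j by (auto simp: algebra_simps)
qed (use g in \<open>auto simp: rt_dim\<close>)

lemma rt_zero: "rt m i j 0 = 1\<^sub>m (2*m)"
  by (rule eq_matI) (auto simp: rt_def)

lemma rt_inverse:
  assumes g: "g \<in> carrier_mat (2*m) (2*m)" and i: "i < 2*m" and j: "j < 2*m" and ij: "i \<noteq> j"
  shows "rt m i j (- t) * (rt m i j t * g) = g"
  using rt_rt[OF assms, of "- t" t] g by (simp add: rt_zero)

lemma rt_entry_poly:
  assumes "a < 2*m" "l < 2*m"
  shows "\<exists>p. \<forall>s::'a::field. rt m i j s $$ (a, l) = poly p s"
proof -
  have gen: "(if A then 1 else 0) + (if B then s else 0) + (if C then - (x * y * s) else 0) =
      poly [:if A then 1 else 0, (if B then 1 else 0) + (if C then - (x * y) else 0):] s"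
    for A B C and x y s :: 'a
    by (cases A; cases B; cases C) (simp_all add: algebra_simps)
  have "rt m i j s $$ (a, l) = (if a = l then 1 else 0) + (if a = i \<and> l = j then s else 0) +
     (if a = cj m j \<and> l = cj m i \<and> i \<noteq> cj m j then - (sg m i * sg m j * s) else 0)" for s :: 'a
    unfolding rt_def index_mat(1)[OF assms] prod.case ..
  then show ?thesis unfolding gen by blast
qed

text \<open>Given by generators instead of equations: invariance under positive root elements then
  passes to all of \<open>Upos\<close> by induction.\<close>

inductive_set Upos :: "nat \<Rightarrow> 'a::field mat set" for m where
  one: "1\<^sub>m (2*m) \<in> Upos m"
| rt: "i < j \<Longrightarrow> j < 2*m \<Longrightarrow> u \<in> Upos m \<Longrightarrow> rt m i j t * u \<in> Upos m"

lemma Upos_Sp: "u \<in> Upos m \<Longrightarrow> u \<in> carrier (Sp m)"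
  by (induction rule: Upos.induct) (auto intro: Sp_one rt_mult_Sp)

lemma Upos_carrier_mat: "u \<in> Upos m \<Longrightarrow> u \<in> carrier_mat (2*m) (2*m)"
  by (rule Sp_carrier_mat[OF Upos_Sp])

lemma Upos_mult:
  assumes u: "u \<in> Upos m" and v: "v \<in> Upos m"
  shows "u * v \<in> Upos m"
  using u
proof induction
  case one
  then show ?case using v Upos_carrier_mat[OF v] by simp
next
  case (rt i j u t)
  then show ?case
    using Upos_carrier_mat[OF rt(3)] Upos_carrier_mat[OF v] Upos.rt[OF rt(1,2,4)]
    by (simp add: assoc_square_mat[where n = "2*m"])
qed

lemma Upos_upper: "u \<in> Upos m \<Longrightarrow> l < k \<Longrightarrow> k < 2*m \<Longrightarrow> u $$ (k, l) = 0"
proof (induction arbitrary: k l rule: Upos.induct)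
  case one
  then show ?case by simp
next
  case (rt i j u t)
  have l: "l < 2*m" and i: "i < 2*m" using rt by auto
  show ?case
    unfolding rt_mult_entry[OF Upos_carrier_mat[OF rt(3)] i rt(2) rt(6) l]
    using rt.IH[OF rt(5,6)] rt.IH[of l j] rt.IH[of l "cj m i"] rt i by (auto simp: cj_def)
qed

lemma Upos_left_inverse:
  assumes "u \<in> Upos m"
  shows "\<exists>v\<in>Upos m. v * u = 1\<^sub>m (2*m)"
  using assms
proof induction
  case one
  show ?case by (intro bexI[OF _ Upos.one]) simp
next
  case (rt i j u t)
  then obtain v where v: "v \<in> Upos m" "v * u = 1\<^sub>m (2*m)" by blast
  have r: "rt m i j (- t) \<in> Upos m"
    using Upos.rt[OF rt(1,2) Upos.one, of "- t"] by (simp add: right_mult_one_mat[OF rt_carrier_mat])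
  have u: "u \<in> carrier_mat (2*m) (2*m)" by (rule Upos_carrier_mat[OF rt(3)])
  have "v * rt m i j (- t) * (rt m i j t * u) = v * (rt m i j (- t) * (rt m i j t * u))"
    using u Upos_carrier_mat[OF v(1)] by (intro assoc_square_mat[where n = "2*m"] mult_square_mat) auto
  also have "\<dots> = 1\<^sub>m (2*m)"
    using rt(1,2) by (simp add: rt_inverse[OF u] v(2))
  finally show ?case using Upos_mult[OF v(1) r] by blast
qed

section \<open>The negative Borel subgroup\<close>

lemma borel_neg_Sp: "b \<in> borel_neg m \<Longrightarrow> b \<in> carrier (Sp m)"
  by (simp add: borel_neg_def)

lemma borel_neg_carrier_mat: "b \<in> borel_neg m \<Longrightarrow> b \<in> carrier_mat (2*m) (2*m)"
  by (rule Sp_carrier_mat[OF borel_neg_Sp])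

lemma borel_neg_mult:
  fixes a b :: "'a::field mat"
  assumes a: "a \<in> borel_neg m" and b: "b \<in> borel_neg m"
  shows "a * b \<in> borel_neg m"
proof -
  have "(a * b) $$ (i, j) = 0" if "i < j" "j < 2*m" for i j
  proof -
    have "(a * b) $$ (i, j) = (\<Sum>k<2*m. a $$ (i, k) * b $$ (k, j))"
      using that by (intro mult_entry borel_neg_carrier_mat a b) auto
    also have "\<dots> = 0"
    proof (intro sum.neutral ballI)
      fix k assume "k \<in> {..<2*m}"
      then show "a $$ (i, k) * b $$ (k, j) = 0"
        using a b that by (cases "i < k") (auto simp: borel_neg_def)
    qed
    finally show ?thesis .
  qed
  then show ?thesis
    using Sp_mult[OF borel_neg_Sp[OF a] borel_neg_Sp[OF b]] unfolding borel_neg_def by blast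
qed

lemma Upos_transpose_borel: 
  fixes u :: "'a::field mat"
  assumes "u \<in> Upos m"
  shows "u\<^sup>T \<in> borel_neg m"
  using Sp_transpose[OF Upos_Sp[OF assms]] Upos_upper[OF assms] Upos_carrier_mat[OF assms]
  by (auto simp: borel_neg_def)

lemma tor_borel: "i < 2*m \<Longrightarrow> s \<noteq> 0 \<Longrightarrow> tor m i s \<in> borel_neg m"
  using tor_Sp[of i m s] by (auto simp: borel_neg_def tor_def)

text \<open>The copy of \<open>Sp (m - k)\<close> that acts on the middle \<open>2m - 2k\<close>
  coordinates. Elimination removes one outer hyperbolic pair at a time.\<close>

definition blk :: "nat \<Rightarrow> nat \<Rightarrow> 'a::field mat set" where
  "blk m k = {g \<in> carrier (Sp m). \<forall>i<2*m. \<forall>j<2*m. i < k \<or> 2*m - k \<le> i \<or> j < k \<or> 2*m - k \<le> j \<longrightarrow>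
     g $$ (i, j) = (if i = j then 1 else 0)}"

lemma blk_Sp: "g \<in> blk m k \<Longrightarrow> g \<in> carrier (Sp m)"
  by (simp add: blk_def)

lemma blk_entry: "g \<in> blk m k \<Longrightarrow> i < 2*m \<Longrightarrow> j < 2*m \<Longrightarrow> i < k \<or> 2*m - k \<le> i \<or> j < k \<or> 2*m - k \<le> j \<Longrightarrow>
     g $$ (i, j) = (if i = j then 1 else 0)"
  unfolding blk_def by blast

lemma blk_transpose: "g \<in> blk m k \<Longrightarrow> g\<^sup>T \<in> blk m k" for g :: "'a::field mat"
  using Sp_transpose[of g m] Sp_carrier_mat[of g m] by (auto simp: blk_def)

lemma blk_0: "blk m 0 = carrier (Sp m)"
  by (auto simp: blk_def)

lemma blk_all: "blk m m = {1\<^sub>m (2*m)}"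
proof -
  have "g = 1\<^sub>m (2*m)" if "g \<in> blk m m" for g :: "'a mat"
  proof (rule eq_matI)
    fix i j assume "i < dim_row (1\<^sub>m (2*m) :: 'a mat)" "j < dim_col (1\<^sub>m (2*m) :: 'a mat)"
    then show "g $$ (i, j) = 1\<^sub>m (2*m) $$ (i, j)"
      using blk_entry[OF that, of i j] by force
  qed (use Sp_carrier_mat[OF blk_Sp[OF that]] in auto)
  moreover have "1\<^sub>m (2*m) \<in> blk m m" using Sp_one[of m] by (auto simp: blk_def)
  ultimately show ?thesis by blast
qed

lemma blk_rt:
  assumes g: "g \<in> blk m k" and i: "k \<le> i" "i < 2*m - k" and j: "k \<le> j" "j < 2*m - k" and ij: "i \<noteq> j"
  shows "rt m i j t * g \<in> blk m k"
proof -
  have i': "i < 2*m" and j': "j < 2*m" and ci: "k \<le> cj m i" "cj m i < 2*m - k"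
    and c_j: "k \<le> cj m j" "cj m j < 2*m - k" using i j by (auto simp: cj_def)
  have gc: "g \<in> carrier_mat (2*m) (2*m)" by (rule Sp_carrier_mat[OF blk_Sp[OF g]])
  have "(rt m i j t * g) $$ (a, b) = (if a = b then 1 else 0)"
    if ab: "a < 2*m" "b < 2*m" and out: "a < k \<or> 2*m - k \<le> a \<or> b < k \<or> 2*m - k \<le> b" for a b
  proof -
    have 1: "g $$ (j, b) = 0" "g $$ (cj m i, b) = 0" if "b < k \<or> 2*m - k \<le> b"
      using blk_entry[OF g j' ab(2)] blk_entry[OF g cj_less[OF i'] ab(2)] that j ci by auto
    show ?thesis
      unfolding rt_mult_entry[OF gc i' j' ab]
      using blk_entry[OF g ab] out 1 i c_j by (cases "b < k \<or> 2*m - k \<le> b") auto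
  qed
  then show ?thesis
    using rt_mult_Sp[OF blk_Sp[OF g] i' j' ij] unfolding blk_def by blast
qed

text \<open>Multiples of the pivot row \<open>cj m k\<close> are added to the rows above it. Each
  short root element used for a row strictly between \<open>k\<close> and \<open>cj m k\<close> also
  alters row \<open>k\<close>, which is therefore cleared last. No step alters the pivot row
  itself.\<close>

lemma column_elimination:
  fixes g :: "'a::field mat"
  assumes g: "g \<in> blk m k" and k: "k < m" and piv: "g $$ (cj m k, cj m k) \<noteq> 0"
  shows "\<exists>u\<in>Upos m. u * g \<in> blk m k \<and> (\<forall>i<2*m. i \<noteq> cj m k \<longrightarrow> (u * g) $$ (i, cj m k) = 0) \<and>
    (\<forall>l<2*m. (u * g) $$ (cj m k, l) = g $$ (cj m k, l))"
proof -
  let ?q = "cj m k"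
  have q: "?q < 2*m" "k \<le> ?q" "k < ?q" "?q < 2*m - k" "k < 2*m" using k by (auto simp: cj_def)
  have gc: "g \<in> carrier_mat (2*m) (2*m)" by (rule Sp_carrier_mat[OF blk_Sp[OF g]])
  have step: "\<exists>u\<in>Upos m. rt m i ?q t * (h * g) = u * g" if "h \<in> Upos m" "i < ?q" for h i t
    using that gc q Upos_carrier_mat[OF that(1)]
    by (intro bexI[OF _ Upos.rt[OF that(2) q(1) that(1)]])
      (simp add: assoc_square_mat[where n = "2*m"] rt_carrier_mat)
  have "\<exists>u\<in>Upos m. u * g \<in> blk m k \<and> (\<forall>i. k < i \<and> i \<le> k + d \<and> i < ?q \<longrightarrow> (u * g) $$ (i, ?q) = 0) \<and>
      (\<forall>l<2*m. (u * g) $$ (?q, l) = g $$ (?q, l))" for d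
  proof (induction d)
    case 0
    show ?case using g gc by (intro bexI[OF _ Upos.one]) auto
  next
    case (Suc d)
    then obtain u where u: "u \<in> Upos m" "u * g \<in> blk m k"
      "\<And>i. k < i \<Longrightarrow> i \<le> k + d \<Longrightarrow> i < ?q \<Longrightarrow> (u * g) $$ (i, ?q) = 0"
      "\<And>l. l < 2*m \<Longrightarrow> (u * g) $$ (?q, l) = g $$ (?q, l)" by blast
    let ?i = "Suc (k + d)"
    show ?case
    proof (cases "?i < ?q")
      case False
      then show ?thesis using u by (intro bexI[OF _ u(1)]) (auto simp: le_Suc_eq)
    next
      case True
      define t where "t = - ((u * g) $$ (?i, ?q) / g $$ (?q, ?q))"
      obtain v where v: "v \<in> Upos m" "rt m ?i ?q t * (u * g) = v * g" using step[OF u(1) True] by blast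
      have i: "?i < 2*m" using True q by simp
      have ugc: "u * g \<in> carrier_mat (2*m) (2*m)" using gc Upos_carrier_mat[OF u(1)] by (rule mult_square_mat[rotated])
      have ent: "(v * g) $$ (a, l) = (u * g) $$ (a, l) + (if a = ?i then t * (u * g) $$ (?q, l) else 0) +
         (if a = k then - (sg m ?i * sg m ?q * t) * (u * g) $$ (cj m ?i, l) else 0)" if "a < 2*m" "l < 2*m" for a l
        unfolding v(2)[symmetric] rt_mult_entry[OF ugc i q(1) that] using q by simp
      have "v * g \<in> blk m k"
        unfolding v(2)[symmetric] using True q by (intro blk_rt u) auto
      moreover have "(v * g) $$ (a, ?q) = 0" if "k < a" "a \<le> k + Suc d" "a < ?q" for a
      proof -
        have "a < 2*m" using that q by simp
        show ?thesis
          unfolding ent[OF \<open>a < 2*m\<close> q(1)] using that u(3)[of a] u(4)[OF q(1)] piv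
          by (cases "a = ?i") (auto simp: t_def)
      qed
      moreover have "(v * g) $$ (?q, l) = g $$ (?q, l)" if "l < 2*m" for l
        unfolding ent[OF q(1) that] using True q u(4)[OF that] by auto
      ultimately show ?thesis using v(1) by blast
    qed
  qed
  from this[of "2*m"] q(1) obtain u where u: "u \<in> Upos m" "u * g \<in> blk m k"
      "\<And>i. k < i \<Longrightarrow> i < ?q \<Longrightarrow> (u * g) $$ (i, ?q) = 0"
      "\<And>l. l < 2*m \<Longrightarrow> (u * g) $$ (?q, l) = g $$ (?q, l)" by fastforce
  \<comment> \<open>The root is now long, so row \<open>k\<close> is the only one that changes and
    the zeros obtained so far survive.\<close>
  define t where "t = - ((u * g) $$ (k, ?q) / g $$ (?q, ?q))"
  obtain v where v: "v \<in> Upos m" "rt m k ?q t * (u * g) = v * g" using step[OF u(1) q(3)] by blast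
  have ugc: "u * g \<in> carrier_mat (2*m) (2*m)" using gc Upos_carrier_mat[OF u(1)] by (rule mult_square_mat[rotated])
  have ent: "(v * g) $$ (a, l) = (u * g) $$ (a, l) + (if a = k then t * (u * g) $$ (?q, l) else 0)"
    if "a < 2*m" "l < 2*m" for a l
    unfolding v(2)[symmetric] rt_mult_entry[OF ugc q(5) q(1) that] using q by simp
  have vb: "v * g \<in> blk m k"
    unfolding v(2)[symmetric] using q by (intro blk_rt u) auto
  moreover have "(v * g) $$ (a, ?q) = 0" if a: "a < 2*m" "a \<noteq> ?q" for a
  proof -
    consider "a < k \<or> 2*m - k \<le> a" | "a = k" | "k < a" "a < 2*m - k" by linarith
    then show ?thesis
    proof cases
      case 1
      then show ?thesis using blk_entry[OF vb a(1) q(1)] a by auto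
    next
      case 2
      then show ?thesis unfolding ent[OF a(1) q(1)] using u(4)[OF q(1)] piv by (auto simp: t_def)
    next
      case 3
      then have "a < ?q" using a(2) by (auto simp: cj_def)
      then show ?thesis unfolding ent[OF a(1) q(1)] using 3 u(3) by auto
    qed
  qed
  moreover have "(v * g) $$ (?q, l) = g $$ (?q, l)" if "l < 2*m" for l
    unfolding ent[OF q(1) that] using q u(4)[OF that] by auto
  ultimately show ?thesis using v(1) by blast
qed

text \<open>Column \<open>q\<close> is \<open>d\<close> times a coordinate vector, so pairing it
  with column \<open>l\<close> reads off the entry of column \<open>l\<close> in row
  \<open>cj m q\<close>.\<close>

lemma Sp_dual_row:
  fixes g :: "'a::field mat"
  assumes g: "g \<in> carrier (Sp m)" and q: "q < 2*m" and l: "l < 2*m" and d: "d \<noteq> 0"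
    and col: "\<And>i. i < 2*m \<Longrightarrow> g $$ (i, q) = (if i = q then d else 0)"
  shows "g $$ (cj m q, l) = (if l = cj m q then inverse d else 0)"
proof -
  have "bform m (\<lambda>a. g $$ (a, q)) (\<lambda>a. g $$ (a, l)) = bform m (\<lambda>a. if a = q then d else 0) (\<lambda>a. g $$ (a, l))"
    by (rule bform_cong) (auto simp: col)
  also have "\<dots> = sg m q * d * g $$ (cj m q, l)"
    by (rule bform_single_left[OF q])
  also have "bform m (\<lambda>a. g $$ (a, q)) (\<lambda>a. g $$ (a, l)) = (if q = cj m l then sg m q else 0)"
    using g q l unfolding Sp_iff by blast
  finally have e: "sg m q * (d * g $$ (cj m q, l)) = sg m q * (if q = cj m l then 1 else 0)" by (auto simp: mult.assoc)
  have "d * g $$ (cj m q, l) = sg m q * (sg m q * (d * g $$ (cj m q, l)))" by simp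
  also have "\<dots> = (if q = cj m l then 1 else 0)" unfolding e by simp
  finally have "d * g $$ (cj m q, l) = (if l = cj m q then 1 else 0)"
    using eq_cj_iff[OF l q] by auto
  then show ?thesis using d by (auto simp: field_simps split: if_splits)
qed

text \<open>Once the column and the row of the pivot are cleared, \<open>Sp_dual_row\<close> for the
  matrix and for its transpose makes the row and the column of index \<open>k\<close> trivial too,
  so the whole pair splits off.\<close>

lemma blk_decomposition:
  fixes g :: "'a::field mat"
  assumes g: "g \<in> blk m k" and k: "k < m" and piv: "g $$ (cj m k, cj m k) \<noteq> 0"
  shows "\<exists>u\<in>Upos m. \<exists>h\<in>blk m (Suc k). \<exists>b\<in>borel_neg m. g = u * h * b"
proof -
  let ?q = "cj m k"
  define d where "d = g $$ (?q, ?q)"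
  have d: "d \<noteq> 0" using piv by (simp add: d_def)
  have q: "?q < 2*m" "k < 2*m" using k by (auto simp: cj_def)
  note as = assoc_square_mat[where n = "2*m"]
  have gc: "g \<in> carrier_mat (2*m) (2*m)" by (rule Sp_carrier_mat[OF blk_Sp[OF g]])
  obtain u where u: "u \<in> Upos m" "u * g \<in> blk m k"
    "\<And>i. i < 2*m \<Longrightarrow> i \<noteq> ?q \<Longrightarrow> (u * g) $$ (i, ?q) = 0"
    "\<And>l. l < 2*m \<Longrightarrow> (u * g) $$ (?q, l) = g $$ (?q, l)"
    using column_elimination[OF g k piv] by blast
  define g1 where "g1 = u * g"
  have g1c: "g1 \<in> carrier_mat (2*m) (2*m)" using u(2) unfolding g1_def by (intro Sp_carrier_mat blk_Sp)
  have c1: "g1 $$ (i, ?q) = (if i = ?q then d else 0)" if "i < 2*m" for i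
    using u(3)[OF that] u(4)[OF q(1)] by (auto simp: g1_def d_def simp del: index_mult_mat)
  \<comment> \<open>The pivot row is cleared as the pivot column of the transpose; the row
    operations \<open>w\<close> return as a factor from the negative Borel subgroup on the
    right.\<close>
  have t1: "g1\<^sup>T \<in> blk m k" unfolding g1_def by (rule blk_transpose[OF u(2)])
  have piv1: "g1\<^sup>T $$ (?q, ?q) \<noteq> 0" using c1[OF q(1)] d g1c q(1) by simp
  obtain w where w: "w \<in> Upos m" "w * g1\<^sup>T \<in> blk m k"
    "\<And>i. i < 2*m \<Longrightarrow> i \<noteq> ?q \<Longrightarrow> (w * g1\<^sup>T) $$ (i, ?q) = 0"
    "\<And>l. l < 2*m \<Longrightarrow> (w * g1\<^sup>T) $$ (?q, l) = g1\<^sup>T $$ (?q, l)"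
    using column_elimination[OF t1 k piv1] by blast
  define h where "h = w * g1\<^sup>T"
  have hS: "h \<in> carrier (Sp m)" using w(2) unfolding h_def by (rule blk_Sp)
  have hc: "h \<in> carrier_mat (2*m) (2*m)" by (rule Sp_carrier_mat[OF hS])
  have row: "h $$ (?q, l) = (if l = ?q then d else 0)" if "l < 2*m" for l
    using w(4)[OF that] c1[OF that] g1c q that by (simp add: h_def del: index_mult_mat(1))
  have col: "h $$ (i, ?q) = (if i = ?q then d else 0)" if "i < 2*m" for i
    using w(3)[OF that] row[OF q(1)] by (auto simp: h_def simp del: index_mult_mat)
  have rowk: "h $$ (k, l) = (if l = k then inverse d else 0)" if "l < 2*m" for l
    using Sp_dual_row[OF hS q(1) that d col] q by simp
  have colk: "h $$ (i, k) = (if i = k then inverse d else 0)" if "i < 2*m" for i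
    using Sp_dual_row[OF Sp_transpose[OF hS] q(1) that d] row q that hc by simp
  \<comment> \<open>The diagonal entries at \<open>k\<close> and \<open>cj m k\<close> are
    \<open>inverse d\<close> and \<open>d\<close>, so one torus element turns both into 1.\<close>
  define h' where "h' = tor m k d * h"
  have h'S: "h' \<in> carrier (Sp m)" unfolding h'_def by (rule tor_mult_Sp[OF hS q(2) d])
  have "h' $$ (i, j) = (if i = j then 1 else 0)"
    if ij: "i < 2*m" "j < 2*m" and out: "i < Suc k \<or> 2*m - Suc k \<le> i \<or> j < Suc k \<or> 2*m - Suc k \<le> j" for i j
  proof -
    have e: "h' $$ (i, j) = (if i = k then d else if i = ?q then inverse d else 1) * h $$ (i, j)"
      unfolding h'_def by (rule tor_mult_entry[OF hc ij])
    have "i = k \<or> i = ?q \<or> j = k \<or> j = ?q \<or> i < k \<or> 2*m - k \<le> i \<or> j < k \<or> 2*m - k \<le> j"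
      using out by (auto simp: cj_def)
    moreover have "h \<in> blk m k" using w(2) by (simp add: h_def)
    ultimately show ?thesis
      unfolding e using rowk[OF ij(2)] row[OF ij(2)] colk[OF ij(1)] col[OF ij(1)] d q
        blk_entry[of h m k i j] ij by (auto split: if_splits)
  qed
  then have h'b: "h' \<in> blk m (Suc k)" using h'S unfolding blk_def by blast
  have h'c: "h' \<in> carrier_mat (2*m) (2*m)" by (rule Sp_carrier_mat[OF h'S])
  obtain u' where u': "u' \<in> Upos m" "u' * u = 1\<^sub>m (2*m)" using Upos_left_inverse[OF u(1)] by blast
  obtain w' where w': "w' \<in> Upos m" "w' * w = 1\<^sub>m (2*m)" using Upos_left_inverse[OF w(1)] by blast
  note cm = Upos_carrier_mat[OF u(1)] Upos_carrier_mat[OF u'(1)] Upos_carrier_mat[OF w(1)] Upos_carrier_mat[OF w'(1)]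
  have hh': "h = tor m k (inverse d) * h'"
  proof (rule eq_matI)
    fix i j assume "i < dim_row (tor m k (inverse d) * h')" "j < dim_col (tor m k (inverse d) * h')"
    then have ij: "i < 2*m" "j < 2*m" using h'c by (auto simp: tor_dim)
    show "h $$ (i, j) = (tor m k (inverse d) * h') $$ (i, j)"
      unfolding tor_mult_entry[OF h'c ij] unfolding h'_def tor_mult_entry[OF hc ij] using d by simp
  qed (use hc h'c in \<open>auto simp: tor_dim\<close>)
  have "g1\<^sup>T = w' * h"
  proof -
    have "w' * h = w' * w * g1\<^sup>T" unfolding h_def using cm g1c by (simp add: as)
    then show ?thesis using w' g1c by simp
  qed
  then have "g1\<^sup>T = w' * (tor m k (inverse d) * h')" using hh' by simp
  then have "g1 = (w' * (tor m k (inverse d) * h'))\<^sup>T" by (metis Matrix.transpose_transpose)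
  also have "\<dots> = h'\<^sup>T * (tor m k (inverse d))\<^sup>T * w'\<^sup>T"
    using transpose_mult[OF cm(4) mult_square_mat[OF tor_carrier_mat[of m k "inverse d"] h'c]]
      transpose_mult[OF tor_carrier_mat h'c] by simp
  also have "(tor m k (inverse d))\<^sup>T = tor m k (inverse d)" by (rule eq_matI) (auto simp: tor_def)
  also have "h'\<^sup>T * tor m k (inverse d) * w'\<^sup>T = h'\<^sup>T * (tor m k (inverse d) * w'\<^sup>T)"
    using h'c cm by (simp add: as)
  finally have g1: "g1 = h'\<^sup>T * (tor m k (inverse d) * w'\<^sup>T)" .
  have b: "tor m k (inverse d) * w'\<^sup>T \<in> borel_neg m"
    using tor_borel[OF q(2), of "inverse d"] d by (intro borel_neg_mult Upos_transpose_borel w') auto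
  have "g = u' * u * g" using u' gc by simp
  also have "\<dots> = u' * g1" unfolding g1_def using cm gc by (simp add: as)
  also have "\<dots> = u' * h'\<^sup>T * (tor m k (inverse d) * w'\<^sup>T)"
    unfolding g1 using cm h'c borel_neg_carrier_mat[OF b] by (simp add: as)
  finally show ?thesis using u'(1) blk_transpose[OF h'b] b by blast
qed

text \<open>With a nonzero pivot the decomposition applies and its outer factors are absorbed.
  Otherwise \<open>g\<close> is moved along a root curve on which the pivot is nonzero for every
  nonzero parameter; a polynomial in the parameter that vanishes away from 0 vanishes at 0 as
  well.\<close>

lemma cell_vanishing_step:
  fixes P :: "'a::alg_closed_field mat \<Rightarrow> 'a"
  assumes P: "P \<in> poly_funs (2*m)" and k: "k < m"
    and van: "\<And>u h b. u \<in> Upos m \<Longrightarrow> h \<in> blk m (Suc k) \<Longrightarrow> b \<in> borel_neg m \<Longrightarrow> P (u * h * b) = 0"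
    and u: "u \<in> Upos m" and g: "g \<in> blk m k" and b: "b \<in> borel_neg m"
  shows "P (u * g * b) = 0"
proof -
  note as = assoc_square_mat[where n = "2*m"]
  let ?q = "cj m k"
  have q: "?q < 2*m" "k < 2*m" "k \<le> ?q" "?q < 2*m - k" using k by (auto simp: cj_def)
  have piv: "P (u * g * b) = 0" if g: "g \<in> blk m k" and nz: "g $$ (?q, ?q) \<noteq> 0" for g
  proof -
    obtain v h c where v: "v \<in> Upos m" "h \<in> blk m (Suc k)" "c \<in> borel_neg m" "g = v * h * c"
      using blk_decomposition[OF g k nz] by blast
    have "u * g * b = (u * v) * h * (c * b)"
      using Upos_carrier_mat[OF u] Upos_carrier_mat[OF v(1)] Sp_carrier_mat[OF blk_Sp[OF v(2)]]
        borel_neg_carrier_mat[OF v(3)] borel_neg_carrier_mat[OF b]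
      by (simp add: v(4) as mult_square_mat)
    then show ?thesis using van[OF Upos_mult[OF u v(1)] v(2) borel_neg_mult[OF v(3) b]] by simp
  qed
  show ?thesis
  proof (cases "g $$ (?q, ?q) = 0")
    case False
    then show ?thesis by (rule piv[OF g])
  next
    case True
    have gc: "g \<in> carrier_mat (2*m) (2*m)" by (rule Sp_carrier_mat[OF blk_Sp[OF g]])
    \<comment> \<open>If the pivot column were zero, it would pair to 0 with column
      \<open>k\<close>, whereas the group equation gives a sign.\<close>
    have "\<exists>i. k \<le> i \<and> i < ?q \<and> g $$ (i, ?q) \<noteq> 0"
    proof (rule ccontr)
      assume n: "\<not> ?thesis"
      have "g $$ (a, ?q) = 0" if "a < 2*m" for a
      proof -
        consider "a < k \<or> 2*m - k \<le> a" | "k \<le> a" "a < ?q" | "a = ?q" using that by (fastforce simp: cj_def)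
        then show ?thesis using n blk_entry[OF g that q(1)] q True by cases auto
      qed
      then have "bform m (\<lambda>a. g $$ (a, ?q)) (\<lambda>a. g $$ (a, k)) = 0"
        unfolding bform_def by (intro sum.neutral) simp
      moreover have "bform m (\<lambda>a. g $$ (a, ?q)) (\<lambda>a. g $$ (a, k)) = sg m ?q"
        using blk_Sp[OF g] q unfolding Sp_iff by simp
      ultimately show False by (simp add: sg_def split: if_splits)
    qed
    then obtain i where i: "k \<le> i" "i < ?q" "g $$ (i, ?q) \<noteq> 0" by blast
    have i': "i < 2*m" using i q by simp
    obtain Q where Q: "Q \<in> poly_funs (2*m)" "\<And>X. X \<in> carrier_mat (2*m) (2*m) \<Longrightarrow> P (u * X * b) = Q X"
      using poly_funs_translate[OF P Upos_carrier_mat[OF u] borel_neg_carrier_mat[OF b]] by blast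
    have "(\<lambda>s X. Q (rt m ?q i s * X)) \<in> fam UNIV (2*m)"
      by (rule poly_funs_poly_family[OF Q(1)]) (simp_all add: rt_entry_poly)
    then obtain p where p: "\<And>s. Q (rt m ?q i s * g) = poly p s" using fam_curve[OF _ gc] by blast
    have "poly p s = 0" if s: "s \<noteq> 0" for s
    proof -
      have "rt m ?q i s * g \<in> blk m k" using g i q by (intro blk_rt) auto
      moreover have "(rt m ?q i s * g) $$ (?q, ?q) \<noteq> 0"
        unfolding rt_mult_entry[OF gc q(1) i' q(1) q(1)] using True i s q i' by auto
      ultimately have "P (u * (rt m ?q i s * g) * b) = 0" by (rule piv)
      then show ?thesis using Q(2)[OF mult_square_mat[OF rt_carrier_mat gc]] p by metis
    qed
    then have "p = 0" by (rule poly_eq_0_if_nonzero_roots)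
    then have "Q (rt m ?q i 0 * g) = 0" using p by simp
    then show ?thesis using Q(2)[OF gc] gc by (simp add: rt_zero)
  qed
qed

text \<open>Vanishing is propagated through the products \<open>u * h * b\<close> with
  \<open>h\<close> in \<open>blk m k\<close>, from \<open>k = m\<close>, which is the big cell, to
  \<open>k = 0\<close>, which is the whole group.\<close>

theorem big_cell_dense:
  fixes P :: "'a::alg_closed_field mat \<Rightarrow> 'a"
  assumes P: "P \<in> poly_funs (2*m)"
    and van: "\<And>u b. u \<in> Upos m \<Longrightarrow> b \<in> borel_neg m \<Longrightarrow> P (u * b) = 0"
    and g: "g \<in> carrier (Sp m)"
  shows "P g = 0"
proof -
  have "k \<le> m \<Longrightarrow> \<forall>u\<in>Upos m. \<forall>h\<in>blk m k. \<forall>b\<in>borel_neg m. P (u * h * b) = 0" for k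
  proof (induction k rule: inc_induct)
    case base
    show ?case using van right_mult_one_mat[OF Upos_carrier_mat] unfolding blk_all by fastforce
  next
    case (step k)
    then show ?case using cell_vanishing_step[OF P, of k] by blast
  qed
  from this[of 0] have all: "\<forall>u\<in>Upos m. \<forall>h\<in>carrier (Sp m). \<forall>b\<in>borel_neg m. P (u * h * b) = 0"
    by (simp add: blk_0)
  have "1\<^sub>m (2*m) \<in> borel_neg m" using Upos_transpose_borel[OF Upos.one[of m]] by simp
  then have "P (1\<^sub>m (2*m) * g * 1\<^sub>m (2*m)) = 0"
    using all g Upos.one[of m] by blast
  then show ?thesis using Sp_carrier_mat[OF g] by simp
qed

section \<open>The induced module\<close>

definition hchar :: "nat \<Rightarrow> 'a::field mat \<Rightarrow> 'a" where
  "hchar r b = (\<Prod>i<r. b $$ (i, i))"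

abbreviation ind :: "nat \<Rightarrow> nat \<Rightarrow> ('a::field mat \<Rightarrow> 'a) set" where
  "ind m r \<equiv> induced_module m (fund_weight r)"

lemma weight_char_fund: "r \<le> m \<Longrightarrow> weight_char m (fund_weight r) b = hchar r b"
proof -
  assume r: "r \<le> m"
  have "(\<Prod>i<m. (b $$ (i, i)) powi fund_weight r i) = (\<Prod>i<r. (b $$ (i, i)) powi fund_weight r i)"
    using r by (intro prod.mono_neutral_right) (auto simp: fund_weight_def)
  also have "\<dots> = (\<Prod>i<r. b $$ (i, i))"
    by (intro prod.cong) (auto simp: fund_weight_def)
  finally show ?thesis by (simp add: weight_char_def hchar_def)
qed

lemma ind_outside: "f \<in> ind m r \<Longrightarrow> g \<notin> carrier (Sp m) \<Longrightarrow> f g = 0"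
  by (auto simp: induced_module_def regular_funs_def)

lemma ind_eqI:
  assumes "f \<in> ind m r" "h \<in> ind m r" "\<And>g. g \<in> carrier (Sp m) \<Longrightarrow> f g = h g"
  shows "f = h"
proof
  fix g show "f g = h g"
    using assms ind_outside[OF assms(1), of g] ind_outside[OF assms(2), of g] by (cases "g \<in> carrier (Sp m)") auto
qed

lemma ind_poly: "f \<in> ind m r \<Longrightarrow> \<exists>P\<in>poly_funs (2*m). \<forall>g\<in>carrier (Sp m). f g = P g"
  by (auto simp: induced_module_def regular_funs_def)

lemma ind_semi: "f \<in> ind m r \<Longrightarrow> r \<le> m \<Longrightarrow> g \<in> carrier (Sp m) \<Longrightarrow> b \<in> borel_neg m \<Longrightarrow> f (g * b) = inverse (hchar r b) * f g"
  by (simp add: induced_module_def weight_char_fund)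

lemma indI:
  assumes r: "r \<le> m" and P: "P \<in> poly_funs (2*m)" and out: "\<And>g. g \<notin> carrier (Sp m) \<Longrightarrow> f g = 0"
    and eq: "\<And>g. g \<in> carrier (Sp m) \<Longrightarrow> f g = P g"
    and semi: "\<And>g b. g \<in> carrier (Sp m) \<Longrightarrow> b \<in> borel_neg m \<Longrightarrow> f (g * b) = inverse (hchar r b) * f g"
  shows "f \<in> ind m r"
proof -
  have "f = (\<lambda>g. if g \<in> carrier (Sp m) then P g else 0)" using out eq by auto
  then have "f \<in> regular_funs m" using P unfolding regular_funs_def by blast
  then show ?thesis using semi by (simp add: induced_module_def weight_char_fund[OF r])
qed

text \<open>Translation without an inverse, hence a right action. It has the same stable subspaces
  as \<open>left_translation\<close>, and in the contragredient action the two inverses cancel to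
  leave exactly this map.\<close>

definition trl :: "nat \<Rightarrow> 'a::field mat \<Rightarrow> ('a mat \<Rightarrow> 'a) \<Rightarrow> 'a mat \<Rightarrow> 'a" where
  "trl m h f = (\<lambda>x. if x \<in> carrier (Sp m) then f (h * x) else 0)"

lemma left_translation_trl: "left_translation m g f = trl m (inv\<^bsub>Sp m\<^esub> g) f"
  by (simp add: left_translation_def trl_def)

lemma trl_apply: "x \<in> carrier (Sp m) \<Longrightarrow> trl m h f x = f (h * x)"
  by (simp add: trl_def)

lemma trl_ind:
  fixes h :: "'a::field mat"
  assumes f: "f \<in> ind m r" and r: "r \<le> m" and h: "h \<in> carrier (Sp m)"
  shows "trl m h f \<in> ind m r"
proof -
  obtain P where P: "P \<in> poly_funs (2*m)" "\<And>g. g \<in> carrier (Sp m) \<Longrightarrow> f g = P g"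
    using ind_poly[OF f] by blast
  obtain Q where Q: "Q \<in> poly_funs (2*m)" "\<And>g. g \<in> carrier_mat (2*m) (2*m) \<Longrightarrow> P (h * g * 1\<^sub>m (2*m)) = Q g"
    using poly_funs_translate[OF P(1) Sp_carrier_mat[OF h] one_carrier_mat] by blast
  show ?thesis
  proof (rule indI[OF r Q(1)])
    fix g :: "'a mat" assume g: "g \<in> carrier (Sp m)"
    have c: "h * g \<in> carrier_mat (2*m) (2*m)" by (rule Sp_carrier_mat[OF Sp_mult[OF h g]])
    show "trl m h f g = Q g"
      using P(2)[OF Sp_mult[OF h g]] Q(2)[OF Sp_carrier_mat[OF g]] right_mult_one_mat[OF c] by (simp add: trl_def g)
    fix b :: "'a mat" assume b: "b \<in> borel_neg m"
    show "trl m h f (g * b) = inverse (hchar r b) * trl m h f g"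
      using ind_semi[OF f r Sp_mult[OF h g] b] Sp_mult[OF g borel_neg_Sp[OF b]] g
      by (simp add: trl_def Sp_assoc[OF h g borel_neg_Sp[OF b]])
  qed (simp add: trl_def)
qed

lemma ind_add: 
  assumes f: "f \<in> ind m r" and h: "h \<in> ind m r" and r: "r \<le> m"
  shows "(\<lambda>g. f g + h g) \<in> ind m r"
proof -
  obtain P Q where "P \<in> poly_funs (2*m)" "\<And>g. g \<in> carrier (Sp m) \<Longrightarrow> f g = P g"
    "Q \<in> poly_funs (2*m)" "\<And>g. g \<in> carrier (Sp m) \<Longrightarrow> h g = Q g"
    using ind_poly[OF f] ind_poly[OF h] by blast
  then show ?thesis
    by (intro indI[OF r, of "\<lambda>g. P g + Q g"])
      (auto intro: poly_funs.intros simp: ind_outside[OF f] ind_outside[OF h] ind_semi[OF f r] ind_semi[OF h r] distrib_left)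
qed

lemma ind_cmult: 
  assumes f: "f \<in> ind m r" and r: "r \<le> m"
  shows "(\<lambda>g. c * f g) \<in> ind m r"
proof -
  obtain P where "P \<in> poly_funs (2*m)" "\<And>g. g \<in> carrier (Sp m) \<Longrightarrow> f g = P g"
    using ind_poly[OF f] by blast
  then show ?thesis
    by (intro indI[OF r, of "\<lambda>g. c * P g"])
      (auto intro: poly_funs.intros simp: ind_outside[OF f] ind_semi[OF f r])
qed

lemma ind_zero: "r \<le> m \<Longrightarrow> (\<lambda>g. 0) \<in> ind m r"
  by (rule indI[of _ _ "\<lambda>g. 0"]) (auto intro: poly_funs.intros)

lemma ind_diff: 
  assumes f: "f \<in> ind m r" and h: "h \<in> ind m r" and r: "r \<le> m"
  shows "(\<lambda>g. f g - h g) \<in> ind m r"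
  using ind_add[OF f ind_cmult[OF h r, of "- 1"] r] by simp

lemma ind_subspace: "r \<le> m \<Longrightarrow> fun_space.subspace (ind m r)"
  unfolding fun_space.subspace_def
  using ind_add ind_cmult ind_zero by (fastforce simp: plus_fun_def zero_fun_def fun_scale_def)

lemma ind_vanish:
  fixes f :: "'a::alg_closed_field mat \<Rightarrow> 'a"
  assumes f: "f \<in> ind m r" and van: "\<And>u b. u \<in> Upos m \<Longrightarrow> b \<in> borel_neg m \<Longrightarrow> f (u * b) = 0"
  shows "f g = 0"
proof (cases "g \<in> carrier (Sp m)")
  case True
  obtain P where P: "P \<in> poly_funs (2*m)" "\<And>g. g \<in> carrier (Sp m) \<Longrightarrow> f g = P g"
    using ind_poly[OF f] by blast
  have "P g = 0"
    by (rule big_cell_dense[OF P(1) _ True])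
      (use van P(2)[OF Sp_mult[OF Upos_Sp borel_neg_Sp]] in metis)
  then show ?thesis using P(2)[OF True] by simp
qed (rule ind_outside[OF f])

section \<open>Weights\<close>

text \<open>The one-parameter subgroups along which poles are measured: \<open>d = 1\<close> will
  bound single entries of a weight, \<open>d = m\<close> the number of nonzero entries.\<close>

definition tord :: "nat \<Rightarrow> nat \<Rightarrow> 'a::field \<Rightarrow> 'a mat" where
  "tord m d s = mat (2*m) (2*m) (\<lambda>(k, l). if k = l then (if k < d then s else if 2*m - d \<le> k then inverse s else 1) else 0)"

definition dmat :: "nat \<Rightarrow> (nat \<Rightarrow> 'a::field) \<Rightarrow> 'a mat" where
  "dmat n c = mat n n (\<lambda>(k, l). if k = l then c k else 0)"

lemma dmat_carrier [simp]: "dmat n c \<in> carrier_mat n n"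
  by (simp add: dmat_def)

lemma dmat_mult_entry: "A \<in> carrier_mat n n \<Longrightarrow> k < n \<Longrightarrow> l < n \<Longrightarrow> (dmat n c * A) $$ (k, l) = c k * A $$ (k, l)"
proof -
  assume A: "A \<in> carrier_mat n n" and kl: "k < n" "l < n"
  have "(dmat n c * A) $$ (k, l) = (\<Sum>a<n. if a = k then c k * A $$ (k, l) else 0)"
    unfolding mult_entry[OF dmat_carrier A kl] using kl by (intro sum.cong) (auto simp: dmat_def)
  then show ?thesis using kl by simp
qed

lemma mult_dmat_entry: "A \<in> carrier_mat n n \<Longrightarrow> k < n \<Longrightarrow> l < n \<Longrightarrow> (A * dmat n c) $$ (k, l) = A $$ (k, l) * c l"
proof -
  assume A: "A \<in> carrier_mat n n" and kl: "k < n" "l < n"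
  have "(A * dmat n c) $$ (k, l) = (\<Sum>a<n. if a = l then A $$ (k, l) * c l else 0)"
    unfolding mult_entry[OF A dmat_carrier kl] using kl by (intro sum.cong) (auto simp: dmat_def)
  then show ?thesis using kl by simp
qed

lemma dmat_mult: "dmat n c * dmat n d = dmat n (\<lambda>k. c k * d k)"
proof (rule eq_matI)
  fix i j assume "i < dim_row (dmat n (\<lambda>k. c k * d k))" "j < dim_col (dmat n (\<lambda>k. c k * d k))"
  then have ij: "i < n" "j < n" by (auto simp: dmat_def)
  show "(dmat n c * dmat n d) $$ (i, j) = dmat n (\<lambda>k. c k * d k) $$ (i, j)"
    unfolding dmat_mult_entry[OF dmat_carrier ij] using ij by (simp add: dmat_def)
qed (auto simp: dmat_def)

lemma dmat_cong: "(\<And>k. k < n \<Longrightarrow> c k = d k) \<Longrightarrow> dmat n c = dmat n d"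
  by (auto simp: dmat_def)

lemma dmat_one: "dmat n (\<lambda>_. 1) = 1\<^sub>m n"
  by (auto simp: dmat_def one_mat_def)

definition dc :: "nat \<Rightarrow> nat \<Rightarrow> 'a::field \<Rightarrow> nat \<Rightarrow> 'a" where
  "dc m i s k = (if k = i then s else if k = cj m i then inverse s else 1)"

definition dd :: "nat \<Rightarrow> nat \<Rightarrow> 'a::field \<Rightarrow> nat \<Rightarrow> 'a" where
  "dd m d s k = (if k < d then s else if 2*m - d \<le> k then inverse s else 1)"

lemma tor_dmat: "tor m i s = dmat (2*m) (dc m i s)"
  by (auto simp: tor_def dmat_def dc_def)

lemma tord_dmat: "tord m d s = dmat (2*m) (dd m d s)"
  by (auto simp: tord_def dmat_def dd_def)

lemma tord_carrier [simp]: "tord m d s \<in> carrier_mat (2*m) (2*m)"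
  by (simp add: tord_dmat)

lemma dc_cj: "i < 2*m \<Longrightarrow> k < 2*m \<Longrightarrow> dc m i s (cj m k) = inverse (dc m i s k)"
proof -
  assume a: "i < 2*m" "k < 2*m"
  have "cj m k = i \<longleftrightarrow> k = cj m i" using eq_cj_iff[OF a(2,1)] .
  moreover have "cj m k = cj m i \<longleftrightarrow> k = i" using a by simp
  ultimately show ?thesis using a by (auto simp: dc_def)
qed

lemma dc_nonzero: "s \<noteq> 0 \<Longrightarrow> dc m i s k \<noteq> 0"
  by (auto simp: dc_def)

lemma tor_tor_commute: "tor m i s * tor m j t = tor m j t * tor m i s"
  by (simp add: tor_dmat dmat_mult mult.commute)

lemma tor_tor_same: "i < 2*m \<Longrightarrow> tor m i s * tor m i t = tor m i (s * t)"
  by (auto simp: tor_dmat dmat_mult dc_def intro!: dmat_cong)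

lemma tor_one: "tor m i 1 = 1\<^sub>m (2*m)"
  unfolding tor_dmat dmat_one[symmetric] by (rule dmat_cong) (simp add: dc_def)

lemma tor_cj: "i < 2*m \<Longrightarrow> tor m (cj m i) s = tor m i (inverse s)"
  unfolding tor_dmat by (rule dmat_cong) (simp add: dc_def)

lemma tord_0: "tord m 0 s = 1\<^sub>m (2*m)"
  unfolding tord_dmat dmat_one[symmetric] by (rule dmat_cong) (simp add: dd_def)

lemma tord_Suc: "d < m \<Longrightarrow> tord m (Suc d) s = tor m d s * tord m d s"
  unfolding tord_dmat tor_dmat dmat_mult by (rule dmat_cong) (auto simp: dd_def dc_def cj_def)

lemma tord_Sp: "d \<le> m \<Longrightarrow> s \<noteq> 0 \<Longrightarrow> tord m d s \<in> carrier (Sp m)"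
  by (induction d) (auto simp: tord_0 Sp_one tord_Suc intro: tor_mult_Sp)

lemma tord_inverse: "d \<le> m \<Longrightarrow> s \<noteq> 0 \<Longrightarrow> tord m d (inverse s) * tord m d s = 1\<^sub>m (2*m)"
  unfolding tord_dmat dmat_mult dmat_one[symmetric] by (rule dmat_cong) (auto simp: dd_def)

lemma power_sum_coeffs_eq:
  fixes a b :: "nat \<Rightarrow> 'a::alg_closed_field"
  assumes "\<And>s. s \<noteq> 0 \<Longrightarrow> (\<Sum>k\<le>M. s ^ k * a k) = (\<Sum>k\<le>M. s ^ k * b k)" and "k \<le> M"
  shows "a k = b k"
proof -
  have "(\<Sum>k\<le>M. monom (a k) k) = (\<Sum>k\<le>M. monom (b k) k)"
    by (rule poly_eqI_nonzero) (use assms(1) in \<open>simp add: poly_sum poly_monom mult.commute\<close>)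
  then have "coeff (\<Sum>k\<le>M. monom (a k) k) k = coeff (\<Sum>k\<le>M. monom (b k) k) k" by simp
  then show ?thesis using assms(2) by (simp add: coeff_sum)
qed

lemma power_sum_poly: "(\<Sum>k\<le>M. s ^ k * a k) = poly (\<Sum>k\<le>M. monom (a k) k) s" for M :: nat and s :: "'a::field"
  by (simp add: poly_sum poly_monom mult.commute)

lemma hchar_tord: "b \<in> carrier_mat (2*m) (2*m) \<Longrightarrow> d \<le> m \<Longrightarrow> r \<le> m \<Longrightarrow> hchar r (tord m d s * b) = s ^ min d r * hchar r b"
proof -
  assume b: "b \<in> carrier_mat (2*m) (2*m)" and d: "d \<le> m" and r: "r \<le> m"
  have "hchar r (tord m d s * b) = (\<Prod>i<r. dd m d s i * b $$ (i, i))"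
    unfolding hchar_def tord_dmat using r by (intro prod.cong refl dmat_mult_entry b) auto
  also have "\<dots> = (\<Prod>i<r. dd m d s i) * hchar r b" by (simp add: hchar_def prod.distrib)
  also have "(\<Prod>i<r. dd m d s i) = (\<Prod>i\<in>{..<min d r}. s)"
    using d r by (intro prod.mono_neutral_cong_right) (auto simp: dd_def)
  finally show ?thesis by simp
qed

text \<open>With \<open>T = tord m d s\<close>, a point \<open>u * b\<close> of the big cell is
  moved to \<open>(T * u * inverse T) * (T * b)\<close>. The first factor depends polynomially on
  \<open>s\<close>, and the second contributes the power \<open>- min d r\<close> of
  \<open>s\<close> by semi-invariance. So the coefficients of a worse pole vanish on the big cell,
  hence everywhere.\<close>

lemma tord_pole:
  fixes f :: "'a::alg_closed_field mat \<Rightarrow> 'a"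
  assumes f: "f \<in> ind m r" and r: "r \<le> m" and d: "d \<le> m" and g: "g \<in> carrier (Sp m)"
  shows "\<exists>p. \<forall>s. s \<noteq> 0 \<longrightarrow> s ^ min d r * f (tord m d s * g) = poly p s"
proof -
  let ?e = "min d r"
  obtain P where P: "P \<in> poly_funs (2*m)" "\<And>g. g \<in> carrier (Sp m) \<Longrightarrow> f g = P g"
    using ind_poly[OF f] by blast
  have ent: "\<exists>p. \<forall>s\<in>- {0}. poly [:0, 1:] s * tord m d s $$ (i, j) = poly p s" if "i < 2*m" "j < 2*m" for i j
    by (intro exI[of _ "if i = j then (if i < d then [:0, 0, 1:] else if 2*m - d \<le> i then 1 else [:0, 1:]) else 0"])
      (use that in \<open>auto simp: tord_def power2_eq_square\<close>)
  obtain N where "(\<lambda>s g. poly [:0, 1:] s ^ N * P (tord m d s * g)) \<in> fam (- {0}) (2*m)"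
    using poly_funs_family[OF P(1), of "- {0}" "tord m d" "[:0, 1:]"] ent by auto
  then obtain M Q where Q: "\<And>k. Q k \<in> poly_funs (2*m)"
    and Q': "\<forall>s\<in>- {0}. \<forall>g\<in>carrier_mat (2*m) (2*m).
      poly [:0, 1:] s ^ N * P (tord m d s * g) = (\<Sum>k\<le>M::nat. s ^ k * Q k g)"
    unfolding fam_def by blast
  have fQ: "s ^ N * f (tord m d s * g) = (\<Sum>k\<le>M::nat. s ^ k * Q k g)" if "s \<noteq> 0" "g \<in> carrier (Sp m)" for s g
    using Q'[rule_format, OF _ Sp_carrier_mat[OF that(2)], of s] that(1) P(2)[OF Sp_mult[OF tord_Sp[OF d that(1)] that(2)]] by simp
  show ?thesis
  proof (cases "N \<le> ?e")
    case True
    show ?thesis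
    proof (intro exI allI impI)
      fix s :: 'a assume s: "s \<noteq> 0"
      have "s ^ ?e = s ^ (?e - N) * s ^ N" using True by (simp add: power_add[symmetric])
      then have "s ^ ?e * f (tord m d s * g) = s ^ (?e - N) * (\<Sum>k\<le>M. s ^ k * Q k g)"
        unfolding fQ[OF s g, symmetric] by (simp only: mult.assoc)
      then show "s ^ ?e * f (tord m d s * g) = poly (monom 1 (?e - N) * (\<Sum>k\<le>M. monom (Q k g) k)) s"
        by (simp add: power_sum_poly poly_monom)
    qed
  next
    case False
    then have "N - ?e + ?e = N" by (intro le_add_diff_inverse2) linarith
    then have Ne: "s ^ (N - ?e) * s ^ ?e = s ^ N" for s :: 'a by (metis power_add)
    \<comment> \<open>The coefficients below \<open>N - ?e\<close> are the ones that would make the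
      pole too large.\<close>
    have cell: "Q k (u * b) = 0" if u: "u \<in> Upos m" and b: "b \<in> borel_neg m" and k: "k < N - ?e" "k \<le> M" for u b k
    proof -
      define cu where "cu s = tord m d s * u * tord m d (inverse s)" for s :: 'a
      have uc: "u \<in> carrier_mat (2*m) (2*m)" and bc: "b \<in> carrier_mat (2*m) (2*m)"
        by (rule Upos_carrier_mat[OF u], rule borel_neg_carrier_mat[OF b])
      have cuS: "cu s \<in> carrier (Sp m)" if "s \<noteq> 0" for s
        unfolding cu_def using that u d by (intro Sp_mult tord_Sp Upos_Sp) auto
      have cu_entry: "cu s $$ (i, j) = dd m d s i * u $$ (i, j) * dd m d (inverse s) j" if "i < 2*m" "j < 2*m" for s i j
        unfolding cu_def tord_dmat using that uc
        by (simp add: mult_dmat_entry[OF mult_square_mat[OF dmat_carrier uc]] dmat_mult_entry del: index_mult_mat)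
      have "\<exists>p. \<forall>s\<in>- {0}. P (cu s) = poly p s"
      proof (rule poly_funs_curve[OF P(1)])
        show "cu s \<in> carrier_mat (2*m) (2*m)" for s unfolding cu_def by (intro mult_square_mat uc) auto
        show "\<exists>p. \<forall>s\<in>- {0}. cu s $$ (i, j) = poly p s" if ij: "i < 2*m" "j < 2*m" for i j
        proof (cases "i \<le> j")
          case True
          \<comment> \<open>Along the diagonal the exponents of \<open>s\<close> in
            \<open>tord m d s\<close> decrease from 1 over 0 to -1. Conjugation scales the entry
            \<open>(i, j)\<close> by the difference of two of them, which is not negative on and
            above the diagonal.\<close>
          have "\<exists>e::nat. \<forall>s\<in>- {0::'a}. dd m d s i * dd m d (inverse s) j = s ^ e"
          proof -
            consider "i < d" "j < d" | "i < d" "\<not> j < d" "2*m - d \<le> j" | "i < d" "\<not> j < d" "\<not> 2*m - d \<le> j"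
              | "\<not> i < d" "2*m - d \<le> i" "2*m - d \<le> j" | "\<not> i < d" "\<not> 2*m - d \<le> i" "2*m - d \<le> j"
              | "\<not> i < d" "\<not> 2*m - d \<le> i" "\<not> 2*m - d \<le> j"
              using True d by linarith
            then show ?thesis
            proof cases
              case 1 then show ?thesis by (intro exI[of _ 0]) (auto simp: dd_def)
            next
              case 2 then show ?thesis by (intro exI[of _ 2]) (auto simp: dd_def power2_eq_square)
            next
              case 3 then show ?thesis by (intro exI[of _ 1]) (auto simp: dd_def)
            next
              case 4 then show ?thesis using True d by (intro exI[of _ 0]) (auto simp: dd_def)
            next
              case 5 then show ?thesis using True d by (intro exI[of _ 1]) (auto simp: dd_def)
            next
              case 6 then show ?thesis using True d by (intro exI[of _ 0]) (auto simp: dd_def)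
            qed
          qed
          then obtain e :: nat where e: "\<And>s::'a. s \<noteq> 0 \<Longrightarrow> dd m d s i * dd m d (inverse s) j = s ^ e" by auto
          show ?thesis
          proof (intro exI[of _ "monom (u $$ (i, j)) e"] ballI)
            fix s :: 'a assume "s \<in> - {0}"
            then have "dd m d s i * u $$ (i, j) * dd m d (inverse s) j = u $$ (i, j) * s ^ e"
              using e[of s] by (metis ComplD insertI1 mult.assoc mult.commute)
            then show "cu s $$ (i, j) = poly (monom (u $$ (i, j)) e) s"
              by (simp add: cu_entry[OF ij] poly_monom)
          qed
        next
          case False
          then have "u $$ (i, j) = 0" using Upos_upper[OF u, of j i] ij by simp
          then show ?thesis by (intro exI[of _ 0]) (simp add: cu_entry[OF ij])
        qed
      qed
      then obtain c where c: "\<And>s. s \<noteq> 0 \<Longrightarrow> P (cu s) = poly c s" by auto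
      have eq: "(\<Sum>k\<le>M. s ^ k * Q k (u * b)) = poly (monom (inverse (hchar r b)) (N - ?e) * c) s" if s: "s \<noteq> 0" for s
      proof -
        have tb: "tord m d s * b \<in> borel_neg m"
        proof -
          have "tord m d s \<in> borel_neg m"
            using tord_Sp[OF d s] by (auto simp: borel_neg_def tord_def)
          then show ?thesis using b by (rule borel_neg_mult)
        qed
        have "tord m d s * (u * b) = cu s * (tord m d s * b)"
        proof -
          have "cu s * (tord m d s * b) = tord m d s * u * (tord m d (inverse s) * tord m d s) * b"
            unfolding cu_def using uc bc by (simp add: assoc_square_mat[where n = "2*m"] mult_square_mat)
          also have "\<dots> = tord m d s * (u * b)"
            unfolding tord_inverse[OF d s] using uc bc
            by (simp add: assoc_square_mat[where n = "2*m"] mult_square_mat)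
          finally show ?thesis ..
        qed
        then have "f (tord m d s * (u * b)) = inverse (s ^ ?e * hchar r b) * poly c s"
          using ind_semi[OF f r cuS[OF s] tb] hchar_tord[OF bc d r, of s] P(2)[OF cuS[OF s]] c[OF s] by simp
        then have "s ^ N * f (tord m d s * (u * b)) = s ^ (N - ?e) * inverse (hchar r b) * poly c s"
          unfolding Ne[symmetric] using s by simp
        then show ?thesis
          using fQ[OF s Sp_mult[OF Upos_Sp[OF u] borel_neg_Sp[OF b]]] by (simp add: poly_monom mult_ac)
      qed
      have "(\<Sum>k\<le>M. monom (Q k (u * b)) k) = monom (inverse (hchar r b)) (N - ?e) * c"
        by (rule poly_eqI_nonzero) (use eq in \<open>simp add: power_sum_poly\<close>)
      then have "coeff (\<Sum>k\<le>M. monom (Q k (u * b)) k) k = coeff (monom (inverse (hchar r b)) (N - ?e) * c) k" by simp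
      then show ?thesis using k by (simp add: coeff_sum coeff_monom_mult)
    qed
    have van: "Q k g = 0" if "k < N - ?e" "k \<le> M" for k
      by (rule big_cell_dense[OF Q cell g]) (use that in auto)
    show ?thesis
    proof (intro exI allI impI)
      fix s :: 'a assume s: "s \<noteq> 0"
      have "s ^ (N - ?e) * (s ^ ?e * f (tord m d s * g)) = s ^ N * f (tord m d s * g)"
        by (simp only: Ne mult.assoc[symmetric])
      also have "\<dots> = (\<Sum>k\<le>M. s ^ k * Q k g)" by (rule fQ[OF s g])
      also have "\<dots> = (\<Sum>k\<le>M. s ^ (N - ?e) * (s ^ (k - (N - ?e)) * Q k g))"
      proof (intro sum.cong refl)
        fix k assume "k \<in> {..M}"
        then show "s ^ k * Q k g = s ^ (N - ?e) * (s ^ (k - (N - ?e)) * Q k g)"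
          using van[of k] by (cases "k < N - ?e") (simp_all add: mult.assoc[symmetric] power_add[symmetric])
      qed
      finally have "s ^ ?e * f (tord m d s * g) = (\<Sum>k\<le>M. s ^ (k - (N - ?e)) * Q k g)"
        using s by (simp add: sum_distrib_left[symmetric])
      then show "s ^ ?e * f (tord m d s * g) = poly (\<Sum>k\<le>M. monom (Q k g) (k - (N - ?e))) s"
        by (simp add: poly_sum poly_monom mult.commute)
    qed
  qed
qed

section \<open>Signed permutation matrices\<close>

text \<open>
  An index \<open>c < m\<close> also stands for the weight \<open>\<epsilon>_(c+1)\<close>, and \<open>cj m c\<close> for its negative. The matrix
  \<open>frm m l\<close> below represents the Weyl group element that sends \<open>\<epsilon>_(i+1)\<close> to the weight of \<open>l ! i\<close>.
\<close>

definition nm :: "nat \<Rightarrow> nat \<Rightarrow> nat" where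
  "nm m c = (if c < m then c else cj m c)"

text \<open>\<open>nm\<close> names the hyperbolic pair of an index, so the entries belong to
  distinct pairs. As a list of coordinate vectors this spans an isotropic subspace, and as a list of
  signed \<open>\<epsilon>\<close> it encodes a weight with entries -1, 0, 1.\<close>

definition iso_list :: "nat \<Rightarrow> nat list \<Rightarrow> bool" where
  "iso_list m l \<longleftrightarrow> set l \<subseteq> {..<2*m} \<and> distinct (map (nm m) l)"

definition fperm :: "nat \<Rightarrow> nat list \<Rightarrow> nat \<Rightarrow> nat" where
  "fperm m l i = (if i < m then l ! i else cj m (l ! cj m i))"

definition frm :: "nat \<Rightarrow> nat list \<Rightarrow> 'a::field mat" where
  "frm m l = mat (2*m) (2*m) (\<lambda>(a, b). if a = fperm m l b then if b < m then 1 else - sg m a else 0)"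

lemma nm_less: "c < 2*m \<Longrightarrow> nm m c < m"
  by (auto simp: nm_def cj_def)

lemma nm_cases: "c < 2*m \<Longrightarrow> c = nm m c \<or> c = cj m (nm m c)"
  by (auto simp: nm_def cj_def)

lemma nm_cj [simp]: "c < 2*m \<Longrightarrow> nm m (cj m c) = nm m c"
  by (auto simp: nm_def cj_def)

lemma nm_eq_iff: "c < 2*m \<Longrightarrow> d < 2*m \<Longrightarrow> nm m c = nm m d \<longleftrightarrow> c = d \<or> c = cj m d"
  by (auto simp: nm_def cj_def)

lemma nm_id [simp]: "c < m \<Longrightarrow> nm m c = c"
  by (simp add: nm_def)

lemma iso_list_nth: "iso_list m l \<Longrightarrow> i < length l \<Longrightarrow> l ! i < 2*m"
  unfolding iso_list_def by (metis lessThan_iff nth_mem subsetD)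

text \<open>The pairs on which the weight of \<open>q\<close> is zero. They serve both to complete
  \<open>q\<close> to a Weyl group element and as the ground set of the sets
  \<open>J\<close>.\<close>

definition zc :: "nat \<Rightarrow> nat list \<Rightarrow> nat list" where
  "zc m q = filter (\<lambda>c. c \<notin> nm m ` set q) [0..<m]"

lemma set_zc: "set (zc m q) = {..<m} - nm m ` set q"
  by (auto simp: zc_def)

lemma iso_list_zc:
  assumes q: "iso_list m q"
  shows "iso_list m (q @ zc m q)" "length (q @ zc m q) = m"
proof -
  have less: "set (map (nm m) q) \<subseteq> {..<m}" using q nm_less by (auto simp: iso_list_def)
  have c: "card (set (map (nm m) q)) = length q" using q distinct_card[of "map (nm m) q"] by (simp add: iso_list_def)
  have "card (set (zc m q)) = m - length q" using less c by (simp add: set_zc card_Diff_subset)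
  moreover have "card (set (zc m q)) = length (zc m q)" by (rule distinct_card) (simp add: zc_def)
  moreover have "length q \<le> m" using card_mono[OF _ less] c by simp
  ultimately show "length (q @ zc m q) = m" by simp
  have "map (nm m) (zc m q) = zc m q" by (rule map_idI) (auto simp: zc_def)
  then show "iso_list m (q @ zc m q)" using q by (auto simp: iso_list_def zc_def)
qed

lemma fperm_props:
  assumes l: "iso_list m l" "length l = m"
  shows "i < 2*m \<Longrightarrow> fperm m l i < 2*m" "i < 2*m \<Longrightarrow> fperm m l (cj m i) = cj m (fperm m l i)"
    and "i < 2*m \<Longrightarrow> j < 2*m \<Longrightarrow> fperm m l i = fperm m l j \<longleftrightarrow> i = j"
proof -
  have ent: "l ! i < 2*m" if "i < m" for i
    using iso_list_nth[OF l(1)] l(2) that by simp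
  show less: "fperm m l i < 2*m" if "i < 2*m" for i
    using that ent[of i] ent[of "cj m i"] by (auto simp: fperm_def cj_def)
  show cj: "fperm m l (cj m i) = cj m (fperm m l i)" if "i < 2*m" for i
  proof (cases "i < m")
    case True
    then have "\<not> cj m i < m" by (auto simp: cj_def)
    then show ?thesis using True that by (simp add: fperm_def)
  next
    case False
    then have "cj m i < m" using that by (auto simp: cj_def)
    then show ?thesis using False that ent[of "cj m i"] by (simp add: fperm_def)
  qed
  have nmf: "nm m (fperm m l i) = nm m (l ! nm m i)" if "i < 2*m" for i
    using that ent[of "cj m i"] by (auto simp: fperm_def nm_def[of m i] cj_def[of m i])
  have inj: "nm m (l ! i) = nm m (l ! j) \<longleftrightarrow> i = j" if "i < m" "j < m" for i j
    using l that nth_eq_iff_index_eq[of "map (nm m) l" i j] by (simp add: iso_list_def)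
  show "fperm m l i = fperm m l j \<longleftrightarrow> i = j" if ij: "i < 2*m" "j < 2*m" for i j
  proof
    assume e: "fperm m l i = fperm m l j"
    then have "nm m i = nm m j"
      using nmf[OF ij(1)] nmf[OF ij(2)] inj[OF nm_less[OF ij(1)] nm_less[OF ij(2)]] by simp
    then consider "i = j" | "i = cj m j" using nm_eq_iff[OF ij] by blast
    then show "i = j"
    proof cases
      case 2
      then have "cj m (fperm m l j) = fperm m l j" using e cj[OF ij(2)] by simp
      then show ?thesis using cj_neq(1)[OF less[OF ij(2)]] by simp
    qed
  qed simp
qed

lemma frm_carrier [simp]: "frm m l \<in> carrier_mat (2*m) (2*m)"
  by (simp add: frm_def)

lemma frm_entry: "a < 2*m \<Longrightarrow> b < 2*m \<Longrightarrow>
    frm m l $$ (a, b) = (if a = fperm m l b then if b < m then 1 else - sg m a else 0)"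
  by (simp add: frm_def)

text \<open>The columns are signed coordinate vectors. The sign on the columns from \<open>m\<close>
  on compensates for the sign of the form when a pair is mapped with its two members
  exchanged.\<close>

lemma frm_Sp:
  assumes l: "iso_list m l" "length l = m"
  shows "(frm m l :: 'a::field mat) \<in> carrier (Sp m)"
proof -
  note fp = fperm_props[OF l]
  define t :: "nat \<Rightarrow> 'a" where "t b = (if b < m then 1 else - sg m (fperm m l b))" for b
  have col: "(frm m l :: 'a mat) $$ (a, b) = (if a = fperm m l b then t b else 0)" if "a < 2*m" "b < 2*m" for a b
    using that by (simp add: frm_entry t_def)
  have "bform m (\<lambda>a. (frm m l :: 'a mat) $$ (a, k)) (\<lambda>a. frm m l $$ (a, j)) = (if k = cj m j then sg m k else 0)"
    if kj: "k < 2*m" "j < 2*m" for k j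
  proof -
    have "bform m (\<lambda>a. (frm m l :: 'a mat) $$ (a, k)) (\<lambda>a. frm m l $$ (a, j))
        = bform m (\<lambda>a. if a = fperm m l k then t k else 0) (\<lambda>a. if a = fperm m l j then t j else 0)"
      by (rule bform_cong) (auto simp: col kj)
    also have "\<dots> = sg m (fperm m l k) * t k * (if cj m k = j then t j else 0)"
      using fp(2)[OF kj(1)] fp(3)[OF cj_less[OF kj(1)] kj(2)] by (simp add: bform_single_left[OF fp(1)[OF kj(1)]])
    also have "\<dots> = (if k = cj m j then sg m k else 0)"
    proof (cases "k = cj m j")
      case True
      then have j: "j = cj m k" using kj by simp
      have "t k * t j = sg m (fperm m l k) * sg m k"
      proof (cases "k < m")
        case True
        then have "\<not> j < m" using j by (auto simp: cj_def)
        then show ?thesis using True fp(2)[OF kj(1)] fp(1)[OF kj(1)] by (simp add: t_def j) (simp add: sg_def)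
      next
        case False
        then have "j < m" using j kj by (auto simp: cj_def)
        then show ?thesis using False by (simp add: t_def) (simp add: sg_def)
      qed
      then have "sg m (fperm m l k) * t k * t j = sg m k" by (simp add: mult.assoc)
      then show ?thesis unfolding if_P[OF j[symmetric]] if_P[OF True] .
    qed (use kj in auto)
    finally show ?thesis .
  qed
  then show ?thesis unfolding Sp_iff using frm_carrier by blast
qed

lemma tor_frm:
  assumes l: "iso_list m l" "length l = m" and i: "i < m"
  shows "tor m (l ! i) s * frm m l = frm m l * tor m i s"
proof (rule eq_matI)
  note fp = fperm_props[OF l]
  have li: "l ! i = fperm m l i" using i by (simp add: fperm_def)
  fix k j assume "k < dim_row (frm m l * tor m i s)" "j < dim_col (frm m l * tor m i s)"
  then have kj: "k < 2*m" "j < 2*m" by (auto simp: frm_def tor_def)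
  have "dc m (l ! i) s (fperm m l j) = dc m i s j"
  proof -
    have "fperm m l j = fperm m l i \<longleftrightarrow> j = i" using fp(3) kj i by simp
    moreover have "fperm m l j = cj m (fperm m l i) \<longleftrightarrow> j = cj m i" using fp(3)[OF kj(2), of "cj m i"] fp(2)[of i] i by simp
    ultimately show ?thesis unfolding li dc_def by simp
  qed
  then show "(tor m (l ! i) s * frm m l) $$ (k, j) = (frm m l * tor m i s) $$ (k, j)"
    unfolding tor_dmat dmat_mult_entry[OF frm_carrier kj] mult_dmat_entry[OF frm_carrier kj]
    by (simp add: frm_entry kj)
qed (auto simp: frm_def tor_def)

lemma rt_transpose:
  assumes "i < 2*m" "j < 2*m"
  shows "(rt m i j t)\<^sup>T = rt m j i t"
proof -
  obtain B where B: "(i = cj m j) = B" "(j = cj m i) = B" using eq_cj_iff[OF assms] by auto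
  show ?thesis
  proof (rule eq_matI)
    fix k l assume "k < dim_row (rt m j i t)" "l < dim_col (rt m j i t)"
    then have kl: "k < 2*m" "l < 2*m" by (auto simp: rt_dim)
    have "(rt m i j t)\<^sup>T $$ (k, l) = rt m i j t $$ (l, k)" using kl by (simp add: rt_dim)
    also have "\<dots> = rt m j i t $$ (k, l)"
      unfolding rt_def index_mat(1)[OF kl] index_mat(1)[OF kl(2,1)] prod.case B
      by (simp only: conj_ac eq_commute[of l k] mult.commute[of "sg m j" "sg m i"])
    finally show "(rt m i j t)\<^sup>T $$ (k, l) = rt m j i t $$ (k, l)" .
  qed (simp_all add: rt_dim)
qed

lemma mult_rt_entry:
  assumes g: "g \<in> carrier_mat (2*m) (2*m)" and i: "i < 2*m" and j: "j < 2*m" and k: "k < 2*m" and l: "l < 2*m"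
  shows "(g * rt m i j t) $$ (k, l) = g $$ (k, l) + (if l = j then t * g $$ (k, i) else 0) +
     (if l = cj m i \<and> i \<noteq> cj m j then - (sg m i * sg m j * t) * g $$ (k, cj m j) else 0)"
proof -
  have gt: "g\<^sup>T \<in> carrier_mat (2*m) (2*m)" using g by simp
  have "(g * rt m i j t) $$ (k, l) = (g * rt m i j t)\<^sup>T $$ (l, k)"
    using g k l by (simp add: rt_dim)
  also have "(g * rt m i j t)\<^sup>T = rt m j i t * g\<^sup>T"
    unfolding transpose_mult[OF g rt_carrier_mat] rt_transpose[OF i j] ..
  also have "\<dots> $$ (l, k) = g $$ (k, l) + (if l = j then t * g $$ (k, i) else 0) +
     (if l = cj m i \<and> i \<noteq> cj m j then - (sg m i * sg m j * t) * g $$ (k, cj m j) else 0)"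
    unfolding rt_mult_entry[OF gt j i l k] using eq_cj_iff[OF i j] g i j k l
    by (auto simp: mult.commute[of "sg m j" "sg m i"])
  finally show ?thesis .
qed

lemma rt_frm:
  assumes l: "iso_list m l" "length l = m" and i: "i < m" "l ! i < m" and j: "j < m" "l ! j < m" and ij: "i \<noteq> j"
  shows "rt m (l ! i) (l ! j) t * frm m l = frm m l * rt m i j t"
proof (rule eq_matI)
  note fp = fperm_props[OF l]
  have lt: "i < 2*m" "j < 2*m" "l ! i < 2*m" "l ! j < 2*m" using i j by auto
  have li: "fperm m l i = l ! i" "fperm m l j = l ! j" using i j by (auto simp: fperm_def)
  have lc: "fperm m l (cj m i) = cj m (l ! i)" "fperm m l (cj m j) = cj m (l ! j)" using fp(2) lt li by auto
  have nc: "l ! i \<noteq> cj m (l ! j)" "i \<noteq> cj m j" using i j by (auto simp: cj_def)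
  have cm: "\<not> cj m i < m" "\<not> cj m j < m" "\<not> cj m (l ! i) < m" using i j by (auto simp: cj_def)
  fix a b assume "a < dim_row (frm m l * rt m i j t :: 'a mat)" "b < dim_col (frm m l * rt m i j t :: 'a mat)"
  then have ab: "a < 2*m" "b < 2*m" by (auto simp: frm_def rt_def)
  have 1: "frm m l $$ (l ! j, b) = (if b = j then 1 else 0 :: 'a)"
    unfolding frm_entry[OF lt(4) ab(2)] using fp(3)[OF ab(2) lt(2)] li j by (auto simp: eq_commute[of "l ! j"])
  have 2: "frm m l $$ (cj m (l ! i), b) = (if b = cj m i then 1 else 0 :: 'a)"
    unfolding frm_entry[OF cj_less[OF lt(3)] ab(2)] using fp(3)[OF ab(2) cj_less[OF lt(1)]] lc cm lt i
    by (auto simp: eq_commute[of "cj m (l ! i)"] sg_def)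
  have 3: "frm m l $$ (a, i) = (if a = l ! i then 1 else 0 :: 'a)"
    unfolding frm_entry[OF ab(1) lt(1)] using li i by simp
  have 4: "frm m l $$ (a, cj m j) = (if a = cj m (l ! j) then 1 else 0 :: 'a)"
    unfolding frm_entry[OF ab(1) cj_less[OF lt(2)]] using lc cm lt j by (auto simp: sg_def cj_def)
  show "(rt m (l ! i) (l ! j) t * frm m l) $$ (a, b) = (frm m l * rt m i j t) $$ (a, b)"
    unfolding rt_mult_entry[OF frm_carrier lt(3,4) ab] mult_rt_entry[OF frm_carrier lt(1,2) ab] 1 2 3 4
    using nc i j by (auto simp: sg_def)
qed (auto simp: frm_def rt_def)

section \<open>Weight bounds\<close>

text \<open>Exponents are recorded at all \<open>2m\<close> indices, although those of a nonzero
  vector are opposite at \<open>i\<close> and \<open>cj m i\<close>; then every \<open>tor\<close>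
  is treated alike. With respect to \<open>left_translation\<close> the weight is the negative of
  \<open>\<nu>\<close>.\<close>

definition Hw :: "nat \<Rightarrow> nat \<Rightarrow> (nat \<Rightarrow> int) \<Rightarrow> ('a::field mat \<Rightarrow> 'a) set" where
  "Hw m r \<nu> = {f \<in> ind m r. \<forall>i<2*m. \<forall>s. s \<noteq> 0 \<longrightarrow> (\<forall>g\<in>carrier (Sp m). f (tor m i s * g) = s powi \<nu> i * f g)}"

lemma Hw_ind: "f \<in> Hw m r \<nu> \<Longrightarrow> f \<in> ind m r"
  by (simp add: Hw_def)

lemma Hw_tor: "f \<in> Hw m r \<nu> \<Longrightarrow> i < 2*m \<Longrightarrow> s \<noteq> 0 \<Longrightarrow> g \<in> carrier (Sp m) \<Longrightarrow> f (tor m i s * g) = s powi \<nu> i * f g"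
  by (simp add: Hw_def)

lemma Hw_cong: "(\<And>i. i < 2*m \<Longrightarrow> \<nu> i = \<mu> i) \<Longrightarrow> Hw m r \<nu> = Hw m r \<mu>"
  by (auto simp: Hw_def)

lemma powi_exponent_eq:
  assumes "\<And>s::'a::alg_closed_field. s \<noteq> 0 \<Longrightarrow> s powi a = s powi b"
  shows "a = b"
proof -
  have gen: "a = b" if ab: "a \<le> b" and eq: "\<And>s::'a. s \<noteq> 0 \<Longrightarrow> s powi a = s powi b" for a b :: int
  proof (rule ccontr)
    assume "a \<noteq> b"
    with ab have d: "nat (b - a) > 0" by simp
    have "monom (1::'a) (nat (b - a)) = 1"
    proof (rule poly_eqI_nonzero)
      fix s :: 'a assume s: "s \<noteq> 0"
      have "s ^ nat (b - a) = s powi (b - a)" using ab by (simp add: power_int_def)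
      also have "\<dots> = 1" using eq[OF s] s by (simp add: power_int_diff)
      finally show "poly (monom 1 (nat (b - a))) s = poly 1 s" by (simp add: poly_monom)
    qed
    then have "degree (monom (1::'a) (nat (b - a))) = 0" by simp
    then show False using d by (simp add: degree_monom_eq)
  qed
  show ?thesis using gen[of a b] gen[of b a] assms by (cases "a \<le> b") auto
qed

lemma Hw_cj:
  fixes f :: "'a::alg_closed_field mat \<Rightarrow> 'a"
  assumes f: "f \<in> Hw m r \<nu>" and g: "g \<in> carrier (Sp m)" "f g \<noteq> 0" and i: "i < 2*m"
  shows "\<nu> (cj m i) = - \<nu> i"
proof (rule powi_exponent_eq)
  fix s :: 'a assume s: "s \<noteq> 0"
  have "s powi \<nu> (cj m i) * f g = f (tor m (cj m i) s * g)"
    using Hw_tor[OF f cj_less[OF i] s g(1)] by simp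
  also have "\<dots> = f (tor m i (inverse s) * g)" by (simp add: tor_cj[OF i])
  also have "\<dots> = inverse s powi \<nu> i * f g" using s by (intro Hw_tor[OF f i _ g(1)]) simp
  also have "inverse s powi \<nu> i = s powi (- \<nu> i)" by (simp add: power_int_minus power_int_inverse)
  finally show "s powi \<nu> (cj m i) = s powi (- \<nu> i)" using g(2) by simp
qed

lemma powi_poly_nonneg:
  fixes c :: "'a::alg_closed_field"
  assumes "\<And>s. s \<noteq> 0 \<Longrightarrow> s powi a * c = poly p s" and c: "c \<noteq> 0"
  shows "a \<ge> 0"
proof (rule ccontr)
  assume a: "\<not> a \<ge> 0"
  have "[:c:] = monom 1 (nat (- a)) * p"
  proof (rule poly_eqI_nonzero)
    fix s :: 'a assume s: "s \<noteq> 0"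
    have "s ^ nat (- a) = s powi (- a)" using a by (simp add: power_int_def)
    then have "s ^ nat (- a) * (s powi a * c) = c" using s by (simp add: power_int_minus)
    then show "poly [:c:] s = poly (monom 1 (nat (- a)) * p) s"
      using assms(1)[OF s] by (simp add: poly_monom)
  qed
  then have "coeff [:c:] 0 = coeff (monom 1 (nat (- a)) * p) 0" by simp
  then show False using a c by (simp add: coeff_monom_mult)
qed

lemma trl_frm_Hw:
  assumes f: "f \<in> Hw m r \<nu>" and r: "r \<le> m" and l: "iso_list m l" "length l = m"
  shows "trl m (frm m l) f \<in> ind m r"
    and "i < m \<Longrightarrow> s \<noteq> 0 \<Longrightarrow> g \<in> carrier (Sp m) \<Longrightarrow>
      trl m (frm m l) f (tor m i s * g) = s powi \<nu> (l ! i) * trl m (frm m l) f g"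
proof -
  note W = frm_Sp[OF l]
  show "trl m (frm m l) f \<in> ind m r" by (rule trl_ind[OF Hw_ind[OF f] r W])
  assume i: "i < m" and s: "s \<noteq> 0" and g: "g \<in> carrier (Sp m)"
  have i2: "i < 2*m" using i by simp
  have li: "l ! i < 2*m" using iso_list_nth[OF l(1)] l(2) i by simp
  have "frm m l * (tor m i s * g) = tor m (l ! i) s * (frm m l * g)"
    using Sp_assoc[OF W tor_Sp[OF i2 s] g] Sp_assoc[OF tor_Sp[OF li s] W g] tor_frm[OF l i, of s] by metis
  then show "trl m (frm m l) f (tor m i s * g) = s powi \<nu> (l ! i) * trl m (frm m l) f g"
    using Hw_tor[OF f li s Sp_mult[OF W g]] tor_mult_Sp[OF g i2 s] g by (simp add: trl_def)
qed

lemma trl_nonzero: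
  fixes f :: "'a::field mat \<Rightarrow> 'a"
  assumes h: "h \<in> carrier (Sp m)" and g: "g \<in> carrier (Sp m)" and nz: "f g \<noteq> 0"
  shows "\<exists>g'\<in>carrier (Sp m). trl m h f g' \<noteq> 0"
  using nz Sp_inv_cancel(1)[OF h g] Sp_mult[OF Sp_inv(1)[OF h] g]
  by (intro bexI[of _ "inv\<^bsub>Sp m\<^esub> h * g"]) (auto simp: trl_def)

lemma tord_1: "m > 0 \<Longrightarrow> tord m 1 s = tor m 0 s"
  using tord_Suc[of 0 m s] tor_carrier_mat[of m 0 s] by (simp add: tord_0)

text \<open>A Weyl group element moves the index to position 0, where \<open>tord_pole\<close> with
  \<open>d = 1\<close> bounds the entry from below. The same for \<open>cj m i\<close> bounds it
  from above.\<close>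

lemma weight_bound_single:
  fixes f :: "'a::alg_closed_field mat \<Rightarrow> 'a"
  assumes f: "f \<in> Hw m r \<nu>" and r: "r \<le> m" and g: "g \<in> carrier (Sp m)" "f g \<noteq> 0" and i: "i < 2*m"
  shows "\<bar>\<nu> i\<bar> \<le> 1"
proof -
  have low: "\<nu> i \<ge> - 1" if i: "i < 2*m" for i
  proof -
    have m: "0 < m" using i by simp
    have "iso_list m [i]" using i by (simp add: iso_list_def)
    then obtain l' where l: "iso_list m ([i] @ l')" "length ([i] @ l') = m" using iso_list_zc by blast
    let ?f = "trl m (frm m ([i] @ l')) f"
    obtain h where h: "h \<in> carrier (Sp m)" "?f h \<noteq> 0"
      using trl_nonzero[of _ m g f, OF frm_Sp[OF l] g] by blast
    have m1: "1 \<le> m" using m by simp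
    obtain p where "\<forall>s. s \<noteq> 0 \<longrightarrow> s ^ min 1 r * ?f (tord m 1 s * h) = poly p s"
      using tord_pole[OF trl_frm_Hw(1)[OF f r l] r m1 h(1)] by blast
    then have p: "s ^ min 1 r * ?f (tord m 1 s * h) = poly p s" if "s \<noteq> 0" for s using that by blast
    have "int (min 1 r) + \<nu> i \<ge> 0"
    proof (rule powi_poly_nonneg[OF _ h(2)])
      fix s :: 'a assume s: "s \<noteq> 0"
      have "s powi (int (min 1 r) + \<nu> i) = s ^ min 1 r * s powi \<nu> i"
        using s by (simp only: power_int_add power_int_of_nat simp_thms)
      then show "s powi (int (min 1 r) + \<nu> i) * ?f h = poly p s"
        using p[OF s] trl_frm_Hw(2)[OF f r l m s h(1)] by (simp add: tord_1[OF m] mult.assoc del: One_nat_def)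
    qed
    then show ?thesis by (simp add: min_def split: if_splits)
  qed
  show ?thesis using low[OF i] low[OF cj_less[OF i]] Hw_cj[OF f g i] by simp
qed

lemma tord_weight:
  assumes e: "\<And>i s g. i < m \<Longrightarrow> s \<noteq> 0 \<Longrightarrow> g \<in> carrier (Sp m) \<Longrightarrow> f (tor m i s * g) = s powi \<mu> i * f g"
    and s: "s \<noteq> 0" and g: "g \<in> carrier (Sp m)"
  shows "d \<le> m \<Longrightarrow> f (tord m d s * g) = s powi (\<Sum>i<d. \<mu> i) * f g"
proof (induction d)
  case 0
  then show ?case using Sp_carrier_mat[OF g] by (simp add: tord_0)
next
  case (Suc d)
  have S: "tord m d s \<in> carrier (Sp m)" "tor m d s \<in> carrier (Sp m)" using Suc.prems s by (auto intro: tord_Sp tor_Sp)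
  have "f (tord m (Suc d) s * g) = f (tor m d s * (tord m d s * g))"
    using Suc.prems by (simp add: tord_Suc Sp_assoc[OF S(2,1) g])
  also have "\<dots> = s powi \<mu> d * (s powi (\<Sum>i<d. \<mu> i) * f g)"
    using e[of d s "tord m d s * g"] Suc s Sp_mult[OF S(1) g] by simp
  finally show ?case using s by (simp add: power_int_add mult_ac)
qed

text \<open>After all nonzero entries have been made -1 by the Weyl group, the pole of order at most
  \<open>r\<close> along \<open>tord m m\<close> bounds their number.\<close>

lemma weight_bound_support:
  fixes f :: "'a::alg_closed_field mat \<Rightarrow> 'a"
  assumes f: "f \<in> Hw m r \<nu>" and r: "r \<le> m" and g: "g \<in> carrier (Sp m)" "f g \<noteq> 0"
  shows "card {i. i < m \<and> \<nu> i \<noteq> 0} \<le> r"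
proof -
  \<comment> \<open>Only the entries equal to 1 need their sign changed.\<close>
  define l where "l = map (\<lambda>i. if \<nu> i = 1 then cj m i else i) [0..<m]"
  have nml: "map (nm m) l = [0..<m]" unfolding l_def by (rule nth_equalityI) auto
  have l: "iso_list m l" "length l = m" unfolding iso_list_def nml by (auto simp: l_def)
  let ?f = "trl m (frm m l) f"
  obtain h where h: "h \<in> carrier (Sp m)" "?f h \<noteq> 0"
    using trl_nonzero[of _ m g f, OF frm_Sp[OF l] g] by blast
  obtain p where "\<forall>s. s \<noteq> 0 \<longrightarrow> s ^ min m r * ?f (tord m m s * h) = poly p s"
    using tord_pole[OF trl_frm_Hw(1)[OF f r l] r order_refl h(1)] by blast
  then have p: "s ^ min m r * ?f (tord m m s * h) = poly p s" if "s \<noteq> 0" for s using that by blast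
  have \<nu>l: "\<nu> (l ! i) = (if \<nu> i = 0 then 0 else - 1)" if "i < m" for i
    using that Hw_cj[OF f g, of i] weight_bound_single[OF f r g, of i] by (auto simp: l_def)
  have "int (min m r) + (\<Sum>i<m. \<nu> (l ! i)) \<ge> 0"
  proof (rule powi_poly_nonneg[OF _ h(2)])
    fix s :: 'a assume s: "s \<noteq> 0"
    have "s powi (int (min m r) + (\<Sum>i<m. \<nu> (l ! i))) = s ^ min m r * s powi (\<Sum>i<m. \<nu> (l ! i))"
      using s by (simp only: power_int_add power_int_of_nat simp_thms)
    then show "s powi (int (min m r) + (\<Sum>i<m. \<nu> (l ! i))) * ?f h = poly p s"
      using p[OF s] tord_weight[OF trl_frm_Hw(2)[OF f r l] s h(1), of m] by (simp add: mult.assoc)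
  qed
  moreover have "(\<Sum>i<m. \<nu> (l ! i)) = (\<Sum>i<m. if \<nu> i = 0 then 0 else - 1)"
    by (intro sum.cong) (auto simp: \<nu>l)
  moreover have "\<dots> = - int (card {i. i < m \<and> \<nu> i \<noteq> 0})"
  proof -
    have "(\<Sum>i<m. if \<nu> i = 0 then 0 else - 1 :: int) = (\<Sum>i\<in>{i. i < m \<and> \<nu> i \<noteq> 0}. - 1)"
      by (rule sum.mono_neutral_cong_right) auto
    then show ?thesis by simp
  qed
  ultimately show ?thesis using r by simp
qed

section \<open>Weight decomposition\<close>

definition submod :: "nat \<Rightarrow> ('a::field mat \<Rightarrow> 'a) set \<Rightarrow> bool" where
  "submod m A \<longleftrightarrow> fun_space.subspace A \<and> (\<forall>h\<in>carrier (Sp m). \<forall>f\<in>A. trl m h f \<in> A)"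

lemma submod_ind: "r \<le> m \<Longrightarrow> submod m (ind m r)"
  by (simp add: submod_def ind_subspace trl_ind)

lemma submod_trl: "submod m A \<Longrightarrow> f \<in> A \<Longrightarrow> h \<in> carrier (Sp m) \<Longrightarrow> trl m h f \<in> A"
  by (simp add: submod_def)

lemma submod_cmult: "submod m A \<Longrightarrow> f \<in> A \<Longrightarrow> (\<lambda>g. c * f g) \<in> A"
  using fun_space.subspace_scale[of A f c] by (simp add: submod_def fun_scale_def)

lemma submod_add: "submod m A \<Longrightarrow> f \<in> A \<Longrightarrow> h \<in> A \<Longrightarrow> (\<lambda>g. f g + h g) \<in> A"
  using fun_space.subspace_add[of A f h] by (simp add: submod_def plus_fun_def)

lemma submod_diff: "submod m A \<Longrightarrow> f \<in> A \<Longrightarrow> h \<in> A \<Longrightarrow> (\<lambda>g. f g - h g) \<in> A"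
  using submod_add[of m A f "\<lambda>g. - 1 * h g"] submod_cmult[of m A h "- 1"] by simp

lemma submod_zero: "submod m A \<Longrightarrow> (\<lambda>g. 0) \<in> A"
  using fun_space.subspace_0[of A] by (simp add: submod_def zero_fun_def)

lemma trl_tor_frm:
  fixes f :: "'a::field mat \<Rightarrow> 'a"
  assumes l: "iso_list m l" "length l = m" and i: "i < m" and s: "s \<noteq> 0" and g: "g \<in> carrier (Sp m)"
  shows "trl m (frm m l) f (tor m i s * (inv\<^bsub>Sp m\<^esub> (frm m l) * g)) = f (tor m (l ! i) s * g)"
proof -
  note W = frm_Sp[OF l]
  let ?h = "inv\<^bsub>Sp m\<^esub> (frm m l) * g"
  have h: "?h \<in> carrier (Sp m)" by (rule Sp_mult[OF Sp_inv(1)[OF W] g])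
  have i2: "i < 2*m" using i by simp
  have li: "l ! i < 2*m" using iso_list_nth[OF l(1)] l(2) i by simp
  have "frm m l * (tor m i s * ?h) = tor m (l ! i) s * (frm m l * ?h)"
    using Sp_assoc[OF W tor_Sp[OF i2 s] h] Sp_assoc[OF tor_Sp[OF li s] W h] tor_frm[OF l i, of s] by metis
  also have "frm m l * ?h = g" by (rule Sp_inv_cancel(1)[OF W g])
  finally show ?thesis using tor_mult_Sp[OF h i2 s] by (simp add: trl_def)
qed

lemma tor_pole:
  fixes f :: "'a::alg_closed_field mat \<Rightarrow> 'a"
  assumes f: "f \<in> ind m r" and r: "r \<le> m" and i: "i < 2*m" and g: "g \<in> carrier (Sp m)"
  shows "\<exists>p. \<forall>s. s \<noteq> 0 \<longrightarrow> s * f (tor m i s * g) = poly p s"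
proof -
  have m: "0 < m" "1 \<le> m" using i by auto
  have "iso_list m [i]" using i by (simp add: iso_list_def)
  then obtain l' where l: "iso_list m ([i] @ l')" "length ([i] @ l') = m" using iso_list_zc by blast
  note W = frm_Sp[OF l]
  let ?h = "inv\<^bsub>Sp m\<^esub> (frm m ([i] @ l')) * g"
  have h: "?h \<in> carrier (Sp m)" by (rule Sp_mult[OF Sp_inv(1)[OF W] g])
  obtain p where p: "\<forall>s. s \<noteq> 0 \<longrightarrow> s ^ min 1 r * trl m (frm m ([i] @ l')) f (tord m 1 s * ?h) = poly p s"
    using tord_pole[OF trl_ind[OF f r W] r m(2) h] by blast
  have e: "trl m (frm m ([i] @ l')) f (tord m 1 s * ?h) = f (tor m i s * g)" if "s \<noteq> 0" for s
    unfolding tord_1[OF m(1)] trl_tor_frm[OF l m(1) that g] by simp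
  show ?thesis
  proof (cases "r = 0")
    case True
    then show ?thesis using p e by (intro exI[of _ "[:0, 1:] * p"]) simp
  next
    case False
    then show ?thesis using p e by (intro exI[of _ p]) (simp add: min_def)
  qed
qed

text \<open>The pole at 0 is at most simple, and so is the pole at infinity, which is the pole at 0
  for the index \<open>cj m i\<close>.\<close>

lemma tor_expansion:
  fixes f :: "'a::alg_closed_field mat \<Rightarrow> 'a"
  assumes f: "f \<in> ind m r" and r: "r \<le> m" and i: "i < 2*m" and g: "g \<in> carrier (Sp m)"
  shows "\<exists>c. \<forall>s. s \<noteq> 0 \<longrightarrow> f (tor m i s * g) = (\<Sum>e\<in>{- 1, 0, 1}. c e * s powi e)"
proof -
  obtain p where p: "\<forall>s. s \<noteq> 0 \<longrightarrow> s * f (tor m i s * g) = poly p s"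
    using tor_pole[OF f r i g] by blast
  obtain q where q: "\<forall>s. s \<noteq> 0 \<longrightarrow> s * f (tor m (cj m i) s * g) = poly q s"
    using tor_pole[OF f r cj_less[OF i] g] by blast
  have q': "f (tor m i s * g) = s * poly q (inverse s)" if s: "s \<noteq> 0" for s
  proof -
    have "inverse s * f (tor m i s * g) = poly q (inverse s)"
      using q[rule_format, of "inverse s"] s i by (simp add: tor_cj)
    then show ?thesis using s by (simp add: field_simps)
  qed
  \<comment> \<open>On nonzero \<open>s\<close> this is \<open>p(s) = s^2 q(1/s)\<close>, multiplied
    by a power of \<open>s\<close> so as to be an identity of polynomials; it bounds the degree of
    \<open>p\<close> by 2.\<close>
  have "monom 1 (degree q) * p = monom 1 2 * reflect_poly q"
  proof (rule poly_eqI_nonzero)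
    fix s :: 'a assume s: "s \<noteq> 0"
    have "poly p s = s * (s * poly q (inverse s))" using p[rule_format, OF s] q'[OF s] by simp
    then show "poly (monom 1 (degree q) * p) s = poly (monom 1 2 * reflect_poly q) s"
      using s by (simp add: poly_monom poly_reflect_poly_nz power2_eq_square)
  qed
  moreover have "degree (monom 1 2 * reflect_poly q) \<le> 2 + degree q"
    by (rule order_trans[OF degree_mult_le]) (simp add: degree_monom_eq degree_reflect_poly_le)
  ultimately have le: "degree (monom 1 (degree q) * p) \<le> 2 + degree q" by simp
  have d: "degree p \<le> 2"
  proof (cases "p = 0")
    case False
    have "degree (monom (1::'a) (degree q) * p) = degree q + degree p"
      using False by (simp add: degree_mult_eq degree_monom_eq)
    then show ?thesis using le by linarith
  qed simp
  have ps: "poly p s = coeff p 0 + coeff p 1 * s + coeff p 2 * s\<^sup>2" for s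
  proof -
    have "poly p s = (\<Sum>k\<le>2. coeff p k * s ^ k)"
      unfolding poly_altdef using d by (intro sum.mono_neutral_left) (auto intro: coeff_eq_0)
    then show ?thesis by (simp add: numeral_2_eq_2)
  qed
  show ?thesis
  proof (intro exI[of _ "\<lambda>e. if e = - 1 then coeff p 0 else if e = 0 then coeff p 1 else coeff p 2"] allI impI)
    fix s :: 'a assume s: "s \<noteq> 0"
    have "f (tor m i s * g) = inverse s * poly p s" using p[rule_format, OF s, symmetric] s by simp
    also have "\<dots> = coeff p 0 * inverse s + coeff p 1 + coeff p 2 * s"
      unfolding ps using s by (simp add: field_simps power2_eq_square)
    finally show "f (tor m i s * g) = (\<Sum>e\<in>{- 1, 0, 1}. (if e = - 1 then coeff p 0 else if e = 0 then coeff p 1 else coeff p 2) * s powi e)"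
      by (simp add: power_int_minus)
  qed
qed

text \<open>Avoiding 0, 1 and -1 makes the three possible eigenvalues \<open>inverse sep\<close>, 1
  and \<open>sep\<close> distinct.\<close>

definition sep :: "'a::field" where
  "sep = (SOME s. s \<noteq> 0 \<and> s \<noteq> 1 \<and> s \<noteq> - 1)"

lemma sep: "(sep :: 'a::alg_closed_field) \<noteq> 0" "(sep :: 'a) \<noteq> 1" "(sep :: 'a) \<noteq> - 1"
proof -
  have "\<exists>s::'a. s \<notin> {0, 1, - 1}"
    using ex_new_if_finite[OF infinite_alg_closed, of "{0, 1, - 1}"] by blast
  then have "\<exists>s::'a. s \<noteq> 0 \<and> s \<noteq> 1 \<and> s \<noteq> - 1" by blast
  then have "(sep :: 'a) \<noteq> 0 \<and> (sep :: 'a) \<noteq> 1 \<and> (sep :: 'a) \<noteq> - 1"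
    unfolding sep_def by (rule someI_ex)
  then show "(sep :: 'a) \<noteq> 0" "(sep :: 'a) \<noteq> 1" "(sep :: 'a) \<noteq> - 1" by auto
qed

lemma sep_inverse: "inverse (sep :: 'a::alg_closed_field) \<noteq> sep" "inverse (sep :: 'a) \<noteq> 1"
proof -
  show "inverse (sep :: 'a) \<noteq> 1" using sep by (metis inverse_1 inverse_inverse_eq)
  show "inverse (sep :: 'a) \<noteq> sep"
  proof
    assume "inverse (sep :: 'a) = sep"
    then have "(sep :: 'a) * sep = 1" using sep by (metis right_inverse)
    then have "((sep :: 'a) - 1) * (sep + 1) = 0" by (simp add: algebra_simps)
    then show False using sep[where 'a = 'a] eq_neg_iff_add_eq_0[of "sep :: 'a" 1] by auto
  qed
qed

text \<open>Lagrange interpolation at the eigenvalues \<open>sep\<close>, \<open>1\<close>, \<open>inverse sep\<close> of \<open>tor m k sep\<close>.\<close>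

definition cmp :: "nat \<Rightarrow> nat \<Rightarrow> int \<Rightarrow> ('a::field mat \<Rightarrow> 'a) \<Rightarrow> 'a mat \<Rightarrow> 'a" where
  "cmp m k e f = (let x = sep powi (if e = - 1 then 0 else - 1); y = sep powi (if e = 1 then 0 else 1); z = sep powi e
     in (\<lambda>g. inverse ((z - x) * (z - y)) * (trl m (tor m k (sep * sep)) f g - (x + y) * trl m (tor m k sep) f g
       + x * y * trl m (1\<^sub>m (2*m)) f g)))"

lemma trl_one: "(\<And>g. g \<notin> carrier (Sp m) \<Longrightarrow> f g = 0) \<Longrightarrow> trl m (1\<^sub>m (2*m)) f = f" for f :: "'a::field mat \<Rightarrow> 'a"
  using Sp_carrier_mat left_mult_one_mat unfolding trl_def by fastforce

text \<open>Interpolating at one torus element writes the component as a combination of three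
  translates, so it remains in every submodule.\<close>

lemma cmp_submod:
  fixes f :: "'a::alg_closed_field mat \<Rightarrow> 'a"
  assumes A: "submod m A" and f: "f \<in> A" and k: "k < 2*m"
  shows "cmp m k e f \<in> A"
proof -
  have "sep * sep \<noteq> (0::'a)" using sep by simp
  then show ?thesis
    unfolding cmp_def Let_def
    by (intro submod_cmult[OF A] submod_add[OF A] submod_diff[OF A] submod_trl[OF A f] tor_Sp k Sp_one sep)
qed

lemma cmp_expansion:
  fixes f :: "'a::alg_closed_field mat \<Rightarrow> 'a"
  assumes k: "k < 2*m" and e: "e \<in> {- 1, 0, 1}" and g: "g \<in> carrier (Sp m)" and t: "t \<noteq> 0"
    and c: "\<And>s. s \<noteq> 0 \<Longrightarrow> f (tor m k s * g) = (\<Sum>e\<in>{- 1, 0, 1}. c e * s powi e)"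
  shows "cmp m k e f (tor m k t * g) = c e * t powi e"
proof -
  have sh: "trl m (tor m k s) f (tor m k t * g) = c (- 1) * inverse (s * t) + c 0 + c 1 * (s * t)" if s: "s \<noteq> 0" for s
  proof -
    have "tor m k s * (tor m k t * g) = tor m k (s * t) * g"
      using Sp_assoc[OF tor_Sp[OF k s] tor_Sp[OF k t] g] tor_tor_same[OF k, of s t] by simp
    then show ?thesis using c[of "s * t"] s t tor_mult_Sp[OF g k t] by (simp add: trl_def power_int_minus)
  qed
  have one: "trl m (1\<^sub>m (2*m)) f (tor m k t * g) = c (- 1) * inverse t + c 0 + c 1 * t"
    using sh[of 1] by (simp add: tor_one)
  have s0: "sep \<noteq> (0::'a)" "sep * sep \<noteq> (0::'a)" using sep by auto
  define u :: 'a where "u = inverse sep"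
  have u: "u * sep = 1" "sep * u = 1" "u \<noteq> 0" using sep[where 'a = 'a] by (auto simp: u_def)
  have su: "sep * (u * x) = x" "sep * (y * (u * x)) = y * x" for x y
    using u(2) by (simp_all add: mult.left_commute[of sep y] mult.assoc[symmetric])
  have i2: "inverse (sep * sep * t) = u * u * inverse t" "inverse (sep * t) = u * inverse t"
    by (simp_all add: u_def)
  have nz: "u - 1 \<noteq> 0" "u - sep \<noteq> 0" "1 - u \<noteq> 0" "1 - sep \<noteq> (0::'a)" "sep - u \<noteq> 0" "sep - 1 \<noteq> (0::'a)"
    using sep_inverse[where 'a = 'a] sep[where 'a = 'a] by (auto simp: u_def)
  have canc: "inverse P * (q * P) = q" if "P \<noteq> 0" for P q :: 'a using that by (simp add: field_simps)
  consider "e = - 1" | "e = 0" | "e = 1" using e by auto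
  then show ?thesis
  proof cases
    case 1
    have "cmp m k e f (tor m k t * g) = inverse ((u - 1) * (u - sep)) * (c (- 1) * inverse t * ((u - 1) * (u - sep)))"
      unfolding cmp_def Let_def sh[OF s0(1)] sh[OF s0(2)] one i2 using 1 u
      by (simp add: power_int_minus flip: u_def) (simp add: algebra_simps)
    also have "\<dots> = c (- 1) * inverse t" by (rule canc) (use nz in simp)
    finally show ?thesis using 1 by (simp add: power_int_minus)
  next
    case 2
    have "cmp m k e f (tor m k t * g) = inverse ((1 - u) * (1 - sep)) * (c 0 * ((1 - u) * (1 - sep)))"
      unfolding cmp_def Let_def sh[OF s0(1)] sh[OF s0(2)] one i2 using 2 u
      by (simp add: power_int_minus flip: u_def) (simp add: algebra_simps su)
    also have "\<dots> = c 0" by (rule canc) (use nz in simp)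
    finally show ?thesis using 2 by simp
  next
    case 3
    have "cmp m k e f (tor m k t * g) = inverse ((sep - u) * (sep - 1)) * (c 1 * t * ((sep - u) * (sep - 1)))"
      unfolding cmp_def Let_def sh[OF s0(1)] sh[OF s0(2)] one i2 using 3 u
      by (simp add: power_int_minus flip: u_def) (simp add: algebra_simps)
    also have "\<dots> = c 1 * t" by (rule canc) (use nz in simp)
    finally show ?thesis using 3 by simp
  qed
qed

text \<open>Weight vectors for the first \<open>k\<close> torus coordinates only. Splitting by one
  more coordinate keeps the earlier ones because the torus is commutative.\<close>

definition hom_upto :: "nat \<Rightarrow> nat \<Rightarrow> (nat \<Rightarrow> int) \<Rightarrow> ('a::field mat \<Rightarrow> 'a) \<Rightarrow> bool" where
  "hom_upto m k \<nu> f \<longleftrightarrow> (\<forall>i<k. \<forall>s. s \<noteq> 0 \<longrightarrow> (\<forall>g\<in>carrier (Sp m). f (tor m i s * g) = s powi \<nu> i * f g))"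

lemma cmp_hom_other:
  fixes f :: "'a::alg_closed_field mat \<Rightarrow> 'a"
  assumes k: "k < 2*m" and i: "i < 2*m" and s: "s \<noteq> 0" and g: "g \<in> carrier (Sp m)"
    and w: "\<And>g. g \<in> carrier (Sp m) \<Longrightarrow> f (tor m i s * g) = c * f g"
  shows "cmp m k e f (tor m i s * g) = c * cmp m k e f g"
proof -
  have sh: "trl m (tor m k t) f (tor m i s * g) = c * trl m (tor m k t) f g" if t: "t \<noteq> 0" for t
  proof -
    have "tor m k t * (tor m i s * g) = tor m i s * (tor m k t * g)"
      using Sp_assoc[OF tor_Sp[OF k t] tor_Sp[OF i s] g] Sp_assoc[OF tor_Sp[OF i s] tor_Sp[OF k t] g]
        tor_tor_commute[of m k t i s] by simp
    then show ?thesis using w[OF tor_mult_Sp[OF g k t]] tor_mult_Sp[OF g i s] g by (simp add: trl_def)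
  qed
  have "sep \<noteq> (0::'a)" "sep * sep \<noteq> (0::'a)" using sep by auto
  then show ?thesis
    unfolding cmp_def Let_def using sh[of sep] sh[of "sep * sep"] sh[of 1] by (simp add: tor_one algebra_simps)
qed

lemma cmp_decompose:
  fixes f :: "'a::alg_closed_field mat \<Rightarrow> 'a"
  assumes f: "f \<in> ind m r" and r: "r \<le> m" and k: "k < m" and h: "hom_upto m k \<nu> f"
  shows "e \<in> {- 1, 0, 1} \<Longrightarrow> hom_upto m (Suc k) (\<nu>(k := e)) (cmp m k e f)"
    and "f = (\<Sum>e\<in>{- 1, 0, 1}. cmp m k e f)"
proof -
  have k2: "k < 2*m" using k by simp
  show "hom_upto m (Suc k) (\<nu>(k := e)) (cmp m k e f)" if e: "e \<in> {- 1, 0, 1}"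
    unfolding hom_upto_def
  proof (intro allI impI ballI)
    fix i and s :: 'a and g :: "'a mat" assume i: "i < Suc k" and s: "s \<noteq> 0" and g: "g \<in> carrier (Sp m)"
    show "cmp m k e f (tor m i s * g) = s powi (\<nu>(k := e)) i * cmp m k e f g"
    proof (cases "i = k")
      case True
      obtain c where c: "\<forall>s. s \<noteq> 0 \<longrightarrow> f (tor m k s * g) = (\<Sum>e\<in>{- 1, 0, 1}. c e * s powi e)"
        using tor_expansion[OF f r k2 g] by blast
      have "cmp m k e f (tor m k s * g) = c e * s powi e" "cmp m k e f (tor m k 1 * g) = c e * 1 powi e"
        by (rule cmp_expansion[OF k2 e g _ c[rule_format]]; use s in simp)+
      then show ?thesis using True left_mult_one_mat[OF Sp_carrier_mat[OF g]] by (simp add: tor_one)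
    next
      case False
      then have i': "i < k" "i < 2*m" using i k by auto
      show ?thesis using cmp_hom_other[OF k2 i'(2) s g, of f "s powi \<nu> i" e] h i'(1) s False
        by (simp add: hom_upto_def)
    qed
  qed
  show "f = (\<Sum>e\<in>{- 1, 0, 1}. cmp m k e f)"
  proof (rule ind_eqI[OF f])
    have "cmp m k e f \<in> ind m r" for e by (rule cmp_submod[OF submod_ind[OF r] f k2])
    then have "(\<lambda>g. cmp m k (- 1) f g + (cmp m k 0 f g + cmp m k 1 f g)) \<in> ind m r"
      by (intro ind_add r)
    moreover have "(\<Sum>e\<in>{- 1, 0, 1}. cmp m k e f) = (\<lambda>g. cmp m k (- 1) f g + (cmp m k 0 f g + cmp m k 1 f g))"
      by (auto simp: plus_fun_def)
    ultimately show "(\<Sum>e\<in>{- 1, 0, 1}. cmp m k e f) \<in> ind m r" by simp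
    fix g :: "'a mat" assume g: "g \<in> carrier (Sp m)"
    obtain c where c: "\<forall>s. s \<noteq> 0 \<longrightarrow> f (tor m k s * g) = (\<Sum>e\<in>{- 1, 0, 1}. c e * s powi e)"
      using tor_expansion[OF f r k2 g] by blast
    have "cmp m k e f (tor m k 1 * g) = c e * 1 powi e" if "e \<in> {- 1, 0, 1}" for e
      by (rule cmp_expansion[OF k2 that g _ c[rule_format]]) auto
    then have "cmp m k e f g = c e" if "e \<in> {- 1, 0, 1}" for e
      using that left_mult_one_mat[OF Sp_carrier_mat[OF g]] by (simp add: tor_one)
    moreover have "f g = c (- 1) + c 0 + c 1"
      using c[rule_format, of 1] left_mult_one_mat[OF Sp_carrier_mat[OF g]] by (simp add: tor_one)
    ultimately show "f g = (\<Sum>e\<in>{- 1, 0, 1}. cmp m k e f) g" by simp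
  qed
qed

definition wext :: "nat \<Rightarrow> (nat \<Rightarrow> int) \<Rightarrow> nat \<Rightarrow> int" where
  "wext m \<nu> i = (if i < m then \<nu> i else - \<nu> (cj m i))"

lemma hom_upto_Hw:
  assumes f: "f \<in> ind m r" and h: "hom_upto m m \<nu> f"
  shows "f \<in> Hw m r (wext m \<nu>)"
  unfolding Hw_def
proof (intro CollectI conjI f allI impI ballI)
  fix i and s :: 'a and g :: "'a mat" assume i: "i < 2*m" and s: "s \<noteq> 0" and g: "g \<in> carrier (Sp m)"
  show "f (tor m i s * g) = s powi wext m \<nu> i * f g"
  proof (cases "i < m")
    case True
    then show ?thesis using h s g by (simp add: hom_upto_def wext_def)
  next
    case False
    then have c: "cj m i < m" using i by (auto simp: cj_def)
    have "tor m i s = tor m (cj m i) (inverse s)" using tor_cj[of "cj m i" m s] c i by simp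
    then have "f (tor m i s * g) = inverse s powi \<nu> (cj m i) * f g"
      using h s g c by (simp add: hom_upto_def)
    then show ?thesis using False by (simp add: wext_def power_int_minus power_int_inverse)
  qed
qed

text \<open>In each coordinate the vector is the sum of its three components, so one of them is
  nonzero, and it still lies in \<open>A\<close>.\<close>

lemma weight_vector_exists:
  fixes A :: "('a::alg_closed_field mat \<Rightarrow> 'a) set"
  assumes A: "submod m A" "A \<subseteq> ind m r" and r: "r \<le> m" and f: "f \<in> A" "f \<noteq> 0"
  shows "\<exists>\<nu> h. h \<in> A \<and> h \<in> Hw m r \<nu> \<and> h \<noteq> 0"
proof -
  have "k \<le> m \<Longrightarrow> \<exists>\<nu> h. h \<in> A \<and> hom_upto m k \<nu> h \<and> h \<noteq> 0" for k
  proof (induction k)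
    case 0
    then show ?case using f unfolding hom_upto_def by blast
  next
    case (Suc k)
    have k: "k < m" using Suc by simp
    obtain \<nu> h where h: "h \<in> A" "hom_upto m k \<nu> h" "h \<noteq> 0" using Suc.IH k less_imp_le by blast
    have hi: "h \<in> ind m r" using h A by blast
    obtain e where e: "e \<in> {- 1, 0, 1}" "cmp m k e h \<noteq> 0"
      using cmp_decompose(2)[OF hi r k h(2)] h(3) by (metis sum.neutral)
    moreover have "cmp m k e h \<in> A" using k by (intro cmp_submod[OF A(1) h(1)]) simp
    ultimately show ?case using cmp_decompose(1)[OF hi r k h(2) e(1)] by blast
  qed
  then obtain \<nu> h where "h \<in> A" "hom_upto m m \<nu> h" "h \<noteq> 0" by blast
  then show ?thesis using hom_upto_Hw A by blast
qed

lemma weight_decomposition: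
  fixes f :: "'a::alg_closed_field mat \<Rightarrow> 'a"
  assumes r: "r \<le> m" and f: "f \<in> ind m r"
  shows "f \<in> fun_space.span (\<Union>\<nu>. Hw m r \<nu>)"
proof -
  define S :: "('a mat \<Rightarrow> 'a) set" where "S = fun_space.span (\<Union>\<nu>. Hw m r \<nu>)"
  have "k \<le> m \<Longrightarrow> \<forall>\<nu> f. f \<in> ind m r \<and> hom_upto m k \<nu> f \<longrightarrow> f \<in> S" for k
  proof (induction k rule: inc_induct)
    case base
    show ?case
    proof (intro allI impI)
      fix \<nu> and f :: "'a mat \<Rightarrow> 'a" assume "f \<in> ind m r \<and> hom_upto m m \<nu> f"
      then have "f \<in> Hw m r (wext m \<nu>)" by (intro hom_upto_Hw) auto
      then show "f \<in> S" unfolding S_def by (intro fun_space.span_base) blast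
    qed
  next
    case (step k)
    show ?case
    proof (intro allI impI)
      fix \<nu> and f :: "'a mat \<Rightarrow> 'a" assume "f \<in> ind m r \<and> hom_upto m k \<nu> f"
      then have f: "f \<in> ind m r" "hom_upto m k \<nu> f" by auto
      have k: "k < m" using step by simp
      have "cmp m k e f \<in> S" if e: "e \<in> {- 1, 0, 1}" for e
      proof -
        have "cmp m k e f \<in> ind m r" using k by (intro cmp_submod[OF submod_ind[OF r] f(1)]) simp
        then show ?thesis using cmp_decompose(1)[OF f(1) r k f(2) e] step.IH by blast
      qed
      then have "(\<Sum>e\<in>{- 1, 0, 1}. cmp m k e f) \<in> S"
        unfolding S_def by (rule fun_space.span_sum)
      then show "f \<in> S"
        using cmp_decompose(2)[OF f(1) r k f(2)] by simp
    qed
  qed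
  from this[of 0] have "\<forall>\<nu> f. f \<in> ind m r \<and> hom_upto m 0 \<nu> f \<longrightarrow> f \<in> S"
    by blast
  moreover have "hom_upto m 0 (\<lambda>_. 0) f" by (simp add: hom_upto_def)
  ultimately show ?thesis using f unfolding S_def by blast
qed

section \<open>Root operators\<close>

text \<open>The pairing of the root of \<open>rt m i j\<close> with the cocharacter
  \<open>tor m c\<close>; for a long root it takes the values 2 and -2.\<close>

definition rw :: "nat \<Rightarrow> nat \<Rightarrow> nat \<Rightarrow> nat \<Rightarrow> int" where
  "rw m i j c = (if c = i then 1 else 0) - (if c = cj m i then 1 else 0) - (if c = j then 1 else 0) + (if c = cj m j then 1 else 0)"

lemma dc_powi: "s \<noteq> 0 \<Longrightarrow> c < 2*m \<Longrightarrow> i < 2*m \<Longrightarrow> dc m c s i = s powi ((if c = i then 1 else 0) - (if c = cj m i then 1 else 0))"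
  using eq_cj_iff[of i m c] by (auto simp: dc_def power_int_minus)

lemma dc_rw:
  assumes "s \<noteq> 0" "c < 2*m" "i < 2*m" "j < 2*m"
  shows "dc m c s i * inverse (dc m c s j) = s powi rw m i j c"
proof -
  have "rw m i j c = ((if c = i then 1 else 0) - (if c = cj m i then 1 else 0)) + - ((if c = j then 1 else 0) - (if c = cj m j then 1 else 0))"
    by (simp add: rw_def)
  then show ?thesis
    unfolding dc_powi[OF assms(1,2,3)] dc_powi[OF assms(1,2,4)] using assms(1)
    by (simp only: power_int_add power_int_minus simp_thms)
qed

lemma tor_rt:
  assumes c: "c < 2*m" and i: "i < 2*m" and j: "j < 2*m" and s: "s \<noteq> 0"
  shows "rt m i j t * tor m c s = tor m c s * rt m i j (t * inverse (s powi rw m i j c))"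
proof (rule eq_matI)
  let ?d = "dc m c s"
  have d: "?d k \<noteq> 0" for k using s by (rule dc_nonzero)
  have e: "inverse (s powi rw m i j c) = inverse (?d i) * ?d j" unfolding dc_rw[OF s c i j, symmetric] by simp
  fix k l assume "k < dim_row (tor m c s * rt m i j (t * inverse (s powi rw m i j c)))"
    "l < dim_col (tor m c s * rt m i j (t * inverse (s powi rw m i j c)))"
  then have kl: "k < 2*m" "l < 2*m" by (auto simp: tor_dim rt_dim)
  have 1: "(if k = l then 1 else 0) * ?d l = ?d k * (if k = l then 1 else 0)" by simp
  have 2: "(if k = i \<and> l = j then t else 0) * ?d l = ?d k * (if k = i \<and> l = j then t * (inverse (?d i) * ?d j) else 0)"
    using d[of i] by (cases "k = i \<and> l = j") auto
  have 3: "(if k = cj m j \<and> l = cj m i \<and> B then - (x * y * t) else 0) * ?d l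
      = ?d k * (if k = cj m j \<and> l = cj m i \<and> B then - (x * y * (t * (inverse (?d i) * ?d j))) else 0)" for B x y
  proof (cases "k = cj m j \<and> l = cj m i \<and> B")
    case True
    then have "?d k = inverse (?d j)" "?d l = inverse (?d i)" using dc_cj[OF c i] dc_cj[OF c j] by auto
    then show ?thesis unfolding if_P[OF True] using d[of j] by (simp add: mult_ac)
  next
    case False
    show ?thesis unfolding if_not_P[OF False] by simp
  qed
  show "(rt m i j t * tor m c s) $$ (k, l) = (tor m c s * rt m i j (t * inverse (s powi rw m i j c))) $$ (k, l)"
    unfolding tor_dmat dmat_mult_entry[OF rt_carrier_mat kl] mult_dmat_entry[OF rt_carrier_mat kl]
    unfolding rt_def index_mat(1)[OF kl] prod.case e
    by (simp only: distrib_left distrib_right 1 2 3)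
qed (auto simp: tor_dim rt_dim)

text \<open>The \<open>k n\<close> are the divided powers of a root vector applied to
  \<open>f\<close>. A torus element rescales the parameter \<open>t\<close>, so comparing the
  coefficients of \<open>t ^ n\<close> shifts the weight by \<open>n\<close> times the root;
  comparing them for right multiplication by the Borel subgroup puts \<open>k n\<close> into the
  induced module.\<close>

lemma root_expansion:
  fixes f :: "'a::alg_closed_field mat \<Rightarrow> 'a"
  assumes f: "f \<in> Hw m r \<nu>" and r: "r \<le> m" and i: "i < 2*m" and j: "j < 2*m" and ij: "i \<noteq> j"
  shows "\<exists>M k. (\<forall>n. k n \<in> Hw m r (\<lambda>c. \<nu> c - int n * rw m i j c)) \<and>
    (\<forall>t. \<forall>g\<in>carrier (Sp m). f (rt m i j t * g) = (\<Sum>n\<le>M::nat. t ^ n * k n g)) \<and> k 0 = f"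
proof -
  have fi: "f \<in> ind m r" using f by (rule Hw_ind)
  obtain P where P: "P \<in> poly_funs (2*m)" "\<And>g. g \<in> carrier (Sp m) \<Longrightarrow> f g = P g"
    using ind_poly[OF fi] by blast
  have "(\<lambda>t g. P (rt m i j t * g)) \<in> fam UNIV (2*m)"
    by (rule poly_funs_poly_family[OF P(1)]) (simp_all add: rt_entry_poly)
  then obtain M Q where Q: "\<And>k. Q k \<in> poly_funs (2*m)"
    and Q': "\<forall>t\<in>UNIV. \<forall>g\<in>carrier_mat (2*m) (2*m). P (rt m i j t * g) = (\<Sum>k\<le>M::nat. t ^ k * Q k g)"
    unfolding fam_def by blast
  \<comment> \<open>Zero outside the group and above degree \<open>M\<close>, so that every
    \<open>k n\<close>, not only those up to \<open>M\<close>, belongs to the induced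
    module.\<close>
  define k where "k n g = (if g \<in> carrier (Sp m) \<and> n \<le> M then Q n g else 0)" for n g
  have fk: "f (rt m i j t * g) = (\<Sum>n\<le>M. t ^ n * k n g)" if g: "g \<in> carrier (Sp m)" for t g
  proof -
    have "f (rt m i j t * g) = (\<Sum>n\<le>M. t ^ n * Q n g)"
      using Q' Sp_carrier_mat[OF g] P(2)[OF rt_mult_Sp[OF g i j ij]] by simp
    also have "\<dots> = (\<Sum>n\<le>M. t ^ n * k n g)" by (intro sum.cong) (auto simp: k_def g)
    finally show ?thesis .
  qed
  have kind: "k n \<in> ind m r" for n
  proof (cases "n \<le> M")
    case True
    show ?thesis
    proof (rule indI[OF r Q[of n]])
      show "k n g = 0" if "g \<notin> carrier (Sp m)" for g using that by (simp add: k_def)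
      show "k n g = Q n g" if "g \<in> carrier (Sp m)" for g using that True by (simp add: k_def)
      fix g b :: "'a mat" assume g: "g \<in> carrier (Sp m)" and b: "b \<in> borel_neg m"
      note gb = Sp_mult[OF g borel_neg_Sp[OF b]]
      show "k n (g * b) = inverse (hchar r b) * k n g"
      proof (rule power_sum_coeffs_eq[OF _ True])
        fix t :: 'a
        have "(\<Sum>n\<le>M. t ^ n * k n (g * b)) = f (rt m i j t * g * b)"
          using fk[OF gb] Sp_assoc[OF rt_Sp[OF i j ij] g borel_neg_Sp[OF b], of t] by simp
        also have "\<dots> = inverse (hchar r b) * (\<Sum>n\<le>M. t ^ n * k n g)"
          using ind_semi[OF fi r rt_mult_Sp[OF g i j ij] b] fk[OF g] by simp
        finally show "(\<Sum>n\<le>M. t ^ n * k n (g * b)) = (\<Sum>n\<le>M. t ^ n * (inverse (hchar r b) * k n g))"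
          by (simp add: sum_distrib_left mult_ac)
      qed
    qed
  next
    case False
    then have "k n = (\<lambda>g. 0)" by (auto simp: k_def)
    then show ?thesis using ind_zero[OF r] by simp
  qed
  have "k n \<in> Hw m r (\<lambda>c. \<nu> c - int n * rw m i j c)" for n
    unfolding Hw_def
  proof (intro CollectI conjI kind allI impI ballI)
    fix c and s :: 'a and g :: "'a mat" assume c: "c < 2*m" and s: "s \<noteq> 0" and g: "g \<in> carrier (Sp m)"
    let ?d = "s powi rw m i j c"
    note tg = tor_mult_Sp[OF g c s]
    show "k n (tor m c s * g) = s powi (\<nu> c - int n * rw m i j c) * k n g"
    proof (cases "n \<le> M")
      case True
      have "k n (tor m c s * g) = s powi \<nu> c * inverse ?d ^ n * k n g"
      proof (rule power_sum_coeffs_eq[OF _ True])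
        fix t :: 'a
        have "rt m i j t * (tor m c s * g) = tor m c s * (rt m i j (t * inverse ?d) * g)"
          using Sp_assoc[OF rt_Sp[OF i j ij] tor_Sp[OF c s] g] Sp_assoc[OF tor_Sp[OF c s] rt_Sp[OF i j ij] g]
            tor_rt[OF c i j s, of t] by metis
        then have "(\<Sum>n\<le>M. t ^ n * k n (tor m c s * g)) = s powi \<nu> c * (\<Sum>n\<le>M. (t * inverse ?d) ^ n * k n g)"
          using fk[OF tg, of t] fk[OF g, of "t * inverse ?d"] Hw_tor[OF f c s rt_mult_Sp[OF g i j ij]] by simp
        also have "\<dots> = (\<Sum>n\<le>M. t ^ n * (s powi \<nu> c * inverse ?d ^ n * k n g))"
          unfolding sum_distrib_left by (intro sum.cong refl) (simp only: power_mult_distrib mult_ac)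
        finally show "(\<Sum>n\<le>M. t ^ n * k n (tor m c s * g)) = (\<Sum>n\<le>M. t ^ n * (s powi \<nu> c * inverse ?d ^ n * k n g))" .
      qed
      also have "s powi \<nu> c * inverse ?d ^ n = s powi (\<nu> c - int n * rw m i j c)"
      proof -
        have "inverse ?d ^ n = s powi (- (int n * rw m i j c))"
          by (simp add: power_int_minus power_inverse power_int_mult mult.commute[of "int n"])
        then show ?thesis using s by (simp add: power_int_add[symmetric])
      qed
      finally show ?thesis .
    qed (simp add: k_def)
  qed
  moreover have "k 0 = f"
  proof (rule ind_eqI[OF kind fi])
    fix g :: "'a mat" assume g: "g \<in> carrier (Sp m)"
    have "f g = (\<Sum>n\<le>M. 0 ^ n * k n g)" using fk[OF g, of 0] Sp_carrier_mat[OF g] by (simp add: rt_zero)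
    also have "\<dots> = k 0 g" by (simp add: power_0_left if_distrib[of "\<lambda>x. x * _"] cong: if_cong)
    finally show "k 0 g = f g" ..
  qed
  ultimately show ?thesis using fk by blast
qed

lemma root_invariant:
  fixes f :: "'a::alg_closed_field mat \<Rightarrow> 'a"
  assumes f: "f \<in> Hw m r \<nu>" and r: "r \<le> m" and i: "i < 2*m" and j: "j < 2*m" and ij: "i \<noteq> j"
    and no: "\<And>n h. n > 0 \<Longrightarrow> (h :: 'a mat \<Rightarrow> 'a) \<in> Hw m r (\<lambda>c. \<nu> c - int n * rw m i j c) \<Longrightarrow> h = 0"
    and g: "g \<in> carrier (Sp m)"
  shows "f (rt m i j t * g) = f g"
proof -
  obtain M k where k: "\<And>n. k n \<in> Hw m r (\<lambda>c. \<nu> c - int n * rw m i j c)"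
    "\<And>t g. g \<in> carrier (Sp m) \<Longrightarrow> f (rt m i j t * g) = (\<Sum>n\<le>M::nat. t ^ n * k n g)" "k 0 = f"
    using root_expansion[OF f r i j ij] by blast
  have z: "k n g = 0" if "n > 0" for n using no[OF that k(1)] by simp
  have "f (rt m i j t * g) = (\<Sum>n\<le>M. if n = 0 then f g else 0)"
    unfolding k(2)[OF g] by (intro sum.cong) (auto simp: z k(3))
  then show ?thesis by simp
qed

lemma Hw_zeroI:
  fixes h :: "'a::alg_closed_field mat \<Rightarrow> 'a"
  assumes h: "h \<in> Hw m r \<nu>" and r: "r \<le> m" and c: "c < 2*m" "\<bar>\<nu> c\<bar> > 1"
  shows "h = 0"
proof (rule ccontr)
  assume "h \<noteq> 0"
  then obtain g where "h g \<noteq> 0" by (auto simp: fun_eq_iff)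
  moreover from this have "g \<in> carrier (Sp m)" using ind_outside[OF Hw_ind[OF h]] by blast
  ultimately show False using weight_bound_single[OF h r _ _ c(1)] c(2) by fastforce
qed

text \<open>The first-order term of the root action, written as a difference of two translates; this
  form keeps submodules stable. The translate by the identity makes the function vanish outside the
  group.\<close>

definition rdiff :: "nat \<Rightarrow> nat \<Rightarrow> nat \<Rightarrow> ('a::field mat \<Rightarrow> 'a) \<Rightarrow> 'a mat \<Rightarrow> 'a" where
  "rdiff m a b f = (\<lambda>g. trl m (rt m a b 1) f g - trl m (1\<^sub>m (2*m)) f g)"

lemma rdiff_apply: "g \<in> carrier (Sp m) \<Longrightarrow> rdiff m a b f g = f (rt m a b 1 * g) - f g"
  using Sp_carrier_mat[of g m] by (simp add: rdiff_def trl_def)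

text \<open>A term of order \<open>n\<close> has entry \<open>- n\<close> at \<open>a\<close>, which
  the weight bound excludes for \<open>n > 1\<close>. So the expansion is linear in \<open>t\<close>
  and its slope is the value at parameter 1 minus that at 0.\<close>

lemma rdiff_weight:
  fixes f :: "'a::alg_closed_field mat \<Rightarrow> 'a"
  assumes f: "f \<in> Hw m r \<nu>" and r: "r \<le> m" and a: "a < m" "\<nu> a = 0" and b: "b < m" "\<nu> b = 0" and ab: "a \<noteq> b"
  shows "rdiff m a b f \<in> Hw m r (\<lambda>c. \<nu> c - rw m a b c)"
    and "g \<in> carrier (Sp m) \<Longrightarrow> f (rt m a b t * g) = f g + t * rdiff m a b f g"
proof -
  have ab2: "a < 2*m" "b < 2*m" using a b by auto
  obtain M k where k: "\<And>n. k n \<in> Hw m r (\<lambda>c. \<nu> c - int n * rw m a b c)"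
    "\<And>t g. g \<in> carrier (Sp m) \<Longrightarrow> f (rt m a b t * g) = (\<Sum>n\<le>M::nat. t ^ n * k n g)" "k 0 = f"
    using root_expansion[OF f r ab2 ab] by blast
  have z: "k n = 0" if "n > 1" for n
    by (rule Hw_zeroI[OF k(1) r ab2(1)]) (use that a b ab in \<open>auto simp: rw_def cj_def\<close>)
  \<comment> \<open>For \<open>M = 0\<close> the expansion has no linear term, and nothing is known
    about \<open>k 1\<close>.\<close>
  define k1 where "k1 = (if M = 0 then 0 else k 1)"
  have e: "f (rt m a b t * g) = f g + t * k1 g" if g: "g \<in> carrier (Sp m)" for t g
  proof (cases "M = 0")
    case True
    then show ?thesis using k(2)[OF g, of t] k(3) by (simp add: k1_def)
  next
    case False
    have "(\<Sum>n\<le>M. t ^ n * k n g) = (\<Sum>n\<in>{0, 1}. t ^ n * k n g)"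
      by (rule sum.mono_neutral_right) (use False z in auto)
    then show ?thesis using k(2)[OF g, of t] k(3) False by (simp add: k1_def)
  qed
  have "rdiff m a b f g = k1 g" for g
  proof (cases "g \<in> carrier (Sp m)")
    case True
    then show ?thesis using e[OF True, of 1] by (simp add: rdiff_apply)
  next
    case False
    then show ?thesis using ind_outside[OF Hw_ind[OF k(1)[of 1]]] by (simp add: rdiff_def trl_def k1_def)
  qed
  then have r1: "rdiff m a b f = k1" by blast
  show "f (rt m a b t * g) = f g + t * rdiff m a b f g" if "g \<in> carrier (Sp m)" using e[OF that] by (simp add: r1)
  have "(0 :: 'a mat \<Rightarrow> 'a) \<in> Hw m r \<mu>" for \<mu> using ind_zero[OF r] by (simp add: Hw_def zero_fun_def)
  then show "rdiff m a b f \<in> Hw m r (\<lambda>c. \<nu> c - rw m a b c)"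
    using k(1)[of 1] by (simp add: r1 k1_def)
qed

section \<open>Functions killed by the raising operators\<close>

text \<open>The effect of a root element on a single column. Products of root elements are compared
  by composing these maps.\<close>

definition rr :: "nat \<Rightarrow> nat \<Rightarrow> nat \<Rightarrow> 'a::field \<Rightarrow> (nat \<Rightarrow> 'a) \<Rightarrow> nat \<Rightarrow> 'a" where
  "rr m i j t u = (\<lambda>a. u a + (if a = i then t * u j else 0) +
     (if a = cj m j \<and> i \<noteq> cj m j then - (sg m i * sg m j * t) * u (cj m i) else 0))"

lemma rt_rr:
  assumes "g \<in> carrier_mat (2*m) (2*m)" "i < 2*m" "j < 2*m" "a < 2*m" "l < 2*m"
    and "\<And>b. b < 2*m \<Longrightarrow> g $$ (b, l) = u b"
  shows "(rt m i j t * g) $$ (a, l) = rr m i j t u a"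
  unfolding rt_mult_entry[OF assms(1-5)] rr_def using assms by simp

text \<open>A short root element performs two row operations, and either of them may be used to name
  it.\<close>

lemma rt_sym:
  assumes i: "i < 2*m" and j: "j < 2*m" and ij: "i \<noteq> cj m j"
  shows "rt m i j t = rt m (cj m j) (cj m i) (- (sg m i * sg m j * t))"
proof (rule eq_matI)
  have ji: "cj m j \<noteq> cj m (cj m i)" using ij i by auto
  have t: "- (sg m (cj m j) * sg m (cj m i) * - (sg m i * sg m j * t)) = t"
    using i j by (simp add: mult_ac)
  fix k l assume "k < dim_row (rt m (cj m j) (cj m i) (- (sg m i * sg m j * t)))"
    "l < dim_col (rt m (cj m j) (cj m i) (- (sg m i * sg m j * t)))"
  then have kl: "k < 2*m" "l < 2*m" by (auto simp: rt_dim)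
  show "rt m i j t $$ (k, l) = rt m (cj m j) (cj m i) (- (sg m i * sg m j * t)) $$ (k, l)"
    unfolding rt_def index_mat(1)[OF kl] prod.case t cj_cj[OF i] cj_cj[OF j]
    using ij ji i by (simp only: cj_cj add_ac simp_thms)
qed (simp_all add: rt_dim)

text \<open>The commutator for the roots \<open>\<epsilon>_i - \<epsilon>_j\<close> and
  \<open>\<epsilon>_j - \<epsilon>_k\<close>. It derives invariance under distant indices from
  neighbouring ones.\<close>

lemma commutator_short:
  assumes g: "g \<in> carrier_mat (2*m) (2*m)" and "i < m" "j < m" "k < m" "i \<noteq> j" "j \<noteq> k" "i \<noteq> k"
  shows "rt m i j t * (rt m j k 1 * (rt m i j (- t) * (rt m j k (- 1) * g))) = rt m i k t * g"
proof (rule eq_matI)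
  have lt: "i < 2*m" "j < 2*m" "k < 2*m" using assms by auto
  have nc: "i \<noteq> cj m j" "j \<noteq> cj m i" "j \<noteq> cj m k" "k \<noteq> cj m j" "i \<noteq> cj m k" "k \<noteq> cj m i"
    "i \<noteq> cj m i" "j \<noteq> cj m j" "k \<noteq> cj m k"
    using assms by (auto simp: cj_def)
  fix a l assume "a < dim_row (rt m i k t * g)" "l < dim_col (rt m i k t * g)"
  then have al: "a < 2*m" "l < 2*m" using g by (auto simp: rt_dim)
  let ?u = "\<lambda>b. g $$ (b, l)"
  note c = mult_square_mat[OF rt_carrier_mat g] mult_square_mat[OF rt_carrier_mat mult_square_mat[OF rt_carrier_mat g]]
    mult_square_mat[OF rt_carrier_mat mult_square_mat[OF rt_carrier_mat mult_square_mat[OF rt_carrier_mat g]]]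
  have 1: "(rt m i j t * (rt m j k 1 * (rt m i j (- t) * (rt m j k (- 1) * g)))) $$ (a, l)
    = rr m i j t (rr m j k 1 (rr m i j (- t) (rr m j k (- 1) ?u))) a"
    by (intro rt_rr c lt al g refl)
  have 2: "(rt m i k t * g) $$ (a, l) = rr m i k t ?u a"
    by (intro rt_rr lt al g refl)
  have sgm: "sg m i = (1::'a)" "sg m j = (1::'a)" "sg m k = (1::'a)" using assms by (auto simp: sg_def)
  have cc: "cj m i \<noteq> cj m j" "cj m j \<noteq> cj m i" "cj m k \<noteq> cj m j" "cj m j \<noteq> cj m k" "cj m i \<noteq> cj m k" "cj m k \<noteq> cj m i"
    using assms lt by auto
  have "rr m i j t (rr m j k 1 (rr m i j (- t) (rr m j k (- 1) u))) a = rr m i k t u a" for u :: "nat \<Rightarrow> 'a"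
  proof -
    consider "a = i" | "a = j" | "a = cj m j" | "a = cj m k" | "a \<noteq> i" "a \<noteq> j" "a \<noteq> cj m j" "a \<noteq> cj m k" by blast
    then show ?thesis
      using assms(5-7) nc nc[symmetric] cc
      by cases (simp_all add: rr_def sgm algebra_simps)
  qed
  then show "(rt m i j t * (rt m j k 1 * (rt m i j (- t) * (rt m j k (- 1) * g)))) $$ (a, l) = (rt m i k t * g) $$ (a, l)"
    unfolding 1 2 .
qed (use g in \<open>auto simp: rt_dim\<close>)

text \<open>The commutator for a short root and the long root \<open>2 \<epsilon>_j\<close>. It
  produces \<open>\<epsilon>_i + \<epsilon>_j\<close> only together with
  \<open>2 \<epsilon>_i\<close>, so the latter root must be handled beforehand.\<close>

lemma commutator_long:
  assumes g: "g \<in> carrier_mat (2*m) (2*m)" and "i < m" "j < m" "i \<noteq> j"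
  shows "rt m i j t * (rt m j (cj m j) 1 * (rt m i j (- t) * (rt m j (cj m j) (- 1) * g)))
    = rt m i (cj m i) (t * t) * (rt m i (cj m j) t * g)"
proof (rule eq_matI)
  have lt: "i < 2*m" "j < 2*m" "cj m i < 2*m" "cj m j < 2*m" using assms by auto
  have nc: "i \<noteq> cj m j" "j \<noteq> cj m i" "i \<noteq> cj m i" "j \<noteq> cj m j"
    using assms by (auto simp: cj_def)
  fix a l assume "a < dim_row (rt m i (cj m i) (t * t) * (rt m i (cj m j) t * g))"
    "l < dim_col (rt m i (cj m i) (t * t) * (rt m i (cj m j) t * g))"
  then have al: "a < 2*m" "l < 2*m" using g by (auto simp: rt_dim)
  let ?u = "\<lambda>b. g $$ (b, l)"
  note c = mult_square_mat[OF rt_carrier_mat g] mult_square_mat[OF rt_carrier_mat mult_square_mat[OF rt_carrier_mat g]]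
    mult_square_mat[OF rt_carrier_mat mult_square_mat[OF rt_carrier_mat mult_square_mat[OF rt_carrier_mat g]]]
  have 1: "(rt m i j t * (rt m j (cj m j) 1 * (rt m i j (- t) * (rt m j (cj m j) (- 1) * g)))) $$ (a, l)
    = rr m i j t (rr m j (cj m j) 1 (rr m i j (- t) (rr m j (cj m j) (- 1) ?u))) a"
    by (intro rt_rr c lt al g refl)
  have 2: "(rt m i (cj m i) (t * t) * (rt m i (cj m j) t * g)) $$ (a, l) = rr m i (cj m i) (t * t) (rr m i (cj m j) t ?u) a"
    by (intro rt_rr c lt al g refl)
  have sgm: "sg m i = (1::'a)" "sg m j = (1::'a)" "sg m (cj m j) = (- 1::'a)" "sg m (cj m i) = (- 1::'a)"
    using assms lt by (auto simp: sg_def cj_def)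
  have cc: "cj m i \<noteq> cj m j" "cj m j \<noteq> cj m i" "cj m (cj m i) = i" "cj m (cj m j) = j"
    using assms lt by auto
  have "rr m i j t (rr m j (cj m j) 1 (rr m i j (- t) (rr m j (cj m j) (- 1) u))) a
      = rr m i (cj m i) (t * t) (rr m i (cj m j) t u) a" for u :: "nat \<Rightarrow> 'a"
  proof -
    consider "a = i" | "a = j" | "a = cj m j" | "a = cj m i" | "a \<noteq> i" "a \<noteq> j" "a \<noteq> cj m j" "a \<noteq> cj m i" by blast
    then show ?thesis
      using assms(4) nc nc[symmetric] cc
      by cases (simp_all add: rr_def sgm algebra_simps)
  qed
  then show "(rt m i j t * (rt m j (cj m j) 1 * (rt m i j (- t) * (rt m j (cj m j) (- 1) * g)))) $$ (a, l)
    = (rt m i (cj m i) (t * t) * (rt m i (cj m j) t * g)) $$ (a, l)"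
    unfolding 1 2 .
qed (use g in \<open>auto simp: rt_dim\<close>)

lemma rdiff_outside: "g \<notin> carrier (Sp m) \<Longrightarrow> rdiff m a b f g = 0"
  by (simp add: rdiff_def trl_def)

lemma rdiff_eq_0:
  assumes "\<And>g. g \<in> carrier (Sp m) \<Longrightarrow> f (rt m a b 1 * g) = f g"
  shows "rdiff m a b f = 0"
proof
  fix g show "rdiff m a b f g = 0 g"
    using rdiff_outside[of g m a b f] rdiff_apply[of g m a b f] assms[of g] by (cases "g \<in> carrier (Sp m)") auto
qed

text \<open>\<open>F\<close> turns out to be invariant under every positive root element. For roots
  that would push an entry below -1 this is automatic; the roots
  \<open>\<epsilon>_i - \<epsilon>_j\<close> on the zero entries come from \<open>adj\<close>, and
  the sums \<open>\<epsilon>_i + \<epsilon>_j\<close> from commutators. On the big cell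
  \<open>F\<close> is then determined by its value at the identity.\<close>

lemma highest_weight_vanishing:
  fixes F :: "'a::alg_closed_field mat \<Rightarrow> 'a"
  assumes F: "F \<in> Hw m r \<mu>" and r: "r \<le> m"
    and neg: "\<And>i. i < s \<Longrightarrow> \<mu> i = - 1" and zero: "\<And>i. s \<le> i \<Longrightarrow> i < m \<Longrightarrow> \<mu> i = 0"
    and adj: "\<And>i g. s \<le> i \<Longrightarrow> Suc i < m \<Longrightarrow> g \<in> carrier (Sp m) \<Longrightarrow> F (rt m i (Suc i) 1 * g) = F g"
    and one: "F (1\<^sub>m (2*m)) = 0"
  shows "F = 0"
proof -
  define I where "I i j \<longleftrightarrow> (\<forall>t. \<forall>g\<in>carrier (Sp m). F (rt m i j t * g) = F g)" for i j
  \<comment> \<open>All terms of positive order have an entry below -1 at the witness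
    \<open>c\<close>, hence are zero.\<close>
  have big: "I i j" if ij: "i < 2*m" "j < 2*m" "i \<noteq> j" and c: "c < 2*m" "\<mu> c \<le> 0" "rw m i j c \<ge> 1" "\<mu> c - rw m i j c < - 1" for i j c
    unfolding I_def
  proof (intro allI ballI)
    fix t and g :: "'a mat" assume g: "g \<in> carrier (Sp m)"
    show "F (rt m i j t * g) = F g"
    proof (rule root_invariant[OF F r ij _ g])
      fix n :: nat and h :: "'a mat \<Rightarrow> 'a"
      assume n: "n > 0" and h: "h \<in> Hw m r (\<lambda>c. \<mu> c - int n * rw m i j c)"
      have "rw m i j c \<le> int n * rw m i j c" using n c(3) by (simp add: mult_le_cancel_right1)
      then have "\<bar>\<mu> c - int n * rw m i j c\<bar> > 1" using c by linarith
      then show "h = 0" by (rule Hw_zeroI[OF h r c(1)])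
    qed
  qed
  have short: "I i j" if "i < j" "j < m" for i j
  proof (cases "i < s")
    case True
    then show ?thesis using that neg[OF True] by (intro big[of i j i]) (auto simp: rw_def cj_def)
  next
    case False
    have "Suc i \<le> j \<Longrightarrow> j < m \<longrightarrow> I i j"
    proof (induction j rule: dec_induct)
      case base
      show ?case
      proof
        assume m: "Suc i < m"
        \<comment> \<open>The hypothesis covers only the parameter 1, but the dependence on the
          parameter is linear with slope \<open>rdiff\<close>.\<close>
        have z: "rdiff m i (Suc i) F = 0" using adj[of i] False m by (intro rdiff_eq_0) auto
        show "I i (Suc i)"
          unfolding I_def using rdiff_weight(2)[OF F r, of i "Suc i"] zero[of i] zero[of "Suc i"] False m by (simp add: z)
      qed
    next
      case (step k)
      show ?case
      proof
        assume k: "Suc k < m"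
        then have ik: "I i k" using step by simp
        have kk: "I k (Suc k)"
        proof -
          have z: "rdiff m k (Suc k) F = 0" using adj[of k] False k step(1) by (intro rdiff_eq_0) auto
          show ?thesis
            unfolding I_def using rdiff_weight(2)[OF F r, of k "Suc k"] zero[of k] zero[of "Suc k"] False k step(1) by (simp add: z)
        qed
        show "I i (Suc k)"
          unfolding I_def
        proof (intro allI ballI)
          fix t and g :: "'a mat" assume g: "g \<in> carrier (Sp m)"
          have lt: "i < 2*m" "k < 2*m" "Suc k < 2*m" "i \<noteq> k" "k \<noteq> Suc k" using step k by auto
          note S = rt_mult_Sp[OF _ lt(1,2,4)] rt_mult_Sp[OF _ lt(2,3,5)]
          have "F (rt m i (Suc k) t * g) = F (rt m i k t * (rt m k (Suc k) 1 * (rt m i k (- t) * (rt m k (Suc k) (- 1) * g))))"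
            using step k by (subst commutator_short[OF Sp_carrier_mat[OF g]]) auto
          also have "\<dots> = F g"
            by (simp add: ik[unfolded I_def, rule_format] kk[unfolded I_def, rule_format] S g)
          finally show "F (rt m i (Suc k) t * g) = F g" .
        qed
      qed
    qed
    then show ?thesis using that by simp
  qed
  have diag: "I i (cj m i)" if "i < m" for i
    using that neg[of i] zero[of i] by (intro big[of i "cj m i" i]) (cases "i < s"; auto simp: rw_def)+
  have long': "I i (cj m j)" if ij: "i < j" "j < m" for i j
  proof (cases "i < s")
    case True
    have "i \<noteq> cj m j" using ij by (auto simp: cj_def)
    then show ?thesis using ij neg[OF True] by (intro big[of i "cj m j" i]) (auto simp: rw_def cj_def)
  next
    case False
    have lt: "i < 2*m" "j < 2*m" "cj m i < 2*m" "cj m j < 2*m" "i \<noteq> j" "i \<noteq> cj m i" "j \<noteq> cj m j" "i \<noteq> cj m j"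
      using ij by (auto simp: cj_def)
    have d: "I i (cj m i)" "I j (cj m j)" using diag ij by auto
    show ?thesis
      unfolding I_def
    proof (intro allI ballI)
      fix t and g :: "'a mat" assume g: "g \<in> carrier (Sp m)"
      note S = rt_mult_Sp[OF _ lt(1,2,5)] rt_mult_Sp[OF _ lt(2,4,7)] rt_mult_Sp[OF _ lt(1,3,6)] rt_mult_Sp[OF _ lt(1,4,8)]
      \<comment> \<open>The long root factor is inserted for free, since invariance under
        \<open>2 \<epsilon>_i\<close> is known already; the product is then a commutator of elements
        under which \<open>F\<close> is invariant.\<close>
      have "F (rt m i (cj m j) t * g) = F (rt m i (cj m i) (t * t) * (rt m i (cj m j) t * g))"
        by (simp add: d[unfolded I_def, rule_format] S g)
      also have "\<dots> = F (rt m i j t * (rt m j (cj m j) 1 * (rt m i j (- t) * (rt m j (cj m j) (- 1) * g))))"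
        using ij by (subst commutator_long[OF Sp_carrier_mat[OF g]]) auto
      also have "\<dots> = F g"
        by (simp add: d[unfolded I_def, rule_format] short[OF ij, unfolded I_def, rule_format] S g)
      finally show "F (rt m i (cj m j) t * g) = F g" .
    qed
  qed
  have sym: "I i j" if "I (cj m j) (cj m i)" "i < 2*m" "j < 2*m" "i \<noteq> cj m j" for i j
    using that(1) unfolding I_def by (subst rt_sym[OF that(2-4)]) blast
  have all: "I i j" if ij: "i < j" "j < 2*m" for i j
  proof -
    consider "j < m" | "i < m" "\<not> j < m" | "\<not> i < m" by blast
    then show ?thesis
    proof cases
      case 1
      then show ?thesis using short ij by simp
    next
      case 2
      let ?j = "cj m j"
      have j: "?j < m" "cj m ?j = j" using 2 ij by (auto simp: cj_def)
      consider "i = ?j" | "i < ?j" | "?j < i" by linarith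
      then show ?thesis
      proof cases
        case 1
        then show ?thesis using diag[OF 2(1)] j by metis
      next
        case 2
        then show ?thesis using long'[OF 2 j(1)] j by simp
      next
        case 3
        have i2: "i < 2*m" "i \<noteq> cj m j" using 2(1) 3 by linarith+
        show ?thesis by (rule sym[OF long'[OF 3 2(1)] i2(1) ij(2) i2(2)])
      qed
    next
      case 3
      have c: "cj m j < cj m i" "cj m i < m" "i \<noteq> cj m j" "i < 2*m" using 3 ij by (auto simp: cj_def)
      show ?thesis by (rule sym[OF short[OF c(1,2)] c(4) ij(2) c(3)])
    qed
  qed
  have U: "\<forall>g\<in>carrier (Sp m). F (u * g) = F g" if "u \<in> Upos m" for u
    using that
  proof induction
    case one
    then show ?case using Sp_carrier_mat by fastforce
  next
    case (rt i j u t)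
    have lt: "i < 2*m" "i \<noteq> j" using rt by auto
    show ?case
    proof
      fix g :: "'a mat" assume g: "g \<in> carrier (Sp m)"
      have "rt m i j t * u * g = rt m i j t * (u * g)"
        by (rule Sp_assoc[OF rt_Sp[OF lt(1) rt(2) lt(2)] Upos_Sp[OF rt(3)] g])
      then show "F (rt m i j t * u * g) = F g"
        using all[OF rt(1,2)] rt.IH Sp_mult[OF Upos_Sp[OF rt(3)] g] g unfolding I_def by simp
    qed
  qed
  have "F g = 0" for g
  proof (rule ind_vanish[OF Hw_ind[OF F]])
    fix u b :: "'a mat" assume u: "u \<in> Upos m" and b: "b \<in> borel_neg m"
    have "F (u * b) = F (1\<^sub>m (2*m) * b)"
      using U[OF u] borel_neg_Sp[OF b] left_mult_one_mat[OF borel_neg_carrier_mat[OF b]] by simp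
    then show "F (u * b) = 0" using ind_semi[OF Hw_ind[OF F] r Sp_one b] one by simp
  qed
  then show ?thesis by auto
qed

lemma hchar_tor: "i < r \<Longrightarrow> r \<le> m \<Longrightarrow> hchar r (tor m i s) = s"
proof -
  assume i: "i < r" and r: "r \<le> m"
  have "hchar r (tor m i s) = (\<Prod>k<r. if k = i then s else 1)"
    unfolding hchar_def using i r by (intro prod.cong) (auto simp: tor_def cj_def)
  then show ?thesis using i by simp
qed

text \<open>Translating by the Weyl group element of \<open>l\<close> moves the entries -1 to the
  front and turns the raising operators for consecutive members of \<open>l\<close> into those for
  neighbouring indices.\<close>

theorem raising_injective:
  fixes f :: "'a::alg_closed_field mat \<Rightarrow> 'a"
  assumes f: "f \<in> Hw m r \<nu>" and r: "r \<le> m" and l: "iso_list m l" "length l = m" and s: "s \<le> m"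
    and neg: "\<And>i. i < s \<Longrightarrow> \<nu> (l ! i) = - 1"
    and zero: "\<And>i. s \<le> i \<Longrightarrow> i < m \<Longrightarrow> l ! i < m \<and> \<nu> (l ! i) = 0"
    and adj: "\<And>i g. s \<le> i \<Longrightarrow> Suc i < m \<Longrightarrow> g \<in> carrier (Sp m) \<Longrightarrow> f (rt m (l ! i) (l ! Suc i) 1 * g) = f g"
    and one: "s < r \<or> f (frm m l) = 0"
  shows "f = 0"
proof -
  note W = frm_Sp[OF l]
  let ?F = "trl m (frm m l) f"
  let ?\<mu> = "wext m (\<lambda>i. \<nu> (l ! i))"
  have F: "?F \<in> Hw m r ?\<mu>"
    by (rule hom_upto_Hw[OF trl_frm_Hw(1)[OF f r l]]) (simp add: hom_upto_def trl_frm_Hw(2)[OF f r l])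
  have "?F = 0"
  proof (rule highest_weight_vanishing[OF F r])
    show "?\<mu> i = - 1" if "i < s" for i using neg[OF that] that s by (simp add: wext_def)
    show "?\<mu> i = 0" if "s \<le> i" "i < m" for i using zero[OF that] that by (simp add: wext_def)
    show "?F (rt m i (Suc i) 1 * g) = ?F g" if i: "s \<le> i" "Suc i < m" and g: "g \<in> carrier (Sp m)" for i g
    proof -
      have lt: "i < m" "l ! i < m" "Suc i < m" "l ! Suc i < m" "i \<noteq> Suc i" using i zero by auto
      have lt2: "i < 2*m" "Suc i < 2*m" "l ! i < 2*m" "l ! Suc i < 2*m" using lt by auto
      have ne: "l ! i \<noteq> l ! Suc i"
        using fperm_props(3)[OF l lt2(1,2)] lt by (simp add: fperm_def)
      have "frm m l * (rt m i (Suc i) 1 * g) = rt m (l ! i) (l ! Suc i) 1 * (frm m l * g)"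
        using Sp_assoc[OF W rt_Sp[OF lt2(1,2) lt(5)] g] Sp_assoc[OF rt_Sp[OF lt2(3,4) ne] W g]
          rt_frm[OF l lt, of 1] by metis
      then show ?thesis
        using adj[OF i Sp_mult[OF W g]] rt_mult_Sp[OF g lt2(1,2) lt(5)] g by (simp add: trl_def)
    qed
    show "?F (1\<^sub>m (2*m)) = 0"
    proof (cases "s < r")
      case True
      have s2: "s < 2*m" "s < m" using True r by auto
      have sep0: "sep \<noteq> (0::'a)" "sep \<noteq> (1::'a)" using sep by auto
      \<comment> \<open>A torus element may be applied to the identity from either side. On the left
        it acts by the weight, which is 0 at \<open>s\<close>; on the right semi-invariance gives
        the factor \<open>inverse sep\<close>, as \<open>s < r\<close>. So the value at the identity
        is 0.\<close>
      have "?F (tor m s sep * 1\<^sub>m (2*m)) = sep powi ?\<mu> s * ?F (1\<^sub>m (2*m))"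
        by (rule Hw_tor[OF F s2(1) sep0(1) Sp_one])
      moreover have "?\<mu> s = 0" using zero[of s] s2 by (simp add: wext_def)
      moreover have "?F (1\<^sub>m (2*m) * tor m s sep) = inverse (hchar r (tor m s sep)) * ?F (1\<^sub>m (2*m))"
        by (rule ind_semi[OF Hw_ind[OF F] r Sp_one tor_borel[OF s2(1) sep0(1)]])
      ultimately have "?F (1\<^sub>m (2*m)) = inverse sep * ?F (1\<^sub>m (2*m))"
        by (simp add: hchar_tor[OF True r] left_mult_one_mat[OF tor_carrier_mat] right_mult_one_mat[OF tor_carrier_mat])
      then have "(sep - 1) * ?F (1\<^sub>m (2*m)) = 0" using sep0 by (simp add: field_simps)
      then show ?thesis using sep0 by simp
    next
      case False
      then show ?thesis using one by (simp add: trl_apply[OF Sp_one] right_mult_one_mat[OF frm_carrier])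
    qed
  qed
  have "f g = 0" for g
  proof (cases "g \<in> carrier (Sp m)")
    case True
    have "f (frm m l * (inv\<^bsub>Sp m\<^esub> (frm m l) * g)) = ?F (inv\<^bsub>Sp m\<^esub> (frm m l) * g)"
      using Sp_mult[OF Sp_inv(1)[OF W] True] by (simp add: trl_def)
    then show ?thesis using \<open>?F = 0\<close> Sp_inv_cancel(1)[OF W True] by simp
  qed (rule ind_outside[OF Hw_ind[OF f]])
  then show ?thesis by auto
qed

section \<open>Minors\<close>

text \<open>The determinant as a function of its list of rows, so that multilinearity can be applied
  at any place \<open>xs @ u # ys\<close>.\<close>

definition rdet :: "nat \<Rightarrow> (nat \<Rightarrow> 'a::field) list \<Rightarrow> 'a" where
  "rdet r us = det (mat r r (\<lambda>(i, k). (us ! i) k))"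

lemma rdet_sum: "rdet r us = (\<Sum>p | p permutes {0..<r}. signof p * (\<Prod>i=0..<r. (us ! i) (p i)))"
proof -
  have "(\<Prod>i=0..<r. mat r r (\<lambda>(i, k). (us ! i) k) $$ (i, p i)) = (\<Prod>i=0..<r. (us ! i) (p i))"
    if "p permutes {0..<r}" for p
    using that permutes_in_image[OF that] by (intro prod.cong) auto
  then show ?thesis unfolding rdet_def det_def by (auto intro!: sum.cong)
qed

lemma rdet_cong: "(\<And>i k. i < r \<Longrightarrow> k < r \<Longrightarrow> (us ! i) k = (vs ! i) k) \<Longrightarrow> rdet r us = rdet r vs"
  unfolding rdet_def by (rule arg_cong[of _ _ det]) (rule eq_matI; simp)

lemma rdet_add:
  assumes r: "r = length xs + Suc (length ys)"
  shows "rdet r (xs @ (\<lambda>k. u k + v k) # ys) = rdet r (xs @ u # ys) + rdet r (xs @ v # ys)"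
proof -
  let ?n = "length xs"
  have n: "?n \<in> {0..<r}" using r by simp
  have split: "(\<Prod>i=0..<r. ((xs @ w # ys) ! i) (p i)) = w (p ?n) * (\<Prod>i\<in>{0..<r} - {?n}. ((xs @ u # ys) ! i) (p i))" for w p
  proof -
    have "(\<Prod>i=0..<r. ((xs @ w # ys) ! i) (p i)) = w (p ?n) * (\<Prod>i\<in>{0..<r} - {?n}. ((xs @ w # ys) ! i) (p i))"
      using n by (subst prod.remove[of _ ?n]) auto
    also have "(\<Prod>i\<in>{0..<r} - {?n}. ((xs @ w # ys) ! i) (p i)) = (\<Prod>i\<in>{0..<r} - {?n}. ((xs @ u # ys) ! i) (p i))"
      by (intro prod.cong) (auto simp: nth_append nth_Cons')
    finally show ?thesis .
  qed
  show ?thesis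
    unfolding rdet_sum split by (simp add: sum.distrib[symmetric] algebra_simps)
qed

lemma rdet_scale:
  assumes r: "r = length xs + Suc (length ys)"
  shows "rdet r (xs @ (\<lambda>k. c * u k) # ys) = c * rdet r (xs @ u # ys)"
proof -
  let ?n = "length xs"
  have n: "?n \<in> {0..<r}" using r by simp
  have split: "(\<Prod>i=0..<r. ((xs @ w # ys) ! i) (p i)) = w (p ?n) * (\<Prod>i\<in>{0..<r} - {?n}. ((xs @ u # ys) ! i) (p i))" for w p
  proof -
    have "(\<Prod>i=0..<r. ((xs @ w # ys) ! i) (p i)) = w (p ?n) * (\<Prod>i\<in>{0..<r} - {?n}. ((xs @ w # ys) ! i) (p i))"
      using n by (subst prod.remove[of _ ?n]) auto
    also have "(\<Prod>i\<in>{0..<r} - {?n}. ((xs @ w # ys) ! i) (p i)) = (\<Prod>i\<in>{0..<r} - {?n}. ((xs @ u # ys) ! i) (p i))"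
      by (intro prod.cong) (auto simp: nth_append nth_Cons')
    finally show ?thesis .
  qed
  show ?thesis
    unfolding rdet_sum split by (simp add: sum_distrib_left algebra_simps)
qed

lemma rdet_repeat:
  assumes "i < r" "j < r" "i \<noteq> j" "us ! i = us ! j"
  shows "rdet r us = 0"
  unfolding rdet_def
  by (rule det_identical_rows[of _ r i j]) (use assms in \<open>auto intro!: eq_vecI\<close>)

text \<open>Expanding the determinant with the row \<open>u + v\<close> in both places: all terms
  with equal rows vanish, which also covers characteristic 2.\<close>

lemma rdet_swap:
  assumes r: "r = length xs + Suc (Suc (length ys))"
  shows "rdet r (xs @ u # v # ys) = - rdet r (xs @ v # u # ys)"
proof -
  let ?w = "\<lambda>k. u k + v k"
  have rep: "rdet r (xs @ w # w # ys) = 0" for w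
    by (rule rdet_repeat[of "length xs" _ "Suc (length xs)"]) (use r in \<open>auto simp: nth_append\<close>)
  have first: "rdet r (xs @ ?w # w # ys) = rdet r (xs @ u # w # ys) + rdet r (xs @ v # w # ys)" for w
    by (rule rdet_add) (use r in simp)
  have second: "rdet r (xs @ w # ?w # ys) = rdet r (xs @ w # u # ys) + rdet r (xs @ w # v # ys)" for w
    using rdet_add[of r "xs @ [w]" ys u v] r by simp
  have "0 = rdet r (xs @ ?w # ?w # ys)" by (simp add: rep)
  also have "\<dots> = rdet r (xs @ u # v # ys) + rdet r (xs @ v # u # ys)"
    by (simp add: first second rep)
  finally show ?thesis by (simp add: eq_neg_iff_add_eq_0)
qed

lemma rdet_swap_pairs:
  assumes r: "r = length xs + Suc (Suc (Suc (Suc (length ys))))"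
  shows "rdet r (xs @ a # b # c # d # ys) = rdet r (xs @ c # d # a # b # ys)"
proof -
  have "rdet r (xs @ a # b # c # d # ys) = - rdet r (xs @ a # c # b # d # ys)"
    using rdet_swap[of r "xs @ [a]" "d # ys" b c] r by simp
  also have "rdet r (xs @ a # c # b # d # ys) = - rdet r (xs @ c # a # b # d # ys)"
    by (rule rdet_swap) (use r in simp)
  also have "rdet r (xs @ c # a # b # d # ys) = - rdet r (xs @ c # a # d # b # ys)"
    using rdet_swap[of r "xs @ [c, a]" ys b d] r by simp
  also have "rdet r (xs @ c # a # d # b # ys) = - rdet r (xs @ c # d # a # b # ys)"
    using rdet_swap[of r "xs @ [c]" "b # ys" a d] r by simp
  finally show ?thesis by simp
qed

section \<open>Minors in the last \<open>r\<close> columns as elements of the induced module\<close>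

definition mrow :: "nat \<Rightarrow> nat \<Rightarrow> 'a::field mat \<Rightarrow> nat \<Rightarrow> nat \<Rightarrow> 'a" where
  "mrow m r g x = (\<lambda>k. g $$ (x, 2*m - r + k))"

definition mdet :: "nat \<Rightarrow> nat \<Rightarrow> nat list \<Rightarrow> 'a::field mat \<Rightarrow> 'a" where
  "mdet m r l g = rdet r (map (mrow m r g) l)"

definition mfun :: "nat \<Rightarrow> nat \<Rightarrow> nat list \<Rightarrow> 'a::field mat \<Rightarrow> 'a" where
  "mfun m r l = (\<lambda>g. if g \<in> carrier (Sp m) then mdet m r l g else 0)"

lemma mdet_poly_funs:
  assumes "set l \<subseteq> {..<2*m}" "length l = r" "r \<le> m"
  shows "mdet m r l \<in> poly_funs (2*m)"
proof -
  have e: "mdet m r l = (\<lambda>g. \<Sum>p | p permutes {0..<r}. signof p * (\<Prod>i=0..<r. g $$ (l ! i, 2*m - r + p i)))"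
    using assms unfolding mdet_def rdet_sum mrow_def by (auto intro!: ext sum.cong prod.cong)
  have "l ! i < 2*m" if "i < r" for i using assms that nth_mem[of i l] by blast
  moreover have "2*m - r + p i < 2*m" if "p permutes {0..<r}" "i < r" for p i
  proof -
    have "p i < r" using permutes_in_image[OF that(1), of i] that by simp
    then show ?thesis using assms(3) by linarith
  qed
  ultimately show ?thesis
    unfolding e by (intro poly_funs_sum poly_funs_cmult poly_funs_prod poly_funs.coord) auto
qed

lemma borel_neg_diag:
  fixes b :: "'a::field mat"
  assumes b: "b \<in> borel_neg m" and i: "i < 2*m"
  shows "b $$ (i, i) * b $$ (cj m i, cj m i) = 1"
proof -
  have "bform m (\<lambda>a. b $$ (a, i)) (\<lambda>a. b $$ (a, cj m i)) = sg m i"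
    using borel_neg_Sp[OF b] i unfolding Sp_iff by simp
  moreover have "bform m (\<lambda>a. b $$ (a, i)) (\<lambda>a. b $$ (a, cj m i))
      = (\<Sum>a<2*m. if a = i then sg m i * (b $$ (i, i) * b $$ (cj m i, cj m i)) else 0)"
    unfolding bform_def
  proof (intro sum.cong refl)
    fix a assume "a \<in> {..<2*m}"
    then have a: "a < 2*m" by simp
    consider "a = i" | "a < i" | "i < a" by linarith
    then show "sg m a * b $$ (a, i) * b $$ (cj m a, cj m i) = (if a = i then sg m i * (b $$ (i, i) * b $$ (cj m i, cj m i)) else 0)"
    proof cases
      case 2
      then have "b $$ (a, i) = 0" using b a i by (simp add: borel_neg_def)
      then show ?thesis using 2 by simp
    next
      case 3
      then have "cj m a < cj m i" using a i by (simp add: cj_less_iff)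
      then have "b $$ (cj m a, cj m i) = 0" using b a i by (simp add: borel_neg_def)
      then show ?thesis using 3 by simp
    qed simp
  qed
  ultimately have "sg m i * (b $$ (i, i) * b $$ (cj m i, cj m i)) = sg m i" using i by simp
  moreover have "sg m i \<noteq> (0::'a)" by (simp add: sg_def)
  ultimately show ?thesis by simp
qed

text \<open>As \<open>b\<close> is lower triangular, the last \<open>r\<close> columns of
  \<open>g * b\<close> involve only the last \<open>r\<close> columns of \<open>g\<close>, and the
  minor is multiplied by the determinant of the lower right block of \<open>b\<close>. Its diagonal
  entries are the inverses of the first \<open>r\<close> diagonal entries.\<close>

lemma mdet_borel:
  fixes g b :: "'a::field mat"
  assumes l: "set l \<subseteq> {..<2*m}" "length l = r" "r \<le> m" and g: "g \<in> carrier_mat (2*m) (2*m)" and b: "b \<in> borel_neg m"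
  shows "mdet m r l (g * b) = inverse (hchar r b) * mdet m r l g"
proof -
  let ?n = "2*m - r"
  have bc: "b \<in> carrier_mat (2*m) (2*m)" by (rule borel_neg_carrier_mat[OF b])
  have low: "b $$ (i, j) = 0" if "i < j" "j < 2*m" for i j using b that by (simp add: borel_neg_def)
  define N where "N = mat r r (\<lambda>(i, k). b $$ (?n + i, ?n + k))"
  define G where "G = mat r r (\<lambda>(i, k). g $$ (l ! i, ?n + k))"
  have GN: "G \<in> carrier_mat r r" "N \<in> carrier_mat r r" by (auto simp: G_def N_def)
  have md: "mdet m r l h = det (mat r r (\<lambda>(i, k). h $$ (l ! i, ?n + k)))" for h :: "'a mat"
    unfolding mdet_def rdet_def using l by (intro arg_cong[of _ _ det] eq_matI) (auto simp: mrow_def)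
  have "mat r r (\<lambda>(i, k). (g * b) $$ (l ! i, ?n + k)) = G * N"
  proof (rule eq_matI)
    fix i k assume "i < dim_row (G * N)" "k < dim_col (G * N)"
    then have ik: "i < r" "k < r" by (auto simp: G_def N_def)
    have li: "l ! i < 2*m" using l ik nth_mem[of i l] by blast
    have nk: "?n + k < 2*m" using ik l(3) by simp
    have "(g * b) $$ (l ! i, ?n + k) = (\<Sum>a<2*m. g $$ (l ! i, a) * b $$ (a, ?n + k))"
      by (rule mult_entry[OF g bc li nk])
    also have "\<dots> = (\<Sum>a\<in>{?n..<2*m}. g $$ (l ! i, a) * b $$ (a, ?n + k))"
    proof (rule sum.mono_neutral_right)
      show "\<forall>a\<in>{..<2*m} - {?n..<2*m}. g $$ (l ! i, a) * b $$ (a, ?n + k) = 0"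
      proof
        fix a assume "a \<in> {..<2*m} - {?n..<2*m}"
        then have "b $$ (a, ?n + k) = 0" using nk by (intro low) auto
        then show "g $$ (l ! i, a) * b $$ (a, ?n + k) = 0" by simp
      qed
    qed auto
    also have "\<dots> = (\<Sum>j<r. g $$ (l ! i, ?n + j) * b $$ (?n + j, ?n + k))"
      by (rule sum.reindex_bij_witness[of _ "\<lambda>j. ?n + j" "\<lambda>a. a - ?n"]) (use l(3) in auto)
    also have "\<dots> = (G * N) $$ (i, k)"
      unfolding mult_entry[OF GN ik] using ik by (simp add: G_def N_def)
    finally show "mat r r (\<lambda>(i, k). (g * b) $$ (l ! i, ?n + k)) $$ (i, k) = (G * N) $$ (i, k)"
      using ik by simp
  qed (auto simp: G_def N_def)
  then have "mdet m r l (g * b) = det G * det N"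
    unfolding md using det_mult[OF GN] by simp
  moreover have "det G = mdet m r l g" unfolding md G_def ..
  moreover have "det N = inverse (hchar r b)"
  proof -
    have "det N = prod_list (diag_mat N)"
      by (rule det_lower_triangular[OF _ GN(2)]) (use l(3) in \<open>auto simp: N_def intro!: low\<close>)
    also have "\<dots> = (\<Prod>i<r. b $$ (?n + i, ?n + i))"
      by (simp add: prod_list_diag_prod N_def atLeast0LessThan)
    also have "\<dots> = (\<Prod>i<r. b $$ (cj m i, cj m i))"
      by (rule prod.reindex_bij_witness[of _ "\<lambda>i. r - 1 - i" "\<lambda>i. r - 1 - i"]) (use l(3) in \<open>auto simp: cj_def\<close>)
    also have "\<dots> = (\<Prod>i<r. inverse (b $$ (i, i)))"
    proof (intro prod.cong refl)
      fix i assume "i \<in> {..<r}"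
      then have "b $$ (i, i) * b $$ (cj m i, cj m i) = 1" using l(3) by (intro borel_neg_diag[OF b]) auto
      then show "b $$ (cj m i, cj m i) = inverse (b $$ (i, i))" by (metis inverse_unique)
    qed
    finally show ?thesis by (simp add: hchar_def prod_inversef[symmetric] o_def)
  qed
  ultimately show ?thesis by (simp add: mult.commute)
qed

lemma mfun_ind:
  assumes "set l \<subseteq> {..<2*m}" "length l = r" "r \<le> m"
  shows "mfun m r l \<in> ind m r"
proof (rule indI[OF assms(3) mdet_poly_funs[OF assms]])
  fix g b :: "'a mat" assume "g \<in> carrier (Sp m)" "b \<in> borel_neg m"
  then show "mfun m r l (g * b) = inverse (hchar r b) * mfun m r l g"
    using mdet_borel[OF assms Sp_carrier_mat[of g m], of b] Sp_mult[of g m b] borel_neg_Sp[of b m] by (simp add: mfun_def)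
qed (auto simp: mfun_def)

text \<open>The weight of a list of rows: each row contributes 1 at its own index and -1 at the
  partner.\<close>

definition lw :: "nat \<Rightarrow> nat list \<Rightarrow> nat \<Rightarrow> int" where
  "lw m l c = (\<Sum>x\<leftarrow>l. (if c = x then 1 else 0) - (if c = cj m x then 1 else 0))"

lemma lw_Nil [simp]: "lw m [] c = 0"
  by (simp add: lw_def)

lemma lw_Cons: "lw m (x # l) c = (if c = x then 1 else 0) - (if c = cj m x then 1 else 0) + lw m l c"
  by (simp add: lw_def)

lemma lw_append: "lw m (xs @ ys) c = lw m xs c + lw m ys c"
  by (simp add: lw_def)

lemma rdet_scale_rows:
  "length us + length vs = r \<Longrightarrow> length us = length cs \<Longrightarrow>
    rdet r (map2 (\<lambda>c u k. c * u k) cs us @ vs) = prod_list cs * rdet r (us @ vs)"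
proof (induction cs us arbitrary: vs rule: rev_induct2)
  case 1
  then show ?case by simp
next
  case (4 c cs u us)
  have "rdet r (map2 (\<lambda>c u k. c * u k) (cs @ [c]) (us @ [u]) @ vs)
      = rdet r (map2 (\<lambda>c u k. c * u k) cs us @ (\<lambda>k. c * u k) # vs)"
    using 4 by simp
  also have "\<dots> = prod_list cs * rdet r (us @ (\<lambda>k. c * u k) # vs)"
    using 4 by simp
  also have "rdet r (us @ (\<lambda>k. c * u k) # vs) = c * rdet r (us @ u # vs)"
    by (rule rdet_scale) (use 4 in simp)
  finally show ?case by simp
qed auto

lemma prod_list_dc:
  assumes "s \<noteq> 0" "c < 2*m" "set l \<subseteq> {..<2*m}"
  shows "prod_list (map (dc m c s) l) = s powi lw m l c"
  using assms(3)
proof (induction l)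
  case (Cons x l)
  then have x: "x < 2*m" by simp
  then show ?case using Cons assms(1) by (simp add: lw_Cons dc_powi[OF assms(1,2) x] power_int_add)
qed simp

lemma mfun_Hw:
  assumes l: "set l \<subseteq> {..<2*m}" "length l = r" "r \<le> m"
  shows "mfun m r l \<in> Hw m r (lw m l)"
  unfolding Hw_def
proof (intro CollectI conjI mfun_ind[OF l] allI impI ballI)
  fix c and s :: 'a and g :: "'a mat" assume c: "c < 2*m" and s: "s \<noteq> 0" and g: "g \<in> carrier (Sp m)"
  have "mdet m r l (tor m c s * g) = rdet r (map2 (\<lambda>c u k. c * u k) (map (dc m c s) l) (map (mrow m r g) l) @ [])"
    unfolding mdet_def
  proof (rule rdet_cong)
    fix i k assume ik: "i < r" "k < r"
    have "l ! i < 2*m" using l ik nth_mem[of i l] by blast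
    moreover have "2*m - r + k < 2*m" using ik l(3) by linarith
    ultimately show "(map (mrow m r (tor m c s * g)) l ! i) k = ((map2 (\<lambda>c u k. c * u k) (map (dc m c s) l) (map (mrow m r g) l) @ []) ! i) k"
      using ik l(2) by (simp add: mrow_def tor_dmat dmat_mult_entry[OF Sp_carrier_mat[OF g]] del: index_mult_mat)
  qed
  also have "\<dots> = s powi lw m l c * mdet m r l g"
    using l by (subst rdet_scale_rows) (simp_all add: mdet_def prod_list_dc[OF s c l(1)])
  finally show "mfun m r l (tor m c s * g) = s powi lw m l c * mfun m r l g"
    using tor_mult_Sp[OF g c s] g by (simp add: mfun_def)
qed

lemma mfun_repeat:
  assumes "length l = r" "\<not> distinct l"
  shows "mfun m r l = 0"
proof -
  obtain i j where ij: "i < length l" "j < length l" "i \<noteq> j" "l ! i = l ! j"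
    using assms(2) by (auto simp: distinct_conv_nth)
  have "mdet m r l g = 0" for g :: "'a mat"
    unfolding mdet_def by (rule rdet_repeat[of i r j]) (use ij assms(1) in auto)
  then show ?thesis by (auto simp: mfun_def)
qed

text \<open>The rows of complete hyperbolic pairs; they contribute weight 0.\<close>

definition zl :: "nat \<Rightarrow> nat list \<Rightarrow> nat list" where
  "zl m J = concat (map (\<lambda>c. [c, cj m c]) J)"

lemma zl_simps [simp]: "zl m [] = []" "zl m (c # J) = c # cj m c # zl m J"
  by (simp_all add: zl_def)

lemma length_zl [simp]: "length (zl m J) = 2 * length J"
  by (induction J) auto

lemma set_zl: "set (zl m J) = set J \<union> cj m ` set J"
  by (induction J) auto

lemma lw_zl: "set J \<subseteq> {..<2*m} \<Longrightarrow> lw m (zl m J) c = 0"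
  by (induction J) (auto simp: lw_Cons)

lemma mdet_zl_front:
  assumes "x \<in> set J" "length q + 2 * length J = r"
  shows "mdet m r (q @ zl m J) g = mdet m r (q @ zl m (x # remove1 x J)) g"
  using assms
proof (induction J arbitrary: q)
  case (Cons y J)
  show ?case
  proof (cases "x = y")
    case False
    then have x: "x \<in> set J" using Cons by simp
    have len: "length J = Suc (length (remove1 x J))" using length_pos_if_in_set[OF x] x by (simp add: length_remove1)
    have "mdet m r ((q @ [y, cj m y]) @ zl m J) g = mdet m r ((q @ [y, cj m y]) @ zl m (x # remove1 x J)) g"
      by (rule Cons.IH[OF x]) (use Cons.prems in simp)
    then have "mdet m r (q @ zl m (y # J)) g = rdet r (map (mrow m r g) q @ mrow m r g y # mrow m r g (cj m y) #
        mrow m r g x # mrow m r g (cj m x) # map (mrow m r g) (zl m (remove1 x J)))"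
      by (simp add: mdet_def)
    also have "\<dots> = rdet r (map (mrow m r g) q @ mrow m r g x # mrow m r g (cj m x) #
        mrow m r g y # mrow m r g (cj m y) # map (mrow m r g) (zl m (remove1 x J)))"
      by (rule rdet_swap_pairs) (use len Cons.prems in simp)
    finally show ?thesis using False by (simp add: mdet_def)
  qed simp
qed simp

text \<open>Exchanging two pairs of rows is an even permutation. So these minors depend on the set
  of pairs only, with no sign to keep track of.\<close>

lemma mdet_zl_mset:
  assumes "mset J = mset J'" "length q + 2 * length J = r"
  shows "mdet m r (q @ zl m J) g = mdet m r (q @ zl m J') g"
  using assms
proof (induction J arbitrary: q J')
  case (Cons x J)
  have x: "x \<in> set J'" using Cons.prems(1) by (metis list.set_intros(1) set_mset_mset)
  have len: "length J' = length (x # J)" using Cons.prems(1) by (metis size_mset)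
  have "mset J = mset (remove1 x J')" using Cons.prems(1) by (metis add_mset_remove_trivial mset.simps(2) mset_remove1)
  then have "mdet m r ((q @ [x, cj m x]) @ zl m J) g = mdet m r ((q @ [x, cj m x]) @ zl m (remove1 x J')) g"
    by (rule Cons.IH) (use Cons.prems in simp)
  then have "mdet m r (q @ zl m (x # J)) g = mdet m r (q @ zl m (x # remove1 x J')) g" by simp
  also have "\<dots> = mdet m r (q @ zl m J') g"
    by (rule mdet_zl_front[symmetric, OF x]) (use len Cons.prems in simp)
  finally show ?case .
qed simp

lemma mrow_rt:
  assumes g: "g \<in> carrier_mat (2*m) (2*m)" and a: "a < m" and b: "b < m" and x: "x < 2*m" and k: "k < r" and r: "r \<le> m"
  shows "mrow m r (rt m a b t * g) x k = mrow m r g x k + (if x = a then t * mrow m r g b k else 0)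
    + (if x = cj m b then - t * mrow m r g (cj m a) k else 0)"
proof -
  have ab: "a < 2*m" "b < 2*m" "a \<noteq> cj m b" "sg m a = (1::'a)" "sg m b = (1::'a)" using a b by (auto simp: cj_def sg_def)
  have "2*m - r + k < 2*m" using k r by simp
  from rt_mult_entry[OF g ab(1,2) x this, of t] show ?thesis
    using ab unfolding mrow_def by simp
qed

lemma mdet_rt:
  assumes g: "g \<in> carrier_mat (2*m) (2*m)" and a: "a < m" and b: "b < m" and r: "r \<le> m"
    and l: "set l \<subseteq> {..<2*m}" "length l = r"
  shows "mdet m r l (rt m a b t * g) = rdet r (map (\<lambda>x k. mrow m r g x k + (if x = a then t * mrow m r g b k else 0)
    + (if x = cj m b then - t * mrow m r g (cj m a) k else 0)) l)"
  unfolding mdet_def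
proof (rule rdet_cong)
  fix i k assume ik: "i < r" "k < r"
  then have "l ! i < 2*m" using l nth_mem[of i l] by blast
  then show "(map (mrow m r (rt m a b t * g)) l ! i) k = (map (\<lambda>x k. mrow m r g x k + (if x = a then t * mrow m r g b k else 0)
    + (if x = cj m b then - t * mrow m r g (cj m a) k else 0)) l ! i) k"
    using ik l mrow_rt[OF g a b _ ik(2) r] by simp
qed

text \<open>\<open>rt m a b\<close> adds row \<open>b\<close> to row \<open>a\<close> and subtracts
  row \<open>cj m a\<close> from row \<open>cj m b\<close>. A single pair among \<open>a\<close> and
  \<open>b\<close> turns into the rows \<open>b\<close>, \<open>cj m a\<close>, with opposite signs
  for the two choices; if both pairs occur, every correction term repeats a row.\<close>

lemma mdet_rt_z:
  fixes g :: "'a::field mat"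
  assumes g: "g \<in> carrier_mat (2*m) (2*m)" and a: "a < m" and b: "b < m" and ab: "a \<noteq> b" and r: "r \<le> m"
    and q: "set q \<subseteq> {..<2*m}" "a \<notin> set q" "cj m b \<notin> set q"
    and J: "set J \<subseteq> {..<m}" "a \<notin> set J" "b \<notin> set J"
  shows "length q + 2 * length J = r \<Longrightarrow> mdet m r (q @ zl m J) (rt m a b t * g) = mdet m r (q @ zl m J) g"
    and "length q + 2 * Suc (length J) = r \<Longrightarrow>
      mdet m r (q @ zl m (a # J)) (rt m a b t * g) = mdet m r (q @ zl m (a # J)) g + t * mdet m r ((q @ [b, cj m a]) @ zl m J) g"
    and "length q + 2 * Suc (length J) = r \<Longrightarrow>
      mdet m r (q @ zl m (b # J)) (rt m a b t * g) = mdet m r (q @ zl m (b # J)) g - t * mdet m r ((q @ [b, cj m a]) @ zl m J) g"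
    and "length q + 2 * Suc (Suc (length J)) = r \<Longrightarrow>
      mdet m r (q @ zl m (a # b # J)) (rt m a b t * g) = mdet m r (q @ zl m (a # b # J)) g"
proof -
  let ?v = "mrow m r g"
  let ?w = "\<lambda>x k. ?v x k + (if x = a then t * ?v b k else 0) + (if x = cj m b then - t * ?v (cj m a) k else 0)"
  have c: "a \<noteq> cj m b" "cj m a \<noteq> a" "cj m a \<noteq> cj m b" "b \<noteq> cj m b" using a b ab by (auto simp: cj_def)
  have same: "?w x = ?v x" if "x \<noteq> a" "x \<noteq> cj m b" for x using that by simp
  have mq: "map ?w q = map ?v q"
    using q by (intro map_cong refl same) auto
  have aJ: "a \<notin> set (zl m J)" "cj m b \<notin> set (zl m J)"
  proof -
    have "a \<noteq> cj m x" "cj m b \<noteq> x" "cj m b \<noteq> cj m x" if "x \<in> set J" for x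
    proof -
      have "x < m" "x \<noteq> b" using J that by auto
      then show "a \<noteq> cj m x" "cj m b \<noteq> x" "cj m b \<noteq> cj m x" using a b by (auto simp: cj_def)
    qed
    then show "a \<notin> set (zl m J)" "cj m b \<notin> set (zl m J)" using J by (auto simp: set_zl)
  qed
  have mJ: "map ?w (zl m J) = map ?v (zl m J)"
    using aJ by (intro map_cong refl same) auto
  have zJ: "set (zl m J) \<subseteq> {..<2*m}" using J by (auto simp: set_zl cj_def)
  have wa: "?w a = (\<lambda>k. ?v a k + t * ?v b k)" using c by simp
  have wb: "?w (cj m b) = (\<lambda>k. ?v (cj m b) k + - t * ?v (cj m a) k)" using c by simp
  note ex = mdet_rt[OF g a b r]
  show "mdet m r (q @ zl m J) (rt m a b t * g) = mdet m r (q @ zl m J) g" if len: "length q + 2 * length J = r"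
    using ex[of "q @ zl m J" t] len q zJ mq mJ by (simp add: mdet_def)
  show "mdet m r (q @ zl m (a # J)) (rt m a b t * g) = mdet m r (q @ zl m (a # J)) g + t * mdet m r ((q @ [b, cj m a]) @ zl m J) g"
    if len: "length q + 2 * Suc (length J) = r"
  proof -
    have "mdet m r (q @ zl m (a # J)) (rt m a b t * g) = rdet r (map ?v q @ ?w a # ?w (cj m a) # map ?v (zl m J))"
      using ex[of "q @ zl m (a # J)" t] len q zJ mq mJ a by (simp add: mdet_def)
    also have "?w (cj m a) = ?v (cj m a)" by (rule same) (use c in auto)
    also have "rdet r (map ?v q @ ?w a # ?v (cj m a) # map ?v (zl m J)) = rdet r (map ?v q @ ?v a # ?v (cj m a) # map ?v (zl m J))
        + rdet r (map ?v q @ (\<lambda>k. t * ?v b k) # ?v (cj m a) # map ?v (zl m J))"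
      unfolding wa by (rule rdet_add) (use len in simp)
    also have "rdet r (map ?v q @ (\<lambda>k. t * ?v b k) # ?v (cj m a) # map ?v (zl m J))
        = t * rdet r (map ?v q @ ?v b # ?v (cj m a) # map ?v (zl m J))"
      by (rule rdet_scale) (use len in simp)
    finally show ?thesis by (simp add: mdet_def)
  qed
  show "mdet m r (q @ zl m (b # J)) (rt m a b t * g) = mdet m r (q @ zl m (b # J)) g - t * mdet m r ((q @ [b, cj m a]) @ zl m J) g"
    if len: "length q + 2 * Suc (length J) = r"
  proof -
    have "mdet m r (q @ zl m (b # J)) (rt m a b t * g) = rdet r (map ?v q @ ?w b # ?w (cj m b) # map ?v (zl m J))"
      using ex[of "q @ zl m (b # J)" t] len q zJ mq mJ b by (simp add: mdet_def)
    also have "?w b = ?v b" by (rule same) (use c ab in auto)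
    also have "rdet r (map ?v q @ ?v b # ?w (cj m b) # map ?v (zl m J)) = rdet r (map ?v q @ ?v b # ?v (cj m b) # map ?v (zl m J))
        + rdet r (map ?v q @ ?v b # (\<lambda>k. - t * ?v (cj m a) k) # map ?v (zl m J))"
      unfolding wb by (rule rdet_add[of r "map ?v q @ [?v b]" "map ?v (zl m J)", unfolded append_assoc append_Cons append_Nil]) (use len in simp)
    also have "rdet r (map ?v q @ ?v b # (\<lambda>k. - t * ?v (cj m a) k) # map ?v (zl m J))
        = - t * rdet r (map ?v q @ ?v b # ?v (cj m a) # map ?v (zl m J))"
      by (rule rdet_scale[of r "map ?v q @ [?v b]" "map ?v (zl m J)", unfolded append_assoc append_Cons append_Nil]) (use len in simp)
    finally show ?thesis by (simp add: mdet_def)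
  qed
  show "mdet m r (q @ zl m (a # b # J)) (rt m a b t * g) = mdet m r (q @ zl m (a # b # J)) g"
    if len: "length q + 2 * Suc (Suc (length J)) = r"
  proof -
    let ?q = "map ?v q" and ?z = "map ?v (zl m J)"
    have "mdet m r (q @ zl m (a # b # J)) (rt m a b t * g) = rdet r (?q @ ?w a # ?w (cj m a) # ?w b # ?w (cj m b) # ?z)"
      using ex[of "q @ zl m (a # b # J)" t] len q zJ mq mJ a b by (simp add: mdet_def)
    also have "?w (cj m a) = ?v (cj m a)" by (rule same) (use c in auto)
    also have "?w b = ?v b" by (rule same) (use c ab in auto)
    also have "rdet r (?q @ ?w a # ?v (cj m a) # ?v b # ?w (cj m b) # ?z) = rdet r (?q @ ?v a # ?v (cj m a) # ?v b # ?w (cj m b) # ?z)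
        + rdet r (?q @ (\<lambda>k. t * ?v b k) # ?v (cj m a) # ?v b # ?w (cj m b) # ?z)"
      unfolding wa by (rule rdet_add) (use len in simp)
    also have "rdet r (?q @ (\<lambda>k. t * ?v b k) # ?v (cj m a) # ?v b # ?w (cj m b) # ?z)
        = t * rdet r (?q @ ?v b # ?v (cj m a) # ?v b # ?w (cj m b) # ?z)"
      by (rule rdet_scale) (use len in simp)
    also have "rdet r (?q @ ?v b # ?v (cj m a) # ?v b # ?w (cj m b) # ?z) = 0"
      by (rule rdet_repeat[of "length q" _ "length q + 2"]) (use len in \<open>auto simp: nth_append\<close>)
    also have "rdet r (?q @ ?v a # ?v (cj m a) # ?v b # ?w (cj m b) # ?z) = rdet r (?q @ ?v a # ?v (cj m a) # ?v b # ?v (cj m b) # ?z)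
        + rdet r (?q @ ?v a # ?v (cj m a) # ?v b # (\<lambda>k. - t * ?v (cj m a) k) # ?z)"
      unfolding wb by (rule rdet_add[of r "?q @ [?v a, ?v (cj m a), ?v b]" ?z, unfolded append_assoc append_Cons append_Nil]) (use len in simp)
    also have "rdet r (?q @ ?v a # ?v (cj m a) # ?v b # (\<lambda>k. - t * ?v (cj m a) k) # ?z)
        = - t * rdet r (?q @ ?v a # ?v (cj m a) # ?v b # ?v (cj m a) # ?z)"
      by (rule rdet_scale[of r "?q @ [?v a, ?v (cj m a), ?v b]" ?z, unfolded append_assoc append_Cons append_Nil]) (use len in simp)
    also have "rdet r (?q @ ?v a # ?v (cj m a) # ?v b # ?v (cj m a) # ?z) = 0"
      by (rule rdet_repeat[of "length q + 1" _ "length q + 3"]) (use len in \<open>auto simp: nth_append\<close>)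
    finally show ?thesis by (simp add: mdet_def)
  qed
qed

text \<open>The minor \<open>x_S\<close> of the overview, with the rows \<open>q\<close> fixed. The
  pairs are listed in increasing order merely to have a definite list.\<close>

definition zf :: "nat \<Rightarrow> nat \<Rightarrow> nat list \<Rightarrow> nat set \<Rightarrow> 'a::field mat \<Rightarrow> 'a" where
  "zf m r q S = mfun m r (q @ zl m (sorted_list_of_set S))"

definition pair_sign :: "nat \<times> nat \<Rightarrow> nat set \<Rightarrow> 'a::field" where
  "pair_sign p S = (if fst p \<in> S \<and> snd p \<notin> S then 1 else 0) - (if snd p \<in> S \<and> fst p \<notin> S then 1 else 0)"

lemma zf_insert:
  assumes "finite S" "a \<notin> S" "length q + 2 * Suc (card S) = r" "g \<in> carrier (Sp m)"
  shows "zf m r q (insert a S) g = mdet m r (q @ zl m (a # sorted_list_of_set S)) g"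
proof -
  have "mset (sorted_list_of_set (insert a S)) = mset (a # sorted_list_of_set S)"
    using assms by (simp flip: mset_insort)
  then show ?thesis
    unfolding zf_def mfun_def using assms by (simp only: if_True) (rule mdet_zl_mset; simp)
qed

text \<open>Raising takes out the part of the minor that is antisymmetric in the pairs
  \<open>a\<close> and \<open>b\<close>: exactly one of them must occur, and it is replaced by the
  two rows that the weight gains.\<close>

lemma rdiff_zf:
  assumes a: "a < m" and b: "b < m" and ab: "a \<noteq> b" and r: "r \<le> m"
    and q: "set q \<subseteq> {..<2*m}" "a \<notin> set q" "cj m b \<notin> set q"
    and S: "S \<subseteq> {..<m}" and len: "length q + 2 * card S = r"
  shows "rdiff m a b (zf m r q S) = (\<lambda>g. pair_sign (a, b) S * zf m r (q @ [b, cj m a]) (S - {a, b}) g)"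
proof
  fix g :: "'a mat"
  show "rdiff m a b (zf m r q S) g = pair_sign (a, b) S * zf m r (q @ [b, cj m a]) (S - {a, b}) g"
  proof (cases "g \<in> carrier (Sp m)")
    case False
    then show ?thesis by (simp add: rdiff_outside zf_def mfun_def)
  next
    case g: True
    have ab2: "a < 2*m" "b < 2*m" using a b by auto
    have gc: "g \<in> carrier_mat (2*m) (2*m)" by (rule Sp_carrier_mat[OF g])
    have rg: "rt m a b 1 * g \<in> carrier (Sp m)" by (rule rt_mult_Sp[OF g ab2 ab])
    have fin: "finite S" using S finite_subset by blast
    define T where "T = S - {a, b}"
    have T: "finite T" "a \<notin> T" "b \<notin> T" "T \<subseteq> {..<m}" using fin S by (auto simp: T_def)
    let ?J = "sorted_list_of_set T"
    have J: "set ?J \<subseteq> {..<m}" "a \<notin> set ?J" "b \<notin> set ?J" using T by auto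
    note base = mdet_rt_z[OF gc a b ab r q J, of 1, unfolded mult_1]
    have zT: "zf m r (q @ [b, cj m a]) (S - {a, b}) g = mdet m r ((q @ [b, cj m a]) @ zl m ?J) g"
      unfolding zf_def mfun_def T_def using g by (simp only: if_True)
    consider "a \<in> S" "b \<in> S" | "a \<in> S" "b \<notin> S" | "a \<notin> S" "b \<in> S" | "a \<notin> S" "b \<notin> S" by blast
    then show ?thesis
    proof cases
      case 1
      then have S': "S = insert a (insert b T)" by (auto simp: T_def)
      have c: "card S = Suc (Suc (card T))" unfolding S' using T ab by simp
      have "zf m r q S h = mdet m r (q @ zl m (a # b # ?J)) h" if h: "h \<in> carrier (Sp m)" for h :: "'a mat"
      proof -
        have "mset (sorted_list_of_set S) = mset (a # b # ?J)"
          unfolding S' using T ab by (simp flip: mset_insort)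
        then show ?thesis unfolding zf_def mfun_def using h len c by (simp only: if_True) (rule mdet_zl_mset; simp)
      qed
      note e = this
      have len': "length q + 2 * Suc (Suc (card T)) = r" "length ?J = card T" using len c T by auto
      have p: "pair_sign (a, b) S = (0::'a)" using 1 by (simp add: pair_sign_def)
      show ?thesis
        unfolding rdiff_apply[OF g] e[OF rg] e[OF g] p base(4)[unfolded len'(2), OF len'(1)] by simp
    next
      case 2
      then have S': "S = insert a T" by (auto simp: T_def)
      have c: "card S = Suc (card T)" unfolding S' using T by simp
      have "zf m r q S h = mdet m r (q @ zl m (a # ?J)) h" if h: "h \<in> carrier (Sp m)" for h :: "'a mat"
        unfolding S' by (rule zf_insert[OF T(1,2) _ h]) (use len c in simp)
      note e = this
      have len': "length q + 2 * Suc (card T) = r" "length ?J = card T" using len c T by auto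
      have p: "pair_sign (a, b) S = (1::'a)" using 2 by (simp add: pair_sign_def)
      show ?thesis
        unfolding rdiff_apply[OF g] e[OF rg] e[OF g] zT p base(2)[unfolded len'(2), OF len'(1)] by simp
    next
      case 3
      then have S': "S = insert b T" by (auto simp: T_def)
      have c: "card S = Suc (card T)" unfolding S' using T by simp
      have "zf m r q S h = mdet m r (q @ zl m (b # ?J)) h" if h: "h \<in> carrier (Sp m)" for h :: "'a mat"
        unfolding S' by (rule zf_insert[OF T(1,3) _ h]) (use len c in simp)
      note e = this
      have len': "length q + 2 * Suc (card T) = r" "length ?J = card T" using len c T by auto
      have p: "pair_sign (a, b) S = (- 1::'a)" using 3 by (simp add: pair_sign_def)
      show ?thesis
        unfolding rdiff_apply[OF g] e[OF rg] e[OF g] zT p base(3)[unfolded len'(2), OF len'(1)] by simp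
    next
      case 4
      then have S': "S = T" by (auto simp: T_def)
      have len': "length q + 2 * card T = r" "length ?J = card T" using len S' T by auto
      have p: "pair_sign (a, b) S = (0::'a)" using 4 by (simp add: pair_sign_def)
      have e: "zf m r q S h = mdet m r (q @ zl m ?J) h" if h: "h \<in> carrier (Sp m)" for h :: "'a mat"
        unfolding zf_def mfun_def S' using h by (simp only: if_True)
      show ?thesis
        unfolding rdiff_apply[OF g] e[OF rg] e[OF g] p base(1)[unfolded len'(2), OF len'(1)] by simp
    qed
  qed
qed

section \<open>Matchings\<close>

definition pts :: "(nat \<times> nat) set \<Rightarrow> nat set" where
  "pts M = fst ` M \<union> snd ` M"

definition matching :: "(nat \<times> nat) set \<Rightarrow> bool" where
  "matching M \<longleftrightarrow> finite M \<and> (\<forall>p\<in>M. fst p \<noteq> snd p) \<and>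
     (\<forall>p\<in>M. \<forall>p'\<in>M. p \<noteq> p' \<longrightarrow> {fst p, snd p} \<inter> {fst p', snd p'} = {})"

text \<open>The coefficient at \<open>J\<close> of the polytabloid \<open>\<Prod>(a, b)\<in>M. (x_a - x_b)\<close>.\<close>

definition matching_sign :: "(nat \<times> nat) set \<Rightarrow> nat set \<Rightarrow> 'a::field" where
  "matching_sign M J = (\<Prod>p\<in>M. pair_sign p J)"

definition subsets :: "nat \<Rightarrow> nat set \<Rightarrow> nat set set" where
  "subsets j Z = {J. J \<subseteq> Z \<and> card J = j}"

lemma finite_subsets [simp]: "finite Z \<Longrightarrow> finite (subsets j Z)"
  by (simp add: subsets_def)

lemma pts_empty [simp]: "pts {} = {}"
  by (simp add: pts_def)

lemma pts_insert [simp]: "pts (insert p M) = insert (fst p) (insert (snd p) (pts M))"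
  by (auto simp: pts_def)

lemma matching_sign_empty [simp]: "matching_sign {} J = 1"
  by (simp add: matching_sign_def)

lemma matching_sign_insert: "finite M \<Longrightarrow> p \<notin> M \<Longrightarrow> matching_sign (insert p M) J = pair_sign p J * matching_sign M J"
  by (simp add: matching_sign_def)

lemma matching_finite: "matching M \<Longrightarrow> finite M"
  by (simp add: matching_def)

lemma matching_insert:
  assumes "matching M" "a \<notin> pts M" "b \<notin> pts M" "a \<noteq> b"
  shows "matching (insert (a, b) M)" "(a, b) \<notin> M"
  using assms by (auto simp: matching_def pts_def) (force+)?

lemma matching_subset: "matching M \<Longrightarrow> N \<subseteq> M \<Longrightarrow> matching N"
  unfolding matching_def using finite_subset by blast

lemma pair_sign_cong: "(fst p \<in> J \<longleftrightarrow> fst p \<in> J') \<Longrightarrow> (snd p \<in> J \<longleftrightarrow> snd p \<in> J') \<Longrightarrow> pair_sign p J = pair_sign p J'"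
  by (simp add: pair_sign_def)

lemma matching_sign_cong: "(\<And>x. x \<in> pts M \<Longrightarrow> x \<in> J \<longleftrightarrow> x \<in> J') \<Longrightarrow> matching_sign M J = matching_sign M J'"
  unfolding matching_sign_def by (intro prod.cong pair_sign_cong) (auto simp: pts_def)

lemma pair_sign_nonzero: "pair_sign p J \<noteq> 0 \<Longrightarrow> (fst p \<in> J) \<noteq> (snd p \<in> J)"
  by (auto simp: pair_sign_def split: if_splits)

lemma matching_sign_pair_sign_nonzero:
  assumes "finite M" "matching_sign M J \<noteq> (0::'a::field)" "p \<in> M"
  shows "pair_sign p J \<noteq> (0::'a)"
proof
  assume "pair_sign p J = (0::'a)"
  with assms(3) have "\<exists>p\<in>M. pair_sign p J = (0::'a)" by blast
  then have "matching_sign M J = (0::'a)" unfolding matching_sign_def by (rule prod_zero[OF assms(1)])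
  with assms(2) show False by contradiction
qed

lemma matching_meets_card_le:
  assumes M: "matching M" and I: "finite I" and meet: "\<And>p. p \<in> M \<Longrightarrow> fst p \<in> I \<or> snd p \<in> I"
  shows "card M \<le> card (I \<inter> pts M)"
proof -
  define ch where "ch p = (if fst p \<in> I then fst p else snd p)" for p :: "nat \<times> nat"
  have "inj_on ch M"
  proof (rule inj_onI)
    fix p p' assume p: "p \<in> M" "p' \<in> M" "ch p = ch p'"
    have "ch p \<in> {fst p, snd p}" "ch p' \<in> {fst p', snd p'}" by (auto simp: ch_def)
    then show "p = p'" using M p unfolding matching_def by (metis IntI empty_iff)
  qed
  moreover have "ch ` M \<subseteq> I \<inter> pts M" using meet by (auto simp: ch_def pts_def)
  ultimately show ?thesis using I by (intro card_inj_on_le) auto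
qed

text \<open>A nonzero sign forces \<open>J\<close> to meet every arc. The arcs are disjoint and as
  many as the elements of \<open>J\<close>, so no element is left over.\<close>

lemma matching_sign_cover:
  assumes M: "matching M" and J: "finite J" "card J = card M" and nz: "matching_sign M J \<noteq> (0::'a::field)"
  shows "J \<subseteq> pts M"
proof -
  have "fst p \<in> J \<or> snd p \<in> J" if "p \<in> M" for p
    using pair_sign_nonzero[OF matching_sign_pair_sign_nonzero[OF matching_finite[OF M] nz that]] by blast
  then have "card J \<le> card (J \<inter> pts M)" using matching_meets_card_le[OF M J(1)] J(2) by simp
  then have "J \<inter> pts M = J" using J(1) by (intro card_subset_eq) (auto intro: antisym card_mono)
  then show ?thesis by blast
qed

text \<open>The new arc contributes -1 if \<open>c\<close> is not in \<open>J\<close>. If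
  \<open>c\<close> is in \<open>J\<close>, both sides vanish, since then \<open>J\<close> is not
  covered by the arcs of \<open>M\<close>.\<close>

lemma matching_sign_cap:
  assumes M: "matching M" and J: "finite J" "card J = card M" and n: "n \<notin> J" "n \<notin> pts M" and c: "c \<notin> pts M" "c \<noteq> n"
  shows "matching_sign (insert (c, n) M) (insert n J) = - (matching_sign M J :: 'a::field)"
proof -
  have "(c, n) \<notin> M" using n by (force simp: pts_def)
  then have "matching_sign (insert (c, n) M) (insert n J) = pair_sign (c, n) (insert n J) * (matching_sign M (insert n J) :: 'a)"
    using matching_finite[OF M] by (simp add: matching_sign_insert)
  also have "matching_sign M (insert n J) = (matching_sign M J :: 'a)" by (rule matching_sign_cong) (use n in auto)
  also have "pair_sign (c, n) (insert n J) * (matching_sign M J :: 'a) = - matching_sign M J"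
  proof (cases "c \<in> J")
    case True
    then have "matching_sign M J = (0::'a)" using matching_sign_cover[OF M J] c by blast
    then show ?thesis by simp
  next
    case False
    then show ?thesis using c by (simp add: pair_sign_def)
  qed
  finally show ?thesis .
qed

text \<open>Some arc avoids \<open>I\<close>, because \<open>I\<close> has fewer elements than there
  are disjoint arcs. Exchanging its two ends in \<open>J\<close> reverses the sign; sets containing
  both ends or neither contribute 0.\<close>

lemma sum_matching_sign_superset:
  assumes M: "matching M" and Z: "pts M \<subseteq> Z" "finite Z" and I: "finite I" "card I < card M"
  shows "(\<Sum>J | J \<in> subsets (card M) Z \<and> I \<subseteq> J. matching_sign M J) = (0::'a::field)"
proof -
  have "\<exists>p\<in>M. fst p \<notin> I \<and> snd p \<notin> I"
  proof (rule ccontr)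
    assume "\<not> ?thesis"
    then have "card M \<le> card (I \<inter> pts M)" by (intro matching_meets_card_le[OF M I(1)]) blast
    also have "\<dots> \<le> card I" using I(1) by (intro card_mono) auto
    finally show False using I(2) by simp
  qed
  then obtain a b where ab: "(a, b) \<in> M" "a \<notin> I" "b \<notin> I" by force
  have ne: "a \<noteq> b" using M ab by (force simp: matching_def)
  have abZ: "a \<in> Z" "b \<in> Z" using ab Z by (force simp: pts_def)+
  let ?S = "{J. J \<in> subsets (card M) Z \<and> I \<subseteq> J}"
  let ?A = "{J \<in> ?S. a \<in> J \<and> b \<notin> J}" and ?B = "{J \<in> ?S. b \<in> J \<and> a \<notin> J}"
  have fin: "finite ?S" using Z by simp
  have cM: "Suc (card M - Suc 0) = card M" using ab(1) matching_finite[OF M] card_gt_0_iff[of M] by fastforce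
  have rest: "matching_sign M J = (0::'a)" if "J \<in> ?S - (?A \<union> ?B)" for J
  proof -
    have "pair_sign (a, b) J = (0::'a)" using that by (auto simp: pair_sign_def)
    then show ?thesis using matching_sign_pair_sign_nonzero[OF matching_finite[OF M] _ ab(1), of J] by metis
  qed
  have "(\<Sum>J\<in>?S. matching_sign M J) = (\<Sum>J\<in>?A \<union> ?B. matching_sign M J :: 'a)"
    using fin rest by (intro sum.mono_neutral_right) auto
  also have "\<dots> = (\<Sum>J\<in>?A. matching_sign M J) + (\<Sum>J\<in>?B. matching_sign M J)"
  proof (rule sum.union_disjoint)
    show "finite ?A" "finite ?B" by (rule finite_subset[OF _ fin]; blast)+
  qed auto
  also have "(\<Sum>J\<in>?B. matching_sign M J) = (\<Sum>J\<in>?A. - (matching_sign M J :: 'a))"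
  proof (rule sum.reindex_bij_witness[of _ "\<lambda>J. insert b (J - {a})" "\<lambda>J. insert a (J - {b})"])
    fix J assume J: "J \<in> ?B"
    then have fJ: "finite J" using Z by (auto simp: subsets_def intro: finite_subset)
    show "insert b (insert a (J - {b}) - {a}) = J" using J by auto
    show "insert a (J - {b}) \<in> ?A" using J ab abZ ne fJ cM by (auto simp: subsets_def card_insert_if card_Diff_singleton card_gt_0_iff)
    show "- matching_sign M (insert a (J - {b})) = (matching_sign M J :: 'a)"
    proof -
      have M': "M = insert (a, b) (M - {(a, b)})" using ab by blast
      have other: "pair_sign p (insert a (J - {b})) = (pair_sign p J :: 'a)" if "p \<in> M - {(a, b)}" for p
      proof (rule pair_sign_cong)
        have "{fst p, snd p} \<inter> {a, b} = {}" using M that ab unfolding matching_def by fastforce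
        then show "fst p \<in> insert a (J - {b}) \<longleftrightarrow> fst p \<in> J" "snd p \<in> insert a (J - {b}) \<longleftrightarrow> snd p \<in> J" by auto
      qed
      have e: "matching_sign M K = pair_sign (a, b) K * (\<Prod>p\<in>M - {(a, b)}. pair_sign p K :: 'a)" for K
        unfolding matching_sign_def using matching_finite[OF M] ab(1) by (simp add: prod.remove)
      have "(\<Prod>p\<in>M - {(a, b)}. pair_sign p (insert a (J - {b}))) = (\<Prod>p\<in>M - {(a, b)}. pair_sign p J :: 'a)"
        by (intro prod.cong other refl)
      moreover have "pair_sign (a, b) (insert a (J - {b})) = - (pair_sign (a, b) J :: 'a)"
        using J ne by (simp add: pair_sign_def)
      ultimately show ?thesis unfolding e by simp
    qed
  next
    fix J assume J: "J \<in> ?A"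
    then have fJ: "finite J" using Z by (auto simp: subsets_def intro: finite_subset)
    show "insert a (insert b (J - {a}) - {b}) = J" using J by auto
    show "insert b (J - {a}) \<in> ?B" using J ab abZ ne fJ cM by (auto simp: subsets_def card_insert_if card_Diff_singleton card_gt_0_iff)
  qed
  finally show ?thesis by (simp add: sum_negf)
qed

lemma sum_subsets_insert:
  fixes h :: "nat set \<Rightarrow> 'a::field"
  assumes Z: "finite Z" "n \<notin> Z"
  shows "(\<Sum>J | J \<in> subsets (Suc j) (insert n Z) \<and> P J. h J) =
    (\<Sum>J | J \<in> subsets (Suc j) Z \<and> P J. h J) + (\<Sum>J | J \<in> subsets j Z \<and> P (insert n J). h (insert n J))"
proof -
  have fin: "finite {J. J \<in> subsets k Z \<and> Q J}" for k Q using Z by simp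
  have "{J. J \<in> subsets (Suc j) (insert n Z) \<and> P J} = {J. J \<in> subsets (Suc j) Z \<and> P J} \<union>
    insert n ` {J. J \<in> subsets j Z \<and> P (insert n J)}" (is "?L = ?A \<union> ?B")
  proof
    show "?L \<subseteq> ?A \<union> ?B"
    proof
      fix J assume J: "J \<in> ?L"
      show "J \<in> ?A \<union> ?B"
      proof (cases "n \<in> J")
        case True
        have fJ: "finite J" using J Z by (auto simp: subsets_def intro: finite_subset)
        have "J = insert n (J - {n})" using True by blast
        moreover have "J - {n} \<in> {J. J \<in> subsets j Z \<and> P (insert n J)}"
          using J True fJ by (auto simp: subsets_def insert_absorb)
        ultimately show ?thesis by blast
      qed (use J in \<open>auto simp: subsets_def\<close>)
    qed
    show "?A \<union> ?B \<subseteq> ?L"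
    proof
      fix J assume "J \<in> ?A \<union> ?B"
      then show "J \<in> ?L"
      proof
        assume "J \<in> ?B"
        then obtain J' where J': "J = insert n J'" "J' \<subseteq> Z" "card J' = j" "P J" by (auto simp: subsets_def)
        then have "finite J'" "n \<notin> J'" using Z finite_subset by auto
        then show ?thesis using J' by (auto simp: subsets_def)
      qed (auto simp: subsets_def)
    qed
  qed
  moreover have "?A \<inter> ?B = {}" using Z by (auto simp: subsets_def)
  moreover have "sum h ?B = (\<Sum>J | J \<in> subsets j Z \<and> P (insert n J). h (insert n J))"
    by (rule sum.reindex_cong[of "insert n"]) (use Z in \<open>auto simp: subsets_def inj_on_def\<close>)
  ultimately show ?thesis using fin by (simp add: sum.union_disjoint)
qed

text \<open>
  Noncrossing matchings without unmatched points below an arc. Lists are read backwards: the head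
  of \<open>Z\<close> is the last point.
\<close>

inductive nc :: "nat list \<Rightarrow> (nat \<times> nat) set \<Rightarrow> bool" where
  Nil: "nc [] {}"
| skip: "nc Z M \<Longrightarrow> nc (n # Z) M"
| cap: "nc Z M \<Longrightarrow> filter (\<lambda>x. x \<notin> pts M) Z = c # F \<Longrightarrow> nc (n # Z) (insert (c, n) M)"

lemma nc_matching: "nc Z M \<Longrightarrow> distinct Z \<Longrightarrow> pts M \<subseteq> set Z \<and> matching M"
proof (induction rule: nc.induct)
  case Nil
  then show ?case by (simp add: matching_def)
next
  case (skip Z M n)
  then show ?case by auto
next
  case (cap Z M c F n)
  have "c \<in> set (filter (\<lambda>x. x \<notin> pts M) Z)" using cap.hyps by simp
  then have c: "c \<in> set Z" "c \<notin> pts M" by auto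
  have n: "n \<notin> set Z" using cap.prems by simp
  then show ?case using cap c matching_insert(1)[of M c n] by auto
qed

text \<open>An arc between neighbours encloses nothing and leaves the free points elsewhere
  unchanged. Hence an adjacent raising followed by one along a noncrossing matching of the remaining
  points is again of noncrossing type.\<close>

lemma nc_insert_adjacent:
  assumes "nc (X @ Y) M" "distinct (X @ [b, a] @ Y)"
  shows "nc (X @ [b, a] @ Y) (insert (a, b) M)"
  using assms
proof (induction X arbitrary: M)
  case Nil
  have "a \<notin> pts M" using nc_matching[of Y M] Nil by auto
  then have "filter (\<lambda>x. x \<notin> pts M) (a # Y) = a # filter (\<lambda>x. x \<notin> pts M) Y" by simp
  then show ?case using nc.cap[OF nc.skip] Nil by fastforce
next
  case (Cons n X)
  from Cons.prems(1) have "nc (n # (X @ Y)) M" by simp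
  then show ?case
  proof cases
    case skip
    then show ?thesis using Cons by (auto intro: nc.skip)
  next
    case (cap M' c F)
    have d: "distinct (X @ [b, a] @ Y)" using Cons.prems by simp
    have "filter (\<lambda>x. x \<notin> pts (insert (a, b) M')) (X @ [b, a] @ Y) = filter (\<lambda>x. x \<notin> pts M') (X @ Y)"
    proof -
      have "filter (\<lambda>x. x \<notin> pts (insert (a, b) M')) X = filter (\<lambda>x. x \<notin> pts M') X"
        "filter (\<lambda>x. x \<notin> pts (insert (a, b) M')) Y = filter (\<lambda>x. x \<notin> pts M') Y"
        using d by (intro filter_cong refl; fastforce)+
      then show ?thesis by (simp only: filter_append) simp
    qed
    then have "nc (n # (X @ [b, a] @ Y)) (insert (c, n) (insert (a, b) M'))"
      using nc.cap[OF Cons.IH[OF cap(2) d]] cap(3) by simp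
    then show ?thesis unfolding cap(1) by (simp add: insert_commute)
  qed
qed

text \<open>A triangular system, solved by induction on the last point \<open>n\<close>. Sets
  without \<open>n\<close> serve the matchings that leave \<open>n\<close> free; sets with
  \<open>n\<close> then correct the matchings that use \<open>n\<close>, without disturbing the
  others, whose arcs cannot cover such a set.\<close>

lemma nc_interpolation:
  assumes "distinct Z"
  shows "\<exists>c. \<forall>M. nc Z M \<and> card M = j \<longrightarrow> (\<Sum>J\<in>subsets j (set Z). c J * matching_sign M J) = (y M :: 'a::field)"
  using assms
proof (induction Z arbitrary: j y)
  case Nil
  have e: "M = {}" if "nc [] M" for M using that by cases auto
  have s: "subsets 0 {} = {{}}" by (auto simp: subsets_def)
  show ?case
  proof (intro exI[of _ "\<lambda>_. y {}"] allI impI)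
    fix M assume M: "nc [] M \<and> card M = j"
    then have "M = {}" using e by blast
    then show "(\<Sum>J\<in>subsets j (set []). y {} * matching_sign M J) = y M" using M by (auto simp: s)
  qed
next
  case (Cons n Z)
  then have n: "n \<notin> set Z" "distinct Z" by auto
  show ?case
  proof (cases j)
    case 0
    have e: "M = {}" if "nc (n # Z) M" "card M = 0" for M
      using nc_matching[OF that(1)] Cons.prems that(2) by (auto simp: matching_def)
    have s: "subsets 0 (set (n # Z)) = {{}}"
    proof -
      have "J = {}" if "J \<subseteq> set (n # Z)" "card J = 0" for J
        using that finite_subset[of J "set (n # Z)"] by simp
      then show ?thesis by (auto simp: subsets_def)
    qed
    show ?thesis
    proof (intro exI[of _ "\<lambda>_. y {}"] allI impI)
      fix M assume "nc (n # Z) M \<and> card M = j"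
      then have "M = {}" using e 0 by blast
      then show "(\<Sum>J\<in>subsets j (set (n # Z)). y {} * matching_sign M J) = y M" by (simp add: s 0 del: list.set)
    qed
  next
    case (Suc j')
    obtain c0 where c0: "\<And>M. nc Z M \<Longrightarrow> card M = j \<Longrightarrow> (\<Sum>J\<in>subsets j (set Z). c0 J * matching_sign M J) = y M"
      using Cons.IH[OF n(2), of j y] by blast
    \<comment> \<open>The arc at \<open>n\<close> of a matching of this kind is forced: it leads to
      the last free point, the head of the filtered list.\<close>
    define cap where "cap M = insert (hd (filter (\<lambda>x. x \<notin> pts M) Z), n) M" for M
    \<comment> \<open>The error left by the coefficients \<open>c0\<close>, with the sign reversed
      because adding an arc at \<open>n\<close> in \<open>J\<close> costs a factor -1.\<close>
    define y' where "y' M = (\<Sum>J\<in>subsets j (set Z). c0 J * matching_sign (cap M) J) - y (cap M)" for M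
    obtain c1 where c1: "\<And>M. nc Z M \<Longrightarrow> card M = j' \<Longrightarrow> (\<Sum>J\<in>subsets j' (set Z). c1 J * matching_sign M J) = y' M"
      using Cons.IH[OF n(2), of j' y'] by blast
    define c where "c J = (if n \<in> J then c1 (J - {n}) else c0 J)" for J
    have split: "(\<Sum>J\<in>subsets j (set (n # Z)). c J * matching_sign M J) =
        (\<Sum>J\<in>subsets j (set Z). c0 J * matching_sign M J) + (\<Sum>J\<in>subsets j' (set Z). c1 J * matching_sign M (insert n J))" for M
    proof -
      have "(\<Sum>J\<in>subsets j (set (n # Z)). c J * matching_sign M J) =
        (\<Sum>J\<in>subsets j (set Z). c J * matching_sign M J) + (\<Sum>J\<in>subsets j' (set Z). c (insert n J) * matching_sign M (insert n J))"
        using sum_subsets_insert[of "set Z" n "\<lambda>J. c J * matching_sign M J" j' "\<lambda>_. True"] n(1) Suc by simp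
      also have "(\<Sum>J\<in>subsets j (set Z). c J * matching_sign M J) = (\<Sum>J\<in>subsets j (set Z). c0 J * matching_sign M J)"
        using n(1) by (intro sum.cong) (auto simp: c_def subsets_def)
      also have "(\<Sum>J\<in>subsets j' (set Z). c (insert n J) * matching_sign M (insert n J)) = (\<Sum>J\<in>subsets j' (set Z). c1 J * matching_sign M (insert n J))"
      proof (intro sum.cong refl)
        fix J assume "J \<in> subsets j' (set Z)"
        then have "insert n J - {n} = J" using n(1) by (auto simp: subsets_def)
        then show "c (insert n J) * matching_sign M (insert n J) = c1 J * matching_sign M (insert n J)" by (simp add: c_def)
      qed
      finally show ?thesis .
    qed
    have fJ: "finite J \<and> n \<notin> J \<and> card J = k" if "J \<in> subsets k (set Z)" for J k
      using that n(1) finite_subset[of J "set Z"] by (auto simp: subsets_def)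
    show ?thesis
    proof (intro exI[of _ c] allI impI)
      fix M assume "nc (n # Z) M \<and> card M = j"
      then have M: "nc (n # Z) M" "card M = j" by auto
      from M(1) show "(\<Sum>J\<in>subsets j (set (n # Z)). c J * matching_sign M J) = y M"
      proof cases
        case skip
        have m: "pts M \<subseteq> set Z" "matching M" using nc_matching[OF skip n(2)] by auto
        have "matching_sign M (insert n J) = (0::'a)" if "J \<in> subsets j' (set Z)" for J
        proof (rule ccontr)
          assume "matching_sign M (insert n J) \<noteq> (0::'a)"
          then have "insert n J \<subseteq> pts M" using fJ[OF that] M(2) Suc by (intro matching_sign_cover[OF m(2)]) auto
          then show False using m(1) n(1) by blast
        qed
        then have "(\<Sum>J\<in>subsets j' (set Z). c1 J * matching_sign M (insert n J)) = 0" by simp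
        then show ?thesis unfolding split using c0[OF skip M(2)] by simp
      next
        case (cap M' d F)
        have m: "pts M' \<subseteq> set Z" "matching M'" using nc_matching[OF cap(2) n(2)] by auto
        have "d \<in> set (filter (\<lambda>x. x \<notin> pts M') Z)" using cap(3) by simp
        then have d: "d \<in> set Z" "d \<notin> pts M'" by auto
        have dn: "d \<noteq> n" using d n(1) by blast
        have Mcap: "M = cap M'" unfolding cap(1) cap_def cap(3) by simp
        have "(d, n) \<notin> M'" using m(1) n(1) by (force simp: pts_def)
        then have cM': "card M' = j'" using M(2) Suc cap(1) matching_finite[OF m(2)] by simp
        have "(\<Sum>J\<in>subsets j' (set Z). c1 J * matching_sign M (insert n J)) = (\<Sum>J\<in>subsets j' (set Z). - (c1 J * matching_sign M' J))"
        proof (intro sum.cong refl)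
          fix J assume J: "J \<in> subsets j' (set Z)"
          have "matching_sign M (insert n J) = - (matching_sign M' J :: 'a)"
            unfolding cap(1) using fJ[OF J] cM' m(1) n(1) d dn by (intro matching_sign_cap[OF m(2)]) auto
          then show "c1 J * matching_sign M (insert n J) = - (c1 J * matching_sign M' J)" by simp
        qed
        also have "\<dots> = - y' M'" using c1[OF cap(2) cM'] by (simp add: sum_negf)
        finally show ?thesis unfolding split by (simp add: y'_def Mcap)
      qed
    qed
  qed
qed

text \<open>Compatibility with all relations among the minors: the common kernel of the maps that
  sum a function on \<open>j\<close>-subsets over the supersets of smaller sets.\<close>

definition down_zero :: "nat set \<Rightarrow> nat \<Rightarrow> (nat set \<Rightarrow> 'a::field) \<Rightarrow> bool" where
  "down_zero Z j h \<longleftrightarrow> (\<forall>I\<subseteq>Z. card I < j \<longrightarrow> (\<Sum>J | J \<in> subsets j Z \<and> I \<subseteq> J. h J) = 0)"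

lemma sum_avoiding_insert:
  fixes h :: "nat set \<Rightarrow> 'a::field"
  assumes Z: "finite Z" and x: "x \<notin> Q"
  shows "(\<Sum>J | J \<in> subsets j Z \<and> P \<subseteq> J \<and> J \<inter> insert x Q = {}. h J) =
     (\<Sum>J | J \<in> subsets j Z \<and> P \<subseteq> J \<and> J \<inter> Q = {}. h J) - (\<Sum>J | J \<in> subsets j Z \<and> insert x P \<subseteq> J \<and> J \<inter> Q = {}. h J)"
proof -
  have "{J. J \<in> subsets j Z \<and> P \<subseteq> J \<and> J \<inter> Q = {}} =
     {J. J \<in> subsets j Z \<and> P \<subseteq> J \<and> J \<inter> insert x Q = {}} \<union> {J. J \<in> subsets j Z \<and> insert x P \<subseteq> J \<and> J \<inter> Q = {}}"
    by auto
  moreover have "{J. J \<in> subsets j Z \<and> P \<subseteq> J \<and> J \<inter> insert x Q = {}} \<inter> {J. J \<in> subsets j Z \<and> insert x P \<subseteq> J \<and> J \<inter> Q = {}} = {}"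
    by auto
  ultimately show ?thesis using Z by (simp add: sum.union_disjoint)
qed

text \<open>Inclusion and exclusion, one forbidden point at a time: each step moves a point from
  \<open>Q\<close> to \<open>P\<close> or drops it, which does not increase the total size.\<close>

lemma down_zero_avoiding:
  assumes h: "down_zero Z j h" and Z: "finite Z" and Q: "finite Q"
  shows "P \<subseteq> Z \<Longrightarrow> Q \<subseteq> Z \<Longrightarrow> card P + card Q < j \<Longrightarrow>
    (\<Sum>J | J \<in> subsets j Z \<and> P \<subseteq> J \<and> J \<inter> Q = {}. h J) = 0"
  using Q
proof (induction Q arbitrary: P)
  case empty
  then show ?case using h by (simp add: down_zero_def)
next
  case (insert x Q)
  have "finite P" using insert.prems Z finite_subset by blast
  then have "card (insert x P) \<le> Suc (card P)" by (simp add: card_insert_if)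
  then show ?case
    unfolding sum_avoiding_insert[OF Z insert.hyps(2)] using insert.IH[of P] insert.IH[of "insert x P"] insert.prems insert.hyps by simp
qed

text \<open>The sum over all \<open>K\<close> disjoint from \<open>J\<close> is empty, as there is
  no room for two disjoint \<open>j\<close>-sets. Points of \<open>J\<close> are moved from the
  forbidden to the prescribed part one by one, and the sum remains 0 by
  \<open>down_zero_avoiding\<close>; in the end the only term is \<open>h J\<close>.\<close>

lemma down_zero_small:
  assumes h: "down_zero Z j h" and Z: "finite Z" "card Z < 2 * j" and J: "J \<in> subsets j Z"
  shows "h J = 0"
proof -
  have key: "h (P \<union> Q) = 0" if "finite Q" "P \<subseteq> Z" "Q \<subseteq> Z" "P \<inter> Q = {}" "card P + card Q = j"
    "(\<Sum>J | J \<in> subsets j Z \<and> P \<subseteq> J \<and> J \<inter> Q = {}. h J) = 0" for P Q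
    using that
  proof (induction Q arbitrary: P)
    case empty
    have "{J. J \<in> subsets j Z \<and> P \<subseteq> J \<and> J \<inter> {} = {}} = {P}"
    proof -
      have "J = P" if "J \<subseteq> Z" "card J = j" "P \<subseteq> J" for J
        using that empty Z(1) card_subset_eq[of J P] finite_subset[of J Z] by simp
      then show ?thesis using empty by (auto simp: subsets_def)
    qed
    then show ?case using empty by simp
  next
    case (insert x Q)
    have P: "finite P" "x \<notin> P" using insert.prems Z(1) finite_subset by auto
    have "(\<Sum>J | J \<in> subsets j Z \<and> P \<subseteq> J \<and> J \<inter> Q = {}. h J) = 0"
      using insert by (intro down_zero_avoiding[OF h Z(1)]) auto
    then have "(\<Sum>J | J \<in> subsets j Z \<and> insert x P \<subseteq> J \<and> J \<inter> Q = {}. h J) = 0"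
      using insert.prems(5) unfolding sum_avoiding_insert[OF Z(1) insert.hyps(2)] by simp
    then have "h (insert x P \<union> Q) = 0"
      using insert.prems insert.hyps P by (intro insert.IH) auto
    then show ?case by simp
  qed
  have fJ: "finite J" "J \<subseteq> Z" "card J = j" using J Z(1) finite_subset by (auto simp: subsets_def)
  have "{K. K \<in> subsets j Z \<and> {} \<subseteq> K \<and> K \<inter> J = {}} = {}"
  proof (rule ccontr)
    assume "\<not> ?thesis"
    then obtain K where K: "K \<subseteq> Z" "card K = j" "K \<inter> J = {}" by (auto simp: subsets_def)
    then have "card (K \<union> J) = 2 * j" using fJ Z(1) finite_subset[of K Z] by (subst card_Un_disjoint) auto
    moreover have "card (K \<union> J) \<le> card Z" using K fJ Z(1) by (intro card_mono) auto
    ultimately show False using Z(2) by simp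
  qed
  then have "(\<Sum>K | K \<in> subsets j Z \<and> {} \<subseteq> K \<and> K \<inter> J = {}. h K) = 0" by (simp only: sum.empty)
  from key[OF fJ(1) _ fJ(2) _ _ this] show ?thesis using fJ by simp
qed

text \<open>James' kernel intersection theorem for two-row partitions.\<close>

theorem kernel_intersection:
  fixes h :: "nat set \<Rightarrow> 'a::field"
  assumes "finite Z" "down_zero Z j h"
  shows "\<exists>L. (\<forall>(c, M)\<in>set L. matching M \<and> pts M \<subseteq> Z \<and> card M = j) \<and>
     (\<forall>J\<in>subsets j Z. h J = (\<Sum>(c, M)\<leftarrow>L. c * matching_sign M J))"
  using assms
proof (induction Z arbitrary: j h)
  case empty
  show ?case
  proof (cases j)
    case 0
    then show ?thesis by (intro exI[of _ "[(h {}, {})]"]) (auto simp: subsets_def matching_def)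
  next
    case (Suc j')
    then show ?thesis by (intro exI[of _ "[]"]) (auto simp: subsets_def)
  qed
next
  case (insert n Z)
  show ?case
  proof (cases j)
    case 0
    then show ?thesis using insert.hyps
      by (intro exI[of _ "[(h {}, {})]"]) (auto simp: subsets_def matching_def dest: finite_subset)
  next
    case (Suc j')
    show ?thesis
    proof (cases "card (insert n Z) < 2 * j")
      case True
      then show ?thesis using down_zero_small[OF insert.prems] insert.hyps by (intro exI[of _ "[]"]) auto
    next
      case False
      then have big: "2 * j' < card Z" using insert.hyps Suc by simp
      \<comment> \<open>The sets through \<open>n\<close> satisfy the relations of one size less, as
        one sees by adding \<open>n\<close> to the prescribed set.\<close>
      have "down_zero Z j' (\<lambda>J. h (insert n J))"
        unfolding down_zero_def
      proof (intro allI impI)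
        fix I assume I: "I \<subseteq> Z" "card I < j'"
        have fI: "finite I" "n \<notin> I" using I insert.hyps finite_subset by auto
        have e: "{J. J \<in> subsets (Suc j') Z \<and> insert n I \<subseteq> J} = {}" using insert.hyps by (auto simp: subsets_def)
        have "{J. J \<in> subsets j' Z \<and> insert n I \<subseteq> insert n J} = {J. J \<in> subsets j' Z \<and> I \<subseteq> J}"
          using fI by auto
        then have "(\<Sum>J | J \<in> subsets j' Z \<and> I \<subseteq> J. h (insert n J)) = (\<Sum>J | J \<in> subsets j (insert n Z) \<and> insert n I \<subseteq> J. h J)"
          unfolding Suc sum_subsets_insert[OF insert.hyps(1,2)] e by (simp only: sum.empty add_0)
        also have "\<dots> = 0" using insert.prems I fI Suc unfolding down_zero_def by (intro insert.prems[unfolded down_zero_def, rule_format]) auto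
        finally show "(\<Sum>J | J \<in> subsets j' Z \<and> I \<subseteq> J. h (insert n J)) = 0" .
      qed
      from insert.IH[OF this] obtain L1 where L: "\<forall>(c, M)\<in>set L1. matching M \<and> pts M \<subseteq> Z \<and> card M = j'"
        and La: "\<forall>J\<in>subsets j' Z. h (insert n J) = (\<Sum>(c, M)\<leftarrow>L1. c * matching_sign M J)" by blast
      have Lb: "matching M \<and> pts M \<subseteq> Z \<and> card M = j'" if "(c, M) \<in> set L1" for c M using L that by fast
      note L1 = Lb La[rule_format]
      \<comment> \<open>A point for the other end of the arc at \<open>n\<close>. It exists because
        at most \<open>2 * j'\<close> of the more than \<open>2 * j'\<close> points are in
        use.\<close>
      define fr where "fr M = (SOME c. c \<in> Z \<and> c \<notin> pts M)" for M
      have fr: "fr M \<in> Z" "fr M \<notin> pts M" if "(c, M) \<in> set L1" for c M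
      proof -
        have "card (pts M) \<le> card (fst ` M) + card (snd ` M)" unfolding pts_def by (rule card_Un_le)
        also have "\<dots> \<le> 2 * card M"
          using card_image_le[of M fst] card_image_le[of M snd] L1(1)[OF that] matching_finite by fastforce
        finally have "card (pts M) < card Z" using L1(1)[OF that] big by simp
        moreover have "finite (pts M)" using L1(1)[OF that] insert.hyps(1) finite_subset by blast
        ultimately have "\<exists>c. c \<in> Z \<and> c \<notin> pts M" by (metis card_mono not_less subsetI)
        then have "fr M \<in> Z \<and> fr M \<notin> pts M" unfolding fr_def by (rule someI_ex)
        then show "fr M \<in> Z" "fr M \<notin> pts M" by auto
      qed
      \<comment> \<open>With the arcs to \<open>n\<close> added, the combination equals
        \<open>- h\<close> at all sets through \<open>n\<close>. So \<open>h + g\<close> is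
        supported on subsets of \<open>Z\<close> and satisfies the relations there.\<close>
      define L1' where "L1' = map (\<lambda>(c, M). (c, insert (fr M, n) M)) L1"
      have n: "n \<notin> pts M" "fr M \<noteq> n" if "(c, M) \<in> set L1" for c M
        using L1(1)[OF that] fr[OF that] insert.hyps by auto
      have L1'm: "matching M \<and> pts M \<subseteq> insert n Z \<and> card M = j" if "(c, M) \<in> set L1'" for c M
      proof -
        from that obtain x where x: "x \<in> set L1" "(c, M) = (case x of (c, M) \<Rightarrow> (c, insert (fr M, n) M))"
          unfolding L1'_def set_map by blast
        obtain c' M' where "x = (c', M')" by (cases x)
        with x have M': "(c, M') \<in> set L1" "M = insert (fr M', n) M'" by simp_all
        note L = L1(1)[OF M'(1)]
        have "matching M" "(fr M', n) \<notin> M'" unfolding M'(2) using L fr[OF M'(1)] n[OF M'(1)] by (auto intro: matching_insert dest: matching_insert)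
        then show ?thesis using L fr[OF M'(1)] matching_finite[of M'] Suc M'(2) by auto
      qed
      define g where "g J = (\<Sum>(c, M)\<leftarrow>L1'. c * matching_sign M J)" for J :: "nat set"
      have g1: "g (insert n J) = - h (insert n J)" if J: "J \<in> subsets j' Z" for J
      proof -
        have fJ: "finite J" "card J = j'" "n \<notin> J" using J insert.hyps finite_subset by (auto simp: subsets_def)
        have "g (insert n J) = (\<Sum>(c, M)\<leftarrow>L1. c * matching_sign (insert (fr M, n) M) (insert n J))"
          by (simp add: g_def L1'_def o_def case_prod_unfold)
        also have "\<dots> = (\<Sum>(c, M)\<leftarrow>L1. - (c * matching_sign M J))"
        proof (intro arg_cong[of _ _ sum_list] map_cong refl)
          fix x assume x: "x \<in> set L1"
          obtain c M where cM: "x = (c, M)" by (cases x)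
          have "matching_sign (insert (fr M, n) M) (insert n J) = - (matching_sign M J :: 'a)"
            using L1(1)[of c M] fr[of c M] n[of c M] x cM fJ by (intro matching_sign_cap) auto
          then show "(case x of (c, M) \<Rightarrow> c * matching_sign (insert (fr M, n) M) (insert n J)) = (case x of (c, M) \<Rightarrow> - (c * matching_sign M J))"
            by (simp add: cM)
        qed
        also have "\<dots> = - (\<Sum>(c, M)\<leftarrow>L1. c * matching_sign M J)"
          by (simp add: uminus_sum_list_map o_def case_prod_unfold)
        finally show ?thesis using L1(2)[OF J] by simp
      qed
      have fin: "finite (insert n Z)" using insert.hyps by simp
      have gz: "(\<Sum>J | J \<in> subsets j (insert n Z) \<and> I \<subseteq> J. g J) = 0" if I: "I \<subseteq> insert n Z" "card I < j" for I
      proof -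
        have fI: "finite I" using I fin finite_subset by blast
        have "(\<Sum>J | J \<in> subsets j (insert n Z) \<and> I \<subseteq> J. (\<Sum>(c, M)\<leftarrow>L. c * matching_sign M J)) = 0"
          if "set L \<subseteq> set L1'" for L
          using that
        proof (induction L)
          case (Cons x L)
          obtain c M where cM: "x = (c, M)" by (cases x)
          have "matching M" "pts M \<subseteq> insert n Z" "card M = j" using L1'm[of c M] Cons.prems cM by auto
          then have "(\<Sum>J | J \<in> subsets j (insert n Z) \<and> I \<subseteq> J. matching_sign M J) = (0::'a)"
            using sum_matching_sign_superset[of M "insert n Z" I, where 'a = 'a] fin fI I(2) by simp
          then show ?case using Cons by (simp add: cM sum.distrib sum_distrib_left[symmetric])
        qed simp
        then show ?thesis by (simp add: g_def)
      qed
      have "down_zero Z j (\<lambda>J. h J + g J)"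
        unfolding down_zero_def
      proof (intro allI impI)
        fix I assume I: "I \<subseteq> Z" "card I < j"
        have "(\<Sum>J | J \<in> subsets j' Z \<and> I \<subseteq> insert n J. h (insert n J) + g (insert n J)) = 0"
          by (intro sum.neutral) (auto simp: g1)
        then have "(\<Sum>J | J \<in> subsets j Z \<and> I \<subseteq> J. h J + g J) = (\<Sum>J | J \<in> subsets j (insert n Z) \<and> I \<subseteq> J. h J + g J)"
          using sum_subsets_insert[OF insert.hyps(1,2), of "\<lambda>J. h J + g J" j' "\<lambda>J. I \<subseteq> J"] Suc by simp
        also have "\<dots> = 0"
        proof -
          have I': "I \<subseteq> insert n Z" using I by blast
          show ?thesis
            using gz[OF I' I(2)] insert.prems[unfolded down_zero_def, rule_format, OF I' I(2)]
            by (simp add: sum.distrib)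
        qed
        finally show "(\<Sum>J | J \<in> subsets j Z \<and> I \<subseteq> J. h J + g J) = 0" .
      qed
      from insert.IH[OF this] obtain L0 where L: "\<forall>(c, M)\<in>set L0. matching M \<and> pts M \<subseteq> Z \<and> card M = j"
        and La: "\<forall>J\<in>subsets j Z. h J + g J = (\<Sum>(c, M)\<leftarrow>L0. c * matching_sign M J)" by blast
      have Lb: "matching M \<and> pts M \<subseteq> Z \<and> card M = j" if "(c, M) \<in> set L0" for c M using L that by fast
      note L0 = Lb La[rule_format]
      \<comment> \<open>These matchings do not use \<open>n\<close>, so they cannot cover a set
        through \<open>n\<close>.\<close>
      have L0n: "(\<Sum>(c, M)\<leftarrow>L0. c * matching_sign M (insert n J)) = 0" if J: "J \<in> subsets j' Z" for J
      proof -
        have fJ: "finite J" "card J = j'" "n \<notin> J" using J insert.hyps finite_subset by (auto simp: subsets_def)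
        have "matching_sign M (insert n J) = (0::'a)" if "(c, M) \<in> set L0" for c M
        proof (rule ccontr)
          assume "matching_sign M (insert n J) \<noteq> (0::'a)"
          then have "insert n J \<subseteq> pts M" using L0(1)[OF that] fJ Suc by (intro matching_sign_cover) auto
          then show False using L0(1)[OF that] insert.hyps by blast
        qed
        then have e: "map (\<lambda>(c, M). c * matching_sign M (insert n J)) L0 = map (\<lambda>_. 0) L0" by (intro map_cong) auto
        show ?thesis unfolding e by (rule sum_list_0)
      qed
      have "h J = (\<Sum>(c, M)\<leftarrow>L0 @ map (\<lambda>(c, M). (- c, M)) L1'. c * matching_sign M J)" if J: "J \<in> subsets j (insert n Z)" for J
      proof -
        have m: "(\<Sum>(c, M)\<leftarrow>map (\<lambda>(c, M). (- c, M)) L1'. c * matching_sign M J) = - g J"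
          by (simp add: g_def o_def case_prod_unfold uminus_sum_list_map)
        show ?thesis
        proof (cases "n \<in> J")
          case True
          have fJ: "finite J" using J fin finite_subset by (auto simp: subsets_def)
          have J': "J = insert n (J - {n})" "J - {n} \<in> subsets j' Z" using True J fJ Suc by (auto simp: subsets_def)
          show ?thesis using g1[OF J'(2)] L0n[OF J'(2)] J'(1) m by simp
        next
          case False
          then have "J \<in> subsets j Z" using J by (auto simp: subsets_def)
          then have "h J = (\<Sum>(c, M)\<leftarrow>L0. c * matching_sign M J) - g J" using L0(2) by (simp add: eq_diff_eq)
          then show ?thesis using m by simp
        qed
      qed
      moreover have "\<forall>(c, M)\<in>set (L0 @ map (\<lambda>(c, M). (- c, M)) L1'). matching M \<and> pts M \<subseteq> insert n Z \<and> card M = j"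
        using L0(1) L1'm by fastforce
      ultimately show ?thesis by blast
    qed
  qed
qed

lemma card_supersets:
  assumes Z: "finite Z" and I: "I \<subseteq> Z" "card I \<le> j"
  shows "card {J. J \<in> subsets j Z \<and> I \<subseteq> J} = (card Z - card I) choose (j - card I)"
proof -
  have fI: "finite I" using Z I finite_subset by blast
  have "bij_betw (\<lambda>J. J - I) {J. J \<in> subsets j Z \<and> I \<subseteq> J} {B. B \<subseteq> Z - I \<and> card B = j - card I}"
  proof (rule bij_betw_byWitness[where f' = "\<lambda>B. B \<union> I"])
    show "(\<lambda>J. J - I) ` {J. J \<in> subsets j Z \<and> I \<subseteq> J} \<subseteq> {B. B \<subseteq> Z - I \<and> card B = j - card I}"
      using fI by (auto simp: subsets_def card_Diff_subset)
    show "(\<lambda>B. B \<union> I) ` {B. B \<subseteq> Z - I \<and> card B = j - card I} \<subseteq> {J. J \<in> subsets j Z \<and> I \<subseteq> J}"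
    proof
      fix J assume "J \<in> (\<lambda>B. B \<union> I) ` {B. B \<subseteq> Z - I \<and> card B = j - card I}"
      then obtain B where B: "J = B \<union> I" "B \<subseteq> Z - I" "card B = j - card I" by auto
      then have "finite B" using Z finite_subset[of B "Z - I"] by blast
      then have "card J = j" unfolding B(1) using B I fI by (subst card_Un_disjoint) auto
      then show "J \<in> {J. J \<in> subsets j Z \<and> I \<subseteq> J}" using B I by (auto simp: subsets_def)
    qed
  qed auto
  then have "card {J. J \<in> subsets j Z \<and> I \<subseteq> J} = card {B. B \<subseteq> Z - I \<and> card B = j - card I}"
    by (rule bij_betw_same_card)
  also have "\<dots> = card (Z - I) choose (j - card I)" using Z by (simp add: n_subsets)
  finally show ?thesis using fI I by (simp add: card_Diff_subset)
qed

section \<open>Iterated raising operators\<close>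

lemma iso_list_mset: "iso_list m l \<Longrightarrow> mset l = mset l' \<Longrightarrow> iso_list m l'"
  unfolding iso_list_def by (metis mset_eq_imp_distinct_iff mset_eq_setD mset_map)

lemma iso_list_cj: "iso_list m (map (cj m) q @ z) \<longleftrightarrow> iso_list m (q @ z)" if "set q \<subseteq> {..<2*m}"
proof -
  have e: "map (nm m) (map (cj m) q) = map (nm m) q" using that by (auto simp: subset_iff)
  have s: "set (map (cj m) q) \<subseteq> {..<2*m}" using that by auto
  show ?thesis unfolding iso_list_def map_append set_append e using s that by blast
qed

lemma iso_listD: "iso_list m q \<Longrightarrow> set q \<subseteq> {..<2*m}"
  by (simp add: iso_list_def)

lemma iso_list_appendD: "iso_list m (q @ z) \<Longrightarrow> iso_list m q"
  by (simp add: iso_list_def)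

lemma iso_list_snoc_pair:
  assumes q: "iso_list m q" and a: "a < m" "a \<notin> nm m ` set q" and b: "b < m" "b \<notin> nm m ` set q" and ab: "a \<noteq> b"
  shows "iso_list m (q @ [b, cj m a])"
  using assms by (auto simp: iso_list_def)

lemma lw_outside:
  assumes q: "set q \<subseteq> {..<2*m}" and c: "c < 2*m" "nm m c \<notin> nm m ` set q"
  shows "lw m q c = 0"
  using q c(2)
proof (induction q)
  case (Cons x q)
  have "c \<noteq> x" using Cons.prems by auto
  moreover have "c \<noteq> cj m x" using Cons.prems by (metis imageI insertI1 lessThan_iff list.set(2) nm_cj subset_iff)
  ultimately show ?case using Cons by (simp add: lw_Cons)
qed simp

lemma lw_mem:
  assumes "iso_list m q" "x \<in> set q"
  shows "lw m q x = 1" "lw m q (cj m x) = - 1"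
proof -
  have "lw m q x = 1 \<and> lw m q (cj m x) = - 1"
    using assms
  proof (induction q)
    case (Cons y q)
    have q: "iso_list m q" "set q \<subseteq> {..<2*m}" "y < 2*m" "nm m y \<notin> nm m ` set q" using Cons.prems by (auto simp: iso_list_def)
    have x: "x < 2*m" using Cons.prems q by auto
    show ?case
    proof (cases "x = y")
      case True
      have "lw m q y = 0" "lw m q (cj m y) = 0" by (intro lw_outside; use q in simp)+
      then show ?thesis using True x by (simp add: lw_Cons)
    next
      case False
      then have xq: "x \<in> set q" using Cons.prems by simp
      then have "nm m x \<noteq> nm m y" using q(4) by (metis imageI)
      then have "x \<noteq> y" "x \<noteq> cj m y" "cj m x \<noteq> y" using q(3) x by auto
      then show ?thesis using Cons.IH[OF q(1) xq] x q(3) by (simp add: lw_Cons)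
    qed
  qed simp
  then show "lw m q x = 1" "lw m q (cj m x) = - 1" by auto
qed

lemma card_support_lw:
  assumes "iso_list m q"
  shows "card {i. i < m \<and> lw m q i \<noteq> 0} = length q"
proof -
  have "{i. i < m \<and> lw m q i \<noteq> 0} = nm m ` set q"
  proof
    show "{i. i < m \<and> lw m q i \<noteq> 0} \<subseteq> nm m ` set q"
    proof
      fix i assume "i \<in> {i. i < m \<and> lw m q i \<noteq> 0}"
      then show "i \<in> nm m ` set q" using lw_outside[OF iso_listD[OF assms], of i] by auto
    qed
    show "nm m ` set q \<subseteq> {i. i < m \<and> lw m q i \<noteq> 0}"
    proof
      fix i assume "i \<in> nm m ` set q"
      then obtain x where x: "x \<in> set q" "i = nm m x" by auto
      have x2: "x < 2*m" using x iso_listD[OF assms] by auto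
      have "i = x \<or> i = cj m x" using x(2) nm_cases[OF x2] x2 by (auto simp: nm_def)
      then show "i \<in> {i. i < m \<and> lw m q i \<noteq> 0}" using lw_mem[OF assms x(1)] nm_less[OF x2] x(2) by auto
    qed
  qed
  also have "card \<dots> = length q"
    using assms distinct_card[of "map (nm m) q"] by (simp add: iso_list_def)
  finally show ?thesis .
qed

text \<open>A list from distinct pairs has as many nonzero weight entries as members, and there can
  be at most \<open>r\<close> of them. This is what stops the raising.\<close>

lemma Hw_too_long:
  fixes f :: "'a::alg_closed_field mat \<Rightarrow> 'a"
  assumes f: "f \<in> Hw m r (lw m q)" and r: "r \<le> m" and q: "iso_list m q" "r < length q"
  shows "f = 0"
proof (rule ccontr)
  assume "f \<noteq> 0"
  then obtain g where g: "f g \<noteq> 0" by (auto simp: fun_eq_iff)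
  then have "g \<in> carrier (Sp m)" using ind_outside[OF Hw_ind[OF f]] by blast
  then show False using weight_bound_support[OF f r _ g] card_support_lw[OF q(1)] q(2) by simp
qed

lemma Hw_rdiff:
  fixes f :: "'a::alg_closed_field mat \<Rightarrow> 'a"
  assumes f: "f \<in> Hw m r (lw m q)" and r: "r \<le> m" and q: "iso_list m q"
    and a: "a < m" "a \<notin> nm m ` set q" and b: "b < m" "b \<notin> nm m ` set q" and ab: "a \<noteq> b"
  shows "rdiff m a b f \<in> Hw m r (lw m (q @ [b, cj m a]))"
proof -
  have z: "lw m q a = 0" "lw m q b = 0" by (intro lw_outside iso_listD q; use a b in simp)+
  have "Hw m r (\<lambda>c. lw m q c - rw m a b c) = (Hw m r (lw m (q @ [b, cj m a])) :: ('a mat \<Rightarrow> 'a) set)"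
  proof (rule Hw_cong)
    fix i assume "i < 2*m"
    show "lw m q i - rw m a b i = lw m (q @ [b, cj m a]) i"
      using a by (simp add: lw_append lw_Cons rw_def)
  qed
  then show ?thesis using rdiff_weight(1)[OF f r a(1) z(1) b(1) z(2) ab] by simp
qed

section \<open>Composing raising operators along a matching\<close>

fun raise_all :: "nat \<Rightarrow> (nat \<times> nat) list \<Rightarrow> ('a::field mat \<Rightarrow> 'a) \<Rightarrow> 'a mat \<Rightarrow> 'a" where
  "raise_all m [] f = f"
| "raise_all m ((a, b) # D) f = raise_all m D (rdiff m a b f)"

fun raise_rows :: "nat \<Rightarrow> (nat \<times> nat) list \<Rightarrow> nat list \<Rightarrow> nat list" where
  "raise_rows m [] q = q"
| "raise_rows m ((a, b) # D) q = raise_rows m D (q @ [b, cj m a])"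

lemma length_raise_rows [simp]: "length (raise_rows m D q) = length q + 2 * length D"
  by (induction m D q rule: raise_rows.induct) auto

definition raisable :: "nat \<Rightarrow> nat list \<Rightarrow> (nat \<times> nat) list \<Rightarrow> bool" where
  "raisable m q D \<longleftrightarrow> iso_list m q \<and> distinct D \<and> matching (set D) \<and> pts (set D) \<subseteq> {..<m} - nm m ` set q"

lemma raisable_Cons:
  assumes "raisable m q ((a, b) # D)"
  shows "iso_list m q" "a < m" "a \<notin> nm m ` set q" "b < m" "b \<notin> nm m ` set q" "a \<noteq> b"
    "raisable m (q @ [b, cj m a]) D" "a \<notin> pts (set D)" "b \<notin> pts (set D)"
proof -
  have M: "matching (insert (a, b) (set D))" "(a, b) \<notin> set D" using assms by (auto simp: raisable_def)
  show ab: "a < m" "a \<notin> nm m ` set q" "b < m" "b \<notin> nm m ` set q" "iso_list m q" using assms by (auto simp: raisable_def)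
  show ne: "a \<noteq> b" using M by (force simp: matching_def)
  have dis: "{a, b} \<inter> {fst p, snd p} = {}" if "p \<in> set D" for p
    using M that unfolding matching_def by (metis fst_conv snd_conv insertCI)
  then show pa: "a \<notin> pts (set D)" "b \<notin> pts (set D)" by (auto simp: pts_def)
  have "nm m b = b" "nm m (cj m a) = a" using ab by auto
  then show "raisable m (q @ [b, cj m a]) D"
    using assms pa iso_list_snoc_pair[OF ab(5) ab(1-4) ne] matching_subset[OF M(1), of "set D"]
    by (auto simp: raisable_def)
qed

lemma raise_all_Hw:
  fixes f :: "'a::alg_closed_field mat \<Rightarrow> 'a"
  assumes "f \<in> Hw m r (lw m q)" "r \<le> m" "raisable m q D"
  shows "raise_all m D f \<in> Hw m r (lw m (raise_rows m D q)) \<and> iso_list m (raise_rows m D q)"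
  using assms
proof (induction m D q arbitrary: f rule: raise_rows.induct)
  case (1 m q)
  then show ?case by (simp add: raisable_def)
next
  case (2 m a b D q)
  note ok = raisable_Cons[OF 2(4)]
  show ?case using 2(1)[OF Hw_rdiff[OF 2(2,3) ok(1-6)] 2(3) ok(7)] by simp
qed

lemma rdiff_sum:
  "rdiff m a b (\<lambda>g. \<Sum>i\<in>A. c i * F i g) = (\<lambda>g. \<Sum>i\<in>A. c i * rdiff m a b (F i) g)"
proof
  fix g show "rdiff m a b (\<lambda>g. \<Sum>i\<in>A. c i * F i g) g = (\<Sum>i\<in>A. c i * rdiff m a b (F i) g)"
    by (cases "g \<in> carrier (Sp m)") (simp_all add: rdiff_apply rdiff_outside right_diff_distrib sum_subtractf)
qed

lemma raise_all_sum: "raise_all m D (\<lambda>g. \<Sum>i\<in>A. c i * F i g) = (\<lambda>g. \<Sum>i\<in>A. c i * raise_all m D (F i) g)"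
proof (induction D arbitrary: F)
  case (Cons p D)
  obtain a b where p: "p = (a, b)" by (cases p)
  show ?case unfolding p raise_all.simps rdiff_sum by (rule Cons.IH)
qed simp

lemma raise_all_scale: "raise_all m D (\<lambda>g. c * f g) = (\<lambda>g. c * raise_all m D f g)"
  using raise_all_sum[of m D "\<lambda>_. c" "\<lambda>_. f" "{()}"] by simp

lemma rdiff_diff: "rdiff m a b (\<lambda>g. f g - h g) = (\<lambda>g. rdiff m a b f g - rdiff m a b h g)"
proof
  fix g show "rdiff m a b (\<lambda>g. f g - h g) g = rdiff m a b f g - rdiff m a b h g"
    by (cases "g \<in> carrier (Sp m)") (simp_all add: rdiff_apply rdiff_outside)
qed

lemma raise_all_diff: "raise_all m D (\<lambda>g. f g - h g) = (\<lambda>g. raise_all m D f g - raise_all m D h g)"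
proof (induction D arbitrary: f h)
  case (Cons p D)
  obtain a b where p: "p = (a, b)" by (cases p)
  show ?case unfolding p raise_all.simps rdiff_diff by (rule Cons.IH)
qed simp

lemma raise_all_zero: "raise_all m D (\<lambda>g. 0) = (\<lambda>g. 0)"
  using raise_all_scale[of m D 0 "\<lambda>g. 0"] by simp

lemma rt_commute:
  assumes g: "g \<in> carrier_mat (2*m) (2*m)" and "a < m" "b < m" "c < m" "d < m" "{a, b} \<inter> {c, d} = {}"
  shows "rt m a b s * (rt m c d t * g) = rt m c d t * (rt m a b s * g)"
proof (rule eq_matI)
  have lt: "a < 2*m" "b < 2*m" "c < 2*m" "d < 2*m" using assms by auto
  have nc: "x \<noteq> cj m y" "cj m y \<noteq> x" if "x < m" "y < m" for x y using that by (auto simp: cj_def)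
  have dis: "a \<noteq> c" "a \<noteq> d" "b \<noteq> c" "b \<noteq> d" "cj m a \<noteq> cj m c" "cj m a \<noteq> cj m d" "cj m b \<noteq> cj m c" "cj m b \<noteq> cj m d"
    using assms lt by auto
  fix k l assume "k < dim_row (rt m c d t * (rt m a b s * g))" "l < dim_col (rt m c d t * (rt m a b s * g))"
  then have kl: "k < 2*m" "l < 2*m" using g by (auto simp: rt_dim)
  let ?u = "\<lambda>x. g $$ (x, l)"
  have 1: "(rt m a b s * (rt m c d t * g)) $$ (k, l) = rr m a b s (rr m c d t ?u) k"
    by (intro rt_rr mult_square_mat[OF rt_carrier_mat g] lt kl g refl)
  have 2: "(rt m c d t * (rt m a b s * g)) $$ (k, l) = rr m c d t (rr m a b s ?u) k"
    by (intro rt_rr mult_square_mat[OF rt_carrier_mat g] lt kl g refl)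
  have "rr m a b s (rr m c d t u) k = rr m c d t (rr m a b s u) k" for u :: "nat \<Rightarrow> 'a"
  proof -
    consider "k = a" | "k = c" | "k = cj m b" | "k = cj m d" | "k \<noteq> a" "k \<noteq> c" "k \<noteq> cj m b" "k \<noteq> cj m d" by blast
    then show ?thesis
      using dis dis[symmetric] nc[OF assms(2,3)] nc[OF assms(2,4)] nc[OF assms(2,5)] nc[OF assms(3,4)] nc[OF assms(3,5)]
        nc[OF assms(4,2)] nc[OF assms(4,3)] nc[OF assms(4,5)] nc[OF assms(5,2)] nc[OF assms(5,3)] nc[OF assms(5,4)]
        nc[OF assms(3,2)]
      by cases (simp_all add: rr_def)
  qed
  then show "(rt m a b s * (rt m c d t * g)) $$ (k, l) = (rt m c d t * (rt m a b s * g)) $$ (k, l)"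
    unfolding 1 2 .
qed (use g in \<open>auto simp: rt_dim\<close>)

lemma rdiff_commute:
  fixes f :: "'a::field mat \<Rightarrow> 'a"
  assumes "a < m" "b < m" "c < m" "d < m" "{a, b} \<inter> {c, d} = {}" "a \<noteq> b" "c \<noteq> d"
  shows "rdiff m a b (rdiff m c d f) = rdiff m c d (rdiff m a b f)"
proof
  fix g :: "'a mat"
  have lt: "a < 2*m" "b < 2*m" "c < 2*m" "d < 2*m" using assms by auto
  show "rdiff m a b (rdiff m c d f) g = rdiff m c d (rdiff m a b f) g"
  proof (cases "g \<in> carrier (Sp m)")
    case True
    have S: "rt m a b 1 * g \<in> carrier (Sp m)" "rt m c d 1 * g \<in> carrier (Sp m)"
      using assms lt True by (auto intro: rt_mult_Sp)
    show ?thesis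
      unfolding rdiff_apply[OF True] rdiff_apply[OF S(1)] rdiff_apply[OF S(2)]
        rt_commute[OF Sp_carrier_mat[OF True] assms(1-5)] by simp
  qed (simp add: rdiff_outside)
qed

lemma raise_all_front:
  assumes "matching (set D)" "pts (set D) \<subseteq> {..<m}" "distinct D" "p \<in> set D"
  shows "raise_all m D f = raise_all m (p # remove1 p D) f"
  using assms
proof (induction D arbitrary: f)
  case (Cons p' D)
  show ?case
  proof (cases "p = p'")
    case False
    then have p: "p \<in> set D" using Cons by simp
    obtain a b c d where ab: "p' = (a, b)" "p = (c, d)" by (metis surj_pair)
    have M: "matching (set D)" using Cons.prems(1) matching_subset by (metis set_subset_Cons)
    have "raise_all m (p' # D) f = raise_all m D (rdiff m a b f)" by (simp add: ab)
    also have "\<dots> = raise_all m (p # remove1 p D) (rdiff m a b f)"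
      using Cons.prems p M by (intro Cons.IH) auto
    also have "\<dots> = raise_all m (remove1 p D) (rdiff m c d (rdiff m a b f))" by (simp add: ab)
    also have "rdiff m c d (rdiff m a b f) = rdiff m a b (rdiff m c d f)"
    proof (rule rdiff_commute)
      show "c < m" "d < m" "a < m" "b < m" using Cons.prems(2) p ab by (force simp: pts_def)+
      show "{c, d} \<inter> {a, b} = {}" using Cons.prems(1) p False ab unfolding matching_def by fastforce
      show "c \<noteq> d" "a \<noteq> b" using Cons.prems(1) p ab unfolding matching_def by force+
    qed
    finally show ?thesis using False by (simp add: ab)
  qed simp
qed simp

text \<open>Raising operators along disjoint arcs commute, so only the set of arcs matters.\<close>

lemma raise_all_set_eq:
  assumes "matching (set D)" "pts (set D) \<subseteq> {..<m}" "distinct D" "distinct D'" "set D = set D'"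
  shows "raise_all m D f = raise_all m D' f"
  using assms
proof (induction D' arbitrary: D f)
  case (Cons p D')
  have p: "p \<in> set D" using Cons.prems by simp
  obtain a b where ab: "p = (a, b)" by (cases p)
  have s: "set (remove1 p D) = set D'" using Cons.prems by auto
  have "raise_all m D f = raise_all m (p # remove1 p D) f" by (rule raise_all_front[OF Cons.prems(1-3) p])
  also have "\<dots> = raise_all m (remove1 p D) (rdiff m a b f)" by (simp add: ab)
  also have "\<dots> = raise_all m D' (rdiff m a b f)"
  proof (rule Cons.IH[OF _ _ _ _ s])
    show "matching (set (remove1 p D))" using Cons.prems(1) matching_subset set_remove1_subset by metis
    show "pts (set (remove1 p D)) \<subseteq> {..<m}" using Cons.prems(2) set_remove1_subset[of p D] by (fastforce simp: pts_def)
  qed (use Cons.prems in auto)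
  finally show ?case by (simp add: ab)
qed simp

text \<open>Each arc contributes the factor \<open>pair_sign\<close> and consumes one pair of
  \<open>S\<close>. After as many arcs as pairs, an extremal minor remains, with the coefficient of
  \<open>S\<close> in the polytabloid as its factor. This is the link between the group and the
  combinatorics.\<close>

lemma raise_all_zf:
  assumes "raisable m q D" "r \<le> m" "S \<subseteq> {..<m}" "card S = length D" "length q + 2 * card S = r"
  shows "raise_all m D (zf m r q S) = (\<lambda>g. matching_sign (set D) S * mfun m r (raise_rows m D q) g)"
  using assms
proof (induction D arbitrary: q S)
  case Nil
  then have "S = {}" using finite_subset[of S "{..<m}"] by simp
  then show ?case by (simp add: zf_def)
next
  case (Cons p D)
  obtain a b where p: "p = (a, b)" by (cases p)
  note ok = raisable_Cons[OF Cons.prems(1)[unfolded p]]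
  have "a \<notin> set q" "cj m b \<notin> set q"
  proof -
    show "a \<notin> set q" using ok(2,3) by (metis imageI nm_id)
    show "cj m b \<notin> set q" using ok(4,5) by (metis imageI nm_cj nm_id trans_less_add1 mult_2)
  qed
  then have rd: "rdiff m a b (zf m r q S :: 'a mat \<Rightarrow> 'a) = (\<lambda>g. pair_sign (a, b) S * zf m r (q @ [b, cj m a]) (S - {a, b}) g)"
    by (intro rdiff_zf ok Cons.prems iso_listD)
  have nin: "(a, b) \<notin> set D" using ok(8) by (force simp: pts_def)
  have e: "matching_sign (set (p # D)) S = pair_sign (a, b) S * (matching_sign (set D) S :: 'a)"
    unfolding p using nin by (simp add: matching_sign_insert)
  have "raise_all m (p # D) (zf m r q S :: 'a mat \<Rightarrow> 'a) = (\<lambda>g. pair_sign (a, b) S * raise_all m D (zf m r (q @ [b, cj m a]) (S - {a, b})) g)"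
    unfolding p raise_all.simps rd raise_all_scale ..
  also have "\<dots> = (\<lambda>g. matching_sign (set (p # D)) S * mfun m r (raise_rows m (p # D) q) g)"
  proof (cases "pair_sign (a, b) S = (0::'a)")
    case False
    then have one: "(a \<in> S) \<noteq> (b \<in> S)" using pair_sign_nonzero by fastforce
    have fS: "finite S" using Cons.prems(3) finite_subset by blast
    have c: "card (S - {a, b}) = length D"
    proof -
      obtain x where x: "S \<inter> {a, b} = {x}" using one by auto
      have "S - {a, b} = S - {x}" "x \<in> S" using x by auto
      then show ?thesis using fS Cons.prems(4) by (simp add: card_Diff_singleton)
    qed
    have "raise_all m D (zf m r (q @ [b, cj m a]) (S - {a, b}) :: 'a mat \<Rightarrow> 'a)
        = (\<lambda>g. matching_sign (set D) (S - {a, b}) * mfun m r (raise_rows m D (q @ [b, cj m a])) g)"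
      by (rule Cons.IH[OF ok(7) Cons.prems(2) _ c]) (use Cons.prems c in auto)
    moreover have "matching_sign (set D) (S - {a, b}) = (matching_sign (set D) S :: 'a)"
      by (rule matching_sign_cong) (use ok(8,9) in auto)
    ultimately show ?thesis unfolding e by (simp add: p mult.assoc)
  next
    case True
    then show ?thesis unfolding e by simp
  qed
  finally show ?case .
qed

section \<open>The induced module is spanned by minors\<close>

lemma nc_empty: "nc Z {}"
  by (induction Z) (auto intro: nc.intros)

lemma rdiff_invariant:
  assumes "rdiff m a b f = 0" "g \<in> carrier (Sp m)"
  shows "f (rt m a b 1 * g) = f g"
  using rdiff_apply[OF assms(2), of a b f] assms(1) by simp

text \<open>\<open>raising_injective\<close> for weights given by lists: on a shorter list the
  adjacent raisings alone detect zero, on one of length \<open>r\<close> they do so together with a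
  single value.\<close>

lemma vanishing_of_adjacent:
  fixes f :: "'a::alg_closed_field mat \<Rightarrow> 'a"
  assumes f: "f \<in> Hw m r (lw m q)" and r: "r \<le> m" and q: "length q \<le> r"
    and qZ: "iso_list m (q @ Z)" "length (q @ Z) = m" "set Z \<subseteq> {..<m}"
    and adj: "\<And>X a b Y. Z = X @ [b, a] @ Y \<Longrightarrow> rdiff m a b f = 0"
    and one: "length q < r \<or> f (frm m (rev (map (cj m) q) @ rev Z)) = 0"
  shows "f = 0"
proof (rule raising_injective[OF f r])
  \<comment> \<open>The partners of \<open>q\<close> come first because there the weight must be -1.
    Both lists are reversed: \<open>Z\<close> is read backwards like the matchings, and with
    \<open>q\<close> reversed the last \<open>r\<close> columns of the matrix are, up to sign, the
    coordinate vectors of \<open>q\<close> in order.\<close>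
  let ?l = "rev (map (cj m) q) @ rev Z"
  have iq: "iso_list m q" by (rule iso_list_appendD[OF qZ(1)])
  have "mset ?l = mset (map (cj m) q @ Z)" by simp
  moreover have "iso_list m (map (cj m) q @ Z)" using qZ(1) iso_list_cj[OF iso_listD[OF iq]] by simp
  ultimately show "iso_list m ?l" using iso_list_mset by metis
  show "length ?l = m" using qZ(2) by simp
  show "length q \<le> m" using q r by simp
  show "lw m q (?l ! i) = - 1" if i: "i < length q" for i
  proof -
    have "?l ! i = cj m (q ! (length q - Suc i))" using i by (simp add: nth_append rev_nth)
    moreover have "q ! (length q - Suc i) \<in> set q" using i by simp
    ultimately show ?thesis using lw_mem(2)[OF iq] by simp
  qed
  have lZ: "?l ! i = Z ! (length Z - Suc (i - length q))" if "length q \<le> i" "i < m" for i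
  proof -
    have "i - length q < length Z" using that qZ(2) by simp
    then show ?thesis using that by (simp add: nth_append rev_nth)
  qed
  show "?l ! i < m \<and> lw m q (?l ! i) = 0" if i: "length q \<le> i" "i < m" for i
  proof -
    have "length Z - Suc (i - length q) < length Z" using i qZ(2) by simp
    then have mem: "?l ! i \<in> set Z" unfolding lZ[OF i] by (rule nth_mem)
    then have lt: "?l ! i < m" using qZ(3) by auto
    have "nm m x \<noteq> nm m (?l ! i)" if "x \<in> set q" for x
      using qZ(1) that mem by (force simp: iso_list_def)
    then have "nm m (?l ! i) \<notin> nm m ` set q" by force
    then show ?thesis using lw_outside[OF iso_listD[OF iq], of "?l ! i"] lt by simp
  qed
  show "f (rt m (?l ! i) (?l ! Suc i) 1 * g) = f g" if i: "length q \<le> i" "Suc i < m" and g: "g \<in> carrier (Sp m)" for i g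
  proof -
    define k where "k = length Z - Suc (Suc i - length q)"
    have k: "Suc k < length Z" "k < length Z" "?l ! i = Z ! Suc k" "?l ! Suc i = Z ! k"
      using i qZ(2) lZ[of i] lZ[of "Suc i"] by (auto simp: k_def Suc_diff_le Suc_diff_Suc)
    have "Z = take k Z @ [Z ! k, Z ! Suc k] @ drop (Suc (Suc k)) Z"
      using k by (simp add: Cons_nth_drop_Suc)
    from adj[OF this] show ?thesis unfolding k(3,4) by (rule rdiff_invariant[OF _ g])
  qed
  show "length q < r \<or> f (frm m ?l) = 0" by (rule one)
qed

text \<open>By induction every adjacent raising of \<open>f\<close> is zero, and then so is
  \<open>f\<close>. Only noncrossing matchings are ever tested, which keeps the conditions
  independent in the sense of \<open>nc_interpolation\<close>.\<close>

theorem raising_matchings_injective: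
  fixes f :: "'a::alg_closed_field mat \<Rightarrow> 'a"
  assumes f: "f \<in> Hw m r (lw m q)" and r: "r \<le> m" and q: "length q + 2 * j \<le> r"
    and qZ: "iso_list m (q @ Z)" "length (q @ Z) = m" "set Z \<subseteq> {..<m}"
    and D: "\<And>D. nc Z (set D) \<Longrightarrow> distinct D \<Longrightarrow> length D = j \<Longrightarrow> raise_all m D f = 0"
  shows "f = 0"
  using f q qZ D
proof (induction j arbitrary: f q Z)
  case 0
  then show ?case using 0(6)[of "[]"] nc_empty by simp
next
  case (Suc j)
  have Z: "distinct Z" using Suc.prems(3) by (simp add: iso_list_def distinct_map)
  show ?case
  proof (rule vanishing_of_adjacent[OF Suc.prems(1) r _ Suc.prems(3-5)])
    show "length q \<le> r" "length q < r \<or> f (frm m (rev (map (cj m) q) @ rev Z)) = 0" using Suc.prems(2) by auto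
    fix X a b Y assume XY: "Z = X @ [b, a] @ Y"
    have iq: "iso_list m q" by (rule iso_list_appendD[OF Suc.prems(3)])
    have dZ: "distinct (map (nm m) q @ map (nm m) Z)" using Suc.prems(3) by (simp add: iso_list_def)
    have ab: "a < m" "b < m" using Suc.prems(5) XY by auto
    have nq: "a \<notin> nm m ` set q" "b \<notin> nm m ` set q" "a \<noteq> b"
      using dZ ab unfolding XY by (auto simp: image_iff)
    show "rdiff m a b f = 0"
    proof (rule Suc.IH[of _ "q @ [b, cj m a]" "X @ Y"])
      show "rdiff m a b f \<in> Hw m r (lw m (q @ [b, cj m a]))"
        by (rule Hw_rdiff[OF Suc.prems(1) r iq ab(1) nq(1) ab(2) nq(2) nq(3)])
      show "length (q @ [b, cj m a]) + 2 * j \<le> r" using Suc.prems(2) by simp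
      show "length ((q @ [b, cj m a]) @ X @ Y) = m" using Suc.prems(4) by (simp add: XY)
      show "set (X @ Y) \<subseteq> {..<m}" using Suc.prems(5) by (simp add: XY)
      show "iso_list m ((q @ [b, cj m a]) @ X @ Y)"
        using Suc.prems(3) ab unfolding XY iso_list_def by (auto simp: image_iff)
      fix D assume D: "nc (X @ Y) (set D)" "distinct D" "length D = j"
      have "pts (set D) \<subseteq> set (X @ Y)" using nc_matching[OF D(1)] Z by (simp add: XY)
      then have "(a, b) \<notin> set D" using Z by (force simp: XY pts_def)
      \<comment> \<open>The arc between the neighbours extends the noncrossing matching of the other
        points.\<close>
      then have "raise_all m ((a, b) # D) f = 0"
        using nc_insert_adjacent[OF D(1), of b a] Z D XY by (intro Suc.prems(6)) auto
      then show "raise_all m D (rdiff m a b f) = 0" by simp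
    qed
  qed
qed

text \<open>In the rows \<open>q\<close> and the last \<open>r\<close> columns this matrix is
  diagonal with entries 1 and -1.\<close>

lemma mfun_frm_nonzero:
  fixes m :: nat
  assumes q: "length q = r" "r \<le> m" and qZ: "iso_list m (q @ Z)" "length (q @ Z) = m"
  shows "mfun m r q (frm m (rev (map (cj m) q) @ rev Z)) \<noteq> (0::'a::field)"
proof -
  let ?l = "rev (map (cj m) q) @ rev Z"
  have iq: "iso_list m q" by (rule iso_list_appendD[OF qZ(1)])
  have "mset ?l = mset (map (cj m) q @ Z)" by simp
  moreover have "iso_list m (map (cj m) q @ Z)" using qZ(1) iso_list_cj[OF iso_listD[OF iq]] by simp
  ultimately have l: "iso_list m ?l" "length ?l = m" using iso_list_mset qZ(2) by (metis, simp)
  let ?W = "frm m ?l :: 'a mat"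
  have ent: "mrow m r ?W (q ! i) k = (if i = k then - sg m (q ! i) else 0)" if ik: "i < r" "k < r" for i k
  proof -
    let ?b = "2*m - r + k"
    have b: "?b < 2*m" "\<not> ?b < m" "cj m ?b = r - 1 - k" using ik q(2) by (auto simp: cj_def)
    have qk: "q ! k \<in> set q" "q ! i \<in> set q" using ik q by auto
    then have q2: "q ! k < 2*m" "q ! i < 2*m" using iso_listD[OF iq] by auto
    have "fperm m ?l ?b = cj m (?l ! (r - 1 - k))" using b by (simp add: fperm_def)
    also have "?l ! (r - 1 - k) = cj m (q ! k)" using ik q(1) by (simp add: nth_append rev_nth)
    finally have f: "fperm m ?l ?b = q ! k" using q2 by simp
    have "distinct q" using iq by (simp add: iso_list_def distinct_map)
    then have "q ! i = q ! k \<longleftrightarrow> i = k" using ik q(1) by (simp add: nth_eq_iff_index_eq)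
    then show ?thesis unfolding mrow_def frm_entry[OF q2(2) b(1)] f using b(2) by simp
  qed
  have "mdet m r q ?W = det (mat r r (\<lambda>(i, k). if i = k then - sg m (q ! i) else 0))"
    unfolding mdet_def rdet_def using q ent by (intro arg_cong[of _ _ det] eq_matI) auto
  also have "\<dots> = prod_list (diag_mat (mat r r (\<lambda>(i, k). if i = k then - sg m (q ! i) else 0)))"
    by (rule det_lower_triangular[of r]) auto
  also have "\<dots> = (\<Prod>i<r. - sg m (q ! i))"
    by (simp add: prod_list_diag_prod atLeast0LessThan)
  also have "\<dots> \<noteq> 0" by (simp add: sg_def)
  finally show ?thesis using frm_Sp[OF l] by (simp add: mfun_def)
qed

lemma Hw_diff:
  assumes "f \<in> Hw m r \<nu>" "h \<in> Hw m r \<nu>" "r \<le> m"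
  shows "(\<lambda>g. f g - h g) \<in> Hw m r \<nu>"
  using assms ind_diff by (auto simp: Hw_def right_diff_distrib)

lemma Hw_sum:
  assumes r: "r \<le> m" and F: "\<And>i. i \<in> A \<Longrightarrow> F i \<in> Hw m r \<nu>"
  shows "(\<lambda>g. \<Sum>i\<in>A. c i * F i g) \<in> Hw m r \<nu>"
proof -
  have Fi: "F i \<in> ind m r" if "i \<in> A" for i by (rule Hw_ind[OF F[OF that]])
  have "(\<lambda>g. \<Sum>i\<in>A. c i * F i g) \<in> ind m r"
    using Fi
  proof (induction A rule: infinite_finite_induct)
    case (insert x A)
    have "(\<lambda>g. c x * F x g + (\<Sum>i\<in>A. c i * F i g)) \<in> ind m r"
      using insert by (intro ind_add ind_cmult r) auto
    then show ?case using insert by simp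
  qed (use ind_zero[OF r] in auto)
  then show ?thesis using F by (auto simp: Hw_def sum_distrib_left mult.left_commute intro!: sum.cong)
qed

text \<open>Subtracting a multiple of the minor makes the value at one point 0; any further raising
  would give a weight with too many nonzero entries.\<close>

lemma extremal_weight_space:
  fixes f :: "'a::alg_closed_field mat \<Rightarrow> 'a"
  assumes f: "f \<in> Hw m r (lw m q)" and r: "r \<le> m" and q: "iso_list m q" "length q = r"
  shows "\<exists>c. f = (\<lambda>g. c * mfun m r q g)"
proof -
  note qZ = iso_list_zc[OF q(1)]
  let ?W = "frm m (rev (map (cj m) q) @ rev (zc m q)) :: 'a mat"
  have nz: "mfun m r q ?W \<noteq> 0" by (rule mfun_frm_nonzero[OF q(2) r qZ])
  have mf: "mfun m r q \<in> Hw m r (lw m q)" by (rule mfun_Hw[OF iso_listD[OF q(1)] q(2) r])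
  define c where "c = f ?W / mfun m r q ?W"
  define h where "h g = f g - c * mfun m r q g" for g
  have "(\<lambda>g. \<Sum>i\<in>{()}. c * mfun m r q g) \<in> Hw m r (lw m q)" by (rule Hw_sum[OF r mf])
  then have h: "h \<in> Hw m r (lw m q)" unfolding h_def by (intro Hw_diff f r) simp
  have "h = 0"
  proof (rule vanishing_of_adjacent[OF h r _ qZ])
    show "length q \<le> r" using q by simp
    show "set (zc m q) \<subseteq> {..<m}" by (auto simp: set_zc)
    show "length q < r \<or> h ?W = 0" using nz by (simp add: h_def c_def)
    fix X a b Y assume XY: "zc m q = X @ [b, a] @ Y"
    have "a \<in> set (zc m q)" "b \<in> set (zc m q)" by (simp_all add: XY)
    then have ab: "a < m" "a \<notin> nm m ` set q" "b < m" "b \<notin> nm m ` set q" by (auto simp: set_zc)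
    have "distinct (zc m q)" by (simp add: zc_def)
    then have ne: "a \<noteq> b" by (auto simp: XY)
    show "rdiff m a b h = 0"
      by (rule Hw_too_long[OF Hw_rdiff[OF h r q(1) ab ne] r iso_list_snoc_pair[OF q(1) ab ne]]) (use q in simp)
  qed
  then show ?thesis by (intro exI[of _ c]) (auto simp: h_def fun_eq_iff)
qed

lemma zf_Hw:
  assumes r: "r \<le> m" and q: "iso_list m q" and J: "J \<subseteq> {..<m}" "length q + 2 * card J = r"
  shows "zf m r q J \<in> Hw m r (lw m q)"
proof -
  have fJ: "finite J" using J finite_subset by blast
  have J2: "set (sorted_list_of_set J) \<subseteq> {..<2*m}" using J(1) fJ by fastforce
  have s: "set (q @ zl m (sorted_list_of_set J)) \<subseteq> {..<2*m}"
    using iso_listD[OF q] J2 by (auto simp: set_zl)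
  have "mfun m r (q @ zl m (sorted_list_of_set J)) \<in> Hw m r (lw m (q @ zl m (sorted_list_of_set J)))"
    by (rule mfun_Hw[OF s _ r]) (use J(2) in simp)
  moreover have "Hw m r (lw m (q @ zl m (sorted_list_of_set J))) = Hw m r (lw m q)"
    by (rule Hw_cong) (simp add: lw_append lw_zl[OF J2])
  ultimately show ?thesis unfolding zf_def by blast
qed

lemma nc_raisable:
  assumes q: "iso_list m q" and D: "nc (zc m q) (set D)" "distinct D"
  shows "raisable m q D"
proof -
  have "distinct (zc m q)" by (simp add: zc_def)
  then show ?thesis using nc_matching[OF D(1)] q D(2) by (auto simp: raisable_def set_zc)
qed

text \<open>Raising \<open>f\<close> along each noncrossing matching gives a scalar times an
  extremal minor. \<open>nc_interpolation\<close> supplies a combination of minors with the same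
  scalars, and the difference is zero by injectivity of the raisings.\<close>

theorem weight_space_span:
  fixes f :: "'a::alg_closed_field mat \<Rightarrow> 'a"
  assumes f: "f \<in> Hw m r (lw m q)" and r: "r \<le> m" and q: "iso_list m q" "length q + 2 * j = r"
  shows "\<exists>c. f = (\<lambda>g. \<Sum>J\<in>subsets j (set (zc m q)). c J * zf m r q J g)"
proof -
  let ?Z = "zc m q"
  note qZ = iso_list_zc[OF q(1)]
  have dZ: "distinct ?Z" "set ?Z \<subseteq> {..<m}" by (auto simp: zc_def)
  \<comment> \<open>The rows gained depend on the order of the arcs, so one enumeration of each
    matching is fixed to define its scalar.\<close>
  define DM where "DM M = (SOME D. set D = M \<and> distinct D)" for M :: "(nat \<times> nat) set"
  have DM: "set (DM M) = M" "distinct (DM M)" if "nc ?Z M" for M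
  proof -
    have "finite M" using nc_matching[OF that dZ(1)] matching_finite by blast
    then have "\<exists>D. set D = M \<and> distinct D" by (rule finite_distinct_list)
    then have "set (DM M) = M \<and> distinct (DM M)" unfolding DM_def by (rule someI_ex)
    then show "set (DM M) = M" "distinct (DM M)" by auto
  qed
  have ok: "raisable m q (DM M)" if "nc ?Z M" for M
    by (rule nc_raisable[OF q(1)]) (use DM[OF that] that in auto)
  have lenD: "length (DM M) = card M" if "nc ?Z M" for M using DM[OF that] distinct_card by metis
  have "\<exists>c. raise_all m (DM M) f = (\<lambda>g. c * mfun m r (raise_rows m (DM M) q) g)" if M: "nc ?Z M" "card M = j" for M
    using raise_all_Hw[OF f r ok[OF M(1)]] q(2) lenD[OF M(1)] M(2) by (intro extremal_weight_space[OF _ r]) auto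
  then obtain y where y: "\<And>M. nc ?Z M \<Longrightarrow> card M = j \<Longrightarrow> raise_all m (DM M) f = (\<lambda>g. y M * mfun m r (raise_rows m (DM M) q) g)"
    by metis
  obtain c where c: "\<forall>M. nc ?Z M \<and> card M = j \<longrightarrow> (\<Sum>J\<in>subsets j (set ?Z). c J * matching_sign M J) = y M"
    using nc_interpolation[OF dZ(1), of j y] by blast
  define h where "h g = (\<Sum>J\<in>subsets j (set ?Z). c J * zf m r q J g)" for g
  have J: "J \<subseteq> {..<m}" "length q + 2 * card J = r" "card J = j" if "J \<in> subsets j (set ?Z)" for J
    using that dZ(2) q(2) by (auto simp: subsets_def)
  have h: "h \<in> Hw m r (lw m q)" unfolding h_def using J by (intro Hw_sum r zf_Hw q(1)) auto
  have "(\<lambda>g. f g - h g) = 0"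
  proof (rule raising_matchings_injective[OF Hw_diff[OF f h r] r _ qZ dZ(2)])
    show "length q + 2 * j \<le> r" using q by simp
    fix D assume D: "nc ?Z (set D)" "distinct D" "length D = j"
    let ?M = "set D"
    have cM: "card ?M = j" using D distinct_card by metis
    have "raise_all m D (\<lambda>g. f g - h g) = raise_all m (DM ?M) (\<lambda>g. f g - h g)"
      by (rule raise_all_set_eq) (use nc_matching[OF D(1) dZ(1)] dZ(2) D DM[OF D(1)] in auto)
    also have "\<dots> = (\<lambda>g. y ?M * mfun m r (raise_rows m (DM ?M) q) g - raise_all m (DM ?M) h g)"
      unfolding raise_all_diff y[OF D(1) cM] ..
    also have "raise_all m (DM ?M) h = (\<lambda>g. \<Sum>J\<in>subsets j (set ?Z). c J * raise_all m (DM ?M) (zf m r q J) g)"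
      unfolding h_def by (rule raise_all_sum)
    also have "\<dots> = (\<lambda>g. (\<Sum>J\<in>subsets j (set ?Z). c J * matching_sign ?M J) * mfun m r (raise_rows m (DM ?M) q) g)"
    proof
      fix g :: "'a mat"
      have "raise_all m (DM ?M) (zf m r q J) g = matching_sign ?M J * mfun m r (raise_rows m (DM ?M) q) g" if "J \<in> subsets j (set ?Z)" for J
        using raise_all_zf[OF ok[OF D(1)] r J(1)[OF that], THEN fun_cong, of g] J[OF that] lenD[OF D(1)] cM DM(1)[OF D(1)] by simp
      then show "(\<Sum>J\<in>subsets j (set ?Z). c J * raise_all m (DM ?M) (zf m r q J) g) =
          (\<Sum>J\<in>subsets j (set ?Z). c J * matching_sign ?M J) * mfun m r (raise_rows m (DM ?M) q) g"
        unfolding sum_distrib_right by (intro sum.cong refl) simp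
    qed
    also have "(\<Sum>J\<in>subsets j (set ?Z). c J * matching_sign ?M J) = y ?M" using c D(1) cM by blast
    finally show "raise_all m D (\<lambda>g. f g - h g) = 0" by auto
  qed
  then show ?thesis by (intro exI[of _ c]) (auto simp: h_def fun_eq_iff)
qed

text \<open>Raising \<open>j\<close> times leaves one entry fewer than \<open>r\<close>, where the
  value at the identity vanishes and the next raising would give too many entries.\<close>

lemma weight_space_odd:
  fixes f :: "'a::alg_closed_field mat \<Rightarrow> 'a"
  assumes f: "f \<in> Hw m r (lw m q)" and r: "r \<le> m" and q: "iso_list m q" "length q + 2 * j + 1 = r"
  shows "f = 0"
proof -
  note qZ = iso_list_zc[OF q(1)]
  have dZ: "set (zc m q) \<subseteq> {..<m}" by (auto simp: zc_def)
  show ?thesis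
  proof (rule raising_matchings_injective[OF f r _ qZ dZ])
    show "length q + 2 * j \<le> r" using q by simp
    fix D assume D: "nc (zc m q) (set D)" "distinct D" "length D = j"
    let ?q = "raise_rows m D q"
    have g: "raise_all m D f \<in> Hw m r (lw m ?q)" "iso_list m ?q" using raise_all_Hw[OF f r nc_raisable[OF q(1) D(1,2)]] by auto
    have len: "length ?q + 1 = r" using q D by simp
    note qZ' = iso_list_zc[OF g(2)]
    show "raise_all m D f = 0"
    proof (rule vanishing_of_adjacent[OF g(1) r _ qZ'])
      show "length ?q \<le> r" "length ?q < r \<or> raise_all m D f (frm m (rev (map (cj m) ?q) @ rev (zc m ?q))) = 0" using len by auto
      show "set (zc m ?q) \<subseteq> {..<m}" by (auto simp: set_zc)
      fix X a b Y assume XY: "zc m ?q = X @ [b, a] @ Y"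
      have "a \<in> set (zc m ?q)" "b \<in> set (zc m ?q)" by (simp_all add: XY)
      then have ab: "a < m" "a \<notin> nm m ` set ?q" "b < m" "b \<notin> nm m ` set ?q" by (auto simp: set_zc)
      have "distinct (zc m ?q)" by (simp add: zc_def)
      then have ne: "a \<noteq> b" by (auto simp: XY)
      show "rdiff m a b (raise_all m D f) = 0"
        by (rule Hw_too_long[OF Hw_rdiff[OF g(1) r g(2) ab ne] r iso_list_snoc_pair[OF g(2) ab ne]]) (use len in simp)
    qed
  qed
qed

text \<open>Once the entries are known to be -1, 0 or 1, the list consists of the indices at which
  the weight is 1, one from each pair with a nonzero entry.\<close>

lemma weight_list:
  fixes f :: "'a::alg_closed_field mat \<Rightarrow> 'a"
  assumes f: "f \<in> Hw m r \<nu>" "f \<noteq> 0" and r: "r \<le> m"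
  shows "\<exists>q. iso_list m q \<and> length q \<le> r \<and> f \<in> Hw m r (lw m q)"
proof -
  obtain g where g: "f g \<noteq> 0" using f(2) by (auto simp: fun_eq_iff)
  have gS: "g \<in> carrier (Sp m)" using g ind_outside[OF Hw_ind[OF f(1)]] by blast
  note b = weight_bound_single[OF f(1) r gS g]
  note cj = Hw_cj[OF f(1) gS g]
  define q where "q = map (\<lambda>c. if \<nu> c = 1 then c else cj m c) (filter (\<lambda>c. \<nu> c \<noteq> 0) [0..<m])"
  have "map (nm m) q = filter (\<lambda>c. \<nu> c \<noteq> 0) [0..<m]"
    unfolding q_def map_map by (rule map_idI) auto
  then have q: "iso_list m q" by (auto simp: iso_list_def q_def)
  have mem: "c \<in> set q \<longleftrightarrow> \<nu> c = 1" if c: "c < 2*m" for c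
  proof (cases "c < m")
    case True
    have "cj m x \<noteq> c" if "x < m" for x using that True by (auto simp: cj_def)
    then show ?thesis using True by (auto simp: q_def image_iff)
  next
    case False
    then have c': "cj m c < m" "c = cj m (cj m c)" using c by (auto simp: cj_def)
    have "c \<in> set q \<longleftrightarrow> (\<exists>x<m. \<nu> x \<noteq> 0 \<and> \<nu> x \<noteq> 1 \<and> c = cj m x)"
      using False by (auto simp: q_def image_iff)
    also have "\<dots> \<longleftrightarrow> \<nu> (cj m c) \<noteq> 0 \<and> \<nu> (cj m c) \<noteq> 1"
    proof
      assume "\<exists>x<m. \<nu> x \<noteq> 0 \<and> \<nu> x \<noteq> 1 \<and> c = cj m x"
      then show "\<nu> (cj m c) \<noteq> 0 \<and> \<nu> (cj m c) \<noteq> 1" by force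
    next
      assume "\<nu> (cj m c) \<noteq> 0 \<and> \<nu> (cj m c) \<noteq> 1"
      then show "\<exists>x<m. \<nu> x \<noteq> 0 \<and> \<nu> x \<noteq> 1 \<and> c = cj m x" using c' by blast
    qed
    also have "\<dots> \<longleftrightarrow> \<nu> c = 1" using cj[OF c] b[OF c] by auto
    finally show ?thesis .
  qed
  have \<nu>: "\<nu> c = lw m q c" if c: "c < 2*m" for c
  proof -
    consider "\<nu> c = 1" | "\<nu> c = - 1" | "\<nu> c = 0" using b[OF c] by linarith
    then show ?thesis
    proof cases
      case 1
      then show ?thesis using lw_mem(1)[OF q] mem[OF c] by simp
    next
      case 2
      then have "cj m c \<in> set q" using mem[of "cj m c"] cj[OF c] c by simp
      then show ?thesis using lw_mem(2)[OF q, of "cj m c"] 2 c by simp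
    next
      case 3
      have "nm m c \<notin> nm m ` set q"
      proof
        assume "nm m c \<in> nm m ` set q"
        then obtain x where x: "x \<in> set q" "nm m c = nm m x" by auto
        then have x2: "x < 2*m" using iso_listD[OF q] by auto
        have "c = x \<or> c = cj m x" using nm_eq_iff[OF c x2] x(2) by blast
        then show False using 3 mem[OF x2] x(1) cj[OF x2] by auto
      qed
      then show ?thesis using lw_outside[OF iso_listD[OF q] c] 3 by simp
    qed
  qed
  have fq: "f \<in> Hw m r (lw m q)" using f(1) Hw_cong[of m \<nu> "lw m q" r] \<nu> by blast
  have "length q \<le> r"
    using Hw_too_long[OF fq r q] f(2) by (meson not_less)
  then show ?thesis using q fq by blast
qed

definition minors :: "nat \<Rightarrow> nat \<Rightarrow> ('a::field mat \<Rightarrow> 'a) set" where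
  "minors m r = mfun m r ` {l. set l \<subseteq> {..<2*m} \<and> length l = r}"

lemma finite_minors: "finite (minors m r)"
  unfolding minors_def by (intro finite_imageI finite_lists_length_eq) simp

lemma zf_minor:
  assumes "iso_list m q" "J \<subseteq> {..<m}" "length q + 2 * card J = r"
  shows "zf m r q J \<in> minors m r"
proof -
  have "finite J" using assms finite_subset by blast
  moreover have "set (zl m (sorted_list_of_set J)) \<subseteq> {..<2*m}"
    using assms(2) \<open>finite J\<close> by (force simp: set_zl)
  ultimately show ?thesis
    using assms iso_listD[OF assms(1)] unfolding zf_def minors_def by (intro imageI) simp
qed

lemma sum_fun_apply: "(\<Sum>i\<in>A. F i) x = (\<Sum>i\<in>A. F i x)" for F :: "'i \<Rightarrow> 'b \<Rightarrow> 'c::comm_monoid_add"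
  by (induction A rule: infinite_finite_induct) (simp_all add: plus_fun_def zero_fun_def)

text \<open>The spanning set is finite, and it is this finite dimension that the duality argument
  uses.\<close>

theorem ind_span:
  assumes r: "r \<le> m"
  shows "ind m r = fun_space.span (minors m r :: ('a::alg_closed_field mat \<Rightarrow> 'a) set)"
proof
  let ?S = "fun_space.span (minors m r :: ('a mat \<Rightarrow> 'a) set)"
  show "?S \<subseteq> ind m r"
  proof (rule fun_space.span_minimal[OF _ ind_subspace[OF r]])
    show "minors m r \<subseteq> (ind m r :: ('a mat \<Rightarrow> 'a) set)"
      using mfun_ind[OF _ _ r] unfolding minors_def by blast
  qed
  have w: "f \<in> ?S" if f: "f \<in> Hw m r \<nu>" for f \<nu>
  proof (cases "f = 0")
    case False
    obtain q where q: "iso_list m q" "length q \<le> r" "f \<in> Hw m r (lw m q)" using weight_list[OF f False r] by blast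
    have "\<exists>j. length q + 2 * j = r \<or> length q + 2 * j + 1 = r" using q(2) by presburger
    then obtain j where "length q + 2 * j = r \<or> length q + 2 * j + 1 = r" by blast
    then have j: "length q + 2 * j = r" using weight_space_odd[OF q(3) r q(1)] False by blast
    obtain c where c: "f = (\<lambda>g. \<Sum>J\<in>subsets j (set (zc m q)). c J * zf m r q J g)"
      using weight_space_span[OF q(3) r q(1) j] by blast
    have "f = (\<Sum>J\<in>subsets j (set (zc m q)). fun_scale (c J) (zf m r q J))"
      unfolding c by (rule ext) (simp add: sum_fun_apply fun_scale_def)
    also have "\<dots> \<in> ?S"
    proof (intro fun_space.span_sum fun_space.span_scale fun_space.span_base)
      fix J assume "J \<in> subsets j (set (zc m q))"
      then show "zf m r q J \<in> minors m r"
        using j q(1) by (intro zf_minor) (auto simp: subsets_def set_zc)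
    qed
    finally show ?thesis .
  qed (simp add: fun_space.span_zero)
  show "ind m r \<subseteq> ?S"
  proof
    fix f :: "'a mat \<Rightarrow> 'a" assume "f \<in> ind m r"
    then have "f \<in> fun_space.span (\<Union>\<nu>. Hw m r \<nu>)" by (rule weight_decomposition[OF r])
    moreover have "fun_space.span (\<Union>\<nu>. Hw m r \<nu>) \<subseteq> ?S"
      by (rule fun_space.span_minimal) (use w in auto)
    ultimately show "f \<in> ?S" by blast
  qed
qed

text \<open>Zero is detected by the raisings along noncrossing matchings. These replace each minor
  by a polytabloid coefficient, and the coefficients cancel over the supersets of
  \<open>I\<close>.\<close>

theorem minor_relation:
  fixes g :: "'a::alg_closed_field mat"
  assumes r: "r \<le> m" and q: "iso_list m q" "length q + 2 * j = r" and I: "finite I" "card I < j"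
  shows "(\<Sum>J | J \<in> subsets j (set (zc m q)) \<and> I \<subseteq> J. zf m r q J g) = 0"
proof -
  let ?Z = "zc m q"
  let ?S = "{J. J \<in> subsets j (set ?Z) \<and> I \<subseteq> J}"
  note qZ = iso_list_zc[OF q(1)]
  have dZ: "distinct ?Z" "set ?Z \<subseteq> {..<m}" by (auto simp: zc_def)
  have J: "J \<subseteq> {..<m}" "length q + 2 * card J = r" "card J = j" if "J \<in> ?S" for J
    using that dZ(2) q(2) by (auto simp: subsets_def)
  define f :: "'a mat \<Rightarrow> 'a" where "f g = (\<Sum>J\<in>?S. 1 * zf m r q J g)" for g
  have f: "f \<in> Hw m r (lw m q)" unfolding f_def using J by (intro Hw_sum r zf_Hw q(1)) auto
  have "f = 0"
  proof (rule raising_matchings_injective[OF f r _ qZ dZ(2)])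
    show "length q + 2 * j \<le> r" using q by simp
    fix D assume D: "nc ?Z (set D)" "distinct D" "length D = j"
    have cM: "card (set D) = j" using D distinct_card by metis
    have "raise_all m D f = (\<lambda>g. \<Sum>J\<in>?S. 1 * raise_all m D (zf m r q J) g)"
      unfolding f_def by (rule raise_all_sum)
    also have "\<dots> = (\<lambda>g. (\<Sum>J\<in>?S. matching_sign (set D) J) * mfun m r (raise_rows m D q) g)"
    proof
      fix g :: "'a mat"
      have "raise_all m D (zf m r q J) g = matching_sign (set D) J * mfun m r (raise_rows m D q) g" if "J \<in> ?S" for J
        using raise_all_zf[OF nc_raisable[OF q(1) D(1,2)] r J(1)[OF that], THEN fun_cong, of g] J[OF that] D(3) by simp
      then show "(\<Sum>J\<in>?S. 1 * raise_all m D (zf m r q J) g) = (\<Sum>J\<in>?S. matching_sign (set D) J) * mfun m r (raise_rows m D q) g"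
        unfolding sum_distrib_right by (intro sum.cong refl) simp
    qed
    also have "(\<Sum>J\<in>?S. matching_sign (set D) J) = (0::'a)"
      using sum_matching_sign_superset[of "set D" "set ?Z" I, where 'a = 'a] nc_matching[OF D(1) dZ(1)] I cM by simp
    finally show "raise_all m D f = 0" by auto
  qed
  then have "f g = 0" by simp
  then show ?thesis by (simp add: f_def)
qed

section \<open>Submodules of the induced module\<close>

lemma trl_trl:
  assumes "h \<in> carrier (Sp m)" "h' \<in> carrier (Sp m)"
  shows "trl m h (trl m h' f) = trl m (h' * h) f"
proof
  fix x
  show "trl m h (trl m h' f) x = trl m (h' * h) f x"
  proof (cases "x \<in> carrier (Sp m)")
    case True
    then show ?thesis using Sp_mult[OF assms(1) True] Sp_assoc[OF assms(2,1) True] by (simp add: trl_def)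
  qed (simp add: trl_def)
qed

lemma mfun_outside: "g \<notin> carrier (Sp m) \<Longrightarrow> mfun m r l g = 0"
  by (simp add: mfun_def)

lemma trl_frm_mfun:
  assumes q: "iso_list m q" "length q = r" and r: "r \<le> m"
  shows "trl m (frm m (q @ zc m q)) (mfun m r q) = (mfun m r [0..<r] :: 'a::field mat \<Rightarrow> 'a)"
proof
  fix g :: "'a mat"
  let ?l = "q @ zc m q"
  note l = iso_list_zc[OF q(1)]
  show "trl m (frm m ?l) (mfun m r q) g = mfun m r [0..<r] g"
  proof (cases "g \<in> carrier (Sp m)")
    case True
    have gc: "g \<in> carrier_mat (2*m) (2*m)" by (rule Sp_carrier_mat[OF True])
    have "mdet m r q (frm m ?l * g) = mdet m r [0..<r] g"
      unfolding mdet_def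
    proof (rule rdet_cong)
      fix i k assume ik: "i < r" "k < r"
      have i: "i < m" "i < 2*m" using ik r by auto
      have c: "2*m - r + k < 2*m" using ik r by simp
      have qi: "q ! i = fperm m ?l i" using ik q(2) i by (simp add: fperm_def nth_append)
      have qi2: "fperm m ?l i < 2*m" by (rule fperm_props(1)[OF l i(2)])
      have "(frm m ?l * g) $$ (fperm m ?l i, 2*m - r + k)
          = (\<Sum>b<2*m. frm m ?l $$ (fperm m ?l i, b) * g $$ (b, 2*m - r + k))"
        by (rule mult_entry[OF frm_carrier gc qi2 c])
      also have "\<dots> = (\<Sum>b<2*m. if b = i then g $$ (i, 2*m - r + k) else 0)"
      proof (intro sum.cong refl)
        fix b assume "b \<in> {..<2*m}"
        then have b: "b < 2*m" by simp
        show "frm m ?l $$ (fperm m ?l i, b) * g $$ (b, 2*m - r + k) = (if b = i then g $$ (i, 2*m - r + k) else 0)"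
          unfolding frm_entry[OF qi2 b] fperm_props(3)[OF l i(2) b] using i(1) by auto
      qed
      also have "\<dots> = g $$ (i, 2*m - r + k)" using i(2) by simp
      finally show "(map (mrow m r (frm m ?l * g)) q ! i) k = (map (mrow m r g) [0..<r] ! i) k"
        using ik q(2) qi by (simp add: mrow_def del: index_mult_mat)
    qed
    then show ?thesis using True Sp_mult[OF frm_Sp[OF l] True] by (simp add: trl_def mfun_def)
  qed (simp add: trl_def mfun_def)
qed

text \<open>Weyl group elements carry any two extremal minors to the one in the first
  \<open>r\<close> rows.\<close>

lemma extremal_minors_in_submodule:
  fixes A :: "('a::field mat \<Rightarrow> 'a) set"
  assumes A: "submod m A" and r: "r \<le> m" and q: "iso_list m q" "length q = r" and q': "iso_list m q'" "length q' = r"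
    and mem: "mfun m r q \<in> A"
  shows "mfun m r q' \<in> A"
proof -
  let ?W = "frm m (q @ zc m q) :: 'a mat" and ?W' = "frm m (q' @ zc m q') :: 'a mat"
  note W = frm_Sp[OF iso_list_zc[OF q(1)], where 'a = 'a]
  note W' = frm_Sp[OF iso_list_zc[OF q'(1)], where 'a = 'a]
  have "mfun m r [0..<r] \<in> A"
    using submod_trl[OF A mem W] trl_frm_mfun[OF q r, where 'a = 'a] by simp
  then have "trl m (inv\<^bsub>Sp m\<^esub> ?W') (mfun m r [0..<r]) \<in> A" by (rule submod_trl[OF A _ Sp_inv(1)[OF W']])
  also have "trl m (inv\<^bsub>Sp m\<^esub> ?W') (mfun m r [0..<r]) = trl m (?W' * inv\<^bsub>Sp m\<^esub> ?W') (mfun m r q' :: 'a mat \<Rightarrow> 'a)"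
    unfolding trl_frm_mfun[OF q' r, symmetric] by (rule trl_trl[OF Sp_inv(1)[OF W'] W'])
  also have "\<dots> = mfun m r q'"
    unfolding Sp_inv(2)[OF W'] by (rule trl_one) (simp add: mfun_outside)
  finally show ?thesis .
qed

lemma submod_rdiff:
  assumes A: "submod m A" and f: "f \<in> A" and ab: "a < 2*m" "b < 2*m" "a \<noteq> b"
  shows "rdiff m a b f \<in> A"
  unfolding rdiff_def by (intro submod_diff[OF A] submod_trl[OF A f] rt_Sp ab Sp_one)

text \<open>As long as the list is shorter than \<open>r\<close>, some adjacent raising of
  \<open>f\<close> is nonzero, stays in \<open>A\<close> and lengthens the list by two; at length
  \<open>r\<close> the vector is a multiple of a minor.\<close>

lemma extremal_minor_exists:
  fixes f :: "'a::alg_closed_field mat \<Rightarrow> 'a"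
  assumes A: "submod m A" and r: "r \<le> m" and f: "f \<in> A" "f \<in> Hw m r (lw m q)" "f \<noteq> 0"
    and q: "iso_list m q" "length q \<le> r"
  shows "\<exists>q'. iso_list m q' \<and> length q' = r \<and> mfun m r q' \<in> A"
  using f q
proof (induction "r - length q" arbitrary: f q rule: less_induct)
  case less
  show ?case
  proof (cases "length q = r")
    case True
    obtain c where c: "f = (\<lambda>g. c * mfun m r q g)"
      using extremal_weight_space[OF less.prems(2) r less.prems(4) True] by blast
    have "c \<noteq> 0" using c less.prems(3) by (auto simp: zero_fun_def)
    then have "mfun m r q = (\<lambda>g. inverse c * f g)" by (auto simp: c fun_eq_iff)
    then have "mfun m r q \<in> A" using submod_cmult[OF A less.prems(1), of "inverse c"] by simp
    then show ?thesis using less.prems(4) True by blast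
  next
    case False
    then have lt: "length q < r" using less.prems(5) by simp
    note qZ = iso_list_zc[OF less.prems(4)]
    have "\<exists>X a b Y. zc m q = X @ [b, a] @ Y \<and> rdiff m a b f \<noteq> 0"
    proof (rule ccontr)
      assume n: "\<not> ?thesis"
      have "set (zc m q) \<subseteq> {..<m}" by (auto simp: set_zc)
      then have "f = 0"
        by (rule vanishing_of_adjacent[OF less.prems(2) r less.prems(5) qZ]) (use n lt in auto)
      then show False using less.prems(3) by contradiction
    qed
    then obtain X a b Y where XY: "zc m q = X @ [b, a] @ Y" and nz: "rdiff m a b f \<noteq> 0" by blast
    have "a \<in> set (zc m q)" "b \<in> set (zc m q)" by (simp_all add: XY)
    then have ab: "a < m" "a \<notin> nm m ` set q" "b < m" "b \<notin> nm m ` set q" by (auto simp: set_zc)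
    have "distinct (zc m q)" by (simp add: zc_def)
    then have ne: "a \<noteq> b" by (auto simp: XY)
    note w = Hw_rdiff[OF less.prems(2) r less.prems(4) ab ne]
    note iq = iso_list_snoc_pair[OF less.prems(4) ab ne]
    have len: "length (q @ [b, cj m a]) \<le> r" using Hw_too_long[OF w r iq] nz by (meson not_less)
    have mem: "rdiff m a b f \<in> A" using submod_rdiff[OF A less.prems(1), of a b] ab ne by simp
    show ?thesis by (rule less.hyps[OF _ mem w nz iq len]) (use lt in simp)
  qed
qed

text \<open>Both rows \<open>b\<close> and \<open>cj m a\<close> change, so bilinearity gives four
  determinants. Two belong to complete pairs, one is the original minor, and the fourth, with rows
  \<open>a\<close> and \<open>cj m b\<close>, has one pair fewer and is available by induction on
  the number of pairs.\<close>

lemma rdiff_lower: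
  fixes g :: "'a::field mat"
  assumes a: "a < m" and b: "b < m" and ab: "a \<noteq> b" and r: "r \<le> m"
    and q: "set q \<subseteq> {..<2*m}" "a \<notin> nm m ` set q" "b \<notin> nm m ` set q"
    and J: "J \<subseteq> {..<m}" "a \<notin> J" "b \<notin> J" and len: "length q + 2 * Suc (card J) = r" and g: "g \<in> carrier (Sp m)"
  shows "rdiff m b a (zf m r (q @ [b, cj m a]) J) g =
    zf m r q (insert a J) g - zf m r q (insert b J) g - zf m r (q @ [a, cj m b]) J g"
proof -
  let ?J = "sorted_list_of_set J"
  let ?v = "mrow m r g"
  let ?w = "\<lambda>x k. ?v x k + (if x = b then 1 * ?v a k else 0) + (if x = cj m a then - 1 * ?v (cj m b) k else 0)"
  have fJ: "finite J" using J finite_subset by blast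
  have ab2: "a < 2*m" "b < 2*m" using a b by auto
  have gc: "g \<in> carrier_mat (2*m) (2*m)" by (rule Sp_carrier_mat[OF g])
  have rg: "rt m b a 1 * g \<in> carrier (Sp m)" using rt_mult_Sp[OF g ab2(2,1)] ab by simp
  have c: "b \<noteq> cj m a" "cj m a \<noteq> b" using a b by (auto simp: cj_def)
  have same: "?w x = ?v x" if "x \<noteq> b" "x \<noteq> cj m a" for x using that by simp
  have "b \<notin> set q" "cj m a \<notin> set q"
  proof -
    show "b \<notin> set q" using q(3) b by (metis imageI nm_id)
    show "cj m a \<notin> set q" using q(2) a ab2 by (metis imageI nm_cj nm_id)
  qed
  then have mq: "map ?w q = map ?v q" by (intro map_cong refl same) auto
  have "b \<noteq> x" "b \<noteq> cj m x" "cj m a \<noteq> x" "cj m a \<noteq> cj m x" if "x \<in> J" for x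
  proof -
    have "x < m" "x \<noteq> a" "x \<noteq> b" using J that by auto
    then show "b \<noteq> x" "b \<noteq> cj m x" "cj m a \<noteq> x" "cj m a \<noteq> cj m x" using a b by (auto simp: cj_def)
  qed
  then have mJ: "map ?w (zl m ?J) = map ?v (zl m ?J)"
    using fJ by (intro map_cong refl same) (auto simp: set_zl)
  have zJ: "set (zl m ?J) \<subseteq> {..<2*m}" using J fJ by (force simp: set_zl)
  have lJ: "length ?J = card J" by simp
  have wb: "?w b = (\<lambda>k. ?v b k + ?v a k)" using c by simp
  have wa: "?w (cj m a) = (\<lambda>k. ?v (cj m a) k + - 1 * ?v (cj m b) k)" using c by simp
  let ?q = "map ?v q" and ?z = "map ?v (zl m ?J)"
  let ?d = "\<lambda>x y. rdet r (?q @ ?v x # ?v y # ?z)"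
  have zf1: "zf m r (q @ [x, y]) J g = ?d x y" for x y
    using g by (simp add: zf_def mfun_def mdet_def)
  have zf2: "zf m r q (insert x J) g = ?d x (cj m x)" if "x \<notin> J" for x
    using zf_insert[OF fJ that len g] by (simp add: mdet_def)
  have "zf m r (q @ [b, cj m a]) J (rt m b a 1 * g) = mdet m r (q @ [b, cj m a] @ zl m ?J) (rt m b a 1 * g)"
    using rg by (simp add: zf_def mfun_def)
  also have "\<dots> = rdet r (map ?w (q @ [b, cj m a] @ zl m ?J))"
    by (rule mdet_rt[OF gc b a r]) (use q(1) ab2 zJ len lJ in auto)
  also have "\<dots> = rdet r (?q @ ?w b # ?w (cj m a) # ?z)" by (simp only: map_append list.map mq mJ append_Cons append_Nil)
  also have "\<dots> = rdet r (?q @ ?v b # ?w (cj m a) # ?z) + rdet r (?q @ ?v a # ?w (cj m a) # ?z)"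
    unfolding wb by (rule rdet_add) (use len lJ in simp)
  also have "\<dots> = ?d b (cj m a) - ?d b (cj m b) + (?d a (cj m a) - ?d a (cj m b))"
  proof -
    have "rdet r (?q @ u # ?w (cj m a) # ?z) = rdet r (?q @ u # ?v (cj m a) # ?z) - rdet r (?q @ u # ?v (cj m b) # ?z)" for u
    proof -
      have "rdet r (?q @ u # ?w (cj m a) # ?z) = rdet r (?q @ u # ?v (cj m a) # ?z) + rdet r (?q @ u # (\<lambda>k. - 1 * ?v (cj m b) k) # ?z)"
        unfolding wa by (rule rdet_add[of r "?q @ [u]" ?z, unfolded append_assoc append_Cons append_Nil]) (use len lJ in simp)
      also have "rdet r (?q @ u # (\<lambda>k. - 1 * ?v (cj m b) k) # ?z) = - 1 * rdet r (?q @ u # ?v (cj m b) # ?z)"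
        by (rule rdet_scale[of r "?q @ [u]" ?z, unfolded append_assoc append_Cons append_Nil]) (use len lJ in simp)
      finally show ?thesis by simp
    qed
    then show ?thesis by (simp only:)
  qed
  finally have e: "zf m r (q @ [b, cj m a]) J (rt m b a 1 * g) = ?d b (cj m a) - ?d b (cj m b) + (?d a (cj m a) - ?d a (cj m b))" .
  show ?thesis
    unfolding rdiff_apply[OF g] e zf1 zf2[OF J(2)] zf2[OF J(3)] by simp
qed

text \<open>An element of \<open>J - K\<close> is exchanged for one of \<open>K - J\<close>, which
  brings \<open>J\<close> closer to \<open>K\<close>.\<close>

lemma subset_exchange_connected:
  assumes Z: "finite Z" and ex: "\<And>a b K. K \<subseteq> Z \<Longrightarrow> card K = j \<Longrightarrow> a \<in> Z - K \<Longrightarrow> b \<in> Z - K \<Longrightarrow> a \<noteq> b \<Longrightarrow> R (insert a K) (insert b K)"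
    and refl: "\<And>J. R J J" and trans: "\<And>J K L. R J K \<Longrightarrow> R K L \<Longrightarrow> R J L"
    and J: "J \<in> subsets (Suc j) Z" and K: "K \<in> subsets (Suc j) Z"
  shows "R J K"
  using J
proof (induction "card (J - K)" arbitrary: J)
  case 0
  have f: "finite J" "finite K" using 0 K Z finite_subset by (auto simp: subsets_def)
  then have "J \<subseteq> K" using 0 by simp
  then have "J = K" using f K 0 card_subset_eq[of K J] by (auto simp: subsets_def)
  then show ?case using refl by simp
next
  case (Suc n)
  have f: "finite J" "finite K" "J \<subseteq> Z" "K \<subseteq> Z" "card J = Suc j" "card K = Suc j"
    using Suc.prems K Z finite_subset by (auto simp: subsets_def)
  have "J - K \<noteq> {}" using Suc.hyps(2) by (metis card.empty nat.distinct(1))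
  then obtain a where a: "a \<in> J" "a \<notin> K" by blast
  have "\<not> K \<subseteq> J" using card_subset_eq[of J K] f a by auto
  then obtain b where b: "b \<in> K" "b \<notin> J" by blast
  let ?L = "J - {a}"
  have L: "?L \<subseteq> Z" "card ?L = j" "a \<in> Z - ?L" "b \<in> Z - ?L" "a \<noteq> b" using f a b by auto
  have "insert a ?L = J" using a by blast
  then have 1: "R J (insert b ?L)" using ex[OF L] by simp
  have "insert b ?L - K = (J - K) - {a}" using a b by auto
  then have "card (insert b ?L - K) = n" using Suc.hyps(2) f a by simp
  moreover have "insert b ?L \<in> subsets (Suc j) Z" using L f b by (auto simp: subsets_def)
  ultimately have "R (insert b ?L) K" using Suc.hyps(1) by blast
  with 1 show ?case by (rule trans)
qed

lemma minors_in_submodule: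
  fixes A :: "('a::alg_closed_field mat \<Rightarrow> 'a) set"
  assumes A: "submod m A" and r: "r \<le> m"
    and num: "\<And>j. 1 \<le> j \<Longrightarrow> 2 * j \<le> r \<Longrightarrow> \<exists>i. 1 \<le> i \<and> i \<le> j \<and> of_nat ((m - r + j + i) choose i) \<noteq> (0::'a)"
    and extr: "\<And>q. iso_list m q \<Longrightarrow> length q = r \<Longrightarrow> mfun m r q \<in> A"
    and q: "iso_list m q" and J: "J \<in> subsets j (set (zc m q))" and len: "length q + 2 * j = r"
  shows "zf m r q J \<in> A"
  using q J len
proof (induction j arbitrary: q J)
  case 0
  have "J = {}" using 0 finite_subset[of J "set (zc m q)"] by (auto simp: subsets_def)
  then show ?case using extr[OF 0(1)] 0 by (simp add: zf_def)
next
  case (Suc j)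
  let ?Z = "set (zc m q)"
  let ?R = "\<lambda>J K. (\<lambda>g. zf m r q J g - zf m r q K g) \<in> A"
  have refl: "?R J J" for J using submod_zero[OF A] by simp
  have trans: "?R J L" if "?R J K" "?R K L" for J K L
    using submod_add[OF A that] by simp
  have exch: "?R (insert a K) (insert b K)"
    if K: "K \<subseteq> ?Z" "card K = j" and a: "a \<in> ?Z - K" and b: "b \<in> ?Z - K" and ne: "a \<noteq> b" for a b K
  proof -
    have ab: "a < m" "a \<notin> nm m ` set q" "b < m" "b \<notin> nm m ` set q" using a b by (auto simp: set_zc)
    have Km: "K \<subseteq> {..<m}" "a \<notin> K" "b \<notin> K" using K a b by (auto simp: set_zc)
    have iq: "iso_list m (q @ [b, cj m a])" "iso_list m (q @ [a, cj m b])"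
      using iso_list_snoc_pair[OF Suc.prems(1) ab] iso_list_snoc_pair[OF Suc.prems(1) ab(3,4,1,2)] ne by auto
    have "K \<in> subsets j (set (zc m (q @ [b, cj m a])))" "K \<in> subsets j (set (zc m (q @ [a, cj m b])))"
      using K a b ab by (auto simp: subsets_def set_zc)
    then have z: "zf m r (q @ [b, cj m a]) K \<in> A" "zf m r (q @ [a, cj m b]) K \<in> A"
      using Suc.IH[OF iq(1)] Suc.IH[OF iq(2)] Suc.prems(3) by auto
    have "(\<lambda>g. rdiff m b a (zf m r (q @ [b, cj m a]) K) g + zf m r (q @ [a, cj m b]) K g) \<in> A"
      using ab ne by (intro submod_add[OF A] submod_rdiff[OF A] z) auto
    also have "(\<lambda>g :: 'a mat. rdiff m b a (zf m r (q @ [b, cj m a]) K) g + zf m r (q @ [a, cj m b]) K g)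
        = (\<lambda>g. zf m r q (insert a K) g - zf m r q (insert b K) g)"
    proof
      fix g :: "'a mat"
      show "rdiff m b a (zf m r (q @ [b, cj m a]) K) g + zf m r (q @ [a, cj m b]) K g
          = zf m r q (insert a K) g - zf m r q (insert b K) g"
      proof (cases "g \<in> carrier (Sp m)")
        case True
        then show ?thesis
          using rdiff_lower[OF ab(1,3) ne r iso_listD[OF Suc.prems(1)] ab(2,4) Km _ True] K Suc.prems(3) by simp
      qed (simp add: rdiff_outside zf_def mfun_def)
    qed
    finally show ?thesis .
  qed
  have conn: "?R J K" if "J \<in> subsets (Suc j) ?Z" "K \<in> subsets (Suc j) ?Z" for J K
    using subset_exchange_connected[of ?Z j ?R, OF finite_set exch refl trans that] .
  obtain i where i: "1 \<le> i" "i \<le> Suc j" "of_nat ((m - r + Suc j + i) choose i) \<noteq> (0::'a)"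
    using num[of "Suc j"] Suc.prems(3) by auto
  have Jf: "J \<subseteq> ?Z" "card J = Suc j" "finite J" using Suc.prems(2) finite_subset by (auto simp: subsets_def)
  \<comment> \<open>The size of \<open>I\<close> is chosen so that its number of supersets is the
    nonzero binomial coefficient with lower entry \<open>i\<close>.\<close>
  obtain I where I: "I \<subseteq> J" "card I = Suc j - i" "finite I"
    using obtain_subset_with_card_n[of "Suc j - i" J] Jf by auto
  let ?S = "{K. K \<in> subsets (Suc j) ?Z \<and> I \<subseteq> K}"
  have cZ: "card ?Z = m - length q"
  proof -
    have "card ?Z = length (zc m q)" by (rule distinct_card) (simp add: zc_def)
    then show ?thesis using iso_list_zc(2)[OF Suc.prems(1)] by simp
  qed
  have "card ?S = (card ?Z - card I) choose (Suc j - card I)"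
    by (rule card_supersets) (use I Jf in auto)
  also have "card ?Z - card I = m - r + Suc j + i" using cZ I(2) i Suc.prems(3) r by simp
  also have "Suc j - card I = i" using I(2) i by simp
  finally have cS: "card ?S = (m - r + Suc j + i) choose i" .
  have rel: "(\<Sum>K\<in>?S. zf m r q K g) = 0" for g :: "'a mat"
  proof (cases "g \<in> carrier (Sp m)")
    case True
    show ?thesis by (rule minor_relation[OF r Suc.prems(1,3) I(3)]) (use I i in simp)
  qed (simp add: zf_def mfun_def)
  have "(\<lambda>g. \<Sum>K\<in>T. zf m r q J g - zf m r q K g) \<in> A" if "finite T" "T \<subseteq> ?S" for T
    using that
  proof (induction T rule: finite_induct)
    case empty
    then show ?case using submod_zero[OF A] by simp
  next
    case (insert K T)
    then have "?R J K" using conn[OF Suc.prems(2)] by blast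
    then show ?case using submod_add[OF A, of "\<lambda>g. zf m r q J g - zf m r q K g"] insert by simp
  qed
  \<comment> \<open>The minors \<open>zf m r q K\<close> sum to 0 over \<open>?S\<close>, so the sum
    of the differences is \<open>card ?S\<close> times the minor for \<open>J\<close>.\<close>
  from this[of ?S] have "(\<lambda>g. \<Sum>K\<in>?S. zf m r q J g - zf m r q K g) \<in> A" by simp
  also have "(\<lambda>g :: 'a mat. \<Sum>K\<in>?S. zf m r q J g - zf m r q K g) = (\<lambda>g. of_nat (card ?S) * zf m r q J g)"
    by (simp add: sum_subtractf rel)
  finally have "(\<lambda>g. inverse (of_nat (card ?S)) * (of_nat (card ?S) * zf m r q J g)) \<in> A"
    by (rule submod_cmult[OF A])
  moreover have "(of_nat (card ?S) :: 'a) \<noteq> 0" using i(3) unfolding cS .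
  ultimately show ?case by (simp add: mult.assoc[symmetric])
qed

theorem ind_irreducible:
  fixes A :: "('a::alg_closed_field mat \<Rightarrow> 'a) set"
  assumes A: "submod m A" "A \<subseteq> ind m r" and r: "r \<le> m" and nz: "\<exists>f\<in>A. f \<noteq> 0"
    and num: "\<And>j. 1 \<le> j \<Longrightarrow> 2 * j \<le> r \<Longrightarrow> \<exists>i. 1 \<le> i \<and> i \<le> j \<and> of_nat ((m - r + j + i) choose i) \<noteq> (0::'a)"
  shows "A = ind m r"
proof
  obtain \<nu> h where h: "h \<in> A" "h \<in> Hw m r \<nu>" "h \<noteq> 0" using weight_vector_exists[OF A r] nz by blast
  obtain q where q: "iso_list m q" "length q \<le> r" "h \<in> Hw m r (lw m q)" using weight_list[OF h(2,3) r] by blast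
  obtain q' where q': "iso_list m q'" "length q' = r" "mfun m r q' \<in> A"
    using extremal_minor_exists[OF A(1) r h(1) q(3) h(3) q(1,2)] by blast
  have extr: "mfun m r q \<in> A" if "iso_list m q" "length q = r" for q
    by (rule extremal_minors_in_submodule[OF A(1) r q'(1,2) that q'(3)])
  have w: "f \<in> A" if f: "f \<in> Hw m r \<nu>" for f \<nu>
  proof (cases "f = 0")
    case True
    then show ?thesis using submod_zero[OF A(1)] by (simp add: zero_fun_def)
  next
    case False
    obtain q where q: "iso_list m q" "length q \<le> r" "f \<in> Hw m r (lw m q)" using weight_list[OF f False r] by blast
    have "\<exists>j. length q + 2 * j = r \<or> length q + 2 * j + 1 = r" using q(2) by presburger
    then obtain j where "length q + 2 * j = r \<or> length q + 2 * j + 1 = r" by blast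
    then have j: "length q + 2 * j = r" using weight_space_odd[OF q(3) r q(1)] False by blast
    obtain c where c: "f = (\<lambda>g. \<Sum>J\<in>subsets j (set (zc m q)). c J * zf m r q J g)"
      using weight_space_span[OF q(3) r q(1) j] by blast
    have "f = (\<Sum>J\<in>subsets j (set (zc m q)). fun_scale (c J) (zf m r q J))"
      unfolding c by (rule ext) (simp add: sum_fun_apply fun_scale_def)
    also have "\<dots> \<in> A"
    proof (rule fun_space.subspace_sum)
      show "fun_space.subspace A" using A(1) by (simp add: submod_def)
      fix J assume "J \<in> subsets j (set (zc m q))"
      then have "zf m r q J \<in> A" by (intro minors_in_submodule[OF A(1) r _ _ q(1) _ j] num extr)
      then show "fun_scale (c J) (zf m r q J) \<in> A" using submod_cmult[OF A(1)] by (simp add: fun_scale_def)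
    qed
    finally show ?thesis .
  qed
  show "ind m r \<subseteq> A"
  proof
    fix f :: "'a mat \<Rightarrow> 'a" assume "f \<in> ind m r"
    then have "f \<in> fun_space.span (\<Union>\<nu>. Hw m r \<nu>)" by (rule weight_decomposition[OF r])
    moreover have "fun_space.span (\<Union>\<nu>. Hw m r \<nu>) \<subseteq> A"
      by (rule fun_space.span_minimal) (use w A(1) in \<open>auto simp: submod_def\<close>)
    ultimately show "f \<in> A" by blast
  qed
qed (rule A(2))

section \<open>Duality\<close>

text \<open>Gram-Schmidt with functionals from \<open>W\<close> in place of an inner product, adding
  one vector of \<open>B\<close> at a time.\<close>

lemma separating_family:
  fixes H :: "('b \<Rightarrow> 'a::field) set" and W :: "(('b \<Rightarrow> 'a) \<Rightarrow> 'a) set"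
  assumes H: "fun_space.subspace H" and W: "W \<subseteq> dual_space H" "fun_space.subspace W"
    and sep: "\<And>f. f \<in> H \<Longrightarrow> f \<noteq> 0 \<Longrightarrow> \<exists>\<psi>\<in>W. \<psi> f \<noteq> 0" and B: "finite B" "B \<subseteq> H"
  shows "\<exists>E P. finite E \<and> E \<subseteq> H \<and> B \<subseteq> fun_space.span E \<and>
    (\<forall>e\<in>E. P e \<in> W) \<and> (\<forall>e\<in>E. \<forall>e'\<in>E. P e e' = (if e = e' then 1 else 0))"
  using B
proof (induction B rule: finite_induct)
  case empty
  then show ?case by (intro exI[of _ "{}"]) auto
next
  case (insert b B)
  then obtain E P where E: "finite E" "E \<subseteq> H" "B \<subseteq> fun_space.span E"
    and P0: "\<forall>e\<in>E. P e \<in> W" "\<forall>e\<in>E. \<forall>e'\<in>E. P e e' = (if e = e' then 1 else 0)" by blast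
  have P: "P e \<in> W" "e' \<in> E \<Longrightarrow> P e e' = (if e = e' then 1 else 0)" if "e \<in> E" for e e'
    using P0 that by blast+
  have bH: "b \<in> H" using insert by simp
  have add: "\<psi> (f + g) = \<psi> f + \<psi> g" and scale: "\<psi> (fun_scale c f) = c * \<psi> f"
    if "\<psi> \<in> W" "f \<in> H" "g \<in> H" for \<psi> f g c using that W(1) by (auto simp: dual_space_def)
  have zero: "\<psi> 0 = 0" if "\<psi> \<in> W" for \<psi>
  proof -
    have "\<psi> (fun_scale 0 0) = 0 * \<psi> 0" using scale[OF that] fun_space.subspace_0[OF H] by blast
    then show ?thesis by (simp only: fun_space.scale_zero_left mult_zero_left)
  qed
  have sum: "\<psi> (\<Sum>e\<in>T. fun_scale (c e) e) = (\<Sum>e\<in>T. c e * \<psi> e)" if "\<psi> \<in> W" "finite T" "T \<subseteq> H" for \<psi> T c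
    using that(2,3)
  proof (induction T rule: finite_induct)
    case empty
    show ?case unfolding sum.empty by (rule zero[OF that(1)])
  next
    case (insert x T)
    have T: "(\<Sum>e\<in>T. fun_scale (c e) e) \<in> H"
      using insert by (intro fun_space.subspace_sum[OF H] fun_space.subspace_scale[OF H]) auto
    have x: "x \<in> H" using insert by simp
    show ?case
      unfolding sum.insert[OF insert.hyps(1,2)] add[OF that(1) fun_space.subspace_scale[OF H x] T] scale[OF that(1) x x]
      using insert by simp
  qed
  define v where "v = (\<Sum>e\<in>E. fun_scale (P e b) e)"
  have vH: "v \<in> H" unfolding v_def using E by (intro fun_space.subspace_sum[OF H] fun_space.subspace_scale[OF H]) auto
  have vE: "v \<in> fun_space.span E" unfolding v_def by (intro fun_space.span_sum fun_space.span_scale fun_space.span_base)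
  show ?case
  proof (cases "b = v")
    case True
    then show ?thesis using E P vE by (intro exI[of _ E] exI[of _ P]) auto
  next
    case False
    define w where "w = b - v"
    have wH: "w \<in> H" unfolding w_def by (rule fun_space.subspace_diff[OF H bH vH])
    have "w \<noteq> 0" using False by (simp add: w_def)
    then obtain \<psi> where \<psi>: "\<psi> \<in> W" "\<psi> w \<noteq> 0" using sep[OF wH] by blast
    have dual0: "P e w = 0" if "e \<in> E" for e
    proof -
      have "P e b = P e (w + v)" by (simp add: w_def)
      also have "\<dots> = P e w + P e v" by (rule add[OF P(1)[OF that] wH vH])
      also have "P e v = (\<Sum>e'\<in>E. P e' b * P e e')" unfolding v_def by (rule sum[OF P(1)[OF that] E(1,2)])
      also have "\<dots> = (\<Sum>e'\<in>E. if e' = e then P e b else 0)" by (intro sum.cong) (auto simp: P(2) that)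
      finally show ?thesis using E(1) that by simp
    qed
    \<comment> \<open>A functional that is nonzero at the new vector, corrected to vanish on
      \<open>E\<close> and normalised.\<close>
    define \<chi> where "\<chi> = fun_scale (inverse (\<psi> w)) (\<psi> - (\<Sum>e\<in>E. fun_scale (\<psi> e) (P e)))"
    have \<chi>W: "\<chi> \<in> W" unfolding \<chi>_def
      using P(1) by (intro fun_space.subspace_scale[OF W(2)] fun_space.subspace_diff[OF W(2)] \<psi>(1) fun_space.subspace_sum[OF W(2)])
    have \<chi>: "\<chi> f = inverse (\<psi> w) * (\<psi> f - (\<Sum>e\<in>E. \<psi> e * P e f))" for f
      by (simp add: \<chi>_def fun_scale_def sum_fun_apply fun_diff_def)
    have \<chi>w: "\<chi> w = 1" using \<psi>(2) by (simp add: \<chi> dual0)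
    have \<chi>e: "\<chi> e = 0" if "e \<in> E" for e
    proof -
      have "(\<Sum>e'\<in>E. \<psi> e' * P e' e) = (\<Sum>e'\<in>E. if e' = e then \<psi> e else 0)" by (intro sum.cong) (auto simp: P(2) that)
      then show ?thesis using E(1) that by (simp add: \<chi>)
    qed
    have wE: "w \<notin> E" using \<chi>w \<chi>e by force
    have span: "fun_space.span E \<subseteq> fun_space.span (insert w E)" by (rule fun_space.span_mono) auto
    have "b = w + v" by (simp add: w_def)
    then have "b \<in> fun_space.span (insert w E)"
      using vE span by (metis fun_space.span_add fun_space.span_base insertI1 subsetD)
    then have "insert b B \<subseteq> fun_space.span (insert w E)" using E(3) span by blast
    moreover have "\<forall>e\<in>insert w E. (P(w := \<chi>)) e \<in> W" using \<chi>W P(1) by auto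
    moreover have "\<forall>e\<in>insert w E. \<forall>e'\<in>insert w E. (P(w := \<chi>)) e e' = (if e = e' then 1 else 0)"
      using \<chi>w \<chi>e dual0 P(2) wE by auto
    ultimately show ?thesis using E(1,2) wH by (intro exI[of _ "insert w E"] exI[of _ "P(w := \<chi>)"]) auto
  qed
qed

text \<open>A space of functionals that separates the points of a finite-dimensional space contains
  a dual basis, hence is the full dual.\<close>

lemma dual_space_eqI:
  fixes H :: "('b \<Rightarrow> 'a::field) set" and W :: "(('b \<Rightarrow> 'a) \<Rightarrow> 'a) set"
  assumes H: "fun_space.subspace H" "H = fun_space.span B" "finite B" and W: "W \<subseteq> dual_space H" "fun_space.subspace W"
    and sep: "\<And>f. f \<in> H \<Longrightarrow> f \<noteq> 0 \<Longrightarrow> \<exists>\<psi>\<in>W. \<psi> f \<noteq> 0"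
  shows "W = dual_space H"
proof
  have "B \<subseteq> H" using H(2) fun_space.span_superset by blast
  then obtain E P where E: "finite E" "E \<subseteq> H" "B \<subseteq> fun_space.span E"
    and P0: "\<forall>e\<in>E. P e \<in> W" "\<forall>e\<in>E. \<forall>e'\<in>E. P e e' = (if e = e' then 1 else 0)"
    using separating_family[OF H(1) W sep H(3)] by blast
  have P: "P e \<in> W" "e' \<in> E \<Longrightarrow> P e e' = (if e = e' then 1 else 0)" if "e \<in> E" for e e'
    using P0 that by blast+
  have HE: "H \<subseteq> fun_space.span E"
    using H(2) fun_space.span_minimal[OF E(3) fun_space.subspace_span] by simp
  show "dual_space H \<subseteq> W"
  proof
    fix \<phi> assume \<phi>: "\<phi> \<in> dual_space H"
    define \<psi> where "\<psi> = (\<Sum>e\<in>E. fun_scale (\<phi> e) (P e))"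
    have \<psi>W: "\<psi> \<in> W" unfolding \<psi>_def
      using P(1) by (intro fun_space.subspace_sum[OF W(2)] fun_space.subspace_scale[OF W(2)])
    then have \<psi>: "\<psi> \<in> dual_space H" using W(1) by blast
    have eqE: "\<psi> e = \<phi> e" if "e \<in> E" for e
    proof -
      have "\<psi> e = (\<Sum>e'\<in>E. \<phi> e' * P e' e)" by (simp add: \<psi>_def sum_fun_apply fun_scale_def)
      also have "\<dots> = (\<Sum>e'\<in>E. if e' = e then \<phi> e else 0)" by (intro sum.cong) (auto simp: P(2) that)
      finally show ?thesis using E(1) that by simp
    qed
    have zero: "\<chi> 0 = 0" if "\<chi> \<in> dual_space H" for \<chi>
    proof -
      have "\<chi> (fun_scale 0 0) = 0 * \<chi> 0" using that fun_space.subspace_0[OF H(1)] unfolding dual_space_def by blast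
      then show ?thesis by (simp add: fun_scale_def zero_fun_def)
    qed
    have "fun_space.subspace {f \<in> H. \<psi> f = \<phi> f}"
      unfolding fun_space.subspace_def
    proof (intro conjI ballI allI)
      show "0 \<in> {f \<in> H. \<psi> f = \<phi> f}" using fun_space.subspace_0[OF H(1)] zero[OF \<psi>] zero[OF \<phi>] by simp
      fix x assume x: "x \<in> {f \<in> H. \<psi> f = \<phi> f}"
      show "x + y \<in> {f \<in> H. \<psi> f = \<phi> f}" if "y \<in> {f \<in> H. \<psi> f = \<phi> f}" for y
        using x that \<psi> \<phi> fun_space.subspace_add[OF H(1)] by (simp add: dual_space_def)
      show "fun_scale c x \<in> {f \<in> H. \<psi> f = \<phi> f}" for c
        using x \<psi> \<phi> fun_space.subspace_scale[OF H(1)] by (simp add: dual_space_def)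
    qed
    then have "fun_space.span E \<subseteq> {f \<in> H. \<psi> f = \<phi> f}" using E(2) eqE by (intro fun_space.span_minimal) auto
    then have "\<psi> f = \<phi> f" if "f \<in> H" for f using HE that by blast
    moreover have "\<psi> f = \<phi> f" if "f \<notin> H" for f using that \<psi> \<phi> by (simp add: dual_space_def)
    ultimately have "\<psi> = \<phi>" by blast
    then show "\<phi> \<in> W" using \<psi>W by simp
  qed
qed (rule W(1))

section \<open>The Weyl module as the dual of the induced module\<close>

lemma weyl_module_ind: "weyl_module m (fund_weight r) = dual_space (ind m r)"
proof -
  have "- longest_weyl (fund_weight r) = fund_weight r" by (auto simp: longest_weyl_def)
  then show ?thesis by (simp add: weyl_module_def)
qed

lemma weyl_action_trl:
  fixes g :: "'a::field mat"
  assumes g: "g \<in> carrier (Sp m)"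
  shows "weyl_action m (fund_weight r) g \<phi> = (\<lambda>f. if f \<in> ind m r then \<phi> (trl m g f) else 0)"
proof -
  have "- longest_weyl (fund_weight r) = fund_weight r" by (auto simp: longest_weyl_def)
  moreover have "left_translation m (inv\<^bsub>Sp m\<^esub> g) f = trl m g f" for f
    unfolding left_translation_trl group.inv_inv[OF Sp_group g] ..
  ultimately show ?thesis by (simp add: weyl_action_def dual_action_def cong: if_cong)
qed

text \<open>Evaluations at group elements are the functionals at hand; they show that the dual is
  nonzero and that certain submodules are proper.\<close>

definition evf :: "('b \<Rightarrow> 'a::field) set \<Rightarrow> 'b \<Rightarrow> ('b \<Rightarrow> 'a) \<Rightarrow> 'a" where
  "evf H g = (\<lambda>f. if f \<in> H then f g else 0)"

lemma evf_dual: "fun_space.subspace H \<Longrightarrow> evf H g \<in> dual_space H"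
  by (auto simp: dual_space_def evf_def fun_space.subspace_add fun_space.subspace_scale)
    (auto simp: fun_scale_def plus_fun_def)

lemma extremal_minor_nonzero:
  assumes r: "r \<le> m" and q: "iso_list m q" "length q = r"
  shows "\<exists>g\<in>carrier (Sp m). mfun m r q g \<noteq> (0::'a::field)"
proof -
  have nz: "mfun m r q (frm m (rev (map (cj m) q) @ rev (zc m q))) \<noteq> (0::'a)"
    by (rule mfun_frm_nonzero[OF q(2) r iso_list_zc[OF q(1)]])
  then show ?thesis using mfun_outside by blast
qed

text \<open>The common kernel of a nonzero submodule is a proper submodule of the induced module,
  hence zero by irreducibility. So the submodule separates points and is the whole dual.\<close>

theorem weyl_module_simple:
  assumes r: "r \<le> m"
    and num: "\<And>j. 1 \<le> j \<Longrightarrow> 2 * j \<le> r \<Longrightarrow> \<exists>i. 1 \<le> i \<and> i \<le> j \<and> of_nat ((m - r + j + i) choose i) \<noteq> (0::'a::alg_closed_field)"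
  shows "simple_module (Sp m) (weyl_module m (fund_weight r) :: (('a mat \<Rightarrow> 'a) \<Rightarrow> 'a) set) (weyl_action m (fund_weight r))"
proof -
  let ?H = "ind m r :: ('a mat \<Rightarrow> 'a) set"
  have H: "fun_space.subspace ?H" by (rule ind_subspace[OF r])
  have q0: "iso_list m [0..<r]"
  proof -
    have "map (nm m) [0..<r] = [0..<r]" by (rule map_idI) (use r in auto)
    then show ?thesis using r by (auto simp: iso_list_def)
  qed
  have f0: "mfun m r [0..<r] \<in> ?H" by (rule mfun_ind[OF iso_listD[OF q0] _ r]) simp
  obtain g0 where g0: "g0 \<in> carrier (Sp m)" "mfun m r [0..<r] g0 \<noteq> (0::'a)"
    using extremal_minor_nonzero[OF r q0, where 'a = 'a] by auto
  have nontriv: "dual_space ?H \<noteq> {0}"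
  proof
    assume "dual_space ?H = {0}"
    then have "evf ?H g0 = 0" using evf_dual[OF H] by blast
    then have "evf ?H g0 (mfun m r [0..<r]) = 0" by simp
    then show False using f0 g0 by (simp add: evf_def)
  qed
  have "W = {0} \<or> W = dual_space ?H"
    if W: "W \<subseteq> dual_space ?H" "fun_space.subspace W"
      and st: "\<And>g w. g \<in> carrier (Sp m) \<Longrightarrow> w \<in> W \<Longrightarrow> weyl_action m (fund_weight r) g w \<in> W" for W
  proof (cases "W = {0}")
    case False
    then obtain \<phi> where \<phi>: "\<phi> \<in> W" "\<phi> \<noteq> 0" using fun_space.subspace_0[OF W(2)] by blast
    then obtain f where f: "\<phi> f \<noteq> 0" by (auto simp: fun_eq_iff)
    have fH: "f \<in> ?H" using f \<phi>(1) W(1) by (auto simp: dual_space_def)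
    \<comment> \<open>The annihilator of \<open>W\<close>; stability of \<open>W\<close> under the
      contragredient action makes it stable under translation.\<close>
    define A where "A = {f \<in> ?H. \<forall>\<psi>\<in>W. \<psi> f = 0}"
    have WD: "\<psi> (f + g) = \<psi> f + \<psi> g" "\<psi> (fun_scale c f) = c * \<psi> f" if "\<psi> \<in> W" "f \<in> ?H" "g \<in> ?H" for \<psi> f g c
      using that W(1) by (auto simp: dual_space_def)
    have A0: "\<psi> 0 = 0" if "\<psi> \<in> W" for \<psi>
    proof -
      have "\<psi> (fun_scale 0 0) = 0 * \<psi> 0" using WD(2)[OF that] fun_space.subspace_0[OF H] by blast
      then show ?thesis by (simp add: fun_scale_def zero_fun_def)
    qed
    have "fun_space.subspace A"
      unfolding fun_space.subspace_def A_def
      using fun_space.subspace_0[OF H] fun_space.subspace_add[OF H] fun_space.subspace_scale[OF H] A0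
      by (auto simp: WD)
    moreover have "trl m h f \<in> A" if h: "h \<in> carrier (Sp m)" and f: "f \<in> A" for h f
    proof -
      have fH: "f \<in> ?H" using f by (simp add: A_def)
      have "\<psi> (trl m h f) = 0" if \<psi>: "\<psi> \<in> W" for \<psi>
      proof -
        have "weyl_action m (fund_weight r) h \<psi> f = 0" using st[OF h \<psi>] f by (simp add: A_def)
        then show ?thesis using fH by (simp add: weyl_action_trl[OF h])
      qed
      then show ?thesis using trl_ind[OF fH r h] by (simp add: A_def)
    qed
    ultimately have sub: "submod m A" by (simp add: submod_def)
    have "A \<noteq> ?H" using fH f \<phi>(1) by (auto simp: A_def)
    then have "\<not> (\<exists>f\<in>A. f \<noteq> 0)"
      using ind_irreducible[OF sub _ r _ num] by (auto simp: A_def)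
    then have "\<exists>\<psi>\<in>W. \<psi> f \<noteq> 0" if "f \<in> ?H" "f \<noteq> 0" for f using that by (auto simp: A_def)
    then have "W = dual_space ?H"
      by (rule dual_space_eqI[OF H ind_span[OF r] finite_minors W])
    then show ?thesis ..
  qed simp
  then show ?thesis
    unfolding simple_module_def weyl_module_ind using nontriv by blast
qed

section \<open>A linear form on a weight space\<close>

lemma cmp_sum:
  "cmp m k e (\<lambda>g. \<Sum>i\<in>A. c i * F i g) = (\<lambda>g. \<Sum>i\<in>A. c i * cmp m k e (F i) g)"
proof
  fix g :: "'a mat"
  show "cmp m k e (\<lambda>g. \<Sum>i\<in>A. c i * F i g) g = (\<Sum>i\<in>A. c i * cmp m k e (F i) g)"
    by (simp add: cmp_def Let_def trl_def sum_distrib_left sum_distrib_right sum_subtractf sum.distrib algebra_simps)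
qed

text \<open>Projection to a weight space, one torus coordinate at a time.\<close>

fun prj :: "nat \<Rightarrow> (nat \<Rightarrow> int) \<Rightarrow> nat \<Rightarrow> ('a::field mat \<Rightarrow> 'a) \<Rightarrow> 'a mat \<Rightarrow> 'a" where
  "prj m \<mu> 0 f = f"
| "prj m \<mu> (Suc k) f = cmp m k (\<mu> k) (prj m \<mu> k f)"

lemma prj_sum: "prj m \<mu> k (\<lambda>g. \<Sum>i\<in>A. c i * F i g) = (\<lambda>g. \<Sum>i\<in>A. c i * prj m \<mu> k (F i) g)"
  by (induction k) (simp_all add: cmp_sum)

lemma cmp_Hw:
  fixes f :: "'a::alg_closed_field mat \<Rightarrow> 'a"
  assumes f: "f \<in> Hw m r \<nu>" and r: "r \<le> m" and k: "k < m" and e: "e \<in> {- 1, 0, 1}"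
  shows "cmp m k e f = (if \<nu> k = e then f else (\<lambda>_. 0))"
proof
  fix g :: "'a mat"
  have k2: "k < 2*m" using k by simp
  show "cmp m k e f g = (if \<nu> k = e then f else (\<lambda>_. 0)) g"
  proof (cases "g \<in> carrier (Sp m)")
    case True
    let ?c = "\<lambda>e. if \<nu> k = e then f g else 0"
    have "f (tor m k s * g) = (\<Sum>e\<in>{- 1, 0, 1}. ?c e * s powi e)" if s: "s \<noteq> 0" for s
    proof (cases "f g = 0")
      case True
      then show ?thesis using Hw_tor[OF f k2 s \<open>g \<in> carrier (Sp m)\<close>] by simp
    next
      case False
      then have "\<bar>\<nu> k\<bar> \<le> 1" by (rule weight_bound_single[OF f r True _ k2])
      then have "\<nu> k = - 1 \<or> \<nu> k = 0 \<or> \<nu> k = 1" by linarith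
      then show ?thesis using Hw_tor[OF f k2 s \<open>g \<in> carrier (Sp m)\<close>] by auto
    qed
    then have "cmp m k e f (tor m k 1 * g) = ?c e * 1 powi e"
      by (intro cmp_expansion[OF k2 e True]) auto
    then show ?thesis using Sp_carrier_mat[OF True] by (simp add: tor_one)
  next
    case False
    then show ?thesis using ind_outside[OF Hw_ind[OF f]] by (simp add: cmp_def Let_def trl_def)
  qed
qed

lemma cmp_zero: "cmp m k e (\<lambda>_. 0) = (\<lambda>_. 0)"
  by (simp add: cmp_def Let_def trl_def fun_eq_iff)

lemma prj_Hw:
  fixes f :: "'a::alg_closed_field mat \<Rightarrow> 'a"
  assumes f: "f \<in> Hw m r \<nu>" and r: "r \<le> m" and \<mu>: "\<And>i. i < m \<Longrightarrow> \<mu> i \<in> {- 1, 0, 1}"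
  shows "k \<le> m \<Longrightarrow> prj m \<mu> k f = (if \<forall>i<k. \<nu> i = \<mu> i then f else (\<lambda>_. 0))"
proof (induction k)
  case (Suc k)
  then have k: "k < m" by simp
  show ?case
    using Suc.IH k cmp_Hw[OF f r k \<mu>[OF k]] by (auto simp: cmp_zero less_Suc_eq)
qed simp

text \<open>By the kernel intersection theorem \<open>h\<close> is a combination of polytabloids.
  The coefficients of a single polytabloid are the values of a linear form: project to the weight
  space, raise along the matching, and evaluate at a point where the resulting extremal minor does
  not vanish.\<close>

theorem weight_functional:
  fixes h :: "nat set \<Rightarrow> 'a::alg_closed_field"
  assumes r: "r \<le> m" and q: "iso_list m q" and len: "length q + 2 * j = r"
    and h: "down_zero (set (zc m q)) j h"
  shows "\<exists>x :: ('a mat \<Rightarrow> 'a) \<Rightarrow> 'a.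
    (\<forall>A c F. x (\<lambda>g. \<Sum>i\<in>A. c i * F (i::nat) g) = (\<Sum>i\<in>A. c i * x (F i))) \<and>
    (\<forall>J\<in>subsets j (set (zc m q)). x (zf m r q J) = h J) \<and>
    (\<forall>\<nu>. \<forall>f\<in>Hw m r \<nu>. (\<exists>i<m. \<nu> i \<noteq> lw m q i) \<longrightarrow> x f = 0)"
proof -
  let ?Z = "set (zc m q)"
  obtain L where L: "\<forall>(c, M)\<in>set L. matching M \<and> pts M \<subseteq> ?Z \<and> card M = j"
    and hL: "\<forall>J\<in>subsets j ?Z. h J = (\<Sum>(c, M)\<leftarrow>L. c * matching_sign M J)"
    using kernel_intersection[OF finite_set h] by blast
  define enum where "enum M = (SOME D. distinct D \<and> set D = M)" for M :: "(nat \<times> nat) set"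
  have enum: "distinct (enum M)" "set (enum M) = M" if "finite M" for M
    using someI_ex[of "\<lambda>D. distinct D \<and> set D = M"] finite_distinct_list[OF that] by (auto simp: enum_def)
  \<comment> \<open>A point at which the extremal minor of this matching is nonzero;
    \<open>nrm\<close> is its value there.\<close>
  define w where "w M = (frm m (rev (map (cj m) (raise_rows m (enum M) q)) @ rev (zc m (raise_rows m (enum M) q))) :: 'a mat)" for M
  define nrm where "nrm M = (mfun m r (raise_rows m (enum M) q) (w M) :: 'a)" for M
  define x where "x f = (\<Sum>(c, M)\<leftarrow>L. c * (raise_all m (enum M) (prj m (lw m q) m f) (w M) / nrm M))" for f
  have \<mu>: "lw m q i \<in> {- 1, 0, 1}" if i: "i < m" for i
  proof (cases "i \<in> nm m ` set q")
    case True
    then obtain y where y: "y \<in> set q" "i = nm m y" by blast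
    then have "y < 2*m" using iso_listD[OF q] by auto
    then have "i = y \<or> i = cj m y" using y(2) by (auto simp: nm_def)
    then show ?thesis using lw_mem[OF q y(1)] by auto
  next
    case False
    then show ?thesis using lw_outside[OF iso_listD[OF q], of i] i by simp
  qed
  have lin: "x (\<lambda>g. \<Sum>i\<in>A. c i * F i g) = (\<Sum>i\<in>A. c i * x (F i))" for A :: "nat set" and c F
  proof -
    have "(\<Sum>(a, M)\<leftarrow>l. a * (raise_all m (enum M) (prj m (lw m q) m (\<lambda>g. \<Sum>i\<in>A. c i * F i g)) (w M) / nrm M))
      = (\<Sum>i\<in>A. c i * (\<Sum>(a, M)\<leftarrow>l. a * (raise_all m (enum M) (prj m (lw m q) m (F i)) (w M) / nrm M)))" for l
    proof (induction l)
      case (Cons p l)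
      obtain a M where p: "p = (a, M)" by (cases p)
      show ?case
        using Cons by (simp add: p prj_sum raise_all_sum sum_distrib_left sum_divide_distrib sum.distrib algebra_simps)
    qed simp
    then show ?thesis by (simp only: x_def)
  qed
  have val: "x (zf m r q J) = h J" if J: "J \<in> subsets j ?Z" for J
  proof -
    have Jm: "J \<subseteq> {..<m}" "card J = j" using J by (auto simp: subsets_def set_zc)
    have lJ: "length q + 2 * card J = r" using Jm len by simp
    have Hz: "(zf m r q J :: 'a mat \<Rightarrow> 'a) \<in> Hw m r (lw m q)" by (rule zf_Hw[OF r q Jm(1) lJ])
    have "prj m (lw m q) m (zf m r q J) = (zf m r q J :: 'a mat \<Rightarrow> 'a)"
      using prj_Hw[where \<mu> = "lw m q" and k = m, OF Hz r \<mu>] by simp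
    moreover have "c * (raise_all m (enum M) (zf m r q J) (w M) / nrm M) = c * matching_sign M J" if "(c, M) \<in> set L" for c M
    proof -
      have M: "matching M" "pts M \<subseteq> ?Z" "card M = j" using L that by auto
      note e = enum[OF matching_finite[OF M(1)]]
      have ok: "raisable m q (enum M)" using q e M by (simp add: raisable_def set_zc)
      have lD: "length (enum M) = j" using distinct_card[OF e(1)] e(2) M(3) by simp
      have rz: "raise_all m (enum M) (zf m r q J) = (\<lambda>g. matching_sign M J * mfun m r (raise_rows m (enum M) q) g :: 'a)"
        using raise_all_zf[OF ok r Jm(1) _ lJ] e(2) lD Jm(2) by simp
      have iq: "iso_list m (raise_rows m (enum M) q)" using raise_all_Hw[OF Hz r ok] by simp
      have "nrm M \<noteq> 0"
        unfolding nrm_def w_def by (rule mfun_frm_nonzero[OF _ r iso_list_zc[OF iq]]) (use lD len in simp)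
      then show ?thesis unfolding rz nrm_def by simp
    qed
    then have "(\<Sum>(c, M)\<leftarrow>L. c * (raise_all m (enum M) (zf m r q J) (w M) / nrm M)) = (\<Sum>(c, M)\<leftarrow>L. c * matching_sign M J)"
      by (intro arg_cong[of _ _ sum_list] map_cong refl) auto
    ultimately show ?thesis using hL J unfolding x_def by simp
  qed
  have "x f = 0" if f: "f \<in> Hw m r \<nu>" and i: "i < m" "\<nu> i \<noteq> lw m q i" for f \<nu> i
  proof -
    have "prj m (lw m q) m f = (\<lambda>_. 0)" using prj_Hw[where \<mu> = "lw m q" and k = m, OF f r \<mu>] i by auto
    then have "x f = (\<Sum>(c, M)\<leftarrow>L. 0)" unfolding x_def by (simp add: raise_all_zero)
    also have "\<dots> = 0" by (simp add: sum_list_0 case_prod_unfold)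
    finally show ?thesis .
  qed
  with lin val show ?thesis by (intro exI[of _ x]) blast
qed

section \<open>Minors under translation\<close>

lemma rdet_sum_row:
  assumes r: "r = length xs + Suc (length ys)" and A: "finite A"
  shows "rdet r (xs @ (\<lambda>k. \<Sum>a\<in>A. c a * v a k) # ys) = (\<Sum>a\<in>A. c a * rdet r (xs @ v a # ys))"
  using A
proof (induction A rule: finite_induct)
  case empty
  show ?case using rdet_scale[OF r, of 0 "\<lambda>_. 0"] by simp
next
  case (insert b A)
  then show ?case
    using rdet_add[OF r, of "\<lambda>k. c b * v b k" "\<lambda>k. \<Sum>a\<in>A. c a * v a k"] rdet_scale[OF r, of "c b" "v b"] by simp
qed

text \<open>The determinant is \<open>0\<close> unless \<open>s\<close> is a permutation of \<open>l\<close>.\<close>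

definition perm_sign :: "nat \<Rightarrow> nat list \<Rightarrow> nat list \<Rightarrow> 'a::field" where
  "perm_sign r l s = rdet r (map (\<lambda>x k. if x = l ! k then 1 else 0) s)"

lemma perm_sign_nonzero:
  assumes l: "length l = r" and s: "length s = r" and nz: "perm_sign r l s \<noteq> (0::'a::field)"
  shows "distinct s" "set s \<subseteq> set l"
proof -
  let ?u = "\<lambda>x k. if x = l ! k then 1 else 0 :: 'a"
  show "distinct s"
  proof (rule ccontr)
    assume "\<not> distinct s"
    then obtain i k where "i < r" "k < r" "i \<noteq> k" "s ! i = s ! k" using s by (auto simp: distinct_conv_nth)
    then have "perm_sign r l s = (0::'a)" unfolding perm_sign_def by (intro rdet_repeat[of i r k]) (use s in auto)
    then show False using nz by contradiction
  qed
  show "set s \<subseteq> set l"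
  proof
    fix x assume "x \<in> set s"
    then obtain xs ys where sp: "s = xs @ x # ys" by (meson split_list)
    show "x \<in> set l"
    proof (rule ccontr)
      assume x: "x \<notin> set l"
      have "perm_sign r l s = (rdet r (map ?u xs @ (\<lambda>k. 0 * 0) # map ?u ys) :: 'a)"
        unfolding perm_sign_def
      proof (rule rdet_cong)
        fix i k assume ik: "i < r" "k < r"
        then have "l ! k \<noteq> x" using x l by (metis nth_mem)
        then show "(map ?u s ! i) k = ((map ?u xs @ (\<lambda>k. 0 * 0) # map ?u ys) ! i) k"
          using ik s by (auto simp: sp nth_append nth_Cons split: nat.splits)
      qed
      also have "\<dots> = 0 * rdet r (map ?u xs @ (\<lambda>k. 0) # map ?u ys)"
        by (rule rdet_scale) (use s in \<open>simp add: sp\<close>)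
      finally show False using nz by simp
    qed
  qed
qed

text \<open>The rows of the minor for \<open>s\<close> are selected from those for \<open>l\<close>
  by a 0-1 matrix, whose determinant factors out.\<close>

lemma mdet_perm_sign:
  assumes l: "length l = r" "distinct l" and s: "length s = r" "set s \<subseteq> set l"
  shows "mdet m r s g = perm_sign r l s * mdet m r l g"
proof -
  let ?P = "mat r r (\<lambda>(i, k). if s ! i = l ! k then 1 else 0) :: 'a mat"
  let ?G = "mat r r (\<lambda>(i, k). mrow m r g (l ! i) k)"
  have "mat r r (\<lambda>(i, k). mrow m r g (s ! i) k) = ?P * ?G"
  proof (rule eq_matI)
    fix i k assume "i < dim_row (?P * ?G)" "k < dim_col (?P * ?G)"
    then have ik: "i < r" "k < r" by auto
    have "s ! i \<in> set l" using s ik by auto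
    then obtain a where a: "a < r" "s ! i = l ! a" using l by (metis in_set_conv_nth)
    have "(?P * ?G) $$ (i, k) = (\<Sum>b<r. (if s ! i = l ! b then 1 else 0) * mrow m r g (l ! b) k)"
      using ik by (simp add: scalar_prod_def atLeast0LessThan)
    also have "\<dots> = (\<Sum>b<r. if b = a then mrow m r g (l ! a) k else 0)"
      using a l by (intro sum.cong) (auto simp: nth_eq_iff_index_eq)
    also have "\<dots> = mrow m r g (s ! i) k" using a by simp
    finally show "mat r r (\<lambda>(i, k). mrow m r g (s ! i) k) $$ (i, k) = (?P * ?G) $$ (i, k)" using ik by simp
  qed auto
  then have "det (mat r r (\<lambda>(i, k). mrow m r g (s ! i) k)) = det ?P * det ?G"
    using det_mult[of ?P r ?G] by simp
  moreover have "rdet r (map u t) = det (mat r r (\<lambda>(i, k). u (t ! i) k))" if "length t = r" for t and u :: "nat \<Rightarrow> nat \<Rightarrow> 'a"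
    unfolding rdet_def by (rule arg_cong[of _ _ det]) (use that in auto)
  ultimately show ?thesis unfolding mdet_def perm_sign_def using l s by simp
qed

text \<open>The rows of \<open>g * h\<close> are combinations of rows of \<open>h\<close> with
  coefficients from \<open>g\<close>. Expanding one row after the other leaves values of
  \<open>x\<close> at minors in coordinate rows, and \<open>base\<close> reassembles the
  coefficients into minors of \<open>g\<close> in the columns \<open>l J\<close>.\<close>

lemma functional_trl_mfun:
  fixes x :: "('a::field mat \<Rightarrow> 'a) \<Rightarrow> 'a" and g :: "'a mat"
  assumes lin: "\<And>A c F. x (\<lambda>h. \<Sum>i\<in>A. c i * F (i::nat) h) = (\<Sum>i\<in>A. c i * x (F i))"
    and base: "\<And>s. set s \<subseteq> {..<2*m} \<Longrightarrow> length s = r \<Longrightarrow> x (mfun m r s) = (\<Sum>J\<in>S. perm_sign r (l J) s)"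
    and l: "\<And>J. J \<in> S \<Longrightarrow> length (l J) = r \<and> set (l J) \<subseteq> {..<2*m}"
    and s: "set s \<subseteq> {..<2*m}" "length s = r" and r: "r \<le> m" and g: "g \<in> carrier (Sp m)"
  shows "x (trl m g (mfun m r s)) = (\<Sum>J\<in>S. rdet r (map (\<lambda>y k. g $$ (y, l J ! k)) s))"
proof -
  let ?d = "\<lambda>J a k. if a = l J ! k then 1 else 0 :: 'a"
  \<comment> \<open>Rows in \<open>xs\<close> are already plain rows of \<open>h\<close>, rows in
    \<open>ys\<close> are still rows of \<open>g * h\<close>.\<close>
  define F where "F xs ys = (\<lambda>h. if h \<in> carrier (Sp m) then
      rdet r (map (mrow m r h) xs @ map (\<lambda>y k. \<Sum>a<2*m. g $$ (y, a) * mrow m r h a k) ys) else 0)" for xs ys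
  have "x (F xs ys) = (\<Sum>J\<in>S. rdet r (map (?d J) xs @ map (\<lambda>y k. \<Sum>a<2*m. g $$ (y, a) * ?d J a k) ys))"
    if "length xs + length ys = r" "set xs \<subseteq> {..<2*m}" for xs ys
    using that
  proof (induction ys arbitrary: xs)
    case Nil
    have "F xs [] = mfun m r xs" by (auto simp: F_def mfun_def mdet_def)
    then show ?case using base[of xs] Nil by (simp add: perm_sign_def)
  next
    case (Cons y ys)
    have "F xs (y # ys) = (\<lambda>h. \<Sum>a<2*m. g $$ (y, a) * F (xs @ [a]) ys h)"
    proof
      fix h
      show "F xs (y # ys) h = (\<Sum>a<2*m. g $$ (y, a) * F (xs @ [a]) ys h)"
      proof (cases "h \<in> carrier (Sp m)")
        case True
        then show ?thesis using Cons.prems by (simp add: F_def rdet_sum_row)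
      qed (simp add: F_def)
    qed
    then have "x (F xs (y # ys)) = (\<Sum>a<2*m. g $$ (y, a) * x (F (xs @ [a]) ys))" by (simp only: lin)
    also have "\<dots> = (\<Sum>a<2*m. g $$ (y, a) *
        (\<Sum>J\<in>S. rdet r (map (?d J) (xs @ [a]) @ map (\<lambda>y k. \<Sum>a<2*m. g $$ (y, a) * ?d J a k) ys)))"
      by (intro sum.cong refl arg_cong[of _ _ "(*) _"] Cons.IH) (use Cons.prems in auto)
    also have "\<dots> = (\<Sum>J\<in>S. \<Sum>a<2*m. g $$ (y, a) *
        rdet r (map (?d J) xs @ ?d J a # map (\<lambda>y k. \<Sum>a<2*m. g $$ (y, a) * ?d J a k) ys))"
      unfolding sum_distrib_left by (subst sum.swap) simp
    also have "\<dots> = (\<Sum>J\<in>S. rdet r (map (?d J) xs @ (\<lambda>k. \<Sum>a<2*m. g $$ (y, a) * ?d J a k)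
        # map (\<lambda>y k. \<Sum>a<2*m. g $$ (y, a) * ?d J a k) ys))"
      by (intro sum.cong refl rdet_sum_row[symmetric]) (use Cons.prems in auto)
    finally show ?case by (simp only: list.map)
  qed
  from this[of "[]" s] s have e: "x (F [] s) = (\<Sum>J\<in>S. rdet r (map (\<lambda>y k. \<Sum>a<2*m. g $$ (y, a) * ?d J a k) s))"
    by simp
  have "F [] s = trl m g (mfun m r s)"
  proof
    fix h
    show "F [] s h = trl m g (mfun m r s) h"
    proof (cases "h \<in> carrier (Sp m)")
      case True
      have "rdet r (map (\<lambda>y k. \<Sum>a<2*m. g $$ (y, a) * mrow m r h a k) s) = rdet r (map (mrow m r (g * h)) s)"
      proof (rule rdet_cong)
        fix i k assume ik: "i < r" "k < r"
        have "s ! i \<in> set s" using ik s(2) by simp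
        then have "s ! i < 2*m" "2*m - r + k < 2*m" using s(1) ik r by auto
        then show "(map (\<lambda>y k. \<Sum>a<2*m. g $$ (y, a) * mrow m r h a k) s ! i) k = (map (mrow m r (g * h)) s ! i) k"
          using ik s(2) mult_entry[OF Sp_carrier_mat[OF g] Sp_carrier_mat[OF True]]
          by (simp add: mrow_def del: index_mult_mat)
      qed
      then show ?thesis using True Sp_mult[OF g True] by (simp add: F_def trl_def mfun_def mdet_def)
    qed (simp add: F_def trl_def)
  qed
  moreover have "rdet r (map (\<lambda>y k. \<Sum>a<2*m. g $$ (y, a) * ?d J a k) s) = rdet r (map (\<lambda>y k. g $$ (y, l J ! k)) s)"
    if J: "J \<in> S" for J
  proof (rule rdet_cong)
    fix i k assume ik: "i < r" "k < r"
    then have "l J ! k \<in> set (l J)" using l[OF J] by simp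
    then have lk: "l J ! k < 2*m" using l[OF J] by auto
    have "(\<Sum>a<2*m. g $$ (s ! i, a) * ?d J a k) = (\<Sum>a<2*m. if a = l J ! k then g $$ (s ! i, l J ! k) else 0)"
      by (intro sum.cong) auto
    then show "(map (\<lambda>y k. \<Sum>a<2*m. g $$ (y, a) * ?d J a k) s ! i) k = (map (\<lambda>y k. g $$ (y, l J ! k)) s ! i) k"
      using lk ik s(2) by simp
  qed
  ultimately show ?thesis using e by simp
qed

text \<open>The minors of \<open>g\<close> that arise have the last \<open>r\<close> rows and the
  columns \<open>l\<close>. Transposing puts them back into the shape for which the relations are
  known.\<close>

lemma rdet_transpose_rows:
  assumes g: "g \<in> carrier_mat (2*m) (2*m)" and l: "length l = r" "set l \<subseteq> {..<2*m}" and r: "r \<le> m"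
  shows "rdet r (map (\<lambda>y k. g $$ (y, l ! k)) [2*m - r..<2*m]) = mdet m r l (g\<^sup>T)"
proof -
  let ?M = "mat r r (\<lambda>(i, k). g $$ (2*m - r + i, l ! k))"
  have "rdet r (map (\<lambda>y k. g $$ (y, l ! k)) [2*m - r..<2*m]) = det ?M"
    unfolding rdet_def by (intro arg_cong[of _ _ det]) (use r in auto)
  also have "\<dots> = det (?M\<^sup>T)" by (rule det_transpose[of _ r, symmetric]) simp
  also have "?M\<^sup>T = mat r r (\<lambda>(i, k). (map (mrow m r (g\<^sup>T)) l ! i) k)"
  proof (rule eq_matI)
    fix i k assume "i < dim_row (mat r r (\<lambda>(i, k). (map (mrow m r (g\<^sup>T)) l ! i) k))"
      "k < dim_col (mat r r (\<lambda>(i, k). (map (mrow m r (g\<^sup>T)) l ! i) k))"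
    then have ik: "i < r" "k < r" by auto
    then have "l ! i \<in> set l" using l by simp
    then have "l ! i < 2*m" using l by auto
    then show "?M\<^sup>T $$ (i, k) = mat r r (\<lambda>(i, k). (map (mrow m r (g\<^sup>T)) l ! i) k) $$ (i, k)"
      using ik g l r by (simp add: mrow_def)
  qed auto
  finally show ?thesis by (simp add: mdet_def rdet_def)
qed

lemma distinct_pairs:
  assumes q: "iso_list m q" and J: "J \<subseteq> set (zc m q)"
  shows "distinct (q @ zl m (sorted_list_of_set J))" "set (q @ zl m (sorted_list_of_set J)) = set q \<union> J \<union> cj m ` J"
    "set (q @ zl m (sorted_list_of_set J)) \<subseteq> {..<2*m}"
proof -
  have f: "finite J" using J finite_subset by blast
  have Jm: "J \<subseteq> {..<m}" using J by (auto simp: set_zc)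
  show s: "set (q @ zl m (sorted_list_of_set J)) = set q \<union> J \<union> cj m ` J" using f by (auto simp: set_zl)
  show "set (q @ zl m (sorted_list_of_set J)) \<subseteq> {..<2*m}" unfolding s using iso_listD[OF q] Jm by fastforce
  have d: "distinct (zl m l)" if "distinct l" "set l \<subseteq> {..<m}" for l
    using that
  proof (induction l)
    case (Cons c l)
    have "cj m c \<noteq> x" "cj m c \<noteq> cj m x" "c \<noteq> cj m x" if "x \<in> set l" for x
    proof -
      have "x < m" "x \<noteq> c" "c < m" using Cons.prems that by auto
      then show "cj m c \<noteq> x" "cj m c \<noteq> cj m x" "c \<noteq> cj m x" by (auto simp: cj_def)
    qed
    then show ?case using Cons by (auto simp: set_zl)
  qed simp
  have "x \<notin> set q" if x: "x \<in> J \<union> cj m ` J" for x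
  proof
    assume xq: "x \<in> set q"
    obtain c where c: "c \<in> J" "x = c \<or> x = cj m c" using x by blast
    then have "c < m" using Jm by auto
    then have "nm m x = c" using c(2) by (auto simp: nm_cj)
    then have "c \<in> nm m ` set q" using xq by blast
    then show False using c(1) J by (auto simp: set_zc)
  qed
  moreover have "distinct q" using q by (auto simp: iso_list_def distinct_map)
  ultimately show "distinct (q @ zl m (sorted_list_of_set J))"
    using d[of "sorted_list_of_set J"] f Jm by (auto simp: set_zl)
qed

lemma lw_distinct:
  assumes "distinct s" "c < 2*m" "set s \<subseteq> {..<2*m}"
  shows "lw m s c = (if c \<in> set s then 1 else 0) - (if cj m c \<in> set s then 1 else 0)"
  using assms
proof (induction s)
  case (Cons x s)
  then have "c = cj m x \<longleftrightarrow> cj m c = x" using eq_cj_iff[of x m c] by auto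
  then show ?case using Cons by (auto simp: lw_Cons)
qed simp

text \<open>On a pair of \<open>q\<close> the weight is 1 or -1 and forces exactly the member in
  \<open>q\<close>; on any other pair the weight is 0 and forces both members or neither.\<close>

lemma lw_eq_pairs:
  assumes q: "iso_list m q" and s: "distinct s" "set s \<subseteq> {..<2*m}" "length s = length q + 2 * j"
    and w: "\<And>i. i < m \<Longrightarrow> lw m s i = lw m q i"
  shows "\<exists>J\<in>subsets j (set (zc m q)). set s = set (q @ zl m (sorted_list_of_set J))"
proof
  let ?J = "{c \<in> set (zc m q). c \<in> set s}"
  have sub: "?J \<subseteq> set (zc m q)" by blast
  note d = distinct_pairs[OF q sub]
  note q2 = iso_listD[OF q]
  have dq: "distinct q" using q by (auto simp: iso_list_def distinct_map)
  have key: "x \<in> set s \<longleftrightarrow> x \<in> set q \<union> ?J \<union> cj m ` ?J" if x: "x < 2*m" for x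
  proof -
    define c where "c = nm m x"
    have c: "c < m" "x = c \<or> x = cj m c" using nm_less[OF x] nm_cases[OF x] by (auto simp: c_def)
    then have c2: "c < 2*m" "cj m c < 2*m" by auto
    have eq: "(if c \<in> set s then 1 else 0) - (if cj m c \<in> set s then 1 else (0::int))
        = (if c \<in> set q then 1 else 0) - (if cj m c \<in> set q then 1 else 0)"
      using w[OF c(1)] unfolding lw_distinct[OF s(1) c2(1) s(2)] lw_distinct[OF dq c2(1) q2] .
    show ?thesis
    proof (cases "c \<in> nm m ` set q")
      case True
      then obtain y where y: "y \<in> set q" "c = nm m y" by blast
      then have y2: "y < 2*m" using q2 by auto
      then have "y = c \<or> y = cj m c" using nm_cases[OF y2] y(2) by auto
      moreover have "\<not> (c \<in> set q \<and> cj m c \<in> set q)"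
      proof
        assume a: "c \<in> set q \<and> cj m c \<in> set q"
        have "nm m c = nm m (cj m c)" using c2 by simp
        then have "c = cj m c" using a q inj_onD[of "nm m" "set q" c "cj m c"] by (auto simp: iso_list_def distinct_map)
        then show False using cj_neq(2)[OF c2(1)] by simp
      qed
      ultimately have "(c \<in> set s \<longleftrightarrow> c \<in> set q) \<and> (cj m c \<in> set s \<longleftrightarrow> cj m c \<in> set q)"
        using eq y(1) by (auto split: if_splits)
      moreover have "x \<notin> ?J \<union> cj m ` ?J"
      proof
        assume "x \<in> ?J \<union> cj m ` ?J"
        then obtain d where dd: "d \<in> set (zc m q)" "x = d \<or> x = cj m d" by blast
        then have "d < m" by (simp add: set_zc)
        then have "c = d" using dd(2) unfolding c_def by auto
        then show False using dd(1) True by (simp add: set_zc)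
      qed
      ultimately show ?thesis using c(2) by auto
    next
      case False
      then have cz: "c \<in> set (zc m q)" using c(1) by (simp add: set_zc)
      have "nm m c = c" "nm m (cj m c) = c" using c(1) c2 by auto
      then have nq: "c \<notin> set q" "cj m c \<notin> set q" using False by (metis imageI)+
      then have iff: "c \<in> set s \<longleftrightarrow> cj m c \<in> set s" using eq by (auto split: if_splits)
      have xq: "x \<notin> set q" using nq c(2) by auto
      have "x \<in> ?J \<union> cj m ` ?J \<longleftrightarrow> c \<in> set s"
      proof
        assume "x \<in> ?J \<union> cj m ` ?J"
        then obtain d where dd: "d \<in> ?J" "x = d \<or> x = cj m d" by blast
        then have "d < m" by (simp add: set_zc)
        then have "c = d" using dd(2) unfolding c_def by auto
        then show "c \<in> set s" using dd(1) by simp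
      next
        assume "c \<in> set s"
        then have "c \<in> ?J" using cz by simp
        then show "x \<in> ?J \<union> cj m ` ?J" using c(2) by blast
      qed
      then show ?thesis using xq iff c(2) by auto
    qed
  qed
  have eq: "set s = set (q @ zl m (sorted_list_of_set ?J))"
    unfolding d(2) using key s(2) d(2,3) by blast
  then show "set s = set (q @ zl m (sorted_list_of_set ?J))" .
  have "length s = length (q @ zl m (sorted_list_of_set ?J))"
    using distinct_card[OF s(1)] distinct_card[OF d(1)] eq by simp
  then have "card ?J = j" using s(3) by simp
  then show "?J \<in> subsets j (set (zc m q))" by (auto simp: subsets_def)
qed

text \<open>The linear form belonging to the constant function 1 is nonzero, yet it annihilates all
  translates of an extremal minor. The functionals that do so form a nonzero submodule, which is
  proper since evaluation at a suitable point does not belong to it.\<close>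

theorem weyl_module_not_simple:
  assumes r: "r \<le> m" and j: "1 \<le> j" "2 * j \<le> r"
    and num: "\<And>i. 1 \<le> i \<Longrightarrow> i \<le> j \<Longrightarrow> of_nat ((m - r + j + i) choose i) = (0::'a::alg_closed_field)"
  shows "\<not> simple_module (Sp m) (weyl_module m (fund_weight r) :: (('a mat \<Rightarrow> 'a) \<Rightarrow> 'a) set) (weyl_action m (fund_weight r))"
proof
  assume simple: "simple_module (Sp m) (weyl_module m (fund_weight r) :: (('a mat \<Rightarrow> 'a) \<Rightarrow> 'a) set) (weyl_action m (fund_weight r))"
  let ?H = "ind m r :: ('a mat \<Rightarrow> 'a) set"
  define q where "q = [0..<r - 2 * j]"
  have nq: "map (nm m) q = q" unfolding q_def by (rule map_idI) (use r in auto)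
  have q: "iso_list m q" unfolding iso_list_def nq by (use r in \<open>auto simp: q_def\<close>)
  have len: "length q + 2 * j = r" using j by (simp add: q_def)
  let ?Z = "set (zc m q)"
  have cZ: "card ?Z = m - r + 2 * j"
  proof -
    have "card ?Z = length (zc m q)" by (rule distinct_card) (simp add: zc_def)
    then show ?thesis using iso_list_zc(2)[OF q] len r by simp
  qed
  \<comment> \<open>With \<open>i = j - card I\<close> the number of supersets of \<open>I\<close>
    is the binomial coefficient that vanishes by assumption.\<close>
  have "down_zero ?Z j (\<lambda>_. 1 :: 'a)"
    unfolding down_zero_def
  proof (intro allI impI)
    fix I assume I: "I \<subseteq> ?Z" "card I < j"
    have "card {J. J \<in> subsets j ?Z \<and> I \<subseteq> J} = (card ?Z - card I) choose (j - card I)"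
      by (rule card_supersets) (use I in auto)
    also have "card ?Z - card I = m - r + j + (j - card I)" using I cZ by simp
    finally show "(\<Sum>J | J \<in> subsets j ?Z \<and> I \<subseteq> J. 1 :: 'a) = 0" using num[of "j - card I"] I by simp
  qed
  then obtain x :: "('a mat \<Rightarrow> 'a) \<Rightarrow> 'a" where
    lin: "\<forall>A c F. x (\<lambda>g. \<Sum>i\<in>A. c i * F (i::nat) g) = (\<Sum>i\<in>A. c i * x (F i))"
    and val: "\<forall>J\<in>subsets j ?Z. x (zf m r q J) = 1"
    and off: "\<forall>\<nu>. \<forall>f\<in>Hw m r \<nu>. (\<exists>i<m. \<nu> i \<noteq> lw m q i) \<longrightarrow> x f = 0"
    using weight_functional[OF r q len] by blast
  have add: "x (f + h) = x f + x h" for f h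
  proof -
    have "f + h = (\<lambda>g. \<Sum>i\<in>{0, 1::nat}. 1 * (if i = 0 then f else h) g)" by (simp add: fun_eq_iff)
    then have "x (f + h) = (\<Sum>i\<in>{0, 1::nat}. 1 * x (if i = 0 then f else h))" by (simp only: lin[rule_format])
    then show ?thesis by simp
  qed
  have scale: "x (fun_scale c f) = c * x f" for c f
  proof -
    have "fun_scale c f = (\<lambda>g. \<Sum>i\<in>{0::nat}. c * f g)" by (simp add: fun_scale_def)
    then have "x (fun_scale c f) = (\<Sum>i\<in>{0::nat}. c * x f)" by (simp only: lin[rule_format])
    then show ?thesis by simp
  qed
  have scale': "x (\<lambda>g. c * f g) = c * x f" for c f using scale[of c f] by (simp add: fun_scale_def)
  let ?l = "\<lambda>J. q @ zl m (sorted_list_of_set J)"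
  have lJ: "length (?l J) = r" "distinct (?l J)" "set (?l J) = set q \<union> J \<union> cj m ` J" "set (?l J) \<subseteq> {..<2*m}"
    "J \<subseteq> {..<m}" "J \<inter> set q = {}" if J: "J \<in> subsets j ?Z" for J
  proof -
    have J': "J \<subseteq> ?Z" "card J = j" using J by (auto simp: subsets_def)
    note d = distinct_pairs[OF q J'(1)]
    show "length (?l J) = r" using J'(2) len by simp
    show "distinct (?l J)" by (rule d(1))
    show "set (?l J) = set q \<union> J \<union> cj m ` J" by (rule d(2))
    show "set (?l J) \<subseteq> {..<2*m}" by (rule d(3))
    show "J \<subseteq> {..<m}" using J'(1) by (auto simp: set_zc)
    have "nm m ` set q = set q" using nq by (metis set_map)
    then show "J \<inter> set q = {}" using J'(1) by (auto simp: set_zc)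
  qed
  \<comment> \<open>At most one term is nonzero, because the set of rows determines
    \<open>J\<close>. If all terms are zero, then \<open>s\<close> repeats a row, or its weight
    differs from that of \<open>q\<close>, or the minor itself is zero.\<close>
  have base: "x (mfun m r s) = (\<Sum>J\<in>subsets j ?Z. perm_sign r (?l J) s)" if s: "set s \<subseteq> {..<2*m}" "length s = r" for s
  proof (cases "\<exists>J\<in>subsets j ?Z. perm_sign r (?l J) s \<noteq> (0::'a)")
    case True
    then obtain J where J: "J \<in> subsets j ?Z" and nz: "perm_sign r (?l J) s \<noteq> (0::'a)" by blast
    note pn = perm_sign_nonzero[OF lJ(1)[OF J] s(2) nz]
    have eq: "set s = set (?l J')" if J': "J' \<in> subsets j ?Z" and nz': "perm_sign r (?l J') s \<noteq> (0::'a)" for J'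
    proof (rule card_subset_eq)
      note pn' = perm_sign_nonzero[OF lJ(1)[OF J'] s(2) nz']
      show "set s \<subseteq> set (?l J')" by (rule pn'(2))
      show "card (set s) = card (set (?l J'))"
        using distinct_card[OF pn'(1)] distinct_card[OF lJ(2)[OF J']] s(2) lJ(1)[OF J'] by simp
    qed simp
    have uniq: "J' = J" if J': "J' \<in> subsets j ?Z" and nz': "perm_sign r (?l J') s \<noteq> (0::'a)" for J'
    proof -
      have J_eq: "K = {c \<in> set (?l K). c < m \<and> c \<notin> set q}" if "K \<in> subsets j ?Z" for K
      proof -
        have "\<not> cj m c < m" if "c \<in> K" for c
          using lJ(5)[OF \<open>K \<in> subsets j ?Z\<close>] that by (auto simp: cj_def)
        then show ?thesis unfolding lJ(3)[OF that] using lJ(5,6)[OF that] by auto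
      qed
      have "set (?l J') = set (?l J)" using eq[OF J' nz'] eq[OF J nz] by simp
      then show ?thesis using J_eq[OF J] J_eq[OF J'] by simp
    qed
    have "(\<Sum>J'\<in>subsets j ?Z. perm_sign r (?l J') s) = (\<Sum>J'\<in>subsets j ?Z. if J' = J then perm_sign r (?l J) s else (0::'a))"
    proof (rule sum.cong[OF refl])
      fix J' assume J': "J' \<in> subsets j ?Z"
      show "perm_sign r (?l J') s = (if J' = J then perm_sign r (?l J) s else (0::'a))"
      proof (cases "J' = J")
        case False
        then have "perm_sign r (?l J') s = (0::'a)" using uniq[OF J'] by blast
        then show ?thesis using False by (simp only: if_False)
      qed (simp only: refl if_True)
    qed
    also have "\<dots> = perm_sign r (?l J) s" using J by (subst sum.delta) (simp_all only: finite_subsets finite_set if_True)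
    finally have rhs: "(\<Sum>J'\<in>subsets j ?Z. perm_sign r (?l J') s) = (perm_sign r (?l J) s :: 'a)" .
    have "mfun m r s = (\<lambda>g. perm_sign r (?l J) s * zf m r q J g :: 'a)"
    proof
      fix g :: "'a mat"
      show "mfun m r s g = perm_sign r (?l J) s * zf m r q J g"
        using mdet_perm_sign[OF lJ(1)[OF J] lJ(2)[OF J] s(2) pn(2), where g = g] by (simp add: mfun_def zf_def)
    qed
    then show ?thesis using scale'[of "perm_sign r (?l J) s" "zf m r q J"] val J rhs by simp
  next
    case False
    have "x (mfun m r s) = 0"
    proof (cases "distinct s \<and> (\<forall>i<m. lw m s i = lw m q i)")
      case True
      then obtain J where J: "J \<in> subsets j ?Z" and e: "set s = set (?l J)"
        using lw_eq_pairs[OF q _ s(1), of j] s(2) len by auto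
      have "perm_sign r (?l J) s = (0::'a)" using False J by blast
      then have "mfun m r s = (\<lambda>g. 0 :: 'a)"
        using mdet_perm_sign[OF lJ(1)[OF J] lJ(2)[OF J] s(2), where 'a = 'a] e by (simp add: mfun_def fun_eq_iff)
      then show ?thesis using scale'[of 0 "\<lambda>g. 0"] by simp
    next
      case n: False
      show ?thesis
      proof (cases "distinct s")
        case True
        then have "\<exists>i<m. lw m s i \<noteq> lw m q i" using n by blast
        then show ?thesis using off mfun_Hw[OF s r, where 'a = 'a] by blast
      next
        case False
        then have "mfun m r s = (0 :: 'a mat \<Rightarrow> 'a)" by (rule mfun_repeat[OF s(2)])
        then show ?thesis using scale'[of 0 "\<lambda>g. 0"] by (simp add: zero_fun_def)
      qed
    qed
    then show ?thesis using False by simp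
  qed
  \<comment> \<open>With the last \<open>r\<close> rows, the minors of \<open>g\<close> that occur
    in the translate are minors of the transpose in its last \<open>r\<close> columns.\<close>
  define s0 where "s0 = [2*m - r..<2*m]"
  have s0: "set s0 \<subseteq> {..<2*m}" "length s0 = r" using r by (auto simp: s0_def)
  have nc0: "map (nm m) s0 = map (cj m) s0" using r by (auto simp: s0_def nm_def)
  have "distinct (map (cj m) s0)" using r by (auto simp: distinct_map s0_def inj_on_def cj_def)
  then have is0: "iso_list m s0" using s0(1) unfolding iso_list_def nc0 by simp
  define f0 where "f0 = (mfun m r s0 :: 'a mat \<Rightarrow> 'a)"
  have f0: "f0 \<in> ?H" unfolding f0_def by (rule mfun_ind[OF s0 r])
  have x0: "x (trl m g f0) = 0" if g: "g \<in> carrier (Sp m)" for g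
  proof -
    have gt: "g\<^sup>T \<in> carrier (Sp m)" by (rule Sp_transpose[OF g])
    have "x (trl m g f0) = (\<Sum>J\<in>subsets j ?Z. rdet r (map (\<lambda>y k. g $$ (y, ?l J ! k)) s0))"
      unfolding f0_def
      by (rule functional_trl_mfun[OF lin[rule_format] base _ s0 r g]) (use lJ in blast)+
    also have "\<dots> = (\<Sum>J\<in>subsets j ?Z. zf m r q J (g\<^sup>T))"
      unfolding s0_def
      by (intro sum.cong refl, subst rdet_transpose_rows[OF Sp_carrier_mat[OF g] _ _ r])
        (use lJ gt in \<open>auto simp: zf_def mfun_def simp del: length_append set_append\<close>)
    also have "\<dots> = (\<Sum>J | J \<in> subsets j ?Z \<and> {} \<subseteq> J. zf m r q J (g\<^sup>T))" by simp
    also have "\<dots> = 0" by (rule minor_relation[OF r q len]) (use j in auto)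
    finally show ?thesis .
  qed
  have H: "fun_space.subspace ?H" by (rule ind_subspace[OF r])
  \<comment> \<open>The annihilator of the submodule generated by the extremal minor.\<close>
  define W where "W = {\<psi> \<in> dual_space ?H. \<forall>g\<in>carrier (Sp m). \<psi> (trl m g f0) = 0}"
  have trlH: "trl m g f0 \<in> ?H" if "g \<in> carrier (Sp m)" for g by (rule trl_ind[OF f0 r that])
  have sub: "fun_space.subspace W"
    unfolding fun_space.subspace_def W_def dual_space_def
    by (auto simp: algebra_simps) (auto simp: fun_scale_def algebra_simps)
  have inv: "weyl_action m (fund_weight r) g \<psi> \<in> W" if g: "g \<in> carrier (Sp m)" and \<psi>: "\<psi> \<in> W" for g \<psi>
  proof -
    have \<psi>D: "\<psi> (f + h) = \<psi> f + \<psi> h" "\<psi> (fun_scale c f) = c * \<psi> f" if "f \<in> ?H" "h \<in> ?H" for f h c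
      using \<psi> that by (auto simp: W_def dual_space_def)
    have "trl m g (f + h) = trl m g f + trl m g h" "trl m g (fun_scale c f) = fun_scale c (trl m g f)" for f h :: "'a mat \<Rightarrow> 'a" and c
      by (auto simp: trl_def fun_scale_def fun_eq_iff)
    then have "weyl_action m (fund_weight r) g \<psi> \<in> dual_space ?H"
      unfolding weyl_action_trl[OF g] dual_space_def
      using fun_space.subspace_add[OF H] fun_space.subspace_scale[OF H] trl_ind[OF _ r g]
      by (simp add: \<psi>D)
    moreover have "weyl_action m (fund_weight r) g \<psi> (trl m h f0) = 0" if h: "h \<in> carrier (Sp m)" for h
      using \<psi> Sp_mult[OF h g] by (simp add: weyl_action_trl[OF g] trl_trl[OF g h] W_def trlH h)
    ultimately show ?thesis by (simp add: W_def)
  qed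
  define x' where "x' f = (if f \<in> ?H then x f else 0)" for f
  have "x' \<in> dual_space ?H"
    using fun_space.subspace_add[OF H] fun_space.subspace_scale[OF H]
    by (simp add: dual_space_def x'_def add scale)
  then have x'W: "x' \<in> W" using x0 by (simp add: W_def x'_def)
  have "j \<le> card ?Z" using cZ by simp
  then obtain J where "J \<subseteq> ?Z" "card J = j" using obtain_subset_with_card_n by metis
  then have J: "J \<in> subsets j ?Z" by (simp add: subsets_def)
  have "zf m r q J \<in> ?H" unfolding zf_def by (rule mfun_ind[OF lJ(4)[OF J] lJ(1)[OF J] r])
  then have "x' (zf m r q J) = 1" using val J by (simp add: x'_def)
  then have "W \<noteq> {0}" using x'W by auto
  moreover have "W \<noteq> dual_space ?H"
  proof -
    obtain g0 where g0: "g0 \<in> carrier (Sp m)" "f0 g0 \<noteq> 0"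
      using extremal_minor_nonzero[OF r is0 s0(2), where 'a = 'a] by (auto simp: f0_def)
    have "trl m (1\<^sub>m (2*m)) f0 = f0" by (rule trl_one) (simp add: f0_def mfun_outside)
    then have "evf ?H g0 (trl m (1\<^sub>m (2*m)) f0) \<noteq> 0" using g0 f0 by (simp add: evf_def)
    then have "evf ?H g0 \<notin> W" using Sp_one by (auto simp: W_def)
    then show ?thesis using evf_dual[OF H] by blast
  qed
  moreover have "W \<subseteq> dual_space ?H" by (auto simp: W_def)
  ultimately show False
    using simple sub inv unfolding simple_module_def weyl_module_ind by blast
qed

section \<open>Binomial coefficients modulo a prime\<close>

text \<open>Absorption; it brings out the factor \<open>Suc a\<close>, which decides about
  divisibility by the prime.\<close>

lemma mult_choose: "0 < i \<Longrightarrow> i * ((a + i) choose i) = Suc a * ((a + i) choose (i - 1))"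
proof -
  assume i: "0 < i"
  then obtain k where k: "i = Suc k" using gr0_implies_Suc by blast
  have "Suc k * (Suc (a + k) choose Suc k) = (Suc (a + k) choose k) * (Suc (a + k) - k)"
    using binomial_absorb_comp[of "Suc (a + k)" k] binomial_absorption[of k "Suc (a + k)"] by (simp add: algebra_simps)
  then show ?thesis by (simp add: k algebra_simps)
qed

text \<open>Otherwise the binomial coefficient is prime to \<open>p\<close>, and by
  \<open>mult_choose\<close> the whole power of \<open>p\<close> divides the smaller number
  \<open>i\<close>.\<close>

lemma prime_dvd_choose_of_power_dvd:
  fixes p :: nat
  assumes p: "prime p" and Q: "p ^ Suc f dvd Suc a" and i: "0 < i" "i < p ^ Suc f"
  shows "p dvd (a + i) choose i"
proof (rule ccontr)
  assume n: "\<not> ?thesis"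
  have "p ^ Suc f dvd i * ((a + i) choose i)" unfolding mult_choose[OF i(1)] by (rule dvd_mult2[OF Q])
  moreover have "coprime (p ^ Suc f) ((a + i) choose i)"
    using n p by (simp add: prime_imp_coprime)
  ultimately have "p ^ Suc f dvd i" using coprime_dvd_mult_left_iff by blast
  then show False using i by (simp add: nat_dvd_not_less)
qed

text \<open>The entries of the next row of the Pascal triangle are divisible by \<open>p\<close> in
  this range. So consecutive coefficients are negatives of each other modulo \<open>p\<close>,
  starting from 1.\<close>

lemma prime_not_dvd_choose_pred:
  fixes p :: nat
  assumes p: "prime p" and w: "0 < w" and k: "k < p ^ e"
  shows "\<not> p dvd (p ^ e * w - 1) choose k"
  using k
proof (induction k)
  case 0
  show ?case using p not_prime_unit by auto
next
  case (Suc k)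
  have pos: "0 < p ^ e" using p by (simp add: prime_gt_0_nat)
  obtain n where n: "p ^ e * w = Suc n" using pos w by (metis mult_pos_pos gr0_implies_Suc)
  obtain e' where e: "e = Suc e'" using Suc.prems by (cases e) auto
  have "p dvd Suc n choose Suc k"
  proof (rule ccontr)
    assume nd: "\<not> ?thesis"
    have "Suc k * (Suc n choose Suc k) = Suc n * (n choose k)" by (metis Suc_times_binomial_eq mult.commute)
    then have "p ^ e dvd Suc k * (Suc n choose Suc k)" unfolding n[symmetric] by simp
    moreover have "coprime (p ^ e) (Suc n choose Suc k)" using nd p by (simp add: prime_imp_coprime)
    ultimately have "p ^ e dvd Suc k" using coprime_dvd_mult_left_iff by blast
    then show False using Suc.prems by (simp add: nat_dvd_not_less)
  qed
  then have "p dvd (n choose k) + (n choose Suc k)" by simp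
  moreover have "\<not> p dvd n choose k" using Suc n by simp
  ultimately show ?case using n by (metis dvd_add_left_iff diff_Suc_1)
qed

text \<open>Cancelling \<open>p ^ e\<close> in \<open>mult_choose\<close> leaves \<open>u\<close>
  times a coefficient of the row \<open>p ^ e * Suc u - 1\<close>, which
  \<open>prime_not_dvd_choose_pred\<close> covers.\<close>

lemma prime_not_dvd_choose_power:
  fixes p :: nat
  assumes p: "prime p" and a: "Suc a = p ^ e * u" and u: "\<not> p dvd u"
  shows "\<not> p dvd (a + p ^ e) choose (p ^ e)"
proof -
  have pos: "0 < p ^ e" using p by (simp add: prime_gt_0_nat)
  have "p ^ e * ((a + p ^ e) choose (p ^ e)) = p ^ e * (u * ((a + p ^ e) choose (p ^ e - 1)))"
    using mult_choose[OF pos, of a] unfolding a by (simp only: mult.assoc)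
  then have eq: "(a + p ^ e) choose (p ^ e) = u * ((a + p ^ e) choose (p ^ e - 1))" using prime_gt_0_nat[OF p] by simp
  have "p ^ e * Suc u - 1 = a + p ^ e" using a by simp
  then have "\<not> p dvd (a + p ^ e) choose (p ^ e - 1)"
    using prime_not_dvd_choose_pred[OF p, of "Suc u" "p ^ e - 1" e] pos by simp
  then show ?thesis unfolding eq using u p by (simp add: prime_dvd_mult_iff)
qed

text \<open>The witness is \<open>i = p ^ e\<close>, the exact power of \<open>p\<close> in
  \<open>n + j + 1\<close>; what remains is \<open>p ^ e \<le> j\<close>. If \<open>p ^ f\<close>
  divides \<open>j\<close>, the digit at position \<open>f\<close> becomes \<open>d + c\<close> with
  \<open>0 < c\<close> and \<open>d + c < p\<close>, so \<open>e = f\<close>. Otherwise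
  \<open>e < f\<close>, and \<open>p ^ e\<close> divides both \<open>n + 1\<close> and
  \<open>n + 1 + j\<close>, hence \<open>j\<close>.\<close>

lemma exists_choose_nonzero:
  fixes p :: nat
  assumes p: "prime p" and R: "Suc n = p ^ f * (d + p * T)" and d: "0 < d" "d < p"
    and j: "0 < j" "j < (p - d) * p ^ f"
  shows "\<exists>i. 1 \<le> i \<and> i \<le> j \<and> \<not> p dvd (n + j + i) choose i"
proof -
  define e where "e = multiplicity p (Suc (n + j))"
  have p1: "\<not> is_unit p" using p not_prime_unit by blast
  obtain u where u: "Suc (n + j) = p ^ e * u" "\<not> p dvd u"
    using multiplicity_decompose'[of "Suc (n + j)" p] p1 unfolding e_def by (metis nat.distinct(1))
  have le: "p ^ e \<le> j"
  proof (cases "p ^ f dvd j")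
    case True
    then obtain c where c: "j = p ^ f * c" by blast
    have "0 < c" "c < p - d" using j c by (auto simp: mult.commute)
    then have "\<not> p dvd c + d" by (intro nat_dvd_not_less) auto
    then have nd: "\<not> p dvd c + d + p * T" by (simp add: dvd_add_left_iff)
    have "Suc (n + j) = p ^ f * (c + d + p * T)" using R c by (simp add: algebra_simps)
    moreover have "\<not> p ^ Suc f dvd p ^ f * (c + d + p * T)"
      unfolding power_Suc2 using nd prime_gt_0_nat[OF p] by simp
    ultimately have "e = f" unfolding e_def by (intro multiplicity_eqI) simp_all
    then show ?thesis using \<open>0 < c\<close> c by simp
  next
    case False
    have "e < f"
    proof (rule ccontr)
      assume "\<not> e < f"
      then have "p ^ f dvd p ^ e" by (simp add: le_imp_power_dvd)
      then have "p ^ f dvd Suc n + j" using u(1) by (metis add_Suc dvd_mult2)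
      moreover have "p ^ f dvd Suc n" using R by simp
      ultimately show False using False by (metis dvd_add_right_iff)
    qed
    then have "p ^ e dvd Suc n" using R by (metis dvd_mult2 le_imp_power_dvd less_imp_le)
    moreover have "p ^ e dvd Suc n + j" using u(1) by simp
    ultimately have "p ^ e dvd j" by (metis dvd_add_right_iff)
    then show ?thesis using j(1) by (simp add: dvd_imp_le)
  qed
  have "\<not> p dvd (n + j + p ^ e) choose (p ^ e)" by (rule prime_not_dvd_choose_power[OF p u])
  moreover have "1 \<le> p ^ e" using p by (simp add: prime_gt_0_nat Suc_le_eq)
  ultimately show ?thesis using le by blast
qed

theorem theorem5p2:
  fixes p m r f k :: nat
    and R :: "nat \<Rightarrow> nat"
  assumes "prime p" and "CHAR('a::alg_closed_field) = p"
    and "m \<ge> 1" and "r \<le> m"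
    and "f \<le> k"
    and "\<And>i. i \<in> {f..k} \<Longrightarrow> R i \<le> p - 1"
    and "m + 1 - r = (\<Sum>i=f..k. R i * p ^ i)"
    and "R f \<noteq> 0" and "R k \<noteq> 0"
  shows "simple_module (Sp m)
           (weyl_module m (fund_weight r) :: (('a mat \<Rightarrow> 'a) \<Rightarrow> 'a) set)
           (weyl_action m (fund_weight r))
         \<longleftrightarrow> r < 2 * (p - R f) * p ^ f"
proof -
  note p = assms(1)
  let ?n = "m - r" and ?d = "R f"
  \<comment> \<open>The digits above the lowest nonzero one, shifted down, so that the given number
    is \<open>p ^ f * (R f + p * T)\<close>.\<close>
  define T where "T = (\<Sum>i=Suc f..k. R i * p ^ (i - Suc f))"
  have d: "0 < ?d" "?d < p" using assms(5,6,8) prime_gt_0_nat[OF p] by force+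
  have char: "of_nat a = (0::'a) \<longleftrightarrow> p dvd a" for a using assms(2) by (simp add: of_nat_eq_0_iff_char_dvd)
  have "Suc ?n = R f * p ^ f + (\<Sum>i=Suc f..k. R i * p ^ i)"
    using assms(4,5,7) by (simp add: Suc_diff_le sum.atLeast_Suc_atMost)
  also have "(\<Sum>i=Suc f..k. R i * p ^ i) = p ^ f * (p * T)"
    unfolding T_def sum_distrib_left
  proof (rule sum.cong[OF refl])
    fix i assume "i \<in> {Suc f..k}"
    then have "p ^ i = p ^ f * (p * p ^ (i - Suc f))"
      by (simp add: power_Suc[symmetric] power_add[symmetric] del: power_Suc)
    then show "R i * p ^ i = p ^ f * (p * (R i * p ^ (i - Suc f)))" by (simp add: ac_simps)
  qed
  finally have n: "Suc ?n = p ^ f * (?d + p * T)" by (simp add: algebra_simps)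
  show ?thesis
  proof
    assume lt: "r < 2 * (p - ?d) * p ^ f"
    show "simple_module (Sp m) (weyl_module m (fund_weight r) :: (('a mat \<Rightarrow> 'a) \<Rightarrow> 'a) set) (weyl_action m (fund_weight r))"
    proof (rule weyl_module_simple[OF assms(4)])
      fix j assume j: "1 \<le> j" "2 * j \<le> r"
      then have "0 < j" "j < (p - ?d) * p ^ f" using lt by auto
      then show "\<exists>i. 1 \<le> i \<and> i \<le> j \<and> of_nat ((?n + j + i) choose i) \<noteq> (0::'a)"
        unfolding char by (rule exists_choose_nonzero[OF p n d])
    qed
  next
    assume simple: "simple_module (Sp m) (weyl_module m (fund_weight r) :: (('a mat \<Rightarrow> 'a) \<Rightarrow> 'a) set) (weyl_action m (fund_weight r))"
    show "r < 2 * (p - ?d) * p ^ f"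
    proof (rule ccontr)
      assume ge: "\<not> ?thesis"
      \<comment> \<open>Adding this number to \<open>Suc ?n\<close> completes the lowest digit to
        \<open>p\<close> and carries, which produces the factor \<open>p ^ Suc f\<close>; the number
        itself stays below \<open>p ^ Suc f\<close>, so every \<open>i\<close> up to it gives a
        coefficient divisible by \<open>p\<close>.\<close>
      let ?j = "(p - ?d) * p ^ f"
      have j: "1 \<le> ?j" "2 * ?j \<le> r" using ge d prime_gt_0_nat[OF p] by (auto simp: Suc_le_eq)
      have "of_nat ((?n + ?j + i) choose i) = (0::'a)" if i: "1 \<le> i" "i \<le> ?j" for i
        unfolding char
      proof (rule prime_dvd_choose_of_power_dvd[OF p])
        have "Suc (?n + ?j) = p ^ f * (?d + p * T) + (p - ?d) * p ^ f" using n by simp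
        also have "\<dots> = p ^ f * (?d + (p - ?d) + p * T)" by (simp add: algebra_simps)
        also have "?d + (p - ?d) = p" using d by simp
        also have "p ^ f * (p + p * T) = p ^ Suc f * Suc T" by (simp add: algebra_simps)
        finally show "p ^ Suc f dvd Suc (?n + ?j)" by simp
        show "0 < i" using i by simp
        have "?j < p ^ Suc f" using d prime_gt_0_nat[OF p] by simp
        with i(2) show "i < p ^ Suc f" by (rule le_less_trans)
      qed
      then show False using weyl_module_not_simple[OF assms(4) j, where 'a = 'a] simple by blast
    qed
  qed
qed

end
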